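(* If $(\mathcal{C},j)$ is a matching Verdier site and $p:H\to y(U)$ is a hypercover, $U\in\mathcal{C}$, then $p$ can be refined by a split Verdier hypercover; that is, there exist a split Verdier hypercover $q:\widehat{H}\to y(U)$ and a map $g:\widehat{H}\to H$ of simplicial presheaves with $pg=q$.
   Context: Sites. A coverage $j$ on a small category $\mathcal{C}$ assigns to each $U$ a set $j(U)$ of families $\{r_i:U_i\to U\}$ (covering families) such that (1) $\{f\}\in j(U)$ for every isomorphism $f:V\to U$; (2) for $r\in j(U)$, $g:V\to U$ there is $t\in j(V)$ such that for each $t_j:V_j\to V$ in $t$ there are $r_i$ in $r$ and $s_j:V_j\to U_i$ with $r_is_j=gt_j$. A site is a pair $(\mathcal{C},j)$. A morphism of $\mathcal{C}$ is basal if it belongs to a covering family. Hypercovers. A map $p:X\to Y$ of simplicial presheaves (functors $\mathcal{C}^{op}\to\mathbf{sSet}$) is a local fibration if for every $U$, every $n\ge1$, $0\le k\le n$, and commutative square $\Lambda^n_k\to X(U)$, $\Delta^n\to Y(U)$, there is a covering family $\{U_i\to U\}$ such that for each $i$ the square restricted to $U_i$ has a lift $\Delta^n\to X(U_i)$. For objectwise fibrant $X,Y$, $p$ is a local weak equivalence if for every $U$, $n\ge0$ and commutative square $u:\partial\Delta^n\to X(U)$, $v:\Delta^n\to Y(U)$ there is a covering family $\{U_i\to U\}$ such that for each $i$ there is $h:\Delta^n\to X(U_i)$ with $h|_{\partial\Delta^n}=u|_{U_i}$ and $ph$ homotopic to $v|_{U_i}$ rel $\partial\Delta^n$; in general apply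 objectwise fibrant replacement first. A local trivial fibration is a local fibration that is a local weak equivalence. A hypercover of $U$ is a local trivial fibration $p:H\to y(U)$ onto the (discrete) representable presheaf $y(U)$. A map $f:P\to Q$ of presheaves is a local epimorphism if for each $s:y(V)\to Q$ there is a covering family $\{r_i:V_i\to V\}$ and maps $s_i:y(V_i)\to P$ with $fs_i=s\circ y(r_i)$. A presheaf is semi-representable if isomorphic to a coproduct of representables; a map $\coprod_{i\in I}y(U_i)\to\coprod_{i'\in I'}y(V_{i'})$ is given by $\alpha:I\to I'$ and morphisms $f_i:U_i\to V_{\alpha(i)}$. A map of presheaves is basal if it is a map out of the initial presheaf, or a map between semi-representables with each $f_i$ basal; it is covering basal if in addition, for each $i'$, the family $\{f_i:U_i\to V_{i'}\}_{i\in\alpha^{-1}(i')}$ is a covering family whenever it is nonempty. A map $p:H\to y(U)$ is regarded as an augmented simplicial presheaf with $H_{-1}=y(U)$; its augmented matching object $M_n^+H$ is the presheaf $V\mapsto$ set of maps of augmented simplicial sets $\partial\Delta^n\to H(V)$, with $\partial\Delta^n$ given a single point in degree $-1$. A Verdier hypercover is a hypercover $p:H\to y(U)$ with each $H_n$ semi-representable and each augmented matching map $H_n\to M_n^+H$ ($n\ge0$) covering basal. An $n$-truncated Verdier hypercover is an $n$-truncated augmented simplicial presheaf $H$ (degrees $-1,\dots,n$ only) with $H_{-1}=y(U)$, with each $H_k$, $0\le k\le n$, semi-representable and $H_k\to M_k^+H$ a covering basal local epimorphism for $0\le k\le n$. An ($n$-truncated) augmented simplicial presheaf $H$ is split if there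 are subobjects $N_k\hookrightarrow H_k$ such that the canonical map $\coprod_{\sigma:[m]\twoheadrightarrow[k]}N_k\to H_m$, over all surjections out of $[m]$ in $\mathsf{\Delta}$, is an isomorphism for every $m\ge0$ ($m\le n$). Matching Verdier sites. For a degreewise semi-representable $n$-truncated $p:H\to y(U)$ with $H_k=\coprod_{i\in I_k}y(U_i)$, let $\mathrm{ind}(H)$ be the $n$-truncated augmented simplicial set of index sets $I_k$. A map $a:\partial\Delta^{n+1}\to\mathrm{ind}(H)$ (in degrees $\le n$) determines a diagram in the slice $\mathcal{C}_{/U}$, indexed by the opposite of the poset of nondegenerate simplices $\sigma$ of $\partial\Delta^{n+1}$, sending $\sigma$ to $U_{a(\sigma)}\to U$ (structure map from the augmentation) with transition maps induced by the face maps of $H$; denote its limit by $H(a)$. The site $(\mathcal{C},j)$ is matching Verdier if (1) for every $U\in\mathcal{C}$, every $n\ge 0$, every $n$-truncated split Verdier hypercover $p:H\to y(U)$ and every $a:\partial\Delta^{n+1}\to\mathrm{ind}(H)$, the limit $H(a)$ exists in $\mathcal{C}$ (over $U$); and (2) every basal morphism in $\mathcal{C}$ is a monomorphism.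
   Formalization: The formal theorem also assumes that composites of covering families are refined by a covering family (the generated sieves form a Grothendieck topology). The two coverage axioms do not imply this, and without it the claim is false: there is a counterexample on a finite meet-semilattice. *)

theory Defs
  imports Main "HOL-Library.FSet"
begin

section \<open>Categories and sites\<close>

record ('o, 'm) cat =
  Obj :: "'o set"
  Arr :: "'m set"
  Src :: "'m \<Rightarrow> 'o"
  Trg :: "'m \<Rightarrow> 'o"
  Idt :: "'o \<Rightarrow> 'm"
  Cmp :: "'m \<Rightarrow> 'm \<Rightarrow> 'm"  \<comment> \<open>\<open>Cmp C g f\<close> is \<open>g\<close> after \<open>f\<close>\<close>

definition hom :: "('o, 'm) cat \<Rightarrow> 'o \<Rightarrow> 'o \<Rightarrow> 'm set" where
  "hom C A B = {f \<in> Arr C. Src C f = A \<and> Trg C f = B}"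

definition category :: "('o, 'm) cat \<Rightarrow> bool" where
  "category C \<longleftrightarrow>
     (\<forall>f\<in>Arr C. Src C f \<in> Obj C \<and> Trg C f \<in> Obj C) \<and>
     (\<forall>A\<in>Obj C. Idt C A \<in> hom C A A) \<and>
     (\<forall>A\<in>Obj C. \<forall>B\<in>Obj C. \<forall>D\<in>Obj C. \<forall>f\<in>hom C A B. \<forall>g\<in>hom C B D. Cmp C g f \<in> hom C A D) \<and>
     (\<forall>A\<in>Obj C. \<forall>B\<in>Obj C. \<forall>f\<in>hom C A B. Cmp C f (Idt C A) = f \<and> Cmp C (Idt C B) f = f) \<and>
     (\<forall>f\<in>Arr C. \<forall>g\<in>Arr C. \<forall>h\<in>Arr C. Trg C f = Src C g \<and> Trg C g = Src C h \<longrightarrow>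
        Cmp C h (Cmp C g f) = Cmp C (Cmp C h g) f)"

definition is_iso :: "('o, 'm) cat \<Rightarrow> 'm \<Rightarrow> bool" where
  "is_iso C f \<longleftrightarrow> f \<in> Arr C \<and>
     (\<exists>g\<in>hom C (Trg C f) (Src C f). Cmp C g f = Idt C (Src C f) \<and> Cmp C f g = Idt C (Trg C f))"

definition is_mono :: "('o, 'm) cat \<Rightarrow> 'm \<Rightarrow> bool" where
  "is_mono C f \<longleftrightarrow> f \<in> Arr C \<and>
     (\<forall>A\<in>Obj C. \<forall>g\<in>hom C A (Src C f). \<forall>h\<in>hom C A (Src C f). Cmp C f g = Cmp C f h \<longrightarrow> g = h)"

text \<open>A covering family of \<open>U\<close> is a set of morphisms with target \<open>U\<close>.\<close>

type_synonym ('o, 'm) cov = "'o \<Rightarrow> 'm set set"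

definition coverage :: "('o, 'm) cat \<Rightarrow> ('o, 'm) cov \<Rightarrow> bool" where
  "coverage C j \<longleftrightarrow>
     (\<forall>U\<in>Obj C. \<forall>r\<in>j U. r \<subseteq> {f \<in> Arr C. Trg C f = U}) \<and>
     (\<forall>f. is_iso C f \<longrightarrow> {f} \<in> j (Trg C f)) \<and>
     (\<forall>U\<in>Obj C. \<forall>V\<in>Obj C. \<forall>r\<in>j U. \<forall>g\<in>hom C V U.
        \<exists>t\<in>j V. \<forall>e\<in>t. \<exists>f\<in>r. \<exists>s\<in>hom C (Src C e) (Src C f). Cmp C f s = Cmp C g e)"

definition site :: "('o, 'm) cat \<Rightarrow> ('o, 'm) cov \<Rightarrow> bool" where
  "site C j \<longleftrightarrow> category C \<and> coverage C j"

text \<open>Covering families may be composed, up to refinement: this says that the sieves containing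
  a covering family form a Grothendieck topology, i.e. that what holds locally locally holds
  locally.  It is not a consequence of the two axioms of a coverage.\<close>

definition locally_transitive :: "('o, 'm) cat \<Rightarrow> ('o, 'm) cov \<Rightarrow> bool" where
  "locally_transitive C j \<longleftrightarrow>
     (\<forall>U\<in>Obj C. \<forall>r\<in>j U. \<forall>t. (\<forall>f\<in>r. t f \<in> j (Src C f)) \<longrightarrow>
        (\<exists>s\<in>j U. \<forall>e\<in>s. \<exists>f\<in>r. \<exists>g\<in>t f. \<exists>k\<in>hom C (Src C e) (Src C g). e = Cmp C (Cmp C f g) k))"

definition basal :: "('o, 'm) cat \<Rightarrow> ('o, 'm) cov \<Rightarrow> 'm \<Rightarrow> bool" where
  "basal C j f \<longleftrightarrow> (\<exists>U\<in>Obj C. \<exists>r\<in>j U. f \<in> r)"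


section \<open>Simplicial sets\<close>

text \<open>A monotone map \<open>[m] \<rightarrow> [n]\<close> is the list of its \<open>m + 1\<close> values.\<close>

definition \<Delta> :: "nat \<Rightarrow> nat \<Rightarrow> nat list set" where
  "\<Delta> m n = {\<alpha>. length \<alpha> = Suc m \<and> sorted \<alpha> \<and> set \<alpha> \<subseteq> {..n}}"

definition ocomp :: "nat list \<Rightarrow> nat list \<Rightarrow> nat list" where
  "ocomp \<alpha> \<beta> = map (\<lambda>i. \<alpha> ! i) \<beta>"

record 'x sset =
  Sx :: "nat \<Rightarrow> 'x set"
  Act :: "nat \<Rightarrow> nat list \<Rightarrow> 'x \<Rightarrow> 'x"
    \<comment> \<open>\<open>Act X n \<alpha>\<close> maps \<open>X\<^sub>n\<close> to \<open>X\<^sub>m\<close>, for \<open>\<alpha> : [m] \<rightarrow> [n]\<close>\<close>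

text \<open>The parameter \<open>D\<close> below is the set of degrees taken into account: \<open>UNIV\<close> for simplicial
  objects, \<open>{..n}\<close> for \<open>n\<close>-truncated ones.\<close>

definition simplicial_set :: "nat set \<Rightarrow> 'x sset \<Rightarrow> bool" where
  "simplicial_set D X \<longleftrightarrow>
     (\<forall>n\<in>D. \<forall>m\<in>D. \<forall>\<alpha>\<in>\<Delta> m n. \<forall>x\<in>Sx X n. Act X n \<alpha> x \<in> Sx X m) \<and>
     (\<forall>n\<in>D. \<forall>x\<in>Sx X n. Act X n [0..<Suc n] x = x) \<and>
     (\<forall>n\<in>D. \<forall>m\<in>D. \<forall>k\<in>D. \<forall>\<alpha>\<in>\<Delta> m n. \<forall>\<beta>\<in>\<Delta> k m. \<forall>x\<in>Sx X n.
        Act X m \<beta> (Act X n \<alpha> x) = Act X n (ocomp \<alpha> \<beta>) x)"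

definition smap :: "nat set \<Rightarrow> 'x sset \<Rightarrow> 'y sset \<Rightarrow> (nat \<Rightarrow> 'x \<Rightarrow> 'y) \<Rightarrow> bool" where
  "smap D X Y f \<longleftrightarrow>
     (\<forall>n\<in>D. \<forall>x\<in>Sx X n. f n x \<in> Sx Y n) \<and>
     (\<forall>n\<in>D. \<forall>m\<in>D. \<forall>\<alpha>\<in>\<Delta> m n. \<forall>x\<in>Sx X n. f m (Act X n \<alpha> x) = Act Y n \<alpha> (f n x))"

text \<open>Sets of simplicial maps consist of functions that are \<open>undefined\<close> off their domain.\<close>

definition srestrict :: "nat set \<Rightarrow> 'x sset \<Rightarrow> (nat \<Rightarrow> 'x \<Rightarrow> 'y) \<Rightarrow> nat \<Rightarrow> 'x \<Rightarrow> 'y" where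
  "srestrict D X f = (\<lambda>n x. if n \<in> D \<and> x \<in> Sx X n then f n x else undefined)"

definition smaps :: "nat set \<Rightarrow> 'x sset \<Rightarrow> 'y sset \<Rightarrow> (nat \<Rightarrow> 'x \<Rightarrow> 'y) set" where
  "smaps D X Y = {f. smap D X Y f \<and> srestrict D X f = f}"

definition simplex :: "nat \<Rightarrow> nat list sset" where
  "simplex n = \<lparr>Sx = (\<lambda>m. \<Delta> m n), Act = (\<lambda>m \<alpha> x. ocomp x \<alpha>)\<rparr>"

definition bdry :: "nat \<Rightarrow> nat list sset" where
  "bdry n = \<lparr>Sx = (\<lambda>m. {x \<in> \<Delta> m n. set x \<noteq> {..n}}), Act = (\<lambda>m \<alpha> x. ocomp x \<alpha>)\<rparr>"

definition horn :: "nat \<Rightarrow> nat \<Rightarrow> nat list sset" where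
  "horn n k = \<lparr>Sx = (\<lambda>m. {x \<in> \<Delta> m n. \<not> {..n} - {k} \<subseteq> set x}), Act = (\<lambda>m \<alpha> x. ocomp x \<alpha>)\<rparr>"

definition sprod :: "'x sset \<Rightarrow> 'y sset \<Rightarrow> ('x \<times> 'y) sset" where
  "sprod X Y = \<lparr>Sx = (\<lambda>n. Sx X n \<times> Sx Y n),
                Act = (\<lambda>n \<alpha> z. (Act X n \<alpha> (fst z), Act Y n \<alpha> (snd z)))\<rparr>"

text \<open>Homotopy of two maps \<open>a, b : \<Delta>\<^sup>n \<rightarrow> Y\<close> relative to the boundary.\<close>

definition homotopic_rel_bdry ::
  "nat \<Rightarrow> 'y sset \<Rightarrow> (nat \<Rightarrow> nat list \<Rightarrow> 'y) \<Rightarrow> (nat \<Rightarrow> nat list \<Rightarrow> 'y) \<Rightarrow> bool" where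
  "homotopic_rel_bdry n Y a b \<longleftrightarrow>
     (\<exists>h. smap UNIV (sprod (simplex n) (simplex 1)) Y h \<and>
        (\<forall>m. \<forall>x\<in>Sx (simplex n) m. h m (x, replicate (Suc m) 0) = a m x) \<and>
        (\<forall>m. \<forall>x\<in>Sx (simplex n) m. h m (x, replicate (Suc m) 1) = b m x) \<and>
        (\<forall>m. \<forall>x\<in>Sx (bdry n) m. \<forall>t\<in>Sx (simplex 1) m. h m (x, t) = a m x))"


section \<open>Kan's functor \<open>Ex\<^sup>\<infinity>\<close>\<close>

text \<open>The \<open>m\<close>-fold barycentric subdivision of \<open>\<Delta>\<^sup>n\<close> is the nerve of a poset \<open>sd_vert n m\<close>:
  the vertices of \<open>\<Delta>\<^sup>n\<close> for \<open>m = 0\<close>, and then the nonempty chains of the preceding poset, ordered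
  by inclusion.\<close>

datatype vertex = Vtx nat | Chain (elts: "vertex fset")

fun sd_le :: "vertex \<Rightarrow> vertex \<Rightarrow> bool" where
  "sd_le (Vtx i) (Vtx k) = (i \<le> k)"
| "sd_le (Chain c) (Chain d) = (c |\<subseteq>| d)"
| "sd_le _ _ = False"

primrec sd_vert :: "nat \<Rightarrow> nat \<Rightarrow> vertex set" where
  "sd_vert n 0 = Vtx ` {..n}"
| "sd_vert n (Suc m) = {Chain c | c. c \<noteq> {||} \<and> fset c \<subseteq> sd_vert n m \<and>
     (\<forall>x\<in>fset c. \<forall>y\<in>fset c. sd_le x y \<or> sd_le y x)}"

definition sd :: "nat \<Rightarrow> nat \<Rightarrow> vertex list sset" where
  "sd n m = \<lparr>Sx = (\<lambda>k. {xs. length xs = Suc k \<and> set xs \<subseteq> sd_vert n m \<and> sorted_wrt sd_le xs}),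
             Act = (\<lambda>k \<alpha> xs. map (\<lambda>i. xs ! i) \<alpha>)\<rparr>"

primrec sd_map :: "(nat \<Rightarrow> nat) \<Rightarrow> vertex \<Rightarrow> vertex" where
  "sd_map \<alpha> (Vtx i) = Vtx (\<alpha> i)"
| "sd_map \<alpha> (Chain c) = Chain (sd_map \<alpha> |`| c)"

text \<open>On \<open>sd_vert n (Suc m)\<close>, the map \<open>last_vertex m\<close> is the \<open>m\<close>-fold subdivision of the last
  vertex map from the subdivision of \<open>\<Delta>\<^sup>n\<close> to \<open>\<Delta>\<^sup>n\<close>: it replaces the innermost chains, which
  consist of vertices of \<open>\<Delta>\<^sup>n\<close>, by their maxima.\<close>

primrec last_vertex :: "nat \<Rightarrow> vertex \<Rightarrow> vertex" where
  "last_vertex 0 x = Vtx (Max {i. Vtx i |\<in>| elts x})"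
| "last_vertex (Suc m) x = Chain (last_vertex m |`| elts x)"

text \<open>By adjunction, the \<open>n\<close>-simplices of \<open>Ex\<^sup>m X\<close> are the maps from the \<open>m\<close>-fold subdivision
  of \<open>\<Delta>\<^sup>n\<close> to \<open>X\<close>.  The last vertex maps induce \<open>Ex\<^sup>m X \<rightarrow> Ex\<^sup>m\<^sup>+\<^sup>1 X\<close>, and \<open>Ex\<^sup>\<infinity> X\<close> is the
  colimit, whose simplices are equivalence classes of pairs \<open>(m, f)\<close>.\<close>

definition ex_stage :: "nat \<Rightarrow> 'x sset \<Rightarrow> (nat \<Rightarrow> vertex list \<Rightarrow> 'x) sset" where
  "ex_stage m X = \<lparr>Sx = (\<lambda>n. smaps UNIV (sd n m) X),
     Act = (\<lambda>n \<alpha> f. srestrict UNIV (sd (length \<alpha> - 1) m)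
              (\<lambda>k xs. f k (map (sd_map (\<lambda>i. \<alpha> ! i)) xs)))\<rparr>"

primrec ex_iter ::
  "nat \<Rightarrow> nat \<Rightarrow> nat \<Rightarrow> (nat \<Rightarrow> vertex list \<Rightarrow> 'x) \<Rightarrow> nat \<Rightarrow> vertex list \<Rightarrow> 'x" where
  "ex_iter n m 0 f = f"
| "ex_iter n m (Suc d) f = srestrict UNIV (sd n (m + Suc d))
     (\<lambda>k xs. ex_iter n m d f k (map (last_vertex (m + d)) xs))"

definition ex_rel :: "'x sset \<Rightarrow> nat \<Rightarrow> (nat \<times> (nat \<Rightarrow> vertex list \<Rightarrow> 'x)) rel" where
  "ex_rel X n = {((m, f), (m', f')). f \<in> Sx (ex_stage m X) n \<and> f' \<in> Sx (ex_stage m' X) n \<and>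
     (\<exists>d d'. m + d = m' + d' \<and> ex_iter n m d f = ex_iter n m' d' f')}"

definition ex_inf :: "'x sset \<Rightarrow> (nat \<times> (nat \<Rightarrow> vertex list \<Rightarrow> 'x)) set sset" where
  "ex_inf X = \<lparr>Sx = (\<lambda>n. (SIGMA m:UNIV. Sx (ex_stage m X) n) // ex_rel X n),
     Act = (\<lambda>n \<alpha> c. \<Union>(m, f)\<in>c. ex_rel X (length \<alpha> - 1) `` {(m, Act (ex_stage m X) n \<alpha> f)})\<rparr>"

definition ex_inf_map :: "'y sset \<Rightarrow> (nat \<Rightarrow> 'x \<Rightarrow> 'y) \<Rightarrow> nat \<Rightarrow>
    (nat \<times> (nat \<Rightarrow> vertex list \<Rightarrow> 'x)) set \<Rightarrow> (nat \<times> (nat \<Rightarrow> vertex list \<Rightarrow> 'y)) set" where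
  "ex_inf_map Y p n c =
     (\<Union>(m, f)\<in>c. ex_rel Y n `` {(m, srestrict UNIV (sd n m) (\<lambda>k xs. p k (f k xs)))})"


section \<open>Simplicial presheaves and hypercovers\<close>

record ('o, 'm, 'x) spsh =
  Val :: "'o \<Rightarrow> 'x sset"
  Rst :: "'m \<Rightarrow> nat \<Rightarrow> 'x \<Rightarrow> 'x"
    \<comment> \<open>\<open>Rst X f n\<close> maps \<open>X(V)\<^sub>n\<close> to \<open>X(W)\<^sub>n\<close>, for \<open>f : W \<rightarrow> V\<close>\<close>

definition simplicial_presheaf :: "('o, 'm) cat \<Rightarrow> nat set \<Rightarrow> ('o, 'm, 'x) spsh \<Rightarrow> bool" where
  "simplicial_presheaf C D X \<longleftrightarrow>
     (\<forall>V\<in>Obj C. simplicial_set D (Val X V)) \<and>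
     (\<forall>f\<in>Arr C. smap D (Val X (Trg C f)) (Val X (Src C f)) (Rst X f)) \<and>
     (\<forall>V\<in>Obj C. \<forall>n\<in>D. \<forall>x\<in>Sx (Val X V) n. Rst X (Idt C V) n x = x) \<and>
     (\<forall>f\<in>Arr C. \<forall>g\<in>Arr C. Trg C f = Src C g \<longrightarrow>
        (\<forall>n\<in>D. \<forall>x\<in>Sx (Val X (Trg C g)) n. Rst X f n (Rst X g n x) = Rst X (Cmp C g f) n x))"

definition spsh_map :: "('o, 'm) cat \<Rightarrow> nat set \<Rightarrow> ('o, 'm, 'x) spsh \<Rightarrow> ('o, 'm, 'y) spsh \<Rightarrow>
    ('o \<Rightarrow> nat \<Rightarrow> 'x \<Rightarrow> 'y) \<Rightarrow> bool" where
  "spsh_map C D X Y p \<longleftrightarrow>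
     (\<forall>V\<in>Obj C. smap D (Val X V) (Val Y V) (p V)) \<and>
     (\<forall>f\<in>Arr C. \<forall>n\<in>D. \<forall>x\<in>Sx (Val X (Trg C f)) n.
        p (Src C f) n (Rst X f n x) = Rst Y f n (p (Trg C f) n x))"

definition yo :: "('o, 'm) cat \<Rightarrow> 'o \<Rightarrow> ('o, 'm, 'm) spsh" where
  "yo C U = \<lparr>Val = (\<lambda>V. \<lparr>Sx = (\<lambda>n. hom C V U), Act = (\<lambda>n \<alpha> g. g)\<rparr>),
             Rst = (\<lambda>f n g. Cmp C g f)\<rparr>"

definition local_fibration :: "('o, 'm) cat \<Rightarrow> ('o, 'm) cov \<Rightarrow> ('o, 'm, 'x) spsh \<Rightarrow>
    ('o, 'm, 'y) spsh \<Rightarrow> ('o \<Rightarrow> nat \<Rightarrow> 'x \<Rightarrow> 'y) \<Rightarrow> bool" where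
  "local_fibration C j X Y p \<longleftrightarrow>
     (\<forall>U\<in>Obj C. \<forall>n\<ge>1. \<forall>k\<le>n. \<forall>u v.
        smap UNIV (horn n k) (Val X U) u \<and> smap UNIV (simplex n) (Val Y U) v \<and>
        (\<forall>m. \<forall>x\<in>Sx (horn n k) m. p U m (u m x) = v m x) \<longrightarrow>
        (\<exists>r\<in>j U. \<forall>f\<in>r. \<exists>h. smap UNIV (simplex n) (Val X (Src C f)) h \<and>
           (\<forall>m. \<forall>x\<in>Sx (horn n k) m. h m x = Rst X f m (u m x)) \<and>
           (\<forall>m. \<forall>x\<in>Sx (simplex n) m. p (Src C f) m (h m x) = Rst Y f m (v m x))))"

text \<open>The criterion for a map of objectwise fibrant simplicial presheaves to be a local weak
  equivalence.\<close>

definition local_weq_fibrant :: "('o, 'm) cat \<Rightarrow> ('o, 'm) cov \<Rightarrow> ('o, 'm, 'x) spsh \<Rightarrow>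
    ('o, 'm, 'y) spsh \<Rightarrow> ('o \<Rightarrow> nat \<Rightarrow> 'x \<Rightarrow> 'y) \<Rightarrow> bool" where
  "local_weq_fibrant C j X Y p \<longleftrightarrow>
     (\<forall>U\<in>Obj C. \<forall>n u v.
        smap UNIV (bdry n) (Val X U) u \<and> smap UNIV (simplex n) (Val Y U) v \<and>
        (\<forall>m. \<forall>x\<in>Sx (bdry n) m. p U m (u m x) = v m x) \<longrightarrow>
        (\<exists>r\<in>j U. \<forall>f\<in>r. \<exists>h. smap UNIV (simplex n) (Val X (Src C f)) h \<and>
           (\<forall>m. \<forall>x\<in>Sx (bdry n) m. h m x = Rst X f m (u m x)) \<and>
           homotopic_rel_bdry n (Val Y (Src C f))
             (\<lambda>m x. p (Src C f) m (h m x)) (\<lambda>m x. Rst Y f m (v m x))))"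

text \<open>\<open>Ex\<^sup>\<infinity>\<close>, applied objectwise, serves as the functorial objectwise fibrant replacement.\<close>

definition ex_inf_psh :: "('o, 'm) cat \<Rightarrow> ('o, 'm, 'x) spsh \<Rightarrow>
    ('o, 'm, (nat \<times> (nat \<Rightarrow> vertex list \<Rightarrow> 'x)) set) spsh" where
  "ex_inf_psh C X = \<lparr>Val = (\<lambda>V. ex_inf (Val X V)),
     Rst = (\<lambda>f. ex_inf_map (Val X (Src C f)) (Rst X f))\<rparr>"

definition local_weak_equivalence :: "('o, 'm) cat \<Rightarrow> ('o, 'm) cov \<Rightarrow> ('o, 'm, 'x) spsh \<Rightarrow>
    ('o, 'm, 'y) spsh \<Rightarrow> ('o \<Rightarrow> nat \<Rightarrow> 'x \<Rightarrow> 'y) \<Rightarrow> bool" where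
  "local_weak_equivalence C j X Y p \<longleftrightarrow>
     local_weq_fibrant C j (ex_inf_psh C X) (ex_inf_psh C Y) (\<lambda>V. ex_inf_map (Val Y V) (p V))"

definition local_trivial_fibration :: "('o, 'm) cat \<Rightarrow> ('o, 'm) cov \<Rightarrow> ('o, 'm, 'x) spsh \<Rightarrow>
    ('o, 'm, 'y) spsh \<Rightarrow> ('o \<Rightarrow> nat \<Rightarrow> 'x \<Rightarrow> 'y) \<Rightarrow> bool" where
  "local_trivial_fibration C j X Y p \<longleftrightarrow>
     local_fibration C j X Y p \<and> local_weak_equivalence C j X Y p"

definition hypercover :: "('o, 'm) cat \<Rightarrow> ('o, 'm) cov \<Rightarrow> 'o \<Rightarrow> ('o, 'm, 'x) spsh \<Rightarrow>
    ('o \<Rightarrow> nat \<Rightarrow> 'x \<Rightarrow> 'm) \<Rightarrow> bool" where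
  "hypercover C j U H p \<longleftrightarrow>
     simplicial_presheaf C UNIV H \<and> spsh_map C UNIV H (yo C U) p \<and>
     local_trivial_fibration C j H (yo C U) p"


section \<open>Presheaves\<close>

record ('o, 'm, 'x) psh =
  Sec :: "'o \<Rightarrow> 'x set"
  Res :: "'m \<Rightarrow> 'x \<Rightarrow> 'x"

definition psh_map :: "('o, 'm) cat \<Rightarrow> ('o, 'm, 'x) psh \<Rightarrow> ('o, 'm, 'y) psh \<Rightarrow>
    ('o \<Rightarrow> 'x \<Rightarrow> 'y) \<Rightarrow> bool" where
  "psh_map C P Q \<phi> \<longleftrightarrow>
     (\<forall>V\<in>Obj C. \<forall>x\<in>Sec P V. \<phi> V x \<in> Sec Q V) \<and>
     (\<forall>f\<in>Arr C. \<forall>x\<in>Sec P (Trg C f). \<phi> (Src C f) (Res P f x) = Res Q f (\<phi> (Trg C f) x))"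

definition psh_iso :: "('o, 'm) cat \<Rightarrow> ('o, 'm, 'x) psh \<Rightarrow> ('o, 'm, 'y) psh \<Rightarrow>
    ('o \<Rightarrow> 'x \<Rightarrow> 'y) \<Rightarrow> bool" where
  "psh_iso C P Q \<phi> \<longleftrightarrow> psh_map C P Q \<phi> \<and> (\<forall>V\<in>Obj C. bij_betw (\<phi> V) (Sec P V) (Sec Q V))"

definition level :: "('o, 'm, 'x) spsh \<Rightarrow> nat \<Rightarrow> ('o, 'm, 'x) psh" where
  "level X n = \<lparr>Sec = (\<lambda>V. Sx (Val X V) n), Res = (\<lambda>f. Rst X f n)\<rparr>"

definition coprod_repr :: "('o, 'm) cat \<Rightarrow> 'i set \<Rightarrow> ('i \<Rightarrow> 'o) \<Rightarrow> ('o, 'm, 'i \<times> 'm) psh" where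
  "coprod_repr C I A = \<lparr>Sec = (\<lambda>V. SIGMA i:I. hom C V (A i)),
                        Res = (\<lambda>f z. (fst z, Cmp C (snd z) f))\<rparr>"

text \<open>The index type of a presentation of a presheaf with sections in \<open>'x\<close> is fixed to be
  \<open>'o \<times> 'x\<close>.  This is no restriction: the index \<open>i\<close> of any presentation may be replaced by the pair
  of \<open>A i\<close> and the universal section over \<open>A i\<close>.\<close>

definition presentation :: "('o, 'm) cat \<Rightarrow> ('o, 'm, 'x) psh \<Rightarrow> ('o \<times> 'x) set \<Rightarrow>
    ('o \<times> 'x \<Rightarrow> 'o) \<Rightarrow> ('o \<Rightarrow> ('o \<times> 'x) \<times> 'm \<Rightarrow> 'x) \<Rightarrow> bool" where
  "presentation C P I A \<phi> \<longleftrightarrow> A ` I \<subseteq> Obj C \<and> psh_iso C (coprod_repr C I A) P \<phi>"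

definition semi_representable :: "('o, 'm) cat \<Rightarrow> ('o, 'm, 'x) psh \<Rightarrow> bool" where
  "semi_representable C P \<longleftrightarrow> (\<exists>I A \<phi>. presentation C P I A \<phi>)"

definition initial_psh :: "('o, 'm) cat \<Rightarrow> ('o, 'm, 'x) psh \<Rightarrow> bool" where
  "initial_psh C P \<longleftrightarrow> (\<forall>V\<in>Obj C. Sec P V = {})"

text \<open>Up to the presentations \<open>\<phi>\<close> and \<open>\<psi>\<close>, the map \<open>\<pi> : P \<rightarrow> Q\<close> is given by \<open>\<alpha> : I \<rightarrow> J\<close> and
  \<open>F i : A i \<rightarrow> B (\<alpha> i)\<close>.\<close>

definition covering_basal :: "('o, 'm) cat \<Rightarrow> ('o, 'm) cov \<Rightarrow> ('o, 'm, 'x) psh \<Rightarrow>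
    ('o, 'm, 'y) psh \<Rightarrow> ('o \<Rightarrow> 'x \<Rightarrow> 'y) \<Rightarrow> bool" where
  "covering_basal C j P Q \<pi> \<longleftrightarrow> initial_psh C P \<or>
     (\<exists>I A \<phi> J B \<psi> \<alpha> F. presentation C P I A \<phi> \<and> presentation C Q J B \<psi> \<and>
        (\<forall>i\<in>I. \<alpha> i \<in> J \<and> F i \<in> hom C (A i) (B (\<alpha> i)) \<and> basal C j (F i)) \<and>
        (\<forall>V\<in>Obj C. \<forall>i\<in>I. \<forall>g\<in>hom C V (A i). \<pi> V (\<phi> V (i, g)) = \<psi> V (\<alpha> i, Cmp C (F i) g)) \<and>
        (\<forall>k\<in>J. {i \<in> I. \<alpha> i = k} \<noteq> {} \<longrightarrow> F ` {i \<in> I. \<alpha> i = k} \<in> j (B k)))"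

text \<open>A map \<open>y(V) \<rightarrow> Q\<close> is a section of \<open>Q\<close> over \<open>V\<close>.\<close>

definition local_epi :: "('o, 'm) cat \<Rightarrow> ('o, 'm) cov \<Rightarrow> ('o, 'm, 'x) psh \<Rightarrow>
    ('o, 'm, 'y) psh \<Rightarrow> ('o \<Rightarrow> 'x \<Rightarrow> 'y) \<Rightarrow> bool" where
  "local_epi C j P Q \<pi> \<longleftrightarrow>
     (\<forall>V\<in>Obj C. \<forall>s\<in>Sec Q V. \<exists>r\<in>j V. \<forall>f\<in>r. \<exists>t\<in>Sec P (Src C f). \<pi> (Src C f) t = Res Q f s)"


section \<open>Verdier hypercovers\<close>

text \<open>An (\<open>n\<close>-truncated) augmented simplicial presheaf with \<open>y(U)\<close> in degree \<open>-1\<close> is given by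
  an (\<open>n\<close>-truncated) simplicial presheaf \<open>H\<close> and a map \<open>p\<close> from \<open>H\<close> to the discrete \<open>y(U)\<close>.
  A map from the augmented \<open>\<partial>\<Delta>\<^sup>n\<close> to \<open>H(V)\<close> is then a pair \<open>(g, x)\<close>, with \<open>g \<in> y(U)(V)\<close> the image
  of the point of degree \<open>-1\<close>.\<close>

definition matching :: "('o, 'm) cat \<Rightarrow> nat set \<Rightarrow> 'o \<Rightarrow> ('o, 'm, 'x) spsh \<Rightarrow>
    ('o \<Rightarrow> nat \<Rightarrow> 'x \<Rightarrow> 'm) \<Rightarrow> nat \<Rightarrow> ('o, 'm, 'm \<times> (nat \<Rightarrow> nat list \<Rightarrow> 'x)) psh" where
  "matching C D U H p n = \<lparr>
     Sec = (\<lambda>V. {(g, x). g \<in> hom C V U \<and> x \<in> smaps D (bdry n) (Val H V) \<and>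
                   (\<forall>m\<in>D. \<forall>\<sigma>\<in>Sx (bdry n) m. p V m (x m \<sigma>) = g)}),
     Res = (\<lambda>f z. (Cmp C (fst z) f, srestrict D (bdry n) (\<lambda>m \<sigma>. Rst H f m (snd z m \<sigma>))))\<rparr>"

definition matching_map :: "nat set \<Rightarrow> ('o, 'm, 'x) spsh \<Rightarrow> ('o \<Rightarrow> nat \<Rightarrow> 'x \<Rightarrow> 'm) \<Rightarrow> nat \<Rightarrow>
    'o \<Rightarrow> 'x \<Rightarrow> 'm \<times> (nat \<Rightarrow> nat list \<Rightarrow> 'x)" where
  "matching_map D H p n V z = (p V n z, srestrict D (bdry n) (\<lambda>m \<sigma>. Act (Val H V) n \<sigma> z))"

definition verdier_hypercover :: "('o, 'm) cat \<Rightarrow> ('o, 'm) cov \<Rightarrow> 'o \<Rightarrow> ('o, 'm, 'x) spsh \<Rightarrow>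
    ('o \<Rightarrow> nat \<Rightarrow> 'x \<Rightarrow> 'm) \<Rightarrow> bool" where
  "verdier_hypercover C j U H p \<longleftrightarrow> hypercover C j U H p \<and>
     (\<forall>n. semi_representable C (level H n) \<and>
          covering_basal C j (level H n) (matching C UNIV U H p n) (matching_map UNIV H p n))"

definition truncated_verdier_hypercover :: "('o, 'm) cat \<Rightarrow> ('o, 'm) cov \<Rightarrow> nat \<Rightarrow> 'o \<Rightarrow>
    ('o, 'm, 'x) spsh \<Rightarrow> ('o \<Rightarrow> nat \<Rightarrow> 'x \<Rightarrow> 'm) \<Rightarrow> bool" where
  "truncated_verdier_hypercover C j n U H p \<longleftrightarrow>
     simplicial_presheaf C {..n} H \<and> spsh_map C {..n} H (yo C U) p \<and>
     (\<forall>k\<le>n. semi_representable C (level H k) \<and>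
        covering_basal C j (level H k) (matching C {..n} U H p k) (matching_map {..n} H p k) \<and>
        local_epi C j (level H k) (matching C {..n} U H p k) (matching_map {..n} H p k))"

definition split_spsh :: "('o, 'm) cat \<Rightarrow> nat set \<Rightarrow> ('o, 'm, 'x) spsh \<Rightarrow> bool" where
  "split_spsh C D H \<longleftrightarrow> (\<exists>N :: nat \<Rightarrow> 'o \<Rightarrow> 'x set.
     (\<forall>k\<in>D. \<forall>V\<in>Obj C. N k V \<subseteq> Sx (Val H V) k) \<and>
     (\<forall>k\<in>D. \<forall>f\<in>Arr C. \<forall>x\<in>N k (Trg C f). Rst H f k x \<in> N k (Src C f)) \<and>
     (\<forall>m\<in>D. \<forall>V\<in>Obj C. bij_betw (\<lambda>(k, \<sigma>, x). Act (Val H V) k \<sigma> x)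
        (SIGMA k:{..m}. {\<sigma> \<in> \<Delta> m k. set \<sigma> = {..k}} \<times> N k V) (Sx (Val H V) m)))"


section \<open>Matching Verdier sites\<close>

text \<open>Let \<open>H\<close> be presented in degree \<open>k\<close> by \<open>I k\<close>, \<open>A k\<close>, \<open>\<phi> k\<close>.  A simplicial operator
  \<open>\<theta> : [m] \<rightarrow> [k]\<close> maps the summand \<open>y(A k i)\<close> of \<open>H\<^sub>k\<close> to a summand of \<open>H\<^sub>m\<close> through a morphism
  of \<open>C\<close>.  Applied to the universal section of the summand, it gives the pair of the index of that
  summand and of this morphism.\<close>

definition universal_section :: "('o, 'm) cat \<Rightarrow> (nat \<Rightarrow> 'i \<Rightarrow> 'o) \<Rightarrow>
    (nat \<Rightarrow> 'o \<Rightarrow> 'i \<times> 'm \<Rightarrow> 'x) \<Rightarrow> nat \<Rightarrow> 'i \<Rightarrow> 'x" where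
  "universal_section C A \<phi> k i = \<phi> k (A k i) (i, Idt C (A k i))"

definition operator_on_summand :: "('o, 'm) cat \<Rightarrow> ('o, 'm, 'x) spsh \<Rightarrow> (nat \<Rightarrow> 'i set) \<Rightarrow>
    (nat \<Rightarrow> 'i \<Rightarrow> 'o) \<Rightarrow> (nat \<Rightarrow> 'o \<Rightarrow> 'i \<times> 'm \<Rightarrow> 'x) \<Rightarrow> nat \<Rightarrow> nat list \<Rightarrow> 'i \<Rightarrow> 'i \<times> 'm" where
  "operator_on_summand C H I A \<phi> k \<theta> i = (let m = length \<theta> - 1; V = A k i in
     inv_into (Sec (coprod_repr C (I m) (A m)) V) (\<phi> m V)
       (Act (Val H V) k \<theta> (universal_section C A \<phi> k i)))"

definition ind :: "('o, 'm) cat \<Rightarrow> ('o, 'm, 'x) spsh \<Rightarrow> (nat \<Rightarrow> 'i set) \<Rightarrow>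
    (nat \<Rightarrow> 'i \<Rightarrow> 'o) \<Rightarrow> (nat \<Rightarrow> 'o \<Rightarrow> 'i \<times> 'm \<Rightarrow> 'x) \<Rightarrow> 'i sset" where
  "ind C H I A \<phi> = \<lparr>Sx = I, Act = (\<lambda>k \<theta> i. fst (operator_on_summand C H I A \<phi> k \<theta> i))\<rparr>"

definition bdry_faces :: "nat \<Rightarrow> nat \<Rightarrow> nat list set" where
  "bdry_faces n m = {\<sigma> \<in> Sx (bdry n) m. sorted_wrt (<) \<sigma>}"

text \<open>Cones in the slice over \<open>U\<close>, with apex \<open>l : L \<rightarrow> U\<close>, over the diagram determined by
  \<open>a : \<partial>\<Delta>\<^sup>n\<^sup>+\<^sup>1 \<rightarrow> ind(H)\<close>: the leg at a nondegenerate simplex \<open>\<sigma>\<close> is \<open>\<pi> \<sigma>\<close>, and the transition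
  maps are those from \<open>\<sigma>\<close> to its faces \<open>ocomp \<sigma> \<delta>\<close>.\<close>

definition matching_cone :: "('o, 'm) cat \<Rightarrow> 'o \<Rightarrow> ('o, 'm, 'x) spsh \<Rightarrow>
    ('o \<Rightarrow> nat \<Rightarrow> 'x \<Rightarrow> 'm) \<Rightarrow> (nat \<Rightarrow> 'i set) \<Rightarrow> (nat \<Rightarrow> 'i \<Rightarrow> 'o) \<Rightarrow> (nat \<Rightarrow> 'o \<Rightarrow> 'i \<times> 'm \<Rightarrow> 'x) \<Rightarrow>
    nat \<Rightarrow> (nat \<Rightarrow> nat list \<Rightarrow> 'i) \<Rightarrow> 'o \<Rightarrow> 'm \<Rightarrow> (nat list \<Rightarrow> 'm) \<Rightarrow> bool" where
  "matching_cone C U H p I A \<phi> n a L l \<pi> \<longleftrightarrow>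
     L \<in> Obj C \<and> l \<in> hom C L U \<and>
     (\<forall>m\<le>n. \<forall>\<sigma>\<in>bdry_faces (Suc n) m. let i = a m \<sigma> in
        \<pi> \<sigma> \<in> hom C L (A m i) \<and>
        Cmp C (p (A m i) m (universal_section C A \<phi> m i)) (\<pi> \<sigma>) = l \<and>
        (\<forall>k\<le>m. \<forall>\<delta>\<in>\<Delta> k m. sorted_wrt (<) \<delta> \<longrightarrow>
           Cmp C (snd (operator_on_summand C H I A \<phi> m \<delta> i)) (\<pi> \<sigma>) = \<pi> (ocomp \<sigma> \<delta>)))"

definition matching_limit_exists :: "('o, 'm) cat \<Rightarrow> 'o \<Rightarrow> ('o, 'm, 'x) spsh \<Rightarrow>
    ('o \<Rightarrow> nat \<Rightarrow> 'x \<Rightarrow> 'm) \<Rightarrow> (nat \<Rightarrow> 'i set) \<Rightarrow> (nat \<Rightarrow> 'i \<Rightarrow> 'o) \<Rightarrow> (nat \<Rightarrow> 'o \<Rightarrow> 'i \<times> 'm \<Rightarrow> 'x) \<Rightarrow>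
    nat \<Rightarrow> (nat \<Rightarrow> nat list \<Rightarrow> 'i) \<Rightarrow> bool" where
  "matching_limit_exists C U H p I A \<phi> n a \<longleftrightarrow>
     (\<exists>L l \<pi>. matching_cone C U H p I A \<phi> n a L l \<pi> \<and>
        (\<forall>L' l' \<pi>'. matching_cone C U H p I A \<phi> n a L' l' \<pi>' \<longrightarrow>
           (\<exists>!h. h \<in> hom C L' L \<and> Cmp C l h = l' \<and>
              (\<forall>m\<le>n. \<forall>\<sigma>\<in>bdry_faces (Suc n) m. Cmp C (\<pi> \<sigma>) h = \<pi>' \<sigma>))))"

text \<open>There is no type of all sets, so the hypercovers considered in the definition of a matching
  Verdier site have their sections in one type, which depends on the type \<open>'m\<close> of morphisms only.
  It is closed under finite sequences and pairing with morphisms, so it contains the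
  indices of the (finite) matching data and of their covering families.\<close>

datatype 'm rtree = Node 'm "'m rtree list"

definition matching_verdier :: "('o, 'm) cat \<Rightarrow> ('o, 'm) cov \<Rightarrow> bool" where
  "matching_verdier C j \<longleftrightarrow>
     (\<forall>U\<in>Obj C. \<forall>n. \<forall>(H :: ('o, 'm, 'm rtree) spsh) p I A \<phi> a.
        truncated_verdier_hypercover C j n U H p \<and> split_spsh C {..n} H \<and>
        (\<forall>k\<le>n. presentation C (level H k) (I k) (A k) (\<phi> k)) \<and>
        smap {..n} (bdry (Suc n)) (ind C H I A \<phi>) a \<longrightarrow>
        matching_limit_exists C U H p I A \<phi> n a) \<and>
     (\<forall>f. basal C j f \<longrightarrow> is_mono C f)"

end

(* As basal morphisms are monomorphisms, all summands of the refinement are subobjects of U, and a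
   simplex of its index simplicial set is determined by the labels of its faces: the corresponding
   subobject for a nondegenerate face, nothing for a degenerate one.  The refinement is built by
   skeleta.  The limit of a boundary, which exists by hypothesis, is the intersection of the
   subobjects that belong to its faces.  If a degenerate simplex fills the boundary, then its summand
   is already the whole limit, and nothing is added.  Otherwise, the new fillers are indexed by a
   covering family of the limit over whose members the induced boundary in H has fillers.

   A hypercover has such local fillers: the criterion in terms of Ex-infinity provides a filler that is
   defined on an iterated subdivision of the simplex, and it can be moved down one subdivision at a
   time by filling horns in a cylinder.  Conversely, if boundaries have local fillers, then maps extend
   locally along inclusions of finite complexes, in particular from the subdivision of a boundary to
   that of the simplex; hence the refinement is a hypercover. *)
theory Submission
  imports Defs
begin

section \<open>Local existence\<close>

text \<open>The hypothesis on limits concerns only split truncated Verdier hypercovers with sections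
  in \<open>'m rtree\<close>. So each skeleton must be recognized as such a hypercover, inside this
  type, before the boundaries of the next dimension have limits. Labels with values in morphisms
  make this possible: they are finite data.

  A covering basal matching map requires that all fillers of one boundary together form a family in
  \<open>j\<close>. A coverage need not allow its families to be enlarged, so a degenerate filler
  must not stand beside new ones, nor beside a second degenerate one. Leaving degenerate faces
  unlabeled makes the degenerate filler unique: it is the labeled boundary itself.

  Since y(U) is discrete, every simplex of its Ex-infinity is constant, and homotopies there are
  equalities. The criterion for local weak equivalences thereby becomes a strict local extension
  property along boundary inclusions, \<open>Lext\<close>. Fillers are found over a cover, then over
  covers of its members, and so on; \<open>locally_transitive\<close> brings such iterated covers
  back to a single one.\<close>

locale site_ctx =
  fixes C :: "('o, 'm) cat" and j :: "('o, 'm) cov"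
  assumes site: "site C j" and ltr: "locally_transitive C j"
begin

lemma cat: "category C" and cov: "coverage C j"
  using site by (auto simp: site_def)

lemma hom_Src: "f \<in> hom C A B \<Longrightarrow> Src C f = A"
  and hom_Trg: "f \<in> hom C A B \<Longrightarrow> Trg C f = B"
  and hom_Arr: "f \<in> hom C A B \<Longrightarrow> f \<in> Arr C"
  by (auto simp: hom_def)

lemma hom_Obj: assumes "f \<in> hom C A B" shows "A \<in> Obj C" "B \<in> Obj C"
  using assms cat unfolding category_def hom_def by blast+

lemma Arr_hom: "f \<in> Arr C \<Longrightarrow> f \<in> hom C (Src C f) (Trg C f)"
  by (auto simp: hom_def)

lemma comp_hom: assumes "f \<in> hom C A B" "g \<in> hom C B D" shows "Cmp C g f \<in> hom C A D"
  using assms cat hom_Obj[OF assms(1)] hom_Obj[OF assms(2)] unfolding category_def by blast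

lemma comp_assoc:
  assumes "f \<in> hom C A B" "g \<in> hom C B D" "h \<in> hom C D E"
  shows "Cmp C h (Cmp C g f) = Cmp C (Cmp C h g) f"
  using assms cat unfolding category_def hom_def by auto

lemma id_hom: "A \<in> Obj C \<Longrightarrow> Idt C A \<in> hom C A A"
  using cat unfolding category_def by blast

lemma id_right: assumes "f \<in> hom C A B" shows "Cmp C f (Idt C A) = f"
  and id_left: "Cmp C (Idt C B) f = f"
  using assms cat hom_Obj[OF assms] unfolding category_def by blast+

lemma cov_hom: "V \<in> Obj C \<Longrightarrow> r \<in> j V \<Longrightarrow> e \<in> r \<Longrightarrow> e \<in> hom C (Src C e) V"
  using cov unfolding coverage_def hom_def by blast

lemma id_cov: assumes "V \<in> Obj C" shows "{Idt C V} \<in> j V"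
proof -
  have i: "Idt C V \<in> hom C V V" using id_hom assms by blast
  then have "is_iso C (Idt C V)"
    using id_left[OF i] unfolding is_iso_def by (auto simp: hom_def)
  then have "{Idt C V} \<in> j (Trg C (Idt C V))" using cov unfolding coverage_def by blast
  then show ?thesis using hom_Trg[OF i] by simp
qed

lemma cov_pullback:
  assumes "r \<in> j W" "g \<in> hom C V W"
  shows "\<exists>t\<in>j V. \<forall>e\<in>t. \<exists>f\<in>r. \<exists>s\<in>hom C (Src C e) (Src C f). Cmp C f s = Cmp C g e"
proof -
  have "\<forall>U\<in>Obj C. \<forall>V\<in>Obj C. \<forall>r\<in>j U. \<forall>g\<in>hom C V U.
        \<exists>t\<in>j V. \<forall>e\<in>t. \<exists>f\<in>r. \<exists>s\<in>hom C (Src C e) (Src C f). Cmp C f s = Cmp C g e"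
    using cov unfolding coverage_def by (elim conjE)
  then show ?thesis using hom_Obj[OF assms(2)] assms by simp
qed

text \<open>The predicate concerns the members of the family and not just their sources, since local
  data are compared with restrictions along the members.\<close>

definition loc :: "'o \<Rightarrow> ('m \<Rightarrow> bool) \<Rightarrow> bool" where
  "loc V P \<longleftrightarrow> (\<exists>r\<in>j V. \<forall>e\<in>r. P e)"

lemma loc_id: "V \<in> Obj C \<Longrightarrow> P (Idt C V) \<Longrightarrow> loc V P"
  unfolding loc_def using id_cov by (intro bexI[of _ "{Idt C V}"]) auto

lemma loc_mono:
  assumes "V \<in> Obj C" "loc V P" "\<And>e. e \<in> hom C (Src C e) V \<Longrightarrow> P e \<Longrightarrow> Q e"
  shows "loc V Q"
proof -
  obtain r where r: "r \<in> j V" "\<forall>e\<in>r. P e" using assms(2) unfolding loc_def by auto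
  then have "\<forall>e\<in>r. Q e" using assms(3) cov_hom[OF assms(1) r(1)] by simp
  then show ?thesis using r(1) unfolding loc_def by auto
qed

text \<open>The assumption \<open>ltr\<close> yields not the family of all composites but a covering
  family whose members factor through composites. So \<open>Q\<close> has to survive further
  restriction, which is the hypothesis \<open>stable\<close>.\<close>

lemma loc_trans:
  assumes V: "V \<in> Obj C" and P: "loc V P"
    and Q: "\<And>e. e \<in> hom C (Src C e) V \<Longrightarrow> P e \<Longrightarrow> loc (Src C e) (\<lambda>k. Q (Cmp C e k))"
    and stable: "\<And>e k. e \<in> hom C (Src C e) V \<Longrightarrow> k \<in> hom C (Src C k) (Src C e) \<Longrightarrow> Q e \<Longrightarrow> Q (Cmp C e k)"
  shows "loc V Q"
proof -
  obtain r where r: "r \<in> j V" "\<forall>e\<in>r. P e" using P unfolding loc_def by auto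
  have "\<forall>e\<in>r. \<exists>t\<in>j (Src C e). \<forall>k\<in>t. Q (Cmp C e k)"
    using Q cov_hom[OF V r(1)] r(2) unfolding loc_def by simp
  then obtain t where t: "\<And>e. e \<in> r \<Longrightarrow> t e \<in> j (Src C e)" "\<And>e k. e \<in> r \<Longrightarrow> k \<in> t e \<Longrightarrow> Q (Cmp C e k)"
    unfolding bchoice_iff Bex_def by blast
  obtain s where s: "s \<in> j V"
    "\<forall>e\<in>s. \<exists>f\<in>r. \<exists>g\<in>t f. \<exists>k\<in>hom C (Src C e) (Src C g). e = Cmp C (Cmp C f g) k"
    using ltr[unfolded locally_transitive_def, rule_format, OF V r(1), of t] t(1) by blast
  have "Q e" if "e \<in> s" for e
  proof -
    obtain f g k where fgk: "f \<in> r" "g \<in> t f" "k \<in> hom C (Src C e) (Src C g)" "e = Cmp C (Cmp C f g) k"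
      using s(2) \<open>e \<in> s\<close> by blast
    have f: "f \<in> hom C (Src C f) V" using cov_hom V r fgk by blast
    have g: "g \<in> hom C (Src C g) (Src C f)" using cov_hom hom_Obj[OF f] t fgk by blast
    have fg: "Cmp C f g \<in> hom C (Src C g) V" using comp_hom f g by blast
    have "Src C (Cmp C f g) = Src C g" using hom_Src[OF fg] .
    moreover have "Src C k = Src C e" using hom_Src[OF fgk(3)] .
    ultimately show "Q e" using stable[of "Cmp C f g" k] t(2)[OF fgk(1,2)] fg fgk by simp
  qed
  then show ?thesis using s(1) unfolding loc_def by auto
qed

end

section \<open>Monotone maps\<close>

lemma DeltaD:
  assumes "\<alpha> \<in> \<Delta> m n"
  shows "length \<alpha> = Suc m" "sorted \<alpha>" "set \<alpha> \<subseteq> {..n}" "\<alpha> \<noteq> []"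
  using assms by (auto simp: \<Delta>_def)

lemma Delta_nth: "\<alpha> \<in> \<Delta> m n \<Longrightarrow> i \<le> m \<Longrightarrow> \<alpha> ! i \<le> n"
  using nth_mem[of i \<alpha>] by (auto simp: \<Delta>_def simp del: nth_mem)

lemma Delta_mono: "\<alpha> \<in> \<Delta> m n \<Longrightarrow> i \<le> k \<Longrightarrow> k \<le> m \<Longrightarrow> \<alpha> ! i \<le> \<alpha> ! k"
  by (auto simp: \<Delta>_def sorted_iff_nth_mono)

lemma sorted_map_nth:
  assumes "sorted xs" "sorted \<alpha>" "\<forall>i\<in>set \<alpha>. i < length xs"
  shows "sorted (map ((!) xs) \<alpha>)"
  using assms by (auto simp: sorted_iff_nth_mono)

lemma ocomp_Delta: assumes "\<alpha> \<in> \<Delta> m n" "\<beta> \<in> \<Delta> k m" shows "ocomp \<alpha> \<beta> \<in> \<Delta> k n"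
proof -
  have b: "\<forall>i\<in>set \<beta>. i < length \<alpha>" using assms DeltaD(3)[OF assms(2)] DeltaD(1)[OF assms(1)] by auto
  have "sorted (map ((!) \<alpha>) \<beta>)" using sorted_map_nth[OF _ _ b] assms DeltaD(2) by blast
  moreover have "set (map ((!) \<alpha>) \<beta>) \<subseteq> {..n}" using b DeltaD(3)[OF assms(1)] nth_mem by fastforce
  ultimately show ?thesis using DeltaD(1)[OF assms(2)] by (simp add: \<Delta>_def ocomp_def)
qed

lemma id_Delta: "[0..<Suc n] \<in> \<Delta> n n"
  by (auto simp: \<Delta>_def simp del: upt_Suc)

lemma ocomp_id: assumes "\<alpha> \<in> \<Delta> m n" shows "ocomp [0..<Suc n] \<alpha> = \<alpha>" "ocomp \<alpha> [0..<Suc m] = \<alpha>"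
proof -
  show "ocomp [0..<Suc n] \<alpha> = \<alpha>" unfolding ocomp_def
    using DeltaD(3)[OF assms] by (intro map_idI) (auto simp del: upt_Suc simp: nth_upt)
  show "ocomp \<alpha> [0..<Suc m] = \<alpha>" unfolding ocomp_def
    using map_nth[of \<alpha>] DeltaD(1)[OF assms] by simp
qed

lemma nth_ocomp: "\<beta> \<in> \<Delta> k m \<Longrightarrow> i \<le> k \<Longrightarrow> ocomp \<alpha> \<beta> ! i = \<alpha> ! (\<beta> ! i)"
  by (auto simp: ocomp_def \<Delta>_def)

section \<open>Ordered lists of vertices and faces of standard simplices\<close>

definition pos :: "'v list \<Rightarrow> 'v \<Rightarrow> nat" where
  "pos \<sigma> w = (THE i. i < length \<sigma> \<and> \<sigma> ! i = w)"

lemma pos_nth: "distinct \<sigma> \<Longrightarrow> i < length \<sigma> \<Longrightarrow> pos \<sigma> (\<sigma> ! i) = i"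
  unfolding pos_def by (rule the_equality) (auto simp: nth_eq_iff_index_eq)

lemma nth_pos: assumes "distinct \<sigma>" "w \<in> set \<sigma>" shows "\<sigma> ! pos \<sigma> w = w" "pos \<sigma> w < length \<sigma>"
  using assms pos_nth by (metis in_set_conv_nth)+

definition strict :: "('v \<Rightarrow> nat) \<Rightarrow> 'v list \<Rightarrow> bool" where
  "strict rk \<sigma> \<longleftrightarrow> sorted_wrt (<) (map rk \<sigma>)"

lemma strict_distinct: "strict rk \<sigma> \<Longrightarrow> distinct \<sigma>"
  unfolding strict_def by (metis distinct_map strict_sorted_iff)

lemma pos_le_iff:
  assumes "strict rk \<sigma>" "v \<in> set \<sigma>" "w \<in> set \<sigma>"
  shows "pos \<sigma> v \<le> pos \<sigma> w \<longleftrightarrow> rk v \<le> rk w"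
proof -
  have d: "distinct \<sigma>" using assms strict_distinct by blast
  have lt: "rk (\<sigma> ! i) < rk (\<sigma> ! k)" if "i < k" "k < length \<sigma>" for i k
    using assms(1) that unfolding strict_def by (auto simp: sorted_wrt_iff_nth_less)
  have p: "\<sigma> ! pos \<sigma> v = v" "\<sigma> ! pos \<sigma> w = w" "pos \<sigma> v < length \<sigma>" "pos \<sigma> w < length \<sigma>"
    using nth_pos[OF d assms(2)] nth_pos[OF d assms(3)] by auto
  consider "pos \<sigma> v < pos \<sigma> w" | "pos \<sigma> v = pos \<sigma> w" | "pos \<sigma> w < pos \<sigma> v" by linarith
  then show ?thesis
  proof cases
    case 1
    then have "rk v < rk w" using lt[OF 1 p(4)] p by simp
    with 1 show ?thesis by simp
  next
    case 2
    then have "v = w" using p by metis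
    then show ?thesis by simp
  next
    case 3
    then have "rk w < rk v" using lt[OF 3 p(3)] p by simp
    with 3 show ?thesis by simp
  qed
qed

text \<open>The list \<sigma> identifies a standard simplex with the simplex on its entries, and
  \<open>pos \<sigma>\<close> is the inverse. A sorted list of vertices, with repetitions allowed,
  becomes a monotone map.\<close>

lemma pos_list:
  assumes "strict rk \<sigma>" "length \<sigma> = Suc d" "set xs \<subseteq> set \<sigma>" "length xs = Suc m" "sorted (map rk xs)"
  shows "map (pos \<sigma>) xs \<in> \<Delta> m d" "map ((!) \<sigma>) (map (pos \<sigma>) xs) = xs"
proof -
  have d: "distinct \<sigma>" using assms strict_distinct by blast
  show "map ((!) \<sigma>) (map (pos \<sigma>) xs) = xs"
    using assms(3) nth_pos[OF d] by (auto intro!: map_idI)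
  have "sorted (map (pos \<sigma>) xs)"
    unfolding sorted_iff_nth_mono
  proof (intro allI impI)
    fix i k assume "i \<le> k" "k < length (map (pos \<sigma>) xs)"
    then have ik: "i \<le> k" "k < length xs" by auto
    then have "rk (xs ! i) \<le> rk (xs ! k)" using assms(5) by (auto simp: sorted_iff_nth_mono)
    moreover have "xs ! i \<in> set \<sigma>" "xs ! k \<in> set \<sigma>" using ik assms(3) by auto
    ultimately show "map (pos \<sigma>) xs ! i \<le> map (pos \<sigma>) xs ! k"
      using ik pos_le_iff[OF assms(1)] by simp
  qed
  moreover have "set (map (pos \<sigma>) xs) \<subseteq> {..d}"
    using assms(2,3) nth_pos[OF d] by fastforce
  ultimately show "map (pos \<sigma>) xs \<in> \<Delta> m d" using assms(4) by (simp add: \<Delta>_def)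
qed

lemma ex_strict_list:
  assumes "finite F" "inj_on rk F"
  obtains \<sigma> where "strict rk \<sigma>" "set \<sigma> = F" "length \<sigma> = card F"
proof
  let ?l = "sorted_list_of_set (rk ` F)" let ?\<sigma> = "map (the_inv_into F rk) ?l"
  have l: "set ?l = rk ` F" using assms by simp
  have "map rk ?\<sigma> = ?l" using assms l by (auto intro!: map_idI simp: f_the_inv_into_f)
  then show "strict rk ?\<sigma>" unfolding strict_def by simp
  show "set ?\<sigma> = F" using assms l by (auto simp: the_inv_into_f_f image_image)
  show "length ?\<sigma> = card F" using assms by (simp add: card_image)
qed

text \<open>A nonempty face F of a simplex is handled through its inclusion \<open>sl F\<close>, an
  injective monotone map out of [card F - 1]; the subtraction reflects that [d] has d + 1
  elements.\<close>

abbreviation sl :: "nat set \<Rightarrow> nat list" where "sl \<equiv> sorted_list_of_set"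

lemma sl_Delta: assumes "F \<noteq> {}" "F \<subseteq> {..k}" shows "sl F \<in> \<Delta> (card F - 1) k"
proof -
  have f: "finite F" using assms finite_subset by blast
  then have "card F > 0" using assms by (simp add: card_gt_0_iff)
  then show ?thesis using f assms by (simp add: \<Delta>_def)
qed

lemma sl_Suc: assumes "F \<noteq> {}" "finite F" shows "length (sl F) = Suc (card F - 1)"
  using assms by (simp add: card_gt_0_iff)

lemma sl_strict: "strict id (sl F)"
  unfolding strict_def by simp

lemma sl_atMost: "sl {..k} = [0..<Suc k]"
  by (metis atLeast0AtMost atLeastLessThanSuc_atLeastAtMost sorted_list_of_set_range)

lemma strict_eq_sl: "sorted_wrt (<) \<tau> \<Longrightarrow> \<tau> = sl (set \<tau>)"
  by (simp add: sorted_list_of_set.idem_if_sorted_distinct strict_sorted_iff)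

text \<open>The epi-mono factorization in the simplex category: the image of \<tau> is the face
  \<open>set \<tau>\<close>, and \<epsilon> lists positions in it.\<close>

lemma epi_mono:
  assumes "\<tau> \<in> \<Delta> m k"
  obtains \<epsilon> where "\<epsilon> \<in> \<Delta> m (card (set \<tau>) - 1)" "set \<epsilon> = {..card (set \<tau>) - 1}" "\<tau> = ocomp (sl (set \<tau>)) \<epsilon>"
    "sl (set \<tau>) \<in> \<Delta> (card (set \<tau>) - 1) k"
proof
  let ?s = "sl (set \<tau>)" let ?e = "map (pos ?s) \<tau>"
  have ne: "set \<tau> \<noteq> {}" using DeltaD[OF assms] by auto
  have len: "length ?s = Suc (card (set \<tau>) - 1)" using sl_Suc ne by blast
  note pl = pos_list[OF sl_strict len, of \<tau> m]
  show e: "?e \<in> \<Delta> m (card (set \<tau>) - 1)" using pl DeltaD[OF assms] by simp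
  show "\<tau> = ocomp ?s ?e" using pl DeltaD[OF assms] by (simp add: ocomp_def)
  show "?s \<in> \<Delta> (card (set \<tau>) - 1) k" using sl_Delta ne DeltaD[OF assms] by blast
  show "set ?e = {..card (set \<tau>) - 1}"
  proof
    show "set ?e \<subseteq> {..card (set \<tau>) - 1}" using DeltaD[OF e] by simp
    show "{..card (set \<tau>) - 1} \<subseteq> set ?e"
    proof
      fix i assume "i \<in> {..card (set \<tau>) - 1}"
      then have i: "i < length ?s" using len by simp
      then have "?s ! i \<in> set \<tau>" using nth_mem[of i ?s] by simp
      moreover have "pos ?s (?s ! i) = i" by (rule pos_nth) (use i in auto)
      ultimately show "i \<in> set ?e" by (metis image_eqI list.set_map)
    qed
  qed
qed

section \<open>Ordered simplicial complexes\<close>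

text \<open>A simplicial complex, given by the set of its simplices, whose vertices are ordered in each
  simplex by an injective rank.\<close>

definition scomplex :: "('v \<Rightarrow> nat) \<Rightarrow> 'v set set \<Rightarrow> bool" where
  "scomplex rk T \<longleftrightarrow> (\<forall>F\<in>T. finite F \<and> F \<noteq> {} \<and> inj_on rk F \<and> (\<forall>G\<subseteq>F. G \<noteq> {} \<longrightarrow> G \<in> T))"

text \<open>Lists may repeat vertices, which gives the degenerate simplices. Standard simplices,
  boundaries, horns and iterated subdivisions all have this form, so the same extension lemmas apply
  to all of them.\<close>

definition nrv :: "('v \<Rightarrow> nat) \<Rightarrow> 'v set set \<Rightarrow> 'v list sset" where
  "nrv rk T = \<lparr>Sx = (\<lambda>m. {xs. length xs = Suc m \<and> sorted (map rk xs) \<and> set xs \<in> T}),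
               Act = (\<lambda>m \<alpha> xs. map (\<lambda>i. xs ! i) \<alpha>)\<rparr>"

lemma Sx_nrv: "xs \<in> Sx (nrv rk T) m \<longleftrightarrow> length xs = Suc m \<and> sorted (map rk xs) \<and> set xs \<in> T"
  by (simp add: nrv_def)

lemma Act_nrv: "Act (nrv rk T) m \<alpha> xs = map ((!) xs) \<alpha>"
  by (simp add: nrv_def)

lemma simplex_nrv: "simplex n = nrv id {F. F \<noteq> {} \<and> F \<subseteq> {..n}}"
  by (auto simp: simplex_def nrv_def \<Delta>_def ocomp_def fun_eq_iff)

lemma bdry_nrv: "bdry n = nrv id {F. F \<noteq> {} \<and> F \<subseteq> {..n} \<and> F \<noteq> {..n}}"
  by (auto simp: bdry_def nrv_def \<Delta>_def ocomp_def fun_eq_iff)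

lemma horn_nrv: "horn n k = nrv id {F. F \<noteq> {} \<and> F \<subseteq> {..n} \<and> \<not> {..n} - {k} \<subseteq> F}"
  by (auto simp: horn_def nrv_def \<Delta>_def ocomp_def fun_eq_iff)

lemma Sx_simplex: "Sx (simplex n) m = \<Delta> m n"
  by (simp add: simplex_def)

lemma Sx_bdry: "x \<in> Sx (bdry n) m \<longleftrightarrow> x \<in> \<Delta> m n \<and> set x \<noteq> {..n}"
  by (simp add: bdry_def)

lemma Act_simplex: "Act (simplex n) m \<alpha> x = ocomp x \<alpha>"
  by (simp add: simplex_def)

lemma Act_bdry: "Act (bdry n) m \<alpha> x = ocomp x \<alpha>"
  by (simp add: bdry_def)

lemma nrv_act_Sx:
  assumes "scomplex rk T" "xs \<in> Sx (nrv rk T) n" "\<alpha> \<in> \<Delta> m n"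
  shows "map ((!) xs) \<alpha> \<in> Sx (nrv rk T) m"
proof -
  have a: "\<forall>i\<in>set \<alpha>. i < length xs" using assms by (auto simp: \<Delta>_def Sx_nrv)
  have "sorted (map ((!) (map rk xs)) \<alpha>)"
    using sorted_map_nth[of "map rk xs" \<alpha>] assms a by (auto simp: \<Delta>_def Sx_nrv)
  moreover have "map ((!) (map rk xs)) \<alpha> = map rk (map ((!) xs) \<alpha>)" using a by auto
  ultimately have 1: "sorted (map rk (map ((!) xs) \<alpha>))" by simp
  have "set (map ((!) xs) \<alpha>) \<subseteq> set xs" using a by auto
  moreover have "set (map ((!) xs) \<alpha>) \<noteq> {}" using DeltaD[OF assms(3)] by auto
  ultimately have "set (map ((!) xs) \<alpha>) \<in> T" using assms(1,2) unfolding scomplex_def Sx_nrv by blast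
  then show ?thesis using 1 DeltaD(1)[OF assms(3)] unfolding Sx_nrv by simp
qed

lemma smap_nrv:
  "smap UNIV (nrv rk T) X f \<longleftrightarrow> (\<forall>n. \<forall>x\<in>Sx (nrv rk T) n. f n x \<in> Sx X n) \<and>
     (\<forall>n m. \<forall>\<alpha>\<in>\<Delta> m n. \<forall>x\<in>Sx (nrv rk T) n. f m (map ((!) x) \<alpha>) = Act X n \<alpha> (f n x))"
  by (simp add: smap_def Act_nrv)

text \<open>The enlarged complex is a pushout: each of its lists either lies in \<open>S\<close> or
  consists of vertices of \<sigma>, and \<open>agree\<close> is the compatibility on the
  overlap.\<close>

lemma attach_simplex:
  assumes S: "scomplex rk S" and \<sigma>: "strict rk \<sigma>" "length \<sigma> = Suc d"
    and f: "smap UNIV (nrv rk S) X f" and v: "smap UNIV (simplex d) X v"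
    and agree: "\<And>m x. x \<in> \<Delta> m d \<Longrightarrow> (!) \<sigma> ` set x \<in> S \<Longrightarrow> v m x = f m (map ((!) \<sigma>) x)"
  obtains f' where "smap UNIV (nrv rk (S \<union> {F. F \<noteq> {} \<and> F \<subseteq> set \<sigma>})) X f'"
    "\<And>m xs. xs \<in> Sx (nrv rk S) m \<Longrightarrow> f' m xs = f m xs"
    "\<And>m x. x \<in> \<Delta> m d \<Longrightarrow> f' m (map ((!) \<sigma>) x) = v m x"
proof
  define f' where "f' m xs = (if set xs \<in> S then f m xs else v m (map (pos \<sigma>) xs))" for m xs
  let ?T = "S \<union> {F. F \<noteq> {} \<and> F \<subseteq> set \<sigma>}"
  have d: "distinct \<sigma>" using \<sigma> strict_distinct by blast
  show 1: "f' m xs = f m xs" if "xs \<in> Sx (nrv rk S) m" for m xs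
    using that by (simp add: f'_def Sx_nrv)
  show 2: "f' m (map ((!) \<sigma>) x) = v m x" if x: "x \<in> \<Delta> m d" for m x
  proof -
    have "map (pos \<sigma>) (map ((!) \<sigma>) x) = x"
      using x \<sigma> pos_nth[OF d] by (auto simp: \<Delta>_def subset_iff less_Suc_eq_le intro!: map_idI)
    then show ?thesis using agree[OF x] by (auto simp: f'_def)
  qed
  have cases: "xs \<in> Sx (nrv rk S) n \<or> (\<exists>y\<in>\<Delta> n d. xs = map ((!) \<sigma>) y)"
    if "xs \<in> Sx (nrv rk ?T) n" for n xs
  proof (cases "set xs \<in> S")
    case False
    then have "map (pos \<sigma>) xs \<in> \<Delta> n d" "xs = map ((!) \<sigma>) (map (pos \<sigma>) xs)"
      using that pos_list[OF \<sigma>, of xs n] by (auto simp: Sx_nrv)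
    then show ?thesis by blast
  qed (use that in \<open>auto simp: Sx_nrv\<close>)
  show "smap UNIV (nrv rk ?T) X f'" unfolding smap_nrv
  proof (intro conjI allI ballI)
    fix n x assume x: "x \<in> Sx (nrv rk ?T) n"
    have "f n y \<in> Sx X n" if "y \<in> Sx (nrv rk S) n" for y using f that by (simp add: smap_def)
    moreover have "v n y \<in> Sx X n" if "y \<in> \<Delta> n d" for y using v that by (simp add: smap_def Sx_simplex)
    ultimately show "f' n x \<in> Sx X n" using cases[OF x] 1[of x n] 2[of _ n] by auto
  next
    fix n m \<alpha> x assume \<alpha>: "\<alpha> \<in> \<Delta> m n" and x: "x \<in> Sx (nrv rk ?T) n"
    from cases[OF x] show "f' m (map ((!) x) \<alpha>) = Act X n \<alpha> (f' n x)"
    proof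
      assume xS: "x \<in> Sx (nrv rk S) n"
      then show ?thesis using 1[OF xS] 1[OF nrv_act_Sx[OF S xS \<alpha>]] f \<alpha> by (simp add: smap_nrv)
    next
      assume "\<exists>y\<in>\<Delta> n d. x = map ((!) \<sigma>) y"
      then obtain y where y: "y \<in> \<Delta> n d" "x = map ((!) \<sigma>) y" by blast
      have "map ((!) x) \<alpha> = map ((!) \<sigma>) (ocomp y \<alpha>)"
        using \<alpha> y by (auto simp: \<Delta>_def ocomp_def)
      then have "f' m (map ((!) x) \<alpha>) = v m (ocomp y \<alpha>)" using 2 ocomp_Delta y \<alpha> by metis
      also have "\<dots> = Act X n \<alpha> (v n y)"
        using v y \<alpha> by (simp add: smap_def Sx_simplex Act_simplex)
      finally show ?thesis using 2 y by simp
    qed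
  qed
qed

lemma scomplex_attach:
  assumes "scomplex rk S" "strict rk \<sigma>"
  shows "scomplex rk (S \<union> {F. F \<noteq> {} \<and> F \<subseteq> set \<sigma>})"
proof -
  have "inj_on rk (set \<sigma>)" using assms(2) unfolding strict_def by (metis distinct_map strict_sorted_iff)
  then show ?thesis using assms(1) unfolding scomplex_def
    by (auto intro: finite_subset inj_on_subset)
qed

section \<open>Local extension of simplicial maps\<close>

lemma scomplex_face: "scomplex rk T \<Longrightarrow> F \<in> T \<Longrightarrow> G \<subseteq> F \<Longrightarrow> G \<noteq> {} \<Longrightarrow> G \<in> T"
  unfolding scomplex_def by (drule (1) bspec) simp

lemma scomplexD:
  assumes "scomplex rk T" "F \<in> T"
  shows "F \<noteq> {}" "finite F" "inj_on rk F"
  using assms unfolding scomplex_def by simp_all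

lemmas scomplex_ne = scomplexD(1)

text \<open>A pairing \<open>\<mu>\<close> of the simplices outside \<open>S\<close>: the vertex \<open>\<mu> F\<close> is what distinguishes the
  members of the pair of \<open>F\<close>.  The last condition makes the larger member of a pair attachable along
  a horn, when the pairs are ordered by \<open>key\<close>.\<close>

definition pairing :: "'v set set \<Rightarrow> 'v set set \<Rightarrow> ('v set \<Rightarrow> 'v) \<Rightarrow> ('v set \<Rightarrow> nat) \<Rightarrow> bool" where
  "pairing T S \<mu> key \<longleftrightarrow> (\<forall>F\<in>T - S. insert (\<mu> F) F \<in> T - S \<and> F - {\<mu> F} \<in> T - S \<and>
     \<mu> (insert (\<mu> F) F) = \<mu> F \<and> \<mu> (F - {\<mu> F}) = \<mu> F \<and>
     key (insert (\<mu> F) F) = key F \<and> key (F - {\<mu> F}) = key F \<and>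
     (\<forall>w\<in>F. \<mu> F \<in> F \<longrightarrow> w \<noteq> \<mu> F \<longrightarrow> F - {w} \<in> T - S \<longrightarrow> key (F - {w}) < key F))"

lemma pairingD:
  assumes "pairing T S \<mu> key" "F \<in> T - S"
  shows "insert (\<mu> F) F \<in> T - S" "F - {\<mu> F} \<in> T - S"
    "\<mu> (insert (\<mu> F) F) = \<mu> F" "\<mu> (F - {\<mu> F}) = \<mu> F"
    "key (insert (\<mu> F) F) = key F" "key (F - {\<mu> F}) = key F"
    "\<mu> F \<in> F \<Longrightarrow> w \<in> F \<Longrightarrow> w \<noteq> \<mu> F \<Longrightarrow> F - {w} \<in> T - S \<Longrightarrow> key (F - {w}) < key F"
  using assms unfolding pairing_def by simp_all

text \<open>No hypercover condition is included, because the locale is used for the given presheaf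
  \<open>H\<close> as well as for the refinement, where being a hypercover is the goal.\<close>

locale aug = site_ctx C j for C :: "('o, 'm) cat" and j +
  fixes U :: 'o and H :: "('o, 'm, 'x) spsh" and p :: "'o \<Rightarrow> nat \<Rightarrow> 'x \<Rightarrow> 'm"
  assumes U: "U \<in> Obj C" and spsh: "simplicial_presheaf C UNIV H" and aug: "spsh_map C UNIV H (yo C U) p"
begin

lemma Val_sset: "V \<in> Obj C \<Longrightarrow> simplicial_set UNIV (Val H V)"
  using spsh unfolding simplicial_presheaf_def by simp

lemma Act_mem: "V \<in> Obj C \<Longrightarrow> \<alpha> \<in> \<Delta> m n \<Longrightarrow> x \<in> Sx (Val H V) n \<Longrightarrow> Act (Val H V) n \<alpha> x \<in> Sx (Val H V) m"
  using Val_sset unfolding simplicial_set_def by simp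

lemma Act_comp: "V \<in> Obj C \<Longrightarrow> \<alpha> \<in> \<Delta> m n \<Longrightarrow> \<beta> \<in> \<Delta> k m \<Longrightarrow> x \<in> Sx (Val H V) n \<Longrightarrow>
  Act (Val H V) m \<beta> (Act (Val H V) n \<alpha> x) = Act (Val H V) n (ocomp \<alpha> \<beta>) x"
  using Val_sset unfolding simplicial_set_def by simp

lemma Rst_smap: "e \<in> hom C W V \<Longrightarrow> smap UNIV (Val H V) (Val H W) (Rst H e)"
  using spsh unfolding simplicial_presheaf_def hom_def by auto

lemma Rst_mem: "e \<in> hom C W V \<Longrightarrow> x \<in> Sx (Val H V) n \<Longrightarrow> Rst H e n x \<in> Sx (Val H W) n"
  using Rst_smap unfolding smap_def by simp

lemma Rst_Act: "e \<in> hom C W V \<Longrightarrow> \<alpha> \<in> \<Delta> m n \<Longrightarrow> x \<in> Sx (Val H V) n \<Longrightarrow>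
  Rst H e m (Act (Val H V) n \<alpha> x) = Act (Val H W) n \<alpha> (Rst H e n x)"
  using Rst_smap unfolding smap_def by simp

lemma Rst_id: "V \<in> Obj C \<Longrightarrow> x \<in> Sx (Val H V) n \<Longrightarrow> Rst H (Idt C V) n x = x"
  using spsh unfolding simplicial_presheaf_def by simp

lemma Rst_comp: "e \<in> hom C W V \<Longrightarrow> k \<in> hom C W' W \<Longrightarrow> x \<in> Sx (Val H V) n \<Longrightarrow>
  Rst H k n (Rst H e n x) = Rst H (Cmp C e k) n x"
  using spsh unfolding simplicial_presheaf_def hom_def by auto

lemma p_Act: "V \<in> Obj C \<Longrightarrow> \<alpha> \<in> \<Delta> m n \<Longrightarrow> x \<in> Sx (Val H V) n \<Longrightarrow> p V m (Act (Val H V) n \<alpha> x) = p V n x"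
  using aug unfolding spsh_map_def smap_def yo_def by simp

lemma p_Rst: "e \<in> hom C W V \<Longrightarrow> x \<in> Sx (Val H V) n \<Longrightarrow> p W n (Rst H e n x) = Cmp C (p V n x) e"
  using aug unfolding spsh_map_def yo_def hom_def by auto

text \<open>A map from a connected nonempty \<open>B\<close> to the discrete y(U) is constant, but
  the boundaries of the 0-simplex and of the 1-simplex are empty or disconnected. Hence the common
  value \<open>g\<close> is part of the data.\<close>

definition over :: "'o \<Rightarrow> 'y sset \<Rightarrow> 'm \<Rightarrow> (nat \<Rightarrow> 'y \<Rightarrow> 'x) \<Rightarrow> bool" where
  "over V B g f \<longleftrightarrow> smap UNIV B (Val H V) f \<and> (\<forall>m. \<forall>x\<in>Sx B m. p V m (f m x) = g)"

lemma over_mem: "over V B g f \<Longrightarrow> x \<in> Sx B m \<Longrightarrow> f m x \<in> Sx (Val H V) m"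
  unfolding over_def smap_def by simp

lemma over_Act: "over V B g f \<Longrightarrow> x \<in> Sx B n \<Longrightarrow> \<alpha> \<in> \<Delta> m n \<Longrightarrow> f m (Act B n \<alpha> x) = Act (Val H V) n \<alpha> (f n x)"
  unfolding over_def smap_def by simp

lemma over_p: "over V B g f \<Longrightarrow> x \<in> Sx B m \<Longrightarrow> p V m (f m x) = g"
  unfolding over_def by simp

lemma overI:
  assumes "\<And>m x. x \<in> Sx B m \<Longrightarrow> f m x \<in> Sx (Val H V) m"
    "\<And>n m x \<alpha>. x \<in> Sx B n \<Longrightarrow> \<alpha> \<in> \<Delta> m n \<Longrightarrow> f m (Act B n \<alpha> x) = Act (Val H V) n \<alpha> (f n x)"
    "\<And>m x. x \<in> Sx B m \<Longrightarrow> p V m (f m x) = g"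
  shows "over V B g f"
  using assms unfolding over_def smap_def by simp

lemma over_Rst:
  assumes f: "over V B g f" and e: "e \<in> hom C W V"
  shows "over W B (Cmp C g e) (\<lambda>m x. Rst H e m (f m x))"
proof (rule overI)
  fix m x assume x: "x \<in> Sx B m"
  note fx = over_mem[OF f x]
  show "Rst H e m (f m x) \<in> Sx (Val H W) m" using Rst_mem[OF e fx] .
  show "p W m (Rst H e m (f m x)) = Cmp C g e" using p_Rst[OF e fx] over_p[OF f x] by simp
  fix k \<alpha> assume \<alpha>: "\<alpha> \<in> \<Delta> k m"
  show "Rst H e k (f k (Act B m \<alpha> x)) = Act (Val H W) m \<alpha> (Rst H e m (f m x))"
    using Rst_Act[OF e \<alpha> fx] over_Act[OF f x \<alpha>] by simp
qed

text \<open>\<open>B\<close> is meant to be a simplicial subset of \<open>T\<close>.\<close>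

definition Lext :: "'y sset \<Rightarrow> 'y sset \<Rightarrow> bool" where
  "Lext B T \<longleftrightarrow> (\<forall>V\<in>Obj C. \<forall>g\<in>hom C V U. \<forall>f. over V B g f \<longrightarrow>
     loc V (\<lambda>e. \<exists>h. over (Src C e) T (Cmp C g e) h \<and> (\<forall>m. \<forall>x\<in>Sx B m. h m x = Rst H e m (f m x))))"

lemma LextD:
  assumes "Lext B T" "g \<in> hom C V U" "over V B g f"
  shows "loc V (\<lambda>e. \<exists>h. over (Src C e) T (Cmp C g e) h \<and> (\<forall>m. \<forall>x\<in>Sx B m. h m x = Rst H e m (f m x)))"
  using assms hom_Obj unfolding Lext_def by simp

lemma Lext_refl: "Lext B B"
  unfolding Lext_def
proof (intro ballI allI impI)
  fix V g f assume V: "V \<in> Obj C" and g: "g \<in> hom C V U" and f: "over V B g f"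
  have "Src C (Idt C V) = V" using id_hom[OF V] by (auto simp: hom_def)
  then show "loc V (\<lambda>e. \<exists>h. over (Src C e) B (Cmp C g e) h \<and> (\<forall>m. \<forall>x\<in>Sx B m. h m x = Rst H e m (f m x)))"
    using f id_right[OF g] Rst_id[OF V] over_mem[OF f] by (intro loc_id[OF V] exI[of _ f]) simp
qed

text \<open>Combines two successive local constructions. The intermediate datum \<open>h\<close> is
  arbitrary and may live on another complex than \<open>T\<close>. Restrictions of extensions extend
  the restrictions, which supplies the stability that \<open>loc_trans\<close> asks for.\<close>

lemma loc_over_trans:
  assumes V: "g \<in> hom C V U" 
    and P: "loc V (\<lambda>e. \<exists>h. P e h)"
    and Q: "\<And>e h. e \<in> hom C (Src C e) V \<Longrightarrow> P e h \<Longrightarrow> 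
      loc (Src C e) (\<lambda>k. \<exists>h. over (Src C k) T (Cmp C (Cmp C g e) k) h \<and>
        (\<forall>m. \<forall>x\<in>Sx B m. h m x = Rst H k m (Rst H e m (f m x))))"
    and f: "\<And>m x. x \<in> Sx B m \<Longrightarrow> f m x \<in> Sx (Val H V) m"
    and sub: "\<And>m. Sx B m \<subseteq> Sx T m"
  shows "loc V (\<lambda>e. \<exists>h. over (Src C e) T (Cmp C g e) h \<and> (\<forall>m. \<forall>x\<in>Sx B m. h m x = Rst H e m (f m x)))"
proof (rule loc_trans[OF hom_Obj(1)[OF V] P])
  fix e assume e: "e \<in> hom C (Src C e) V" and "\<exists>h. P e h"
  then obtain h where h: "P e h" by blast
  show "loc (Src C e) (\<lambda>k. \<exists>h. over (Src C (Cmp C e k)) T (Cmp C g (Cmp C e k)) h \<and>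
        (\<forall>m. \<forall>x\<in>Sx B m. h m x = Rst H (Cmp C e k) m (f m x)))"
  proof (rule loc_mono[OF hom_Obj(1)[OF e] Q[OF e h]])
    fix k assume k: "k \<in> hom C (Src C k) (Src C e)"
      and ex: "\<exists>h. over (Src C k) T (Cmp C (Cmp C g e) k) h \<and>
        (\<forall>m. \<forall>x\<in>Sx B m. h m x = Rst H k m (Rst H e m (f m x)))"
    have "Src C (Cmp C e k) = Src C k" using hom_Src[OF comp_hom[OF k e]] .
    then show "\<exists>h. over (Src C (Cmp C e k)) T (Cmp C g (Cmp C e k)) h \<and>
        (\<forall>m. \<forall>x\<in>Sx B m. h m x = Rst H (Cmp C e k) m (f m x))"
      using ex f Rst_comp[OF e k] comp_assoc[OF k e V] by simp
  qed
next
  fix e k assume e: "e \<in> hom C (Src C e) V" and k: "k \<in> hom C (Src C k) (Src C e)"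
    and "\<exists>h. over (Src C e) T (Cmp C g e) h \<and> (\<forall>m. \<forall>x\<in>Sx B m. h m x = Rst H e m (f m x))"
  then obtain h where h: "over (Src C e) T (Cmp C g e) h" "\<And>m x. x \<in> Sx B m \<Longrightarrow> h m x = Rst H e m (f m x)"
    by auto
  have "over (Src C (Cmp C e k)) T (Cmp C g (Cmp C e k)) (\<lambda>m x. Rst H k m (h m x))"
    using over_Rst[OF h(1) k] hom_Src[OF comp_hom[OF k e]] comp_assoc[OF k e V] by simp
  moreover have "Rst H k m (h m x) = Rst H (Cmp C e k) m (f m x)" if "x \<in> Sx B m" for m x
    using h(2)[OF that] Rst_comp[OF e k] f[OF that] by simp
  ultimately show "\<exists>h. over (Src C (Cmp C e k)) T (Cmp C g (Cmp C e k)) h \<and>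
        (\<forall>m. \<forall>x\<in>Sx B m. h m x = Rst H (Cmp C e k) m (f m x))"
    by blast
qed

lemma Lext_trans:
  assumes BT: "Lext B T" and TR: "Lext T R" and sub: "\<And>m. Sx B m \<subseteq> Sx T m" "\<And>m. Sx T m \<subseteq> Sx R m"
  shows "Lext B R"
  unfolding Lext_def
proof (intro ballI allI impI)
  fix V g f assume V: "V \<in> Obj C" and g: "g \<in> hom C V U" and f: "over V B g f"
  show "loc V (\<lambda>e. \<exists>h. over (Src C e) R (Cmp C g e) h \<and> (\<forall>m. \<forall>x\<in>Sx B m. h m x = Rst H e m (f m x)))"
  proof (rule loc_over_trans[OF g LextD[OF BT g f]])
    fix e h assume e: "e \<in> hom C (Src C e) V"
      and h: "over (Src C e) T (Cmp C g e) h \<and> (\<forall>m. \<forall>x\<in>Sx B m. h m x = Rst H e m (f m x))"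
    have ge: "Cmp C g e \<in> hom C (Src C e) U" using comp_hom[OF e g] .
    show "loc (Src C e) (\<lambda>k. \<exists>h. over (Src C k) R (Cmp C (Cmp C g e) k) h \<and>
        (\<forall>m. \<forall>x\<in>Sx B m. h m x = Rst H k m (Rst H e m (f m x))))"
    proof (rule loc_mono[OF hom_Obj(1)[OF e] LextD[OF TR ge]])
      show "over (Src C e) T (Cmp C g e) h" using h by simp
      fix k assume "\<exists>h'. over (Src C k) R (Cmp C (Cmp C g e) k) h' \<and> (\<forall>m. \<forall>x\<in>Sx T m. h' m x = Rst H k m (h m x))"
      then obtain h' where h': "over (Src C k) R (Cmp C (Cmp C g e) k) h'"
        "\<forall>m. \<forall>x\<in>Sx T m. h' m x = Rst H k m (h m x)" by blast
      then have "\<forall>m. \<forall>x\<in>Sx B m. h' m x = Rst H k m (Rst H e m (f m x))" using h sub(1) by (simp add: subset_iff)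
      then show "\<exists>h. over (Src C k) R (Cmp C (Cmp C g e) k) h \<and>
        (\<forall>m. \<forall>x\<in>Sx B m. h m x = Rst H k m (Rst H e m (f m x)))" using h'(1) by blast
    qed
  next
    show "Sx B m \<subseteq> Sx R m" for m using sub by blast
  qed (use over_mem[OF f] in simp)
qed

text \<open>Local extension properties are stable under pushout. The complex in \<open>ext\<close>
  is the preimage of \<open>S\<close> in the standard simplex, that is, the part along which
  \<sigma> is attached.\<close>

lemma Lext_attach:
  assumes S: "scomplex rk S" and \<sigma>: "strict rk \<sigma>" "length \<sigma> = Suc d"
    and ext: "Lext (nrv id {F. F \<noteq> {} \<and> F \<subseteq> {..d} \<and> (!) \<sigma> ` F \<in> S}) (simplex d)"
  shows "Lext (nrv rk S) (nrv rk (S \<union> {F. F \<noteq> {} \<and> F \<subseteq> set \<sigma>}))"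
  unfolding Lext_def
proof (intro ballI allI impI)
  let ?B = "nrv id {F. F \<noteq> {} \<and> F \<subseteq> {..d} \<and> (!) \<sigma> ` F \<in> S}"
  let ?T = "S \<union> {F. F \<noteq> {} \<and> F \<subseteq> set \<sigma>}"
  fix V g f assume V: "V \<in> Obj C" and g: "g \<in> hom C V U" and f: "over V (nrv rk S) g f"
  define f1 where "f1 m x = f m (map ((!) \<sigma>) x)" for m x
  have B\<Delta>: "x \<in> \<Delta> m d" if "x \<in> Sx ?B m" for x m
    using that by (auto simp: Sx_nrv \<Delta>_def)
  have BS: "map ((!) \<sigma>) x \<in> Sx (nrv rk S) m" if x: "x \<in> Sx ?B m" for x m
  proof -
    have "\<forall>i\<in>set x. i < length (map rk \<sigma>)" using x \<sigma> by (auto simp: Sx_nrv)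
    moreover have "sorted (map rk \<sigma>)" using \<sigma>(1) unfolding strict_def by (simp add: strict_sorted_imp_sorted)
    ultimately have "sorted (map ((!) (map rk \<sigma>)) x)" using sorted_map_nth[of "map rk \<sigma>" x] x by (simp add: Sx_nrv)
    moreover have "map ((!) (map rk \<sigma>)) x = map rk (map ((!) \<sigma>) x)" using x \<sigma> by (auto simp: Sx_nrv)
    ultimately show ?thesis using x by (simp add: Sx_nrv)
  qed
  have f1: "over V ?B g f1"
  proof (rule overI)
    fix n m x \<alpha> assume x: "x \<in> Sx ?B n" and \<alpha>: "\<alpha> \<in> \<Delta> m n"
    have "map ((!) \<sigma>) (map ((!) x) \<alpha>) = map ((!) (map ((!) \<sigma>) x)) \<alpha>"
      using x \<alpha> by (auto simp: Sx_nrv \<Delta>_def)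
    then show "f1 m (Act ?B n \<alpha> x) = Act (Val H V) n \<alpha> (f1 n x)"
      using over_Act[OF f BS[OF x] \<alpha>] unfolding f1_def Act_nrv by (simp only:)
  qed (use over_mem[OF f BS] over_p[OF f BS] in \<open>auto simp: f1_def\<close>)
  show "loc V (\<lambda>e. \<exists>h. over (Src C e) (nrv rk ?T) (Cmp C g e) h \<and>
      (\<forall>m. \<forall>x\<in>Sx (nrv rk S) m. h m x = Rst H e m (f m x)))"
  proof (rule loc_mono[OF V LextD[OF ext g f1]])
    fix e assume e: "e \<in> hom C (Src C e) V" and "\<exists>h. over (Src C e) (simplex d) (Cmp C g e) h \<and>
      (\<forall>m. \<forall>x\<in>Sx ?B m. h m x = Rst H e m (f1 m x))"
    then obtain v where v: "over (Src C e) (simplex d) (Cmp C g e) v"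
      "\<And>m x. x \<in> Sx ?B m \<Longrightarrow> v m x = Rst H e m (f1 m x)" by auto
    let ?f = "\<lambda>m x. Rst H e m (f m x)"
    have fe: "over (Src C e) (nrv rk S) (Cmp C g e) ?f" using over_Rst[OF f e] .
    have agree: "v m x = ?f m (map ((!) \<sigma>) x)" if "x \<in> \<Delta> m d" "(!) \<sigma> ` set x \<in> S" for m x
    proof -
      have "x \<in> Sx ?B m" using that by (auto simp: \<Delta>_def Sx_nrv)
      then show ?thesis using v(2) by (simp add: f1_def)
    qed
    obtain f' where f': "smap UNIV (nrv rk ?T) (Val H (Src C e)) f'"
      "\<And>m xs. xs \<in> Sx (nrv rk S) m \<Longrightarrow> f' m xs = ?f m xs"
      "\<And>m x. x \<in> \<Delta> m d \<Longrightarrow> f' m (map ((!) \<sigma>) x) = v m x"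
      using attach_simplex[OF S \<sigma>, of "Val H (Src C e)" ?f v] fe v(1) agree unfolding over_def by blast
    have "p (Src C e) m (f' m xs) = Cmp C g e" if xs: "xs \<in> Sx (nrv rk ?T) m" for m xs
    proof (cases "set xs \<in> S")
      case True
      then have "xs \<in> Sx (nrv rk S) m" using xs by (simp add: Sx_nrv)
      then show ?thesis using f'(2) over_p[OF fe] by simp
    next
      case False
      then have "map (pos \<sigma>) xs \<in> \<Delta> m d" "map ((!) \<sigma>) (map (pos \<sigma>) xs) = xs"
        using pos_list[OF \<sigma>, of xs m] xs by (auto simp: Sx_nrv)
      then show ?thesis using f'(3)[of "map (pos \<sigma>) xs" m] over_p[OF v(1)] by (simp add: Sx_simplex)
    qed
    then have "over (Src C e) (nrv rk ?T) (Cmp C g e) f'" using f'(1) unfolding over_def by simp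
    then show "\<exists>h. over (Src C e) (nrv rk ?T) (Cmp C g e) h \<and>
      (\<forall>m. \<forall>x\<in>Sx (nrv rk S) m. h m x = ?f m x)" using f'(2) by blast
  qed
qed

text \<open>Cells are attached along their whole boundaries, in the order of increasing dimension.\<close>

lemma Lext_complex:
  assumes rlp: "\<And>n. Lext (bdry n) (simplex n)"
    and "finite T" "scomplex rk T" "S \<subseteq> T" "scomplex rk S"
  shows "Lext (nrv rk S) (nrv rk T)"
  using assms(4,5)
proof (induction "card (T - S)" arbitrary: S rule: less_induct)
  case less
  show ?case
  proof (cases "S = T")
    case False
    define F where "F = arg_min_on card (T - S)"
    have ne: "finite (T - S)" "T - S \<noteq> {}" using less.prems False assms(2) by auto
    have F: "F \<in> T - S" "\<And>G. G \<in> T - S \<Longrightarrow> card F \<le> card G"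
      using arg_min_if_finite[OF ne, of card] arg_min_least[OF ne, of _ card] unfolding F_def by auto
    have fF: "finite F" "inj_on rk F" "F \<noteq> {}" using scomplexD[OF assms(3), of F] F(1) by auto
    obtain \<sigma> where \<sigma>: "strict rk \<sigma>" "set \<sigma> = F" "length \<sigma> = card F" using ex_strict_list[OF fF(1,2)] .
    obtain d where d: "card F = Suc d" using fF by (metis card_gt_0_iff gr0_implies_Suc)
    have faces: "G \<in> S" if "G \<subset> F" "G \<noteq> {}" for G
    proof (rule ccontr)
      assume "G \<notin> S"
      then have "G \<in> T - S" using that F(1) scomplex_face[OF assms(3), of F G] by blast
      then show False using F(2) psubset_card_mono[OF fF(1) that(1)] by fastforce
    qed
    have len: "length \<sigma> = Suc d" using \<sigma> d by simp
    have "{G. G \<noteq> {} \<and> G \<subseteq> {..d} \<and> (!) \<sigma> ` G \<in> S} = {G. G \<noteq> {} \<and> G \<subseteq> {..d} \<and> G \<noteq> {..d}}"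
    proof -
      have inj: "inj_on ((!) \<sigma>) {..d}" using strict_distinct[OF \<sigma>(1)] len
        by (auto simp: inj_on_def nth_eq_iff_index_eq)
      have im: "(!) \<sigma> ` {..d} = F" using \<sigma>(2) len nth_image[of "Suc d" \<sigma>] by (simp add: lessThan_Suc_atMost atLeast0AtMost atLeastLessThanSuc_atLeastAtMost)
      have "(!) \<sigma> ` G \<in> S \<longleftrightarrow> G \<noteq> {..d}" if "G \<subseteq> {..d}" "G \<noteq> {}" for G
      proof
        show "(!) \<sigma> ` G \<in> S \<Longrightarrow> G \<noteq> {..d}" using im F(1) by blast
        assume "G \<noteq> {..d}"
        then have "(!) \<sigma> ` G \<noteq> F" using inj_on_image_eq_iff[OF inj, of G "{..d}"] that im by blast
        then have "(!) \<sigma> ` G \<subset> F" using that im by blast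
        then show "(!) \<sigma> ` G \<in> S" using faces that by blast
      qed
      then show ?thesis by blast
    qed
    then have "Lext (nrv id {G. G \<noteq> {} \<and> G \<subseteq> {..d} \<and> (!) \<sigma> ` G \<in> S}) (simplex d)"
      using rlp[of d] by (simp add: bdry_nrv)
    from Lext_attach[OF less.prems(2) \<sigma>(1) len this]
    have 1: "Lext (nrv rk S) (nrv rk (S \<union> {G. G \<noteq> {} \<and> G \<subseteq> F}))" using \<sigma>(2) by simp
    let ?S = "S \<union> {G. G \<noteq> {} \<and> G \<subseteq> F}"
    have S': "?S \<subseteq> T" "scomplex rk ?S" "F \<in> ?S"
    proof -
      show "scomplex rk ?S" using scomplex_attach[OF less.prems(2) \<sigma>(1)] \<sigma>(2) by simp
      have "G \<in> T" if "G \<noteq> {}" "G \<subseteq> F" for G using scomplex_face[OF assms(3)] F(1) that by blast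
      then show "?S \<subseteq> T" using less.prems(1) by auto
      show "F \<in> ?S" using fF(3) by simp
    qed
    have "card (T - ?S) < card (T - S)" using F(1) ne(1) S'(3) by (intro psubset_card_mono) auto
    then have 2: "Lext (nrv rk ?S) (nrv rk T)" using less.hyps S' by blast
    show ?thesis
    proof (rule Lext_trans[OF 1 2])
      show "Sx (nrv rk S) m \<subseteq> Sx (nrv rk ?S) m" for m by (auto simp: nrv_def)
      show "Sx (nrv rk ?S) m \<subseteq> Sx (nrv rk T) m" for m using S'(1) unfolding nrv_def by auto
    qed
  qed (simp add: Lext_refl)
qed

text \<open>One horn filling attaches both members of a pair: the larger one is the new simplex, the
  smaller one its missing facet. Taking a pair of least key ensures that the other facets are
  already present.\<close>

lemma Lext_pairing:
  fixes key :: "'v set \<Rightarrow> nat"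
  assumes horn: "\<And>n k. n \<ge> 1 \<Longrightarrow> k \<le> n \<Longrightarrow> Lext (horn n k) (simplex n)"
    and "finite T" "scomplex rk T" "S \<subseteq> T" "scomplex rk S"
    and "pairing T S \<mu> key"
  shows "Lext (nrv rk S) (nrv rk T)"
  using assms(4-)
proof (induction "card (T - S)" arbitrary: S rule: less_induct)
  case less
  note up = pairingD(1,2)[OF less.prems(3)] and \<mu> = pairingD(3,4)[OF less.prems(3)]
    and key = pairingD(5,6)[OF less.prems(3)] and desc = pairingD(7)[OF less.prems(3)]
  show ?case
  proof (cases "S = T")
    case False
    define F0 where "F0 = arg_min_on key (T - S)"
    have ne: "finite (T - S)" "T - S \<noteq> {}" using less.prems(1) False assms(2) by auto
    have F0: "F0 \<in> T - S" "\<And>G. G \<in> T - S \<Longrightarrow> key F0 \<le> key G"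
      using arg_min_if_finite[OF ne, of key] arg_min_least[OF ne, of _ key] unfolding F0_def by auto
    \<comment> \<open>\<open>F\<close> is the larger member of the pair of \<open>F0\<close>; it may
      be \<open>F0\<close> itself.\<close>
    define v where "v = \<mu> F0"
    define F where "F = insert v F0"
    have F: "F \<in> T - S" "\<mu> F = v" "v \<in> F" "F - {v} \<in> T - S" "key F = key F0"
    proof -
      show 1: "F \<in> T - S" using up(1)[OF F0(1)] unfolding F_def v_def .
      show "\<mu> F = v" using \<mu>(1)[OF F0(1)] unfolding F_def v_def .
      then show "F - {v} \<in> T - S" using up(2)[OF 1] by simp
      show "v \<in> F" unfolding F_def by simp
      show "key F = key F0" using key(1)[OF F0(1)] unfolding F_def v_def .
    qed
    have fF: "finite F" "inj_on rk F" "F \<noteq> {}" using scomplexD[OF assms(3), of F] F(1) by auto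
    have Fv: "F - {v} \<noteq> {}" using scomplex_ne[OF assms(3)] F(4) by blast
    obtain \<sigma> where \<sigma>: "strict rk \<sigma>" "set \<sigma> = F" "length \<sigma> = card F" using ex_strict_list[OF fF(1,2)] .
    obtain d where d: "card F = Suc d" using fF by (metis card_gt_0_iff gr0_implies_Suc)
    have len: "length \<sigma> = Suc d" using \<sigma> d by simp
    have d1: "d \<ge> 1"
    proof (rule ccontr)
      assume "\<not> d \<ge> 1"
      then have "card F = 1" using d by simp
      then show False using F(3) Fv by (metis card_1_singletonE Diff_cancel singletonD)
    qed
    \<comment> \<open>A facet opposite to a vertex other than \<open>v\<close> has a smaller key,
      hence lies in \<open>S\<close> by minimality. What is missing from \<open>S\<close> is exactly
      \<open>F\<close> and \<open>F - {v}\<close>.\<close>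
    have faces: "G \<in> S \<longleftrightarrow> \<not> F - {v} \<subseteq> G" if "G \<subseteq> F" "G \<noteq> {}" for G
    proof
      assume "G \<in> S"
      show "\<not> F - {v} \<subseteq> G"
      proof
        assume "F - {v} \<subseteq> G"
        then have "F - {v} \<in> S" using scomplex_face[OF less.prems(2) \<open>G \<in> S\<close>] Fv by blast
        then show False using F(4) by blast
      qed
    next
      assume "\<not> F - {v} \<subseteq> G"
      then obtain w where w: "w \<in> F" "w \<noteq> v" "w \<notin> G" by blast
      have "F - {w} \<in> T" using scomplex_face[OF assms(3), of F "F - {w}"] F(1) w F(3) by blast
      moreover have "F - {w} \<notin> T - S"
      proof
        assume a: "F - {w} \<in> T - S"
        have "key (F - {w}) < key F" using desc[OF F(1) _ w(1) _ a] F(2,3) w(2) by simp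
        then show False using F0(2)[OF a] F(5) by simp
      qed
      ultimately have "F - {w} \<in> S" by blast
      moreover have "G \<subseteq> F - {w}" using that w by blast
      ultimately show "G \<in> S" using scomplex_face[OF less.prems(2)] that by blast
    qed
    \<comment> \<open>The missing facet is opposite to \<open>v\<close>, so the horn is the one
      indexed by the position of \<open>v\<close> in \<open>F\<close>.\<close>
    define k where "k = pos \<sigma> v"
    have dist: "distinct \<sigma>" using strict_distinct[OF \<sigma>(1)] .
    have k: "k \<le> d" "\<sigma> ! k = v" using nth_pos[OF dist, of v] \<sigma>(2) F(3) len unfolding k_def by auto
    have "{G. G \<noteq> {} \<and> G \<subseteq> {..d} \<and> (!) \<sigma> ` G \<in> S} = {G. G \<noteq> {} \<and> G \<subseteq> {..d} \<and> \<not> {..d} - {k} \<subseteq> G}"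
    proof -
      have inj: "inj_on ((!) \<sigma>) {..d}" using dist len
        by (auto simp: inj_on_def nth_eq_iff_index_eq)
      have im: "(!) \<sigma> ` {..d} = F" using \<sigma>(2) len nth_image[of "Suc d" \<sigma>] by (simp add: lessThan_Suc_atMost atLeast0AtMost atLeastLessThanSuc_atLeastAtMost)
      have im2: "(!) \<sigma> ` ({..d} - {k}) = F - {v}" using inj_on_image_set_diff[OF inj, of "{..d}" "{k}"] k im by auto
      have "(!) \<sigma> ` G \<in> S \<longleftrightarrow> \<not> {..d} - {k} \<subseteq> G" if "G \<subseteq> {..d}" "G \<noteq> {}" for G
      proof -
        have "(!) \<sigma> ` ({..d} - {k}) \<subseteq> (!) \<sigma> ` G \<longleftrightarrow> {..d} - {k} \<subseteq> G"
        proof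
          assume a: "(!) \<sigma> ` ({..d} - {k}) \<subseteq> (!) \<sigma> ` G"
          show "{..d} - {k} \<subseteq> G"
          proof
            fix x assume x: "x \<in> {..d} - {k}"
            then have "\<sigma> ! x \<in> (!) \<sigma> ` G" using a by blast
            then show "x \<in> G" using inj_on_image_mem_iff[OF inj, of x G] x that(1) by simp
          qed
        qed (rule image_mono)
        moreover have "(!) \<sigma> ` G \<subseteq> F" "(!) \<sigma> ` G \<noteq> {}" using that im by auto
        ultimately show ?thesis using faces[of "(!) \<sigma> ` G"] im2 by simp
      qed
      then show ?thesis by blast
    qed
    then have "Lext (nrv id {G. G \<noteq> {} \<and> G \<subseteq> {..d} \<and> (!) \<sigma> ` G \<in> S}) (simplex d)"
      using horn[OF d1 k(1)] by (simp add: horn_nrv)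
    from Lext_attach[OF less.prems(2) \<sigma>(1) len this]
    have 1: "Lext (nrv rk S) (nrv rk (S \<union> {G. G \<noteq> {} \<and> G \<subseteq> F}))" using \<sigma>(2) by simp
    let ?S = "S \<union> {G. G \<noteq> {} \<and> G \<subseteq> F}"
    have S': "?S \<subseteq> T" "scomplex rk ?S" "F \<in> ?S"
    proof -
      show "scomplex rk ?S" using scomplex_attach[OF less.prems(2) \<sigma>(1)] \<sigma>(2) by simp
      have "G \<in> T" if "G \<noteq> {}" "G \<subseteq> F" for G using scomplex_face[OF assms(3)] F(1) that by blast
      then show "?S \<subseteq> T" using less.prems(1) by auto
      show "F \<in> ?S" using fF(3) by simp
    qed
    have diff: "T - ?S = T - S - {F, F - {v}}"
    proof -
      have "G = F \<or> G = F - {v}" if "G \<in> T - S" "G \<subseteq> F" for G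
        using faces[of G] that scomplex_ne[OF assms(3), of G] by blast
      moreover have "G \<noteq> {}" if "G \<in> T" for G using that scomplex_ne[OF assms(3)] by blast
      ultimately show ?thesis using F by auto
    qed
    \<comment> \<open>Removing the pair of \<open>F\<close> does not break another pair: \<mu> is
      constant on pairs, so a pair meeting \<open>F\<close> or \<open>F - {v}\<close> has
      distinguished vertex \<open>v\<close> and is the same pair.\<close>
    have sep: "insert (\<mu> G) G \<in> T - ?S \<and> G - {\<mu> G} \<in> T - ?S" if G: "G \<in> T - ?S" for G
    proof -
      have G': "G \<in> T - S" "G \<noteq> F" "G \<noteq> F - {v}" using G unfolding diff by auto
      have "\<mu> (F - {v}) = v" using \<mu>[OF F(1)] F(2) by simp
      have a: "insert (\<mu> G) G \<noteq> F"
      proof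
        assume a: "insert (\<mu> G) G = F"
        then have "\<mu> G = v" using \<mu>[OF G'(1)] F(2) by simp
        then show False using a G' by blast
      qed
      have b: "G - {\<mu> G} \<noteq> F - {v}"
      proof
        assume a: "G - {\<mu> G} = F - {v}"
        then have "\<mu> G = v" using \<mu>[OF G'(1)] \<open>\<mu> (F - {v}) = v\<close> by simp
        then show False using a G' F(3) by blast
      qed
      have c: "insert (\<mu> G) G \<noteq> F - {v}"
      proof
        assume a: "insert (\<mu> G) G = F - {v}"
        then have "\<mu> G = v" using \<mu>[OF G'(1)] \<open>\<mu> (F - {v}) = v\<close> by simp
        then show False using a by blast
      qed
      have d: "G - {\<mu> G} \<noteq> F"
      proof
        assume a: "G - {\<mu> G} = F"
        then have "\<mu> G = v" using \<mu>[OF G'(1)] F(2) by simp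
        then show False using a F(3) by blast
      qed
      show ?thesis unfolding diff using up[OF G'(1)] a b c d by blast
    qed
    have sub: "T - ?S \<subseteq> T - S" by blast
    have "card (T - ?S) < card (T - S)" using F(1) ne(1) S'(3) by (intro psubset_card_mono) auto
    then have 2: "Lext (nrv rk ?S) (nrv rk T)"
    proof (rule less.hyps[OF _ S'(1,2)])
      show "pairing T ?S \<mu> key" unfolding pairing_def
      proof (intro ballI)
        fix G assume G': "G \<in> T - ?S"
        then have G: "G \<in> T - S" by blast
        have "\<forall>w\<in>G. \<mu> G \<in> G \<longrightarrow> w \<noteq> \<mu> G \<longrightarrow> G - {w} \<in> T - ?S \<longrightarrow> key (G - {w}) < key G"
          using desc[OF G] by blast
        then show "insert (\<mu> G) G \<in> T - ?S \<and> G - {\<mu> G} \<in> T - ?S \<and>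
          \<mu> (insert (\<mu> G) G) = \<mu> G \<and> \<mu> (G - {\<mu> G}) = \<mu> G \<and>
          key (insert (\<mu> G) G) = key G \<and> key (G - {\<mu> G}) = key G \<and>
          (\<forall>w\<in>G. \<mu> G \<in> G \<longrightarrow> w \<noteq> \<mu> G \<longrightarrow> G - {w} \<in> T - ?S \<longrightarrow> key (G - {w}) < key G)"
          using sep[OF G'] \<mu>[OF G] key[OF G] by (intro conjI) simp_all
      qed
    qed
    show ?thesis
    proof (rule Lext_trans[OF 1 2])
      show "Sx (nrv rk S) m \<subseteq> Sx (nrv rk ?S) m" for m by (auto simp: nrv_def)
      show "Sx (nrv rk ?S) m \<subseteq> Sx (nrv rk T) m" for m using S'(1) unfolding nrv_def by auto
    qed
  qed (simp add: Lext_refl)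
qed

end

section \<open>Iterated subdivisions\<close>

text \<open>The carrier: the vertices of the smallest face of the standard simplex whose subdivision
  contains the given vertex. It detects the subdivided boundary.\<close>

primrec supp :: "vertex \<Rightarrow> nat set" where
  "supp (Vtx i) = {i}"
| "supp (Chain c) = \<Union> (fset (supp |`| c))"

lemma supp_Chain: "supp (Chain c) = (\<Union>x\<in>fset c. supp x)"
  by simp

text \<open>All that matters is strict monotonicity for \<open>sd_le\<close>: it turns the chains of
  a subdivision into the simplices of a complex ordered by a numerical rank.\<close>

primrec rank :: "vertex \<Rightarrow> nat" where
  "rank (Vtx i) = i"
| "rank (Chain c) = fcard c"

lemma sd_le_refl: "sd_le x x"
  by (cases x) auto

lemma rank_mono: "sd_le x y \<Longrightarrow> rank x \<le> rank y"
  by (cases x; cases y) (auto simp: fcard_mono)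

lemma rank_strict: "sd_le x y \<Longrightarrow> rank x = rank y \<Longrightarrow> x = y"
  by (cases x; cases y) (auto simp: fcard_seteq)

definition chain :: "vertex set \<Rightarrow> bool" where
  "chain F \<longleftrightarrow> (\<forall>x\<in>F. \<forall>y\<in>F. sd_le x y \<or> sd_le y x)"

lemma chain_mono: "chain F \<Longrightarrow> G \<subseteq> F \<Longrightarrow> chain G"
  unfolding chain_def by (simp add: subset_iff)

lemma sd_vert_SucE:
  assumes "x \<in> sd_vert n (Suc m)"
  obtains c where "x = Chain c" "fset c \<noteq> {}" "fset c \<subseteq> sd_vert n m" "chain (fset c)"
  using assms that unfolding chain_def by auto

lemma sd_vert_SucI: "fset c \<noteq> {} \<Longrightarrow> fset c \<subseteq> sd_vert n m \<Longrightarrow> chain (fset c) \<Longrightarrow> Chain c \<in> sd_vert n (Suc m)"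
  unfolding chain_def by auto

declare sd_vert.simps(2)[simp del]

lemma finite_sd_vert: "finite (sd_vert n m)"
proof (induction m)
  case (Suc m)
  have "sd_vert n (Suc m) \<subseteq> (\<lambda>F. Chain (Abs_fset F)) ` Pow (sd_vert n m)"
  proof
    fix x assume "x \<in> sd_vert n (Suc m)"
    then obtain c where "x = Chain c" "fset c \<subseteq> sd_vert n m" by (elim sd_vert_SucE)
    then show "x \<in> (\<lambda>F. Chain (Abs_fset F)) ` Pow (sd_vert n m)"
      by (intro image_eqI[of _ _ "fset c"]) (auto simp: fset_inverse)
  qed
  then show ?case using Suc finite_subset by blast
qed simp

lemma supp_bounds: "x \<in> sd_vert n m \<Longrightarrow> supp x \<noteq> {} \<and> supp x \<subseteq> {..n}"
proof (induction m arbitrary: x)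
  case (Suc m)
  then obtain c where c: "x = Chain c" "fset c \<noteq> {}" "fset c \<subseteq> sd_vert n m" by (elim sd_vert_SucE)
  then have "\<forall>y\<in>fset c. supp y \<noteq> {} \<and> supp y \<subseteq> {..n}" using Suc.IH by blast
  then show ?case using c(1,2) unfolding c(1) supp_Chain by blast
qed auto

lemma finite_supp: "x \<in> sd_vert n m \<Longrightarrow> finite (supp x)"
  using finite_subset[OF conjunct2[OF supp_bounds]] by simp

text \<open>The composite of all last vertex maps down to the unsubdivided simplex; see
  \<open>lvi_0\<close>.\<close>

definition lvx :: "vertex \<Rightarrow> nat" where
  "lvx x = Max (supp x)"

lemma lvx_mem: "x \<in> sd_vert n m \<Longrightarrow> lvx x \<in> supp x"
  unfolding lvx_def using finite_supp supp_bounds by simp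

lemma lvx_mono:
  assumes "sd_le x y" "x \<in> sd_vert n m" "y \<in> sd_vert n m"
  shows "lvx x \<le> lvx y"
proof (cases x)
  case (Vtx i)
  then show ?thesis using assms(1) by (cases y) (auto simp: lvx_def)
next
  case (Chain c)
  then obtain d where d: "y = Chain d" "c |\<subseteq>| d" using assms(1) by (cases y) auto
  then have "supp x \<subseteq> supp y" unfolding Chain d(1) supp_Chain by (auto simp: less_eq_fset.rep_eq)
  then show ?thesis unfolding lvx_def using supp_bounds[OF assms(2)] finite_supp[OF assms(3)] by (intro Max_mono) auto
qed

lemma Max_Union_cong:
  fixes A B :: "'a \<Rightarrow> nat set"
  assumes "finite I" "I \<noteq> {}" "\<And>i. i \<in> I \<Longrightarrow> finite (A i) \<and> A i \<noteq> {}" "\<And>i. i \<in> I \<Longrightarrow> finite (B i) \<and> B i \<noteq> {}"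
    and eq: "\<And>i. i \<in> I \<Longrightarrow> Max (A i) = Max (B i)"
  shows "Max (\<Union>i\<in>I. A i) = Max (\<Union>i\<in>I. B i)"
proof -
  have le: "Max (\<Union>i\<in>I. A i) \<le> Max (\<Union>i\<in>I. B i)"
    if "\<And>i. i \<in> I \<Longrightarrow> finite (A i) \<and> A i \<noteq> {}" "\<And>i. i \<in> I \<Longrightarrow> finite (B i) \<and> B i \<noteq> {}"
      "\<And>i. i \<in> I \<Longrightarrow> Max (A i) = Max (B i)" for A B :: "'a \<Rightarrow> nat set"
  proof (rule Max.boundedI)
    show "finite (\<Union>i\<in>I. A i)" using assms(1) that(1) by blast
    show "(\<Union>i\<in>I. A i) \<noteq> {}" using assms(2) that(1) by blast
    fix a assume "a \<in> (\<Union>i\<in>I. A i)"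
    then obtain i where i: "i \<in> I" "a \<in> A i" by blast
    have "a \<le> Max (A i)" using i that(1) Max_ge by blast
    also have "\<dots> = Max (B i)" using that(3) i by blast
    also have "\<dots> \<le> Max (\<Union>i\<in>I. B i)"
      using i that(2) assms(1) by (intro Max_mono) auto
    finally show "a \<le> Max (\<Union>i\<in>I. B i)" .
  qed
  show ?thesis using le[of A B] le[of B A] assms by (intro antisym) simp_all
qed

lemma last_vertex_0: "x \<in> sd_vert n (Suc 0) \<Longrightarrow> last_vertex 0 x = Vtx (lvx x)"
proof -
  assume "x \<in> sd_vert n (Suc 0)"
  then obtain c where c: "x = Chain c" "fset c \<subseteq> Vtx ` {..n}" by (elim sd_vert_SucE) simp
  then have "{i. Vtx i |\<in>| c} = supp x" unfolding c(1) supp_Chain by force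
  then show ?thesis using c(1) by (simp add: lvx_def del: supp.simps)
qed

lemma last_vertex_Suc: "last_vertex (Suc m) (Chain c) = Chain (last_vertex m |`| c)"
  by simp

declare last_vertex.simps[simp del]

text \<open>The statements are proved together because membership one stage higher means that chains
  go to chains, which rests on monotonicity at the previous stage. The maximum of the support is
  preserved since a maximum over a union only depends on the maxima of its parts.\<close>

lemma last_vertex_props:
  "(\<forall>x\<in>sd_vert n (Suc m). last_vertex m x \<in> sd_vert n m \<and> lvx (last_vertex m x) = lvx x) \<and>
   (\<forall>x\<in>sd_vert n (Suc m). \<forall>y\<in>sd_vert n (Suc m). sd_le x y \<longrightarrow> sd_le (last_vertex m x) (last_vertex m y))"
proof (induction m)
  case 0
  show ?case
  proof (intro conjI ballI impI)
    fix x assume x: "x \<in> sd_vert n (Suc 0)"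
    show "lvx (last_vertex 0 x) = lvx x" unfolding last_vertex_0[OF x] by (simp add: lvx_def)
    show "last_vertex 0 x \<in> sd_vert n 0" unfolding last_vertex_0[OF x] using lvx_mem[OF x] supp_bounds[OF x] by auto
    fix y assume y: "y \<in> sd_vert n (Suc 0)" and "sd_le x y"
    then show "sd_le (last_vertex 0 x) (last_vertex 0 y)"
      unfolding last_vertex_0[OF x] last_vertex_0[OF y] using lvx_mono x by simp
  qed
next
  case (Suc m)
  have lv: "\<And>x. x \<in> sd_vert n (Suc m) \<Longrightarrow> last_vertex m x \<in> sd_vert n m"
      "\<And>x. x \<in> sd_vert n (Suc m) \<Longrightarrow> lvx (last_vertex m x) = lvx x"
      "\<And>x y. x \<in> sd_vert n (Suc m) \<Longrightarrow> y \<in> sd_vert n (Suc m) \<Longrightarrow> sd_le x y \<Longrightarrow> sd_le (last_vertex m x) (last_vertex m y)"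
    using Suc by blast+
  show ?case
  proof (intro conjI ballI impI)
    fix x assume "x \<in> sd_vert n (Suc (Suc m))"
    then obtain c where c: "x = Chain c" "fset c \<noteq> {}" "fset c \<subseteq> sd_vert n (Suc m)" "chain (fset c)"
      by (elim sd_vert_SucE)
    show "last_vertex (Suc m) x \<in> sd_vert n (Suc m)" unfolding c(1) last_vertex_Suc
    proof (rule sd_vert_SucI)
      show "fset (last_vertex m |`| c) \<noteq> {}" using c(2) by simp
      show "fset (last_vertex m |`| c) \<subseteq> sd_vert n m" using c(3) lv(1) by auto
      show "chain (fset (last_vertex m |`| c))" unfolding chain_def
      proof (intro ballI)
        fix a b assume "a \<in> fset (last_vertex m |`| c)" "b \<in> fset (last_vertex m |`| c)"
        then obtain a' b' where ab: "a' \<in> fset c" "a = last_vertex m a'" "b' \<in> fset c" "b = last_vertex m b'" by auto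
        then have "sd_le a' b' \<or> sd_le b' a'" using c(4) unfolding chain_def by blast
        then show "sd_le a b \<or> sd_le b a" using lv(3)[of a' b'] lv(3)[of b' a'] ab c(3) by blast
      qed
    qed
    have "Max (\<Union>y\<in>fset c. supp (last_vertex m y)) = Max (\<Union>y\<in>fset c. supp y)"
    proof (rule Max_Union_cong)
      fix i assume "i \<in> fset c"
      then have i: "i \<in> sd_vert n (Suc m)" using c(3) by blast
      show "finite (supp (last_vertex m i)) \<and> supp (last_vertex m i) \<noteq> {}"
        using lv(1)[OF i] finite_supp supp_bounds by blast
      show "finite (supp i) \<and> supp i \<noteq> {}" using i finite_supp supp_bounds by blast
      show "Max (supp (last_vertex m i)) = Max (supp i)" using lv(2)[OF i] unfolding lvx_def .
    qed (use c(2) in auto)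
    then show "lvx (last_vertex (Suc m) x) = lvx x"
      unfolding c(1) last_vertex_Suc lvx_def by simp
    fix y assume "y \<in> sd_vert n (Suc (Suc m))" "sd_le x y"
    then show "sd_le (last_vertex (Suc m) x) (last_vertex (Suc m) y)"
      unfolding c(1) by (elim sd_vert_SucE) (auto simp: last_vertex_Suc intro: fimage_mono)
  qed
qed

lemma last_vertex_in: "x \<in> sd_vert n (Suc m) \<Longrightarrow> last_vertex m x \<in> sd_vert n m"
  and lvx_last_vertex: "x \<in> sd_vert n (Suc m) \<Longrightarrow> lvx (last_vertex m x) = lvx x"
  and last_vertex_mono: "x \<in> sd_vert n (Suc m) \<Longrightarrow> y \<in> sd_vert n (Suc m) \<Longrightarrow> sd_le x y \<Longrightarrow>
    sd_le (last_vertex m x) (last_vertex m y)"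
  using last_vertex_props[of n m] by simp_all

lemma sd_map_Chain: "sd_map \<alpha> (Chain c) = Chain (sd_map \<alpha> |`| c)"
  by simp

lemma sd_map_mono:
  assumes "mono_on {..n} \<alpha>" "sd_le x y" "x \<in> sd_vert n m" "y \<in> sd_vert n m"
  shows "sd_le (sd_map \<alpha> x) (sd_map \<alpha> y)"
proof (cases x)
  case (Vtx i)
  then show ?thesis using assms by (cases y; cases m) (auto simp: mono_on_def sd_vert.simps(2))
next
  case (Chain c)
  then show ?thesis using assms by (cases y) (auto intro: fimage_mono)
qed

lemma sd_map_in:
  assumes "mono_on {..n} \<alpha>" "\<alpha> ` {..n} \<subseteq> {..n'}"
  shows "x \<in> sd_vert n m \<Longrightarrow> sd_map \<alpha> x \<in> sd_vert n' m"
proof (induction m arbitrary: x)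
  case 0
  then show ?case using assms(2) by auto
next
  case (Suc m)
  then obtain c where c: "x = Chain c" "fset c \<noteq> {}" "fset c \<subseteq> sd_vert n m" "chain (fset c)"
    by (elim sd_vert_SucE)
  show ?case unfolding c(1) sd_map_Chain
  proof (rule sd_vert_SucI)
    show "fset (sd_map \<alpha> |`| c) \<noteq> {}" using c(2) by simp
    show "fset (sd_map \<alpha> |`| c) \<subseteq> sd_vert n' m" using c(3) Suc.IH by auto
    show "chain (fset (sd_map \<alpha> |`| c))" unfolding chain_def
    proof (intro ballI)
      fix a b assume "a \<in> fset (sd_map \<alpha> |`| c)" "b \<in> fset (sd_map \<alpha> |`| c)"
      then obtain a' b' where ab: "a' \<in> fset c" "a = sd_map \<alpha> a'" "b' \<in> fset c" "b = sd_map \<alpha> b'" by auto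
      then have "sd_le a' b' \<or> sd_le b' a'" using c(4) unfolding chain_def by blast
      then show "sd_le a b \<or> sd_le b a"
        using sd_map_mono[OF assms(1), of a' b' m] sd_map_mono[OF assms(1), of b' a' m] ab c(3) by blast
    qed
  qed
qed

lemma supp_sd_map: "supp (sd_map \<alpha> x) = \<alpha> ` supp x"
  by (induction x) auto

lemma sd_map_cong: "(\<And>i. i \<in> supp x \<Longrightarrow> \<alpha> i = \<beta> i) \<Longrightarrow> sd_map \<alpha> x = sd_map \<beta> x"
proof (induction x)
  case (Chain c)
  have "sd_map \<alpha> y = sd_map \<beta> y" if "y \<in> fset c" for y
    using Chain.IH[OF that] Chain.prems that by auto
  then have "sd_map \<alpha> |`| c = sd_map \<beta> |`| c" by (intro fset.map_cong) auto
  then show ?case by simp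
qed simp

lemma sd_map_comp: "sd_map \<alpha> (sd_map \<beta> x) = sd_map (\<lambda>i. \<alpha> (\<beta> i)) x"
proof (induction x)
  case (Chain c)
  have "sd_map \<alpha> |`| (sd_map \<beta> |`| c) = sd_map (\<lambda>i. \<alpha> (\<beta> i)) |`| c"
    unfolding fset.map_comp using Chain by (intro fset.map_cong) auto
  then show ?case by simp
qed simp

lemma sd_map_id: "sd_map (\<lambda>i. i) x = x"
proof (induction x)
  case (Chain c)
  have "sd_map (\<lambda>i. i) |`| c = id |`| c" using Chain by (intro fset.map_cong) auto
  then show ?case by simp
qed simp

lemma lvx_sd_map:
  assumes "mono_on {..n} \<alpha>" "x \<in> sd_vert n m"
  shows "lvx (sd_map \<alpha> x) = \<alpha> (lvx x)"
  unfolding lvx_def supp_sd_map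
proof (rule Max_eqI)
  show "finite (\<alpha> ` supp x)" using finite_supp[OF assms(2)] by simp
  show "\<alpha> (Max (supp x)) \<in> \<alpha> ` supp x" using lvx_mem[OF assms(2)] unfolding lvx_def by simp
  fix y assume "y \<in> \<alpha> ` supp x"
  then obtain i where i: "i \<in> supp x" "y = \<alpha> i" by blast
  have "i \<le> Max (supp x)" using i(1) finite_supp[OF assms(2)] by simp
  moreover have "Max (supp x) \<in> {..n}" "i \<in> {..n}"
    using lvx_mem[OF assms(2)] supp_bounds[OF assms(2)] i(1) unfolding lvx_def by blast+
  ultimately show "y \<le> \<alpha> (Max (supp x))" using assms(1) i(2) unfolding mono_on_def by simp
qed

lemma last_vertex_sd_map:
  assumes "mono_on {..n} \<alpha>" "\<alpha> ` {..n} \<subseteq> {..n'}"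
  shows "x \<in> sd_vert n (Suc m) \<Longrightarrow> last_vertex m (sd_map \<alpha> x) = sd_map \<alpha> (last_vertex m x)"
proof (induction m arbitrary: x)
  case 0
  show ?case using last_vertex_0[OF sd_map_in[OF assms 0]] last_vertex_0[OF 0] lvx_sd_map[OF assms(1) 0] by simp
next
  case (Suc m)
  then obtain c where c: "x = Chain c" "fset c \<subseteq> sd_vert n (Suc m)" by (elim sd_vert_SucE)
  have "last_vertex m |`| (sd_map \<alpha> |`| c) = sd_map \<alpha> |`| (last_vertex m |`| c)"
    unfolding fset.map_comp using Suc.IH c(2) by (intro fset.map_cong) auto
  then show ?case unfolding c(1) sd_map_Chain last_vertex_Suc by simp
qed

text \<open>The composite of the last vertex maps from stage m + d to stage m. It turns the
  recursive \<open>ex_iter\<close> into a single precomposition.\<close>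

primrec lvi :: "nat \<Rightarrow> nat \<Rightarrow> vertex \<Rightarrow> vertex" where
  "lvi m 0 x = x"
| "lvi m (Suc d) x = lvi m d (last_vertex (m + d) x)"

lemma lvi_in: "x \<in> sd_vert n (m + d) \<Longrightarrow> lvi m d x \<in> sd_vert n m"
  by (induction d arbitrary: x) (auto simp: last_vertex_in)

lemma lvi_mono: "x \<in> sd_vert n (m + d) \<Longrightarrow> y \<in> sd_vert n (m + d) \<Longrightarrow> sd_le x y \<Longrightarrow> sd_le (lvi m d x) (lvi m d y)"
  by (induction d arbitrary: x y) (auto simp: last_vertex_in last_vertex_mono)

lemma lvi_0: "x \<in> sd_vert n d \<Longrightarrow> lvi 0 d x = Vtx (lvx x)"
proof (induction d arbitrary: x)
  case 0
  then show ?case by (auto simp: lvx_def)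
next
  case (Suc d)
  then show ?case using last_vertex_in[OF Suc.prems] lvx_last_vertex[OF Suc.prems] by simp
qed

lemma lvi_sd_map:
  assumes "mono_on {..n} \<alpha>" "\<alpha> ` {..n} \<subseteq> {..n'}"
  shows "x \<in> sd_vert n (m + d) \<Longrightarrow> lvi m d (sd_map \<alpha> x) = sd_map \<alpha> (lvi m d x)"
  by (induction d arbitrary: x) (auto simp: last_vertex_sd_map[OF assms] last_vertex_in)

definition sdc :: "nat \<Rightarrow> nat \<Rightarrow> vertex set set" where
  "sdc n m = {F. F \<noteq> {} \<and> F \<subseteq> sd_vert n m \<and> chain F}"

lemma finite_sdc: "finite (sdc n m)"
proof -
  have "sdc n m \<subseteq> Pow (sd_vert n m)" unfolding sdc_def by blast
  then show ?thesis using finite_sd_vert finite_subset by blast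
qed

lemma chain_inj_rank: "chain F \<Longrightarrow> inj_on rank F"
  unfolding chain_def inj_on_def using rank_strict by metis

lemma scomplex_sdc: "scomplex rank (sdc n m)"
  unfolding scomplex_def
proof (intro ballI conjI allI impI)
  fix F assume "F \<in> sdc n m"
  then have F: "F \<noteq> {}" "F \<subseteq> sd_vert n m" "chain F" unfolding sdc_def by auto
  show "finite F" using F finite_sd_vert finite_subset by blast
  show "F \<noteq> {}" using F by simp
  show "inj_on rank F" using F chain_inj_rank by simp
  fix G assume "G \<subseteq> F" "G \<noteq> {}"
  then show "G \<in> sdc n m" using F chain_mono unfolding sdc_def by blast
qed

text \<open>Within a chain, comparing ranks is the same as comparing by \<open>sd_le\<close>, as
  equal ranks of comparable vertices force equality.\<close>

lemma sorted_wrt_sd_le_iff: "sorted_wrt sd_le xs \<longleftrightarrow> chain (set xs) \<and> sorted (map rank xs)"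
proof
  assume s: "sorted_wrt sd_le xs"
  have le: "sd_le (xs ! i) (xs ! k)" if "i \<le> k" "k < length xs" for i k
    using s that sd_le_refl by (cases "i = k") (auto simp: sorted_wrt_iff_nth_less)
  have "sorted (map rank xs)" unfolding sorted_iff_nth_mono using le rank_mono by simp
  moreover have "chain (set xs)" unfolding chain_def
  proof (intro ballI)
    fix x y assume "x \<in> set xs" "y \<in> set xs"
    then obtain i k where "i < length xs" "x = xs ! i" "k < length xs" "y = xs ! k" by (auto simp: in_set_conv_nth)
    then show "sd_le x y \<or> sd_le y x" using le[of i k] le[of k i] by (cases "i \<le> k") auto
  qed
  ultimately show "chain (set xs) \<and> sorted (map rank xs)" by simp
next
  assume c: "chain (set xs) \<and> sorted (map rank xs)"
  show "sorted_wrt sd_le xs" unfolding sorted_wrt_iff_nth_less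
  proof (intro allI impI)
    fix i k assume ik: "i < k" "k < length xs"
    then have mem: "xs ! i \<in> set xs" "xs ! k \<in> set xs" by auto
    have r: "rank (xs ! i) \<le> rank (xs ! k)" using c ik by (auto simp: sorted_iff_nth_mono)
    consider "sd_le (xs ! i) (xs ! k)" | "sd_le (xs ! k) (xs ! i)" using c mem unfolding chain_def by blast
    then show "sd_le (xs ! i) (xs ! k)"
    proof cases
      case 2
      then have "rank (xs ! k) = rank (xs ! i)" using r rank_mono by (intro antisym) auto
      then show ?thesis using rank_strict[OF 2] sd_le_refl by simp
    qed
  qed
qed

lemma sd_nrv: "sd n m = nrv rank (sdc n m)"
proof -
  have "{xs. length xs = Suc k \<and> set xs \<subseteq> sd_vert n m \<and> sorted_wrt sd_le xs} =
    {xs. length xs = Suc k \<and> sorted (map rank xs) \<and> set xs \<in> sdc n m}" for k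
    unfolding sorted_wrt_sd_le_iff sdc_def by auto
  then show ?thesis unfolding sd_def nrv_def by simp
qed

lemma Sx_sd: "xs \<in> Sx (sd n m) k \<longleftrightarrow> length xs = Suc k \<and> set xs \<subseteq> sd_vert n m \<and> sorted_wrt sd_le xs"
  by (simp add: sd_def)

lemma Act_sd: "Act (sd n m) k \<alpha> xs = map ((!) xs) \<alpha>"
  by (simp add: sd_def)

lemma sd_act_Sx: "xs \<in> Sx (sd n m) k \<Longrightarrow> \<alpha> \<in> \<Delta> l k \<Longrightarrow> map ((!) xs) \<alpha> \<in> Sx (sd n m) l"
  unfolding sd_nrv using nrv_act_Sx[OF scomplex_sdc] by blast

lemma sd_map_Sx:
  assumes "xs \<in> Sx (sd n m) k" "\<And>x. x \<in> sd_vert n m \<Longrightarrow> f x \<in> sd_vert n' m'"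
    "\<And>x y. x \<in> sd_vert n m \<Longrightarrow> y \<in> sd_vert n m \<Longrightarrow> sd_le x y \<Longrightarrow> sd_le (f x) (f y)"
  shows "map f xs \<in> Sx (sd n' m') k"
proof -
  have "sorted_wrt (\<lambda>x y. sd_le (f x) (f y)) xs"
    using assms(1,3) unfolding Sx_sd by (auto intro: sorted_wrt_mono_rel[of xs sd_le])
  then show ?thesis using assms(1,2) unfolding Sx_sd by (auto simp: sorted_wrt_map)
qed

section \<open>Simplices of Ex-infinity\<close>

lemma srestrict_in: "n \<in> D \<Longrightarrow> x \<in> Sx X n \<Longrightarrow> srestrict D X f n x = f n x"
  unfolding srestrict_def by simp

lemma srestrict_ext:
  assumes "\<And>n x. n \<in> D \<Longrightarrow> x \<in> Sx X n \<Longrightarrow> f n x = g n x"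
  shows "srestrict D X f = srestrict D X g"
  unfolding srestrict_def using assms by (intro ext) simp

lemma smaps_iff: "f \<in> smaps D X Y \<longleftrightarrow> smap D X Y f \<and> srestrict D X f = f"
  unfolding smaps_def by (rule mem_Collect_eq)

lemmas smaps_smap = smaps_iff[THEN iffD1, THEN conjunct1]
  and smaps_srestrict_eq = smaps_iff[THEN iffD1, THEN conjunct2]

lemma smaps_ext:
  assumes "f \<in> smaps D X Y" "g \<in> smaps D X Y" "\<And>n x. n \<in> D \<Longrightarrow> x \<in> Sx X n \<Longrightarrow> f n x = g n x"
  shows "f = g"
proof -
  have "srestrict D X f = f" by (rule smaps_srestrict_eq[OF assms(1)])
  then have "f = srestrict D X f" by (rule sym)
  also have "\<dots> = srestrict D X g" by (rule srestrict_ext) (rule assms(3))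
  also have "\<dots> = g" by (rule smaps_srestrict_eq[OF assms(2)])
  finally show ?thesis .
qed

lemma smapsD:
  assumes "f \<in> smaps UNIV X Y"
  shows "x \<in> Sx X n \<Longrightarrow> f n x \<in> Sx Y n"
    "\<alpha> \<in> \<Delta> m n \<Longrightarrow> x \<in> Sx X n \<Longrightarrow> f m (Act X n \<alpha> x) = Act Y n \<alpha> (f n x)"
proof -
  have "smap UNIV X Y f" by (rule smaps_smap[OF assms])
  then show "x \<in> Sx X n \<Longrightarrow> f n x \<in> Sx Y n"
    "\<alpha> \<in> \<Delta> m n \<Longrightarrow> x \<in> Sx X n \<Longrightarrow> f m (Act X n \<alpha> x) = Act Y n \<alpha> (f n x)"
    unfolding smap_def by simp_all
qed

lemma smaps_srestrict:
  assumes "\<And>n x. x \<in> Sx X n \<Longrightarrow> f n x \<in> Sx Y n"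
    "\<And>n m \<alpha> x. \<alpha> \<in> \<Delta> m n \<Longrightarrow> x \<in> Sx X n \<Longrightarrow> f m (Act X n \<alpha> x) = Act Y n \<alpha> (f n x)"
    "\<And>n m \<alpha> x. \<alpha> \<in> \<Delta> m n \<Longrightarrow> x \<in> Sx X n \<Longrightarrow> Act X n \<alpha> x \<in> Sx X m"
  shows "srestrict UNIV X f \<in> smaps UNIV X Y"
proof -
  have "smap UNIV X Y (srestrict UNIV X f)"
    unfolding smap_def using assms by (simp add: srestrict_in)
  moreover have "srestrict UNIV X (srestrict UNIV X f) = srestrict UNIV X f"
    by (rule srestrict_ext) (simp add: srestrict_in)
  ultimately show ?thesis unfolding smaps_iff by (rule conjI)
qed

lemma Sx_ex_stage: "Sx (ex_stage m X) n = smaps UNIV (sd n m) X"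
  by (simp add: ex_stage_def)

lemma sd_Act_Sx: "\<alpha> \<in> \<Delta> l k \<Longrightarrow> xs \<in> Sx (sd n m) k \<Longrightarrow> Act (sd n m) k \<alpha> xs \<in> Sx (sd n m) l"
  unfolding Act_sd using sd_act_Sx by blast

lemma map_Act_sd:
  assumes "\<alpha> \<in> \<Delta> l k" "xs \<in> Sx (sd n m) k"
  shows "map f (Act (sd n m) k \<alpha> xs) = Act (sd n' m') k \<alpha> (map f xs)"
  using assms unfolding Act_sd by (auto simp: Sx_sd \<Delta>_def)

lemma smaps_sd_pull:
  assumes f: "f \<in> smaps UNIV (sd n' m') X" and "\<And>k xs. xs \<in> Sx (sd n m) k \<Longrightarrow> map \<phi> xs \<in> Sx (sd n' m') k"
  shows "srestrict UNIV (sd n m) (\<lambda>k xs. f k (map \<phi> xs)) \<in> smaps UNIV (sd n m) X"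
proof (rule smaps_srestrict)
  show "xs \<in> Sx (sd n m) k \<Longrightarrow> f k (map \<phi> xs) \<in> Sx X k" for k xs using smapsD(1)[OF f] assms(2) by blast
  show "f l (map \<phi> (Act (sd n m) k \<alpha> xs)) = Act X k \<alpha> (f k (map \<phi> xs))"
    if "\<alpha> \<in> \<Delta> l k" "xs \<in> Sx (sd n m) k" for k l \<alpha> xs
    using smapsD(2)[OF f that(1) assms(2)[OF that(2)]] map_Act_sd[OF that, of \<phi> n' m'] by simp
qed (rule sd_Act_Sx)

lemma lv_Sx: "xs \<in> Sx (sd n (Suc m)) k \<Longrightarrow> map (last_vertex m) xs \<in> Sx (sd n m) k"
  by (rule sd_map_Sx) (auto simp: last_vertex_in last_vertex_mono)

lemma lvi_Sx: "xs \<in> Sx (sd n (m + d)) k \<Longrightarrow> map (lvi m d) xs \<in> Sx (sd n m) k"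
  by (rule sd_map_Sx) (auto simp: lvi_in lvi_mono)

lemma Delta_mono_on: "\<alpha> \<in> \<Delta> m n \<Longrightarrow> mono_on {..m} ((!) \<alpha>)"
  by (intro mono_onI) (auto intro: Delta_mono)

lemma Delta_image: "\<alpha> \<in> \<Delta> m n \<Longrightarrow> (!) \<alpha> ` {..m} \<subseteq> {..n}"
  using Delta_nth by auto

lemma sd_Delta_Sx: "\<alpha> \<in> \<Delta> l n \<Longrightarrow> xs \<in> Sx (sd l m) k \<Longrightarrow> map (sd_map ((!) \<alpha>)) xs \<in> Sx (sd n m) k"
  by (rule sd_map_Sx)
    (use sd_map_in[OF Delta_mono_on Delta_image] sd_map_mono[OF Delta_mono_on] in blast)+

lemma ex_iter_eq:
  assumes f: "f \<in> smaps UNIV (sd n m) X"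
  shows "ex_iter n m d f = srestrict UNIV (sd n (m + d)) (\<lambda>k xs. f k (map (lvi m d) xs))"
proof (induction d)
  case 0
  have "srestrict UNIV (sd n m) f = f" by (rule smaps_srestrict_eq[OF f])
  then have "f = srestrict UNIV (sd n m) f" by (rule sym)
  then show ?case by simp
next
  case (Suc d)
  have "ex_iter n m (Suc d) f = srestrict UNIV (sd n (m + Suc d))
     (\<lambda>k xs. ex_iter n m d f k (map (last_vertex (m + d)) xs))" by simp
  also have "\<dots> = srestrict UNIV (sd n (m + Suc d)) (\<lambda>k xs. f k (map (lvi m (Suc d)) xs))"
  proof (rule srestrict_ext)
    fix k xs assume "xs \<in> Sx (sd n (m + Suc d)) k"
    then have l: "map (last_vertex (m + d)) xs \<in> Sx (sd n (m + d)) k" using lv_Sx by simp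
    have "map (lvi m d) (map (last_vertex (m + d)) xs) = map (lvi m (Suc d)) xs" by simp
    then show "ex_iter n m d f k (map (last_vertex (m + d)) xs) = f k (map (lvi m (Suc d)) xs)"
      unfolding Suc srestrict_in[OF UNIV_I l] by (rule arg_cong)
  qed
  finally show ?case .
qed

lemma ex_iter_in:
  assumes "f \<in> smaps UNIV (sd n m) X"
  shows "ex_iter n m d f \<in> smaps UNIV (sd n (m + d)) X"
  unfolding ex_iter_eq[OF assms] by (rule smaps_sd_pull[OF assms lvi_Sx])

lemma ex_iter_app:
  assumes "f \<in> smaps UNIV (sd n m) X" "xs \<in> Sx (sd n (m + d)) k"
  shows "ex_iter n m d f k xs = f k (map (lvi m d) xs)"
  unfolding ex_iter_eq[OF assms(1)] by (rule srestrict_in[OF UNIV_I assms(2)])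

lemma ex_iter_add: "ex_iter n (m + d) d' (ex_iter n m d f) = ex_iter n m (d + d') f"
  by (induction d') (simp_all add: add.assoc)

text \<open>Naming the common stage \<open>M\<close> in place of two increments lets equalities be
  raised to later stages, as transitivity requires.\<close>

lemma ex_rel_iff:
  "((m, f), (m', f')) \<in> ex_rel X n \<longleftrightarrow> f \<in> smaps UNIV (sd n m) X \<and> f' \<in> smaps UNIV (sd n m') X \<and>
    (\<exists>M\<ge>max m m'. ex_iter n m (M - m) f = ex_iter n m' (M - m') f')"
proof -
  have "(\<exists>d d'. m + d = m' + d' \<and> ex_iter n m d f = ex_iter n m' d' f') \<longleftrightarrow>
    (\<exists>M\<ge>max m m'. ex_iter n m (M - m) f = ex_iter n m' (M - m') f')" (is "?L \<longleftrightarrow> ?R")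
  proof
    assume ?L
    then obtain d d' where d: "m + d = m' + d'" "ex_iter n m d f = ex_iter n m' d' f'" by blast
    have "m + d - m = d" "m + d - m' = d'" using d(1) by auto
    then show ?R using d by (intro exI[of _ "m + d"]) auto
  next
    assume ?R
    then obtain M where "M \<ge> max m m'" "ex_iter n m (M - m) f = ex_iter n m' (M - m') f'" by blast
    then show ?L by (intro exI[of _ "M - m"] exI[of _ "M - m'"]) auto
  qed
  then show ?thesis unfolding ex_rel_def Sx_ex_stage by simp
qed

lemma ex_iter_raise:
  assumes "m \<le> M" "m' \<le> M" "ex_iter n m (M - m) f = ex_iter n m' (M - m') f'" "M \<le> M'"
  shows "ex_iter n m (M' - m) f = ex_iter n m' (M' - m') f'"
proof -
  have "ex_iter n m (M' - m) f = ex_iter n M (M' - M) (ex_iter n m (M - m) f)"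
    using ex_iter_add[of n m "M - m" "M' - M" f] assms by simp
  also have "\<dots> = ex_iter n M (M' - M) (ex_iter n m' (M - m') f')" using assms by simp
  also have "\<dots> = ex_iter n m' (M' - m') f'"
    using ex_iter_add[of n m' "M - m'" "M' - M" f'] assms by simp
  finally show ?thesis .
qed

lemma equiv_ex_rel: "equiv (SIGMA m:UNIV. Sx (ex_stage m X) n) (ex_rel X n)"
proof (rule equivI)
  show "ex_rel X n \<subseteq> (SIGMA m:UNIV. Sx (ex_stage m X) n) \<times> (SIGMA m:UNIV. Sx (ex_stage m X) n)"
    by (auto simp: ex_rel_iff Sx_ex_stage)
  show "refl_on (SIGMA m:UNIV. Sx (ex_stage m X) n) (ex_rel X n)"
    unfolding refl_on_def by (auto simp: ex_rel_iff Sx_ex_stage)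
  show "sym (ex_rel X n)"
  proof (rule symI)
    fix a b assume ab: "(a, b) \<in> ex_rel X n"
    obtain m f m' f' where eq: "a = (m, f)" "b = (m', f')" by (metis surj_pair)
    obtain M where "M \<ge> max m m'" "ex_iter n m (M - m) f = ex_iter n m' (M - m') f'"
      using ab unfolding eq ex_rel_iff by blast
    then have "M \<ge> max m' m" "ex_iter n m' (M - m') f' = ex_iter n m (M - m) f" by simp_all
    then show "(b, a) \<in> ex_rel X n" using ab unfolding eq ex_rel_iff by blast
  qed
  show "trans (ex_rel X n)"
  proof (rule transI)
    fix a b c assume ab: "(a, b) \<in> ex_rel X n" and bc: "(b, c) \<in> ex_rel X n"
    obtain m f m' f' m'' f'' where abc: "a = (m, f)" "b = (m', f')" "c = (m'', f'')" by (metis surj_pair)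
    obtain M where M: "M \<ge> max m m'" "ex_iter n m (M - m) f = ex_iter n m' (M - m') f'"
      using ab unfolding abc ex_rel_iff by blast
    obtain N where N: "N \<ge> max m' m''" "ex_iter n m' (N - m') f' = ex_iter n m'' (N - m'') f''"
      using bc unfolding abc ex_rel_iff by blast
    have "ex_iter n m (max M N - m) f = ex_iter n m' (max M N - m') f'"
      using ex_iter_raise[of m M m' n f f' "max M N"] M by simp
    also have "\<dots> = ex_iter n m'' (max M N - m'') f''"
      using ex_iter_raise[of m' N m'' n f' f'' "max M N"] N by simp
    finally have "ex_iter n m (max M N - m) f = ex_iter n m'' (max M N - m'') f''" .
    moreover have "max M N \<ge> max m m''" using M(1) N(1) by linarith
    moreover have "f \<in> smaps UNIV (sd n m) X" "f'' \<in> smaps UNIV (sd n m'') X"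
      using ab bc unfolding abc ex_rel_iff by (simp_all only:)
    ultimately show "(a, c) \<in> ex_rel X n" unfolding abc ex_rel_iff by (intro conjI exI[of _ "max M N"])
  qed
qed

section \<open>Operators and maps on classes of Ex-infinity, and the discrete case\<close>

definition ecls :: "'x sset \<Rightarrow> nat \<Rightarrow> nat \<Rightarrow> (nat \<Rightarrow> vertex list \<Rightarrow> 'x) \<Rightarrow> (nat \<times> (nat \<Rightarrow> vertex list \<Rightarrow> 'x)) set" where
  "ecls X n m f = ex_rel X n `` {(m, f)}"

lemma Sx_ex_inf: "c \<in> Sx (ex_inf X) n \<longleftrightarrow> (\<exists>m. \<exists>f\<in>smaps UNIV (sd n m) X. c = ecls X n m f)"
  unfolding ex_inf_def ecls_def quotient_def by (auto simp: Sx_ex_stage)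

lemma ecls_in: "f \<in> smaps UNIV (sd n m) X \<Longrightarrow> ecls X n m f \<in> Sx (ex_inf X) n"
  using Sx_ex_inf by blast

lemma ecls_eq_iff:
  assumes "f \<in> smaps UNIV (sd n m) X" "f' \<in> smaps UNIV (sd n m') X"
  shows "ecls X n m f = ecls X n m' f' \<longleftrightarrow> (\<exists>M\<ge>max m m'. ex_iter n m (M - m) f = ex_iter n m' (M - m') f')"
proof -
  have "ecls X n m f = ecls X n m' f' \<longleftrightarrow> ((m, f), (m', f')) \<in> ex_rel X n"
    unfolding ecls_def
    by (rule eq_equiv_class_iff[OF equiv_ex_rel]) (rule SigmaI[OF UNIV_I], use assms in \<open>simp add: Sx_ex_stage\<close>)+
  then show ?thesis unfolding ex_rel_iff using assms by simp
qed

lemma ecls_up: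
  assumes "f \<in> smaps UNIV (sd n m) X"
  shows "ecls X n (m + d) (ex_iter n m d f) = ecls X n m f"
proof -
  have "ex_iter n (m + d) (m + d - (m + d)) (ex_iter n m d f) = ex_iter n m (m + d - m) f" by simp
  then show ?thesis using assms by (subst ecls_eq_iff) (auto intro: ex_iter_in)
qed

lemma mem_ecls: "f \<in> smaps UNIV (sd n m) X \<Longrightarrow> (m, f) \<in> ecls X n m f"
  unfolding ecls_def ex_rel_iff Image_singleton_iff by auto

lemma ecls_memD:
  assumes "(m', f') \<in> ecls X n m f"
  shows "f \<in> smaps UNIV (sd n m) X" "f' \<in> smaps UNIV (sd n m') X"
    "\<exists>M\<ge>max m m'. ex_iter n m (M - m) f = ex_iter n m' (M - m') f'"
  using assms unfolding ecls_def Image_singleton_iff ex_rel_iff by auto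

text \<open>Operations on classes are defined as unions over all representatives; well-definedness
  makes all terms of the union equal.\<close>

lemma UN_const: "A \<noteq> {} \<Longrightarrow> (\<And>z. z \<in> A \<Longrightarrow> F z = B) \<Longrightarrow> (\<Union>z\<in>A. F z) = B"
  by auto

text \<open>The simplicial operator \<alpha> at a fixed stage: precomposition with the subdivision
  of \<alpha>. Like \<open>epush\<close>, which postcomposes, it commutes with passage to later
  stages and so descends to classes.\<close>

definition epull :: "nat \<Rightarrow> nat \<Rightarrow> nat list \<Rightarrow> (nat \<Rightarrow> vertex list \<Rightarrow> 'x) \<Rightarrow> nat \<Rightarrow> vertex list \<Rightarrow> 'x" where
  "epull l m \<alpha> f = srestrict UNIV (sd l m) (\<lambda>k xs. f k (map (sd_map ((!) \<alpha>)) xs))"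

lemma epull_in: "\<alpha> \<in> \<Delta> l n \<Longrightarrow> f \<in> smaps UNIV (sd n m) X \<Longrightarrow> epull l m \<alpha> f \<in> smaps UNIV (sd l m) X"
  unfolding epull_def by (rule smaps_sd_pull) (assumption, rule sd_Delta_Sx)

lemma epull_app: "xs \<in> Sx (sd l m) k \<Longrightarrow> epull l m \<alpha> f k xs = f k (map (sd_map ((!) \<alpha>)) xs)"
  unfolding epull_def by (simp add: srestrict_in)

lemma ex_iter_epull:
  assumes "\<alpha> \<in> \<Delta> l n" "f \<in> smaps UNIV (sd n m) X"
  shows "ex_iter l m d (epull l m \<alpha> f) = epull l (m + d) \<alpha> (ex_iter n m d f)"
proof (rule smaps_ext)
  show "ex_iter l m d (epull l m \<alpha> f) \<in> smaps UNIV (sd l (m + d)) X"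
    using ex_iter_in epull_in assms by blast
  show "epull l (m + d) \<alpha> (ex_iter n m d f) \<in> smaps UNIV (sd l (m + d)) X"
    using ex_iter_in epull_in assms by blast
  fix k xs assume xs: "xs \<in> Sx (sd l (m + d)) k"
  have "map (sd_map ((!) \<alpha>)) (map (lvi m d) xs) = map (lvi m d) (map (sd_map ((!) \<alpha>)) xs)"
    using xs lvi_sd_map[OF Delta_mono_on[OF assms(1)] Delta_image[OF assms(1)]] by (auto simp: Sx_sd)
  then show "ex_iter l m d (epull l m \<alpha> f) k xs = epull l (m + d) \<alpha> (ex_iter n m d f) k xs"
    by (simp only: ex_iter_app[OF epull_in[OF assms] xs] epull_app[OF lvi_Sx[OF xs]] epull_app[OF xs]
      ex_iter_app[OF assms(2) sd_Delta_Sx[OF assms(1) xs]])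
qed

lemma Act_ecls:
  assumes \<alpha>: "\<alpha> \<in> \<Delta> l n" and f: "f \<in> smaps UNIV (sd n m) X"
  shows "Act (ex_inf X) n \<alpha> (ecls X n m f) = ecls X l m (epull l m \<alpha> f)"
proof -
  have len: "length \<alpha> - 1 = l" using DeltaD(1)[OF \<alpha>] by simp
  have "Act (ex_inf X) n \<alpha> (ecls X n m f) = (\<Union>z\<in>ecls X n m f. ecls X l (fst z) (epull l (fst z) \<alpha> (snd z)))"
    unfolding ex_inf_def ex_stage_def ecls_def epull_def using len by (simp add: case_prod_beta)
  also have "\<dots> = ecls X l m (epull l m \<alpha> f)"
  proof (rule UN_const)
    show "ecls X n m f \<noteq> {}" using mem_ecls[OF f] by blast
    fix z assume "z \<in> ecls X n m f"
    then have z: "(fst z, snd z) \<in> ecls X n m f" by simp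
    obtain M where M: "M \<ge> max m (fst z)" "ex_iter n m (M - m) f = ex_iter n (fst z) (M - fst z) (snd z)"
      using ecls_memD(3)[OF z] by blast
    have "ex_iter l (fst z) (M - fst z) (epull l (fst z) \<alpha> (snd z)) = ex_iter l m (M - m) (epull l m \<alpha> f)"
      using ex_iter_epull[OF \<alpha> f, of "M - m"] ex_iter_epull[OF \<alpha> ecls_memD(2)[OF z], of "M - fst z"] M by simp
    then show "ecls X l (fst z) (epull l (fst z) \<alpha> (snd z)) = ecls X l m (epull l m \<alpha> f)"
      using M(1) by (subst ecls_eq_iff) (use epull_in[OF \<alpha>] f ecls_memD(2)[OF z] in \<open>auto simp: max.commute\<close>)
  qed
  finally show ?thesis .
qed

definition epush :: "nat \<Rightarrow> nat \<Rightarrow> (nat \<Rightarrow> 'x \<Rightarrow> 'y) \<Rightarrow> (nat \<Rightarrow> vertex list \<Rightarrow> 'x) \<Rightarrow> nat \<Rightarrow> vertex list \<Rightarrow> 'y" where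
  "epush n m p f = srestrict UNIV (sd n m) (\<lambda>k xs. p k (f k xs))"

lemma epush_app: "xs \<in> Sx (sd n m) k \<Longrightarrow> epush n m p f k xs = p k (f k xs)"
  unfolding epush_def by (simp add: srestrict_in)

lemma epush_in: 
  assumes p: "smap UNIV X Y p" and f: "f \<in> smaps UNIV (sd n m) X"
  shows "epush n m p f \<in> smaps UNIV (sd n m) Y"
  unfolding epush_def
proof (rule smaps_srestrict)
  show "xs \<in> Sx (sd n m) k \<Longrightarrow> p k (f k xs) \<in> Sx Y k" for k xs
    using smapsD(1)[OF f] p unfolding smap_def by simp
  show "p l (f l (Act (sd n m) k \<alpha> xs)) = Act Y k \<alpha> (p k (f k xs))"
    if "\<alpha> \<in> \<Delta> l k" "xs \<in> Sx (sd n m) k" for k l \<alpha> xs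
    using smapsD(2)[OF f that] smapsD(1)[OF f that(2)] p that(1) unfolding smap_def by simp
qed (rule sd_Act_Sx)

lemma ex_iter_epush:
  assumes "smap UNIV X Y p" "f \<in> smaps UNIV (sd n m) X"
  shows "ex_iter n m d (epush n m p f) = epush n (m + d) p (ex_iter n m d f)"
proof (rule smaps_ext)
  show "ex_iter n m d (epush n m p f) \<in> smaps UNIV (sd n (m + d)) Y"
    using ex_iter_in epush_in assms by blast
  show "epush n (m + d) p (ex_iter n m d f) \<in> smaps UNIV (sd n (m + d)) Y"
    using ex_iter_in epush_in assms by blast
  fix k xs assume xs: "xs \<in> Sx (sd n (m + d)) k"
  show "ex_iter n m d (epush n m p f) k xs = epush n (m + d) p (ex_iter n m d f) k xs"
    by (simp only: ex_iter_app[OF epush_in[OF assms] xs] epush_app[OF lvi_Sx[OF xs]] epush_app[OF xs]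
      ex_iter_app[OF assms(2) xs])
qed

lemma ex_inf_map_ecls:
  assumes p: "smap UNIV X Y p" and f: "f \<in> smaps UNIV (sd n m) X"
  shows "ex_inf_map Y p n (ecls X n m f) = ecls Y n m (epush n m p f)"
proof -
  have "ex_inf_map Y p n (ecls X n m f) = (\<Union>z\<in>ecls X n m f. ecls Y n (fst z) (epush n (fst z) p (snd z)))"
    unfolding ex_inf_map_def ecls_def epush_def by (simp add: case_prod_beta)
  also have "\<dots> = ecls Y n m (epush n m p f)"
  proof (rule UN_const)
    show "ecls X n m f \<noteq> {}" using mem_ecls[OF f] by blast
    fix z assume "z \<in> ecls X n m f"
    then have z: "(fst z, snd z) \<in> ecls X n m f" by simp
    obtain M where M: "M \<ge> max m (fst z)" "ex_iter n m (M - m) f = ex_iter n (fst z) (M - fst z) (snd z)"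
      using ecls_memD(3)[OF z] by blast
    have "ex_iter n (fst z) (M - fst z) (epush n (fst z) p (snd z)) = ex_iter n m (M - m) (epush n m p f)"
      using ex_iter_epush[OF p f, of "M - m"] ex_iter_epush[OF p ecls_memD(2)[OF z], of "M - fst z"] M by simp
    then show "ecls Y n (fst z) (epush n (fst z) p (snd z)) = ecls Y n m (epush n m p f)"
      using M(1) by (subst ecls_eq_iff) (use epush_in[OF p] f ecls_memD(2)[OF z] in \<open>auto simp: max.commute\<close>)
  qed
  finally show ?thesis .
qed

text \<open>A subdivided simplex is connected. In the inductive step, a chain is comparable with the
  singleton of each of its members, and the singletons of comparable x and y both lie below the
  chain of x and y.\<close>

lemma sd_vert_connected:
  assumes "\<And>x y. x \<in> sd_vert n m \<Longrightarrow> y \<in> sd_vert n m \<Longrightarrow> sd_le x y \<Longrightarrow> \<phi> x = \<phi> y"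
  shows "x \<in> sd_vert n m \<Longrightarrow> y \<in> sd_vert n m \<Longrightarrow> \<phi> x = \<phi> y"
  using assms
proof (induction m arbitrary: \<phi> x y)
  case 0
  then obtain i k where ik: "x = Vtx i" "y = Vtx k" "i \<le> n" "k \<le> n" by auto
  show ?case
  proof (cases "i \<le> k")
    case True
    then show ?thesis using 0(3)[of x y] 0(1,2) ik by simp
  next
    case False
    then show ?thesis using 0(3)[of y x] 0(1,2) ik by simp
  qed
next
  case (Suc m)
  have sing: "Chain {|x|} \<in> sd_vert n (Suc m)" if "x \<in> sd_vert n m" for x
    using that sd_le_refl by (intro sd_vert_SucI) (auto simp: chain_def)
  have const: "\<phi> (Chain {|x|}) = \<phi> (Chain {|y|})" if "x \<in> sd_vert n m" "y \<in> sd_vert n m" for x y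
  proof (rule Suc.IH[OF that, of "\<lambda>x. \<phi> (Chain {|x|})"])
    fix x y assume xy: "x \<in> sd_vert n m" "y \<in> sd_vert n m" "sd_le x y"
    have e: "Chain {|x, y|} \<in> sd_vert n (Suc m)"
      using xy sd_le_refl by (intro sd_vert_SucI) (auto simp: chain_def)
    have "\<phi> (Chain {|x|}) = \<phi> (Chain {|x, y|})" by (rule Suc.prems(3)) (use sing e xy in auto)
    moreover have "\<phi> (Chain {|y|}) = \<phi> (Chain {|x, y|})" by (rule Suc.prems(3)) (use sing e xy in auto)
    ultimately show "\<phi> (Chain {|x|}) = \<phi> (Chain {|y|})" by simp
  qed
  have pt: "\<exists>v\<in>sd_vert n m. \<phi> (Chain {|v|}) = \<phi> x" if x: "x \<in> sd_vert n (Suc m)" for x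
  proof -
    obtain c where c: "x = Chain c" "fset c \<noteq> {}" "fset c \<subseteq> sd_vert n m" using x by (elim sd_vert_SucE)
    then obtain v where v: "v \<in> fset c" "v \<in> sd_vert n m" by blast
    have "\<phi> (Chain {|v|}) = \<phi> x" by (rule Suc.prems(3)) (use sing v c x in auto)
    then show ?thesis using v by blast
  qed
  obtain v where v: "v \<in> sd_vert n m" "\<phi> (Chain {|v|}) = \<phi> x" using pt[OF Suc.prems(1)] ..
  obtain w where w: "w \<in> sd_vert n m" "\<phi> (Chain {|w|}) = \<phi> y" using pt[OF Suc.prems(2)] ..
  show ?case using const[OF v(1) w(1)] v(2) w(2) by simp
qed

lemma sd_vert_ne: "\<exists>x. x \<in> sd_vert n m"
proof (induction m)
  case 0
  have "Vtx 0 \<in> sd_vert n 0" by simp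
  then show ?case ..
next
  case (Suc m)
  then obtain x where "x \<in> sd_vert n m" ..
  then have "Chain {|x|} \<in> sd_vert n (Suc m)" using sd_le_refl by (intro sd_vert_SucI) (auto simp: chain_def)
  then show ?case ..
qed

text \<open>By connectedness, as in a discrete target the two ends of every edge have equal images.
  The second conjunct gives a simplex from which the value can be read off.\<close>

lemma sd_const:
  assumes f: "f \<in> smaps UNIV (sd n m) K" and K: "\<And>k \<alpha> x. Act K k \<alpha> x = x"
  shows "\<exists>g. (\<forall>k. \<forall>xs\<in>Sx (sd n m) k. f k xs = g) \<and> (\<exists>xs. xs \<in> Sx (sd n m) 0)"
proof -
  have pt: "[x] \<in> Sx (sd n m) 0" if "x \<in> sd_vert n m" for x using that by (simp add: Sx_sd)
  have edge: "f 0 [x] = f 0 [y]" if "x \<in> sd_vert n m" "y \<in> sd_vert n m" "sd_le x y" for x y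
  proof -
    have e: "[x, y] \<in> Sx (sd n m) 1" using that by (simp add: Sx_sd)
    have "[0] \<in> \<Delta> 0 1" "[1] \<in> \<Delta> 0 1" by (auto simp: \<Delta>_def)
    then have "f 0 (Act (sd n m) 1 [0] [x, y]) = f 1 [x, y]" "f 0 (Act (sd n m) 1 [1] [x, y]) = f 1 [x, y]"
      using smapsD(2)[OF f _ e] K by simp_all
    then show ?thesis by (simp add: Act_sd)
  qed
  obtain x0 where x0: "x0 \<in> sd_vert n m" using sd_vert_ne by blast
  have "f k xs = f 0 [x0]" if xs: "xs \<in> Sx (sd n m) k" for k xs
  proof -
    have "xs ! 0 \<in> set xs" using xs by (intro nth_mem) (simp add: Sx_sd)
    then have mem: "xs ! 0 \<in> sd_vert n m" using xs by (auto simp: Sx_sd)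
    have "[0] \<in> \<Delta> 0 k" by (auto simp: \<Delta>_def)
    then have "f 0 (Act (sd n m) k [0] xs) = f k xs" using smapsD(2)[OF f _ xs] K by simp
    then have "f k xs = f 0 [xs ! 0]" by (simp add: Act_sd)
    also have "\<dots> = f 0 [x0]" by (rule sd_vert_connected[of n m "\<lambda>x. f 0 [x]"]) (use edge mem x0 in auto)
    finally show ?thesis .
  qed
  then have "\<forall>k. \<forall>xs\<in>Sx (sd n m) k. f k xs = f 0 [x0]" by (intro allI ballI)
  moreover have "\<exists>xs. xs \<in> Sx (sd n m) 0" using pt[OF x0] by (rule exI)
  ultimately show ?thesis by (intro exI[of _ "f 0 [x0]"] conjI)
qed

text \<open>The image of the element \<open>g\<close> of the discrete \<open>K\<close> in
  Ex-infinity, represented at stage 0 by a constant map.\<close>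

definition kcls :: "'x sset \<Rightarrow> nat \<Rightarrow> 'x \<Rightarrow> (nat \<times> (nat \<Rightarrow> vertex list \<Rightarrow> 'x)) set" where
  "kcls K n g = ecls K n 0 (srestrict UNIV (sd n 0) (\<lambda>k xs. g))"

lemma kmap_in:
  assumes "\<And>k \<alpha> x. Act K k \<alpha> x = x" "\<And>k. g \<in> Sx K k"
  shows "srestrict UNIV (sd n m) (\<lambda>k xs. g) \<in> smaps UNIV (sd n m) K"
  using assms sd_Act_Sx by (intro smaps_srestrict) auto

text \<open>A map on a subdivision with discrete target has a single value, and this value is
  unchanged at later stages.\<close>

lemma kcls_eq:
  assumes K: "\<And>k \<alpha> x. Act K k \<alpha> x = x" "\<And>k. g \<in> Sx K k" and f: "f \<in> smaps UNIV (sd n m) K"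
  shows "ecls K n m f = kcls K n g \<longleftrightarrow> (\<forall>k. \<forall>xs\<in>Sx (sd n m) k. f k xs = g)"
proof
  note kin = kmap_in[of K g, OF K, of n]
  assume "ecls K n m f = kcls K n g"
  then obtain M where M: "M \<ge> max m 0"
    "ex_iter n m (M - m) f = ex_iter n 0 (M - 0) (srestrict UNIV (sd n 0) (\<lambda>k xs. g))"
    unfolding kcls_def using ecls_eq_iff[OF f kin[of 0]] by auto
  have "sd n (m + (M - m)) = sd n M" "sd n (0 + (M - 0)) = sd n M" using M(1) by auto
  moreover obtain g' where g': "\<And>k xs. xs \<in> Sx (sd n m) k \<Longrightarrow> f k xs = g'"
    using sd_const[OF f K(1)] by (elim exE conjE) simp
  obtain x where x: "x \<in> sd_vert n M" using sd_vert_ne by blast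
  then have x1: "[x] \<in> Sx (sd n (m + (M - m))) 0" "[x] \<in> Sx (sd n (0 + (M - 0))) 0" using M(1) by (auto simp: Sx_sd)
  have "g' = g" using ex_iter_app[OF f x1(1)] g'[OF lvi_Sx[OF x1(1)]] ex_iter_app[OF kin x1(2)] M(2)
     srestrict_in[OF _ lvi_Sx[OF x1(2)], of UNIV "\<lambda>k xs. g"] by simp
  then show "\<forall>k. \<forall>xs\<in>Sx (sd n m) k. f k xs = g" using g' by blast
next
  assume c: "\<forall>k. \<forall>xs\<in>Sx (sd n m) k. f k xs = g"
  note kin = kmap_in[of K g, OF K, of n 0]
  have "f = ex_iter n 0 m (srestrict UNIV (sd n 0) (\<lambda>k xs. g))"
  proof (rule smaps_ext[OF f])
    show "ex_iter n 0 m (srestrict UNIV (sd n 0) (\<lambda>k xs. g)) \<in> smaps UNIV (sd n m) K"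
      using ex_iter_in[OF kin, of m] by simp
    fix k xs assume xs: "xs \<in> Sx (sd n m) k"
    then have xs': "xs \<in> Sx (sd n (0 + m)) k" by simp
    show "f k xs = ex_iter n 0 m (srestrict UNIV (sd n 0) (\<lambda>k xs. g)) k xs"
      unfolding ex_iter_app[OF kin xs'] srestrict_in[OF UNIV_I lvi_Sx[OF xs']] using c xs by simp
  qed
  then show "ecls K n m f = kcls K n g" using ecls_up[OF kin, of m] unfolding kcls_def by simp
qed

lemma kcls_Act:
  assumes K: "\<And>k \<alpha> x. Act K k \<alpha> x = x" "\<And>k. g \<in> Sx K k" and \<alpha>: "\<alpha> \<in> \<Delta> l n"
  shows "Act (ex_inf K) n \<alpha> (kcls K n g) = kcls K l g"
proof -
  note kin = kmap_in[of K g, OF K, of n 0]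
  have e: "epull l 0 \<alpha> (srestrict UNIV (sd n 0) (\<lambda>k xs. g)) \<in> smaps UNIV (sd l 0) K"
    using epull_in[OF \<alpha> kin] .
  have "Act (ex_inf K) n \<alpha> (kcls K n g) = ecls K l 0 (epull l 0 \<alpha> (srestrict UNIV (sd n 0) (\<lambda>k xs. g)))"
    unfolding kcls_def by (rule Act_ecls[OF \<alpha> kin])
  also have "\<dots> = kcls K l g"
    unfolding kcls_eq[of K, OF K e]
  proof (intro allI ballI)
    fix k xs assume xs: "xs \<in> Sx (sd l 0) k"
    show "epull l 0 \<alpha> (srestrict UNIV (sd n 0) (\<lambda>k xs. g)) k xs = g"
      unfolding epull_app[OF xs] by (rule srestrict_in[OF UNIV_I sd_Delta_Sx[OF \<alpha> xs]])
  qed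
  finally show ?thesis .
qed

lemma kcls_inj:
  assumes K: "\<And>k \<alpha> x. Act K k \<alpha> x = x" "\<And>k. g \<in> Sx K k" "\<And>k. g' \<in> Sx K k" and eq: "kcls K n g' = kcls K n g"
  shows "g' = g"
proof -
  obtain x where x: "x \<in> sd_vert n 0" using sd_vert_ne by blast
  then have x1: "[x] \<in> Sx (sd n 0) 0" by (auto simp: Sx_sd)
  moreover have "\<forall>k. \<forall>xs\<in>Sx (sd n 0) k. srestrict UNIV (sd n 0) (\<lambda>k xs. g') k xs = g"
    using kcls_eq[of K g, OF K(1,2) kmap_in[of K g', OF K(1,3)]] eq unfolding kcls_def by simp
  ultimately have "srestrict UNIV (sd n 0) (\<lambda>k xs. g') 0 [x] = g" by blast
  then show ?thesis using srestrict_in[OF UNIV_I x1, of "\<lambda>k xs. g'"] by simp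
qed

text \<open>Together with \<open>kcls_inj\<close>, this says that a discrete simplicial set agrees
  with its Ex-infinity.\<close>

lemma ex_inf_discrete:
  assumes K: "\<And>k \<alpha> x. Act K k \<alpha> x = x" "\<And>k l. Sx K k = Sx K l" and c: "c \<in> Sx (ex_inf K) n"
  shows "\<exists>g. (\<forall>k. g \<in> Sx K k) \<and> c = kcls K n g"
proof -
  obtain m f where f: "f \<in> smaps UNIV (sd n m) K" "c = ecls K n m f" using c unfolding Sx_ex_inf by blast
  obtain g where gx: "(\<forall>k. \<forall>xs\<in>Sx (sd n m) k. f k xs = g) \<and> (\<exists>xs. xs \<in> Sx (sd n m) 0)"
    using sd_const[OF f(1) K(1)] ..
  then have g: "\<And>k xs. xs \<in> Sx (sd n m) k \<Longrightarrow> f k xs = g" by simp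
  from gx obtain xs where xs: "xs \<in> Sx (sd n m) 0" by blast
  have "g \<in> Sx K 0" using smapsD(1)[OF f(1) xs] g[OF xs] by simp
  then have gK: "g \<in> Sx K k" for k using K(2)[of 0 k] by simp
  have "c = kcls K n g" unfolding f(2) kcls_eq[of K g, OF K(1) gK f(1)] using gx by (rule conjunct1)
  then show ?thesis using gK by (intro exI[of _ g] conjI allI)
qed

text \<open>Homotopies in Ex-infinity of a discrete simplicial set are constant. This turns the
  homotopy in the criterion for local weak equivalences into a strict equation over y(U).\<close>

lemma homotopic_discrete:
  assumes K: "\<And>k \<alpha> x. Act K k \<alpha> x = x" "\<And>k l. Sx K k = Sx K l"
    and h: "homotopic_rel_bdry n (ex_inf K) a b" and g: "\<And>k. g \<in> Sx K k"
    and b: "b n [0..<Suc n] = kcls K n g"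
  shows "a n [0..<Suc n] = kcls K n g"
proof -
  obtain h where hh: "smap UNIV (sprod (simplex n) (simplex 1)) (ex_inf K) h \<and>
        (\<forall>m. \<forall>x\<in>Sx (simplex n) m. h m (x, replicate (Suc m) 0) = a m x) \<and>
        (\<forall>m. \<forall>x\<in>Sx (simplex n) m. h m (x, replicate (Suc m) 1) = b m x) \<and>
        (\<forall>m. \<forall>x\<in>Sx (bdry n) m. \<forall>t\<in>Sx (simplex 1) m. h m (x, t) = a m x)"
    using h unfolding homotopic_rel_bdry_def ..
  have h: "smap UNIV (sprod (simplex n) (simplex 1)) (ex_inf K) h"
    "\<And>m x. x \<in> \<Delta> m n \<Longrightarrow> h m (x, replicate (Suc m) 0) = a m x"
    "\<And>m x. x \<in> \<Delta> m n \<Longrightarrow> h m (x, replicate (Suc m) 1) = b m x"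
    using hh unfolding Sx_simplex by (simp_all del: replicate_Suc)
  have mem: "(x, t) \<in> Sx (sprod (simplex n) (simplex 1)) m \<longleftrightarrow> x \<in> \<Delta> m n \<and> t \<in> \<Delta> m 1" for x t m
    by (simp add: sprod_def Sx_simplex)
  have act: "Act (ex_inf K) m \<alpha> (h m (x, t)) = h k (ocomp x \<alpha>, ocomp t \<alpha>)"
    if "x \<in> \<Delta> m n" "t \<in> \<Delta> m 1" "\<alpha> \<in> \<Delta> k m" for x t m k \<alpha>
  proof -
    have "h k (Act (sprod (simplex n) (simplex 1)) m \<alpha> (x, t)) = Act (ex_inf K) m \<alpha> (h m (x, t))"
      using h(1) that mem unfolding smap_def by simp
    then show ?thesis by (simp add: sprod_def Act_simplex)
  qed
  have ex: "\<exists>g. (\<forall>k. g \<in> Sx K k) \<and> h m (x, t) = kcls K m g" if "x \<in> \<Delta> m n" "t \<in> \<Delta> m 1" for x t m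
  proof -
    have "h m (x, t) \<in> Sx (ex_inf K) m" using h(1) mem that unfolding smap_def by simp
    then show ?thesis by (rule ex_inf_discrete[of K, OF K])
  qed
  have tD: "replicate (Suc n) 0 \<in> \<Delta> n 1" "replicate (Suc n) 1 \<in> \<Delta> n 1" by (auto simp: \<Delta>_def sorted_replicate simp del: replicate_Suc)
  have D: "[0, 0] \<in> \<Delta> 1 n" "[0, 1] \<in> \<Delta> 1 1" "[0] \<in> \<Delta> 0 n" "[0] \<in> \<Delta> 0 1" "[1] \<in> \<Delta> 0 1" by (auto simp: \<Delta>_def)
  obtain g0 where gg0: "(\<forall>k. g0 \<in> Sx K k) \<and> h n ([0..<Suc n], replicate (Suc n) 0) = kcls K n g0"
    using ex[OF id_Delta tD(1)] ..
  note g0 = conjunct1[OF gg0, THEN spec] conjunct2[OF gg0]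
  \<comment> \<open>The edge of the cylinder over the vertex 0. It shares a vertex with each end of
    the homotopy, and all simplices here are constant, so all three values agree.\<close>
  obtain g2 where gg2: "(\<forall>k. g2 \<in> Sx K k) \<and> h 1 ([0, 0], [0, 1]) = kcls K 1 g2" using ex[OF D(1,2)] ..
  note g2 = conjunct1[OF gg2, THEN spec] conjunct2[OF gg2]
  have h1: "h n ([0..<Suc n], replicate (Suc n) 1) = kcls K n g" using h(3)[OF id_Delta] b by simp
  have "kcls K 0 g0 = h 0 ([0], [0])"
    using act[OF id_Delta tD(1) D(3)] kcls_Act[of K, OF K(1) g0(1) D(3)] g0(2) by (simp add: ocomp_def del: upt_Suc)
  also have "\<dots> = kcls K 0 g2"
    using act[OF D(1,2,4)] kcls_Act[of K, OF K(1) g2(1) D(4)] g2(2) by (simp add: ocomp_def)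
  finally have 1: "g0 = g2" by (rule kcls_inj[of K, OF K(1) g2(1) g0(1)])
  have "kcls K 0 g = h 0 ([0], [1])"
    using act[OF id_Delta tD(2) D(3)] kcls_Act[of K, OF K(1) g D(3)] h1 by (simp add: ocomp_def del: upt_Suc)
  also have "\<dots> = kcls K 0 g2"
    using act[OF D(1,2,5)] kcls_Act[of K, OF K(1) g2(1) D(5)] g2(2) by (simp add: ocomp_def)
  finally have "g = g2" by (rule kcls_inj[of K, OF K(1) g2(1) g])
  then show ?thesis using 1 g0(2) h(2)[OF id_Delta] by simp
qed

section \<open>Local fillers of boundaries in hypercovers\<close>

definition ssupp :: "vertex set \<Rightarrow> nat set" where
  "ssupp F = (\<Union>x\<in>F. supp x)"

lemma ssupp_bounds: "F \<subseteq> sd_vert n m \<Longrightarrow> ssupp F \<subseteq> {..n}"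
  unfolding ssupp_def by (rule UN_least) (use supp_bounds in blast)

lemma ssupp_ne: "F \<subseteq> sd_vert n m \<Longrightarrow> F \<noteq> {} \<Longrightarrow> ssupp F \<noteq> {}"
  unfolding ssupp_def using supp_bounds by (simp add: subset_iff) (meson all_not_in_conv)

lemma ssupp_mono: "F \<subseteq> G \<Longrightarrow> ssupp F \<subseteq> ssupp G"
  unfolding ssupp_def by auto

lemma ssupp_sd_map: "ssupp (sd_map \<alpha> ` F) = \<alpha> ` ssupp F"
  unfolding ssupp_def by (auto simp: supp_sd_map)

subsection \<open>A cylinder of the subdivision\<close>

text \<open>The simplices of the cylinder consist of a chain \<open>lq F\<close> of vertices and a chain \<open>rc F\<close> of
  vertices of the next subdivision, all members of which contain \<open>lq F\<close>.  Outside \<open>cyl0\<close>, such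
  simplices are paired by toggling the vertex \<open>lq F\<close> of the next subdivision.\<close>

definition lq :: "(vertex + vertex) set \<Rightarrow> vertex set" where "lq F = Inl -` F"

definition rc :: "(vertex + vertex) set \<Rightarrow> vertex set" where "rc F = Inr -` F"

definition cyl :: "nat \<Rightarrow> nat \<Rightarrow> (vertex + vertex) set set" where
  "cyl n M = {F. F \<noteq> {} \<and> lq F \<subseteq> sd_vert n M \<and> chain (lq F) \<and> rc F \<subseteq> sd_vert n (Suc M) \<and> chain (rc F) \<and>
     (\<forall>x\<in>lq F. \<forall>c\<in>rc F. x \<in> fset (elts c))}"

definition csupp :: "(vertex + vertex) set \<Rightarrow> nat set" where "csupp F = ssupp (lq F) \<union> ssupp (rc F)"

text \<open>The part of the cylinder on which a map is prescribed: the end at stage M + 1, where a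
  filler is known, and everything over the boundary of the simplex, where last vertices are used.
  The filler sought is the restriction of an extension to the other end.\<close>

definition cyl0 :: "nat \<Rightarrow> nat \<Rightarrow> (vertex + vertex) set set" where
  "cyl0 n M = {F \<in> cyl n M. lq F = {} \<or> csupp F \<noteq> {..n}}"

text \<open>The shift places all vertices of stage M before those of stage M + 1. With this order
  last vertices do not decrease, see \<open>clv_mono\<close>.\<close>

definition crk :: "nat \<Rightarrow> nat \<Rightarrow> vertex + vertex \<Rightarrow> nat" where
  "crk n M = case_sum rank (\<lambda>c. Suc (Max (rank ` sd_vert n M)) + rank c)"

lemma crk_simps: "crk n M (Inl x) = rank x" "crk n M (Inr c) = Suc (Max (rank ` sd_vert n M)) + rank c"
  by (simp_all add: crk_def)

lemma crk_less: "x \<in> sd_vert n M \<Longrightarrow> crk n M (Inl x) < crk n M (Inr c)"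
  using Max_ge[OF finite_imageI[OF finite_sd_vert] imageI, of x n M rank] by (simp add: crk_simps)

lemma sum_set: "F = Inl ` lq F \<union> Inr ` rc F"
  unfolding lq_def rc_def
proof (intro set_eqI iffI)
  fix z assume "z \<in> F"
  then show "z \<in> Inl ` (Inl -` F) \<union> Inr ` (Inr -` F)" by (cases z) auto
qed auto

lemma cylD:
  assumes "F \<in> cyl n M"
  shows "F \<noteq> {}" "lq F \<subseteq> sd_vert n M" "chain (lq F)" "rc F \<subseteq> sd_vert n (Suc M)" "chain (rc F)"
    "x \<in> lq F \<Longrightarrow> c \<in> rc F \<Longrightarrow> x \<in> fset (elts c)"
  using assms unfolding cyl_def by simp_all

lemma cylI:
  assumes "F \<noteq> {}" "lq F \<subseteq> sd_vert n M" "chain (lq F)" "rc F \<subseteq> sd_vert n (Suc M)" "chain (rc F)"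
    "\<And>x c. x \<in> lq F \<Longrightarrow> c \<in> rc F \<Longrightarrow> x \<in> fset (elts c)"
  shows "F \<in> cyl n M"
  using assms unfolding cyl_def by simp

lemma cyl_finite: 
  assumes "F \<in> cyl n M"
  shows "finite F" "finite (lq F)" "finite (rc F)"
proof -
  show f: "finite (lq F)" "finite (rc F)"
    using cylD(2,4)[OF assms] finite_sd_vert finite_subset by blast+
  show "finite F" by (subst sum_set) (use f in simp)
qed

lemma lq_mono: "G \<subseteq> F \<Longrightarrow> lq G \<subseteq> lq F" and rc_mono: "G \<subseteq> F \<Longrightarrow> rc G \<subseteq> rc F"
  unfolding lq_def rc_def by auto

lemma csupp_mono: "G \<subseteq> F \<Longrightarrow> csupp G \<subseteq> csupp F"
  unfolding csupp_def using ssupp_mono[OF lq_mono] ssupp_mono[OF rc_mono] by (intro Un_mono)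

lemma csupp_bounds: "F \<in> cyl n M \<Longrightarrow> csupp F \<subseteq> {..n}"
  unfolding csupp_def using ssupp_bounds[OF cylD(2)] ssupp_bounds[OF cylD(4)] by (intro Un_least)

lemma cyl_face: 
  assumes F: "F \<in> cyl n M" and G: "G \<subseteq> F" "G \<noteq> {}"
  shows "G \<in> cyl n M"
proof (rule cylI)
  show "G \<noteq> {}" by fact
  show "lq G \<subseteq> sd_vert n M" "rc G \<subseteq> sd_vert n (Suc M)" 
    using cylD(2,4)[OF F] lq_mono[OF G(1)] rc_mono[OF G(1)] by (meson order_trans)+
  show "chain (lq G)" "chain (rc G)"
    using chain_mono[OF cylD(3)[OF F] lq_mono[OF G(1)]] chain_mono[OF cylD(5)[OF F] rc_mono[OF G(1)]] by simp_all
  fix x c assume "x \<in> lq G" "c \<in> rc G"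
  then show "x \<in> fset (elts c)" using cylD(6)[OF F] lq_mono[OF G(1)] rc_mono[OF G(1)] by (meson subsetD)
qed

lemma cyl_inj: assumes F: "F \<in> cyl n M" shows "inj_on (crk n M) F"
proof (rule inj_onI)
  fix v w assume vw: "v \<in> F" "w \<in> F" "crk n M v = crk n M w"
  have in1: "x \<in> sd_vert n M" if "Inl x \<in> F" for x using that cylD(2)[OF F] unfolding lq_def by auto
  show "v = w"
  proof (cases v)
    case v: (Inl x)
    show ?thesis
    proof (cases w)
      case (Inl y)
      then show ?thesis using vw v inj_onD[OF chain_inj_rank[OF cylD(3)[OF F]], of x y] by (simp add: lq_def crk_simps)
    next
      case (Inr c)
      then show ?thesis using vw v crk_less[OF in1, of x c] by simp
    qed
  next
    case v: (Inr c)
    show ?thesis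
    proof (cases w)
      case (Inl y)
      then show ?thesis using vw v crk_less[OF in1, of y c] by simp
    next
      case (Inr d)
      then show ?thesis using vw v inj_onD[OF chain_inj_rank[OF cylD(5)[OF F]], of c d] by (simp add: rc_def crk_simps)
    qed
  qed
qed

lemma scomplex_cyl: "scomplex (crk n M) (cyl n M)"
  unfolding scomplex_def
  by (intro ballI conjI allI impI) (auto intro: cyl_finite(1) cylD(1) cyl_inj cyl_face simp: cylD(1))

lemma scomplex_cyl0: "scomplex (crk n M) (cyl0 n M)"
  unfolding scomplex_def
proof (intro ballI conjI allI impI)
  fix F assume F0: "F \<in> cyl0 n M"
  then have F: "F \<in> cyl n M" unfolding cyl0_def by simp
  show "finite F" "F \<noteq> {}" "inj_on (crk n M) F" using cyl_finite(1)[OF F] cylD(1)[OF F] cyl_inj[OF F] .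
  fix G assume G: "G \<subseteq> F" "G \<noteq> {}"
  have "lq G = {} \<or> csupp G \<noteq> {..n}"
    using F0 lq_mono[OF G(1)] csupp_mono[OF G(1)] csupp_bounds[OF F] unfolding cyl0_def by auto
  then show "G \<in> cyl0 n M" using cyl_face[OF F G] unfolding cyl0_def by simp
qed

lemma finite_cyl: "finite (cyl n M)"
proof -
  have "cyl n M \<subseteq> (\<lambda>(a, b). Inl ` a \<union> Inr ` b) ` (Pow (sd_vert n M) \<times> Pow (sd_vert n (Suc M)))"
  proof
    fix F assume F: "F \<in> cyl n M"
    show "F \<in> (\<lambda>(a, b). Inl ` a \<union> Inr ` b) ` (Pow (sd_vert n M) \<times> Pow (sd_vert n (Suc M)))"
      by (rule image_eqI[of _ _ "(lq F, rc F)"]) (use sum_set[of F] cylD(2,4)[OF F] in auto)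
  qed
  moreover have "finite (Pow (sd_vert n M) \<times> Pow (sd_vert n (Suc M)))" using finite_sd_vert by simp
  ultimately show ?thesis by (rule finite_subset[OF _ finite_imageI])
qed

definition cvx :: "(vertex + vertex) set \<Rightarrow> vertex" where
  "cvx F = Chain (Abs_fset (lq F))"

lemma lq_insert: "lq (insert (Inr c) F) = lq F" and rc_insert: "rc (insert (Inr c) F) = insert c (rc F)"
  and lq_diff: "lq (F - {Inr c}) = lq F" and rc_diff: "rc (F - {Inr c}) = rc F - {c}"
  and lq_diff': "lq (F - {Inl x}) = lq F - {x}" and rc_diff': "rc (F - {Inl x}) = rc F"
  unfolding lq_def rc_def by auto

text \<open>The vertex \<open>cvx F\<close> depends on \<open>lq F\<close> only, so it is constant
  on pairs. It lies below all members of \<open>rc F\<close>, so it can be added to the chain, and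
  its support is that of \<open>lq F\<close>, so toggling it does not affect whether the simplex
  lies over the boundary.\<close>

lemma cyl_pairing: "pairing (cyl n M) (cyl0 n M) (\<lambda>F. Inr (cvx F)) (\<lambda>F. 2 * card (lq F) + card (rc F - {cvx F}))"
  unfolding pairing_def
proof (intro ballI)
  fix F assume F': "F \<in> cyl n M - cyl0 n M"
  then have F: "F \<in> cyl n M" and lne: "lq F \<noteq> {}" and full: "csupp F = {..n}" unfolding cyl0_def by auto
  let ?c = "cvx F"
  have fc: "fset (elts ?c) = lq F" unfolding cvx_def using cyl_finite(2)[OF F] by (simp add: Abs_fset_inverse)
  have c_in: "?c \<in> sd_vert n (Suc M)" unfolding cvx_def
    by (rule sd_vert_SucI) (use fc lne cylD(2,3)[OF F] in \<open>simp_all add: cvx_def\<close>)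
  have le: "sd_le ?c d" if "d \<in> rc F" for d
  proof -
    have "d \<in> sd_vert n (Suc M)" using \<open>d \<in> rc F\<close> cylD(4)[OF F] by blast
    then obtain d' where d: "d = Chain d'" by (rule sd_vert_SucE)
    have "lq F \<subseteq> fset d'" using cylD(6)[OF F _ that] d by auto
    then show ?thesis using fc unfolding d cvx_def by (simp add: less_eq_fset.rep_eq)
  qed
  have supc: "supp ?c = ssupp (lq F)" using fc unfolding cvx_def ssupp_def by simp
  have ins: "insert (Inr ?c) F \<in> cyl n M"
  proof (rule cylI)
    show "chain (rc (insert (Inr ?c) F))" unfolding rc_insert
      using cylD(5)[OF F] le sd_le_refl unfolding chain_def by simp
    show "rc (insert (Inr ?c) F) \<subseteq> sd_vert n (Suc M)" unfolding rc_insert using c_in cylD(4)[OF F] by simp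
    show "x \<in> fset (elts c)" if "x \<in> lq (insert (Inr ?c) F)" "c \<in> rc (insert (Inr ?c) F)" for x c
      using that cylD(6)[OF F] fc unfolding rc_insert lq_insert by auto
  qed (use cylD[OF F] in \<open>simp_all add: lq_insert\<close>)
  have del: "F - {Inr ?c} \<in> cyl n M"
  proof (rule cyl_face[OF F])
    show "F - {Inr ?c} \<noteq> {}" using lne lq_diff[of F ?c] unfolding lq_def by auto
  qed auto
  have "csupp (insert (Inr ?c) F) = {..n}"
    using csupp_mono[of F "insert (Inr ?c) F"] csupp_bounds[OF ins] full by blast
  then have ins': "insert (Inr ?c) F \<in> cyl n M - cyl0 n M" using ins lne by (simp add: cyl0_def lq_insert)
  have "csupp (F - {Inr ?c}) = csupp F"
    unfolding csupp_def lq_diff rc_diff using supc unfolding ssupp_def by auto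
  then have del': "F - {Inr ?c} \<in> cyl n M - cyl0 n M" using del lne full by (simp add: cyl0_def lq_diff)
  have cv: "cvx (insert (Inr ?c) F) = ?c" "cvx (F - {Inr ?c}) = ?c"
    unfolding cvx_def lq_insert lq_diff by simp_all
  have desc: "2 * card (lq (F - {w})) + card (rc (F - {w}) - {cvx (F - {w})}) < 2 * card (lq F) + card (rc F - {?c})"
    if w: "w \<in> F" "Inr ?c \<in> F" "w \<noteq> Inr ?c" for w
  proof (cases w)
    \<comment> \<open>This case explains the factor 2 in the key: removing a vertex from
      \<open>lq F\<close> changes the distinguished vertex, so \<open>?c\<close> may start to count,
      which costs at most 1.\<close>
    case (Inl x)
    then have x: "x \<in> lq F" using w unfolding lq_def by simp
    have "card (lq F - {x}) < card (lq F)" using x cyl_finite(2)[OF F] by (intro psubset_card_mono) auto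
    moreover have "card (rc F - {cvx (F - {w})}) \<le> card (rc F)" using cyl_finite(3)[OF F] by (intro card_mono) auto
    moreover have "card (rc F) = Suc (card (rc F - {?c}))"
      using w(2) cyl_finite(3)[OF F] unfolding rc_def by (intro card.remove) auto
    ultimately show ?thesis unfolding Inl lq_diff' rc_diff' by simp
  next
    case (Inr c)
    then have c: "c \<in> rc F - {?c}" using w unfolding rc_def by simp
    have "cvx (F - {w}) = ?c" unfolding cvx_def Inr lq_diff by simp
    moreover have "card (rc F - {c} - {?c}) < card (rc F - {?c})"
      using c cyl_finite(3)[OF F] by (intro psubset_card_mono) auto
    ultimately show ?thesis unfolding Inr lq_diff rc_diff by simp
  qed
  have "rc (insert (Inr ?c) F) - {?c} = rc F - {?c}" "rc (F - {Inr ?c}) - {?c} = rc F - {?c}"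
    unfolding rc_insert rc_diff by auto
  then show "insert (Inr ?c) F \<in> cyl n M - cyl0 n M \<and> F - {Inr ?c} \<in> cyl n M - cyl0 n M \<and>
    Inr (cvx (insert (Inr ?c) F)) = Inr ?c \<and> Inr (cvx (F - {Inr ?c})) = Inr ?c \<and>
    2 * card (lq (insert (Inr ?c) F)) + card (rc (insert (Inr ?c) F) - {cvx (insert (Inr ?c) F)}) =
    2 * card (lq F) + card (rc F - {?c}) \<and>
    2 * card (lq (F - {Inr ?c})) + card (rc (F - {Inr ?c}) - {cvx (F - {Inr ?c})}) =
    2 * card (lq F) + card (rc F - {?c}) \<and>
    (\<forall>w\<in>F. Inr ?c \<in> F \<longrightarrow> w \<noteq> Inr ?c \<longrightarrow> F - {w} \<in> cyl n M - cyl0 n M \<longrightarrow>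
      2 * card (lq (F - {w})) + card (rc (F - {w}) - {cvx (F - {w})}) < 2 * card (lq F) + card (rc F - {?c}))"
    using ins' del' desc unfolding cv lq_insert lq_diff by simp
qed

definition clv :: "vertex + vertex \<Rightarrow> nat" where "clv = case_sum lvx lvx"

lemma clv_simps: "clv (Inl x) = lvx x" "clv (Inr x) = lvx x"
  by (simp_all add: clv_def)

text \<open>From stage M to stage M + 1, the vertex x is a member of the chain c, so the support of
  x is part of that of c. Inside one stage, ranks decide the order of a chain.\<close>

lemma clv_mono:
  assumes F: "F \<in> cyl n M" and vw: "v \<in> F" "w \<in> F" "crk n M v \<le> crk n M w"
  shows "clv v \<le> clv w"
proof -
  have mono: "lvx x \<le> lvx y" if K: "chain K" "x \<in> K" "y \<in> K" "K \<subseteq> sd_vert n m" "rank x \<le> rank y" for K x y m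
  proof -
    consider "sd_le x y" | "sd_le y x" using K unfolding chain_def by blast
    then show ?thesis
    proof cases
      case 1
      then show ?thesis using lvx_mono[OF 1] that by blast
    next
      case 2
      then have "rank y = rank x" using rank_mono[OF 2] that(5) by simp
      then show ?thesis using rank_strict[OF 2] by simp
    qed
  qed
  show ?thesis
  proof (cases v)
    case v: (Inl x)
    then have x: "x \<in> lq F" using vw unfolding lq_def by simp
    show ?thesis
    proof (cases w)
      case (Inl y)
      then have "y \<in> lq F" using vw unfolding lq_def by simp
      then show ?thesis using mono[OF cylD(3)[OF F] x _ cylD(2)[OF F]] vw(3) unfolding v Inl by (simp add: crk_simps clv_simps)
    next
      case (Inr c)
      then have c: "c \<in> rc F" "c \<in> sd_vert n (Suc M)" using vw cylD(4)[OF F] unfolding rc_def by auto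
      obtain c' where c': "c = Chain c'" using c(2) by (rule sd_vert_SucE)
      have "supp x \<subseteq> supp c" using cylD(6)[OF F x c(1)] unfolding c' by auto
      then have "lvx x \<le> lvx c" unfolding lvx_def
        using supp_bounds[of x n M] x cylD(2)[OF F] finite_supp[OF c(2)] by (intro Max_mono) auto
      then show ?thesis unfolding v Inr by (simp add: clv_simps)
    qed
  next
    case v: (Inr c)
    then have c: "c \<in> rc F" using vw unfolding rc_def by simp
    show ?thesis
    proof (cases w)
      case (Inl y)
      then have "y \<in> sd_vert n M" using vw cylD(2)[OF F] unfolding lq_def by auto
      then show ?thesis using crk_less[of y n M c] vw(3) unfolding v Inl by simp
    next
      case (Inr d)
      then have "d \<in> rc F" using vw unfolding rc_def by simp
      then show ?thesis using mono[OF cylD(5)[OF F] c _ cylD(4)[OF F]] vw(3) unfolding v Inr by (simp add: crk_simps clv_simps)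
    qed
  qed
qed

lemma clv_supp: "F \<in> cyl n M \<Longrightarrow> v \<in> F \<Longrightarrow> clv v \<in> csupp F"
proof (cases v)
  case (Inl x)
  assume F: "F \<in> cyl n M" "v \<in> F"
  then have "x \<in> lq F" "x \<in> sd_vert n M" using Inl cylD(2)[OF F(1)] unfolding lq_def by auto
  then show ?thesis using lvx_mem unfolding Inl csupp_def ssupp_def clv_simps by blast
next
  case (Inr x)
  assume F: "F \<in> cyl n M" "v \<in> F"
  then have "x \<in> rc F" "x \<in> sd_vert n (Suc M)" using Inr cylD(4)[OF F(1)] unfolding rc_def by auto
  then show ?thesis using lvx_mem unfolding Inr csupp_def ssupp_def clv_simps by blast
qed

text \<open>Over the boundary of the simplex, the last vertex map of the cylinder lands in the
  boundary, where \<open>u\<close> is defined.\<close>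

lemma clv_list:
  assumes xs: "xs \<in> Sx (nrv (crk n M) (cyl n M)) k" and ne: "csupp (set xs) \<noteq> {..n}"
  shows "map clv xs \<in> Sx (bdry n) k"
proof -
  have F: "set xs \<in> cyl n M" using xs by (simp add: Sx_nrv)
  have s: "set (map clv xs) \<subseteq> csupp (set xs)" using clv_supp[OF F] by auto
  have "sorted (map clv xs)" unfolding sorted_iff_nth_mono
  proof (intro allI impI)
    fix i l assume il: "i \<le> l" "l < length (map clv xs)"
    then have "crk n M (xs ! i) \<le> crk n M (xs ! l)" using xs by (auto simp: Sx_nrv sorted_iff_nth_mono)
    then show "map clv xs ! i \<le> map clv xs ! l" using clv_mono[OF F, of "xs ! i" "xs ! l"] il by simp
  qed
  moreover have "set (map clv xs) \<subseteq> {..n}" using s csupp_bounds[OF F] by (rule order_trans)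
  moreover have "set (map clv xs) \<noteq> {..n}" using s ne csupp_bounds[OF F] by blast
  ultimately show ?thesis using xs by (simp add: Sx_bdry \<Delta>_def Sx_nrv)
qed

subsection \<open>Descent along the subdivisions\<close>

context aug
begin

lemma over_pull:
  assumes h: "over V T g h" and mem: "\<And>k xs. xs \<in> Sx B k \<Longrightarrow> \<phi> xs \<in> Sx T k"
    and act: "\<And>k l \<alpha> xs. xs \<in> Sx B k \<Longrightarrow> \<alpha> \<in> \<Delta> l k \<Longrightarrow> \<phi> (Act B k \<alpha> xs) = Act T k \<alpha> (\<phi> xs)"
  shows "over V B g (\<lambda>k xs. h k (\<phi> xs))"
proof (rule overI)
  fix k xs assume xs: "xs \<in> Sx B k"
  show "h k (\<phi> xs) \<in> Sx (Val H V) k" using over_mem[OF h mem[OF xs]] .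
  show "p V k (h k (\<phi> xs)) = g" using over_p[OF h mem[OF xs]] .
  fix l \<alpha> assume \<alpha>: "\<alpha> \<in> \<Delta> l k"
  show "h l (\<phi> (Act B k \<alpha> xs)) = Act (Val H V) k \<alpha> (h k (\<phi> xs))"
    unfolding act[OF xs \<alpha>] by (rule over_Act[OF h mem[OF xs] \<alpha>])
qed

text \<open>On the subdivided boundary, \<open>f\<close> is the composite of \<open>u\<close> with
  the last vertex map. In other words, the simplex of Ex-infinity that \<open>f\<close> represents
  has the image of \<open>u\<close> as its boundary, at stage M already.\<close>

definition bdry_lv :: "nat \<Rightarrow> nat \<Rightarrow> (nat \<Rightarrow> nat list \<Rightarrow> 'x) \<Rightarrow> (nat \<Rightarrow> vertex list \<Rightarrow> 'x) \<Rightarrow> bool" where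
  "bdry_lv n M u f \<longleftrightarrow> (\<forall>k. \<forall>xs\<in>Sx (sd n M) k. ssupp (set xs) \<noteq> {..n} \<longrightarrow> f k xs = u k (map lvx xs))"

lemma bdry_lvD: "bdry_lv n M u f \<Longrightarrow> xs \<in> Sx (sd n M) k \<Longrightarrow> ssupp (set xs) \<noteq> {..n} \<Longrightarrow> f k xs = u k (map lvx xs)"
  unfolding bdry_lv_def by simp

text \<open>The prescriptions on the two parts of \<open>cyl0\<close> agree on their overlap by
  \<open>bdry_lv\<close>; simplices in the end at stage M + 1 are sent to \<open>f\<close>, all
  others to \<open>u\<close> after last vertices.\<close>

lemma cyl_over:
  assumes u: "over V (bdry n) g u" and f: "over V (sd n (Suc M)) g f" and uf: "bdry_lv n (Suc M) u f"
  shows "over V (nrv (crk n M) (cyl0 n M)) g (\<lambda>k xs. if lq (set xs) = {} then f k (map projr xs) else u k (map clv xs))"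
    (is "over V ?B g ?f")
proof -
  have cyl: "xs \<in> Sx (nrv (crk n M) (cyl n M)) k" if "xs \<in> Sx ?B k" for xs k
    using that by (simp add: Sx_nrv cyl0_def)
  have R: "map projr xs \<in> Sx (sd n (Suc M)) k" "map Inr (map projr xs) = xs" "set (map projr xs) = rc (set xs)"
    if xs: "xs \<in> Sx ?B k" and l: "lq (set xs) = {}" for xs k
  proof -
    have inr: "\<exists>c. v = Inr c" if "v \<in> set xs" for v using l that unfolding lq_def by (cases v) auto
    show e: "map Inr (map projr xs) = xs" unfolding map_map
    proof (rule map_idI)
      fix v assume "v \<in> set xs"
      from inr[OF this] show "(Inr \<circ> projr) v = v" by auto
    qed
    have F: "set xs \<in> cyl n M" using xs by (simp add: Sx_nrv cyl0_def)
    have s: "set xs = Inr ` set (map projr xs)" by (subst e[symmetric]) (simp add: image_image)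
    show s': "set (map projr xs) = rc (set xs)" unfolding rc_def by (subst s) auto
    have "sorted (map (crk n M) (map Inr (map projr xs)))" using xs unfolding e Sx_nrv by simp
    then have "sorted (map rank (map projr xs))"
      by (simp add: comp_def crk_simps sorted_iff_nth_mono)
    then show "map projr xs \<in> Sx (sd n (Suc M)) k"
      using xs cylD(4,5)[OF F] s' cylD(1)[OF F] unfolding sd_nrv Sx_nrv sdc_def by auto
  qed
  have eq: "?f k xs = u k (map clv xs)" if xs: "xs \<in> Sx ?B k" and s: "csupp (set xs) \<noteq> {..n}" for xs k
  proof (cases "lq (set xs) = {}")
    case True
    have "csupp (set xs) = ssupp (set (map projr xs))" unfolding csupp_def True R(3)[OF xs True] by (simp add: ssupp_def)
    then have "f k (map projr xs) = u k (map lvx (map projr xs))" using bdry_lvD[OF uf R(1)[OF xs True]] s by simp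
    also have "map lvx (map projr xs) = map clv (map Inr (map projr xs))" by (simp add: clv_simps)
    also have "\<dots> = map clv xs" unfolding R(2)[OF xs True] ..
    finally show ?thesis using True by simp
  qed simp
  have s: "csupp (set xs) \<noteq> {..n}" if "xs \<in> Sx ?B k" "lq (set xs) \<noteq> {}" for xs k
    using that by (simp add: Sx_nrv cyl0_def)
  have bd: "map clv xs \<in> Sx (bdry n) k" if "xs \<in> Sx ?B k" "lq (set xs) \<noteq> {}" for xs k
    by (rule clv_list[OF cyl[OF that(1)] s[OF that]])
  show ?thesis
  proof (rule overI)
    fix k xs assume xs: "xs \<in> Sx ?B k"
    show "?f k xs \<in> Sx (Val H V) k"
      using over_mem[OF f R(1)[OF xs]] over_mem[OF u bd[OF xs]] by simp
    show "p V k (?f k xs) = g"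
      using over_p[OF f R(1)[OF xs]] over_p[OF u bd[OF xs]] by simp
    fix l \<alpha> assume \<alpha>: "\<alpha> \<in> \<Delta> l k"
    have ys: "map ((!) xs) \<alpha> \<in> Sx ?B l" using nrv_act_Sx[OF scomplex_cyl0 xs \<alpha>] .
    have len: "\<forall>i\<in>set \<alpha>. i < length xs" using xs \<alpha> by (auto simp: Sx_nrv \<Delta>_def)
    then have sub: "set (map ((!) xs) \<alpha>) \<subseteq> set xs" by auto
    show "?f l (Act ?B k \<alpha> xs) = Act (Val H V) k \<alpha> (?f k xs)"
    proof (cases "lq (set xs) = {}")
      case True
      then have True': "lq (set (map ((!) xs) \<alpha>)) = {}" using lq_mono[OF sub] by simp
      have "map projr (map ((!) xs) \<alpha>) = Act (sd n (Suc M)) k \<alpha> (map projr xs)"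
        using len by (simp add: Act_sd)
      then have "f l (map projr (map ((!) xs) \<alpha>)) = Act (Val H V) k \<alpha> (f k (map projr xs))"
        using over_Act[OF f R(1)[OF xs True] \<alpha>] by (simp only:)
      then show ?thesis unfolding Act_nrv using True True' by (simp only: if_True simp_thms)
    next
      case False
      have "csupp (set (map ((!) xs) \<alpha>)) \<noteq> {..n}"
        using csupp_mono[OF sub] s[OF xs False] csupp_bounds[of "set xs" n M] cyl[OF xs] by (auto simp: Sx_nrv)
      then have e1: "?f l (map ((!) xs) \<alpha>) = u l (map clv (map ((!) xs) \<alpha>))" by (rule eq[OF ys])
      have e2: "map clv (map ((!) xs) \<alpha>) = Act (bdry n) k \<alpha> (map clv xs)"
        using len by (simp add: Act_bdry ocomp_def)
      have "?f l (map ((!) xs) \<alpha>) = Act (Val H V) k \<alpha> (u k (map clv xs))"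
        unfolding e1 unfolding e2 by (rule over_Act[OF u bd[OF xs False] \<alpha>])
      then show ?thesis unfolding Act_nrv using False by (simp only: if_False)
    qed
  qed
qed

text \<open>The cylinder is obtained from \<open>cyl0\<close> by horn fillings, so the prescribed
  map extends locally. Restricting to the end at stage M, embedded by \<open>Inl\<close>, removes
  one subdivision.\<close>

lemma descend_step:
  assumes horn: "\<And>n k. n \<ge> 1 \<Longrightarrow> k \<le> n \<Longrightarrow> Lext (horn n k) (simplex n)"
    and g: "g \<in> hom C V U" and u: "over V (bdry n) g u"
    and f: "over V (sd n (Suc M)) g f" and uf: "bdry_lv n (Suc M) u f"
  shows "loc V (\<lambda>e. \<exists>h. over (Src C e) (sd n M) (Cmp C g e) h \<and> bdry_lv n M (\<lambda>m x. Rst H e m (u m x)) h)"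
proof -
  let ?f = "\<lambda>k xs. if lq (set xs) = {} then f k (map projr xs) else u k (map clv xs)"
  have sub: "cyl0 n M \<subseteq> cyl n M" unfolding cyl0_def by blast
  have L: "Lext (nrv (crk n M) (cyl0 n M)) (nrv (crk n M) (cyl n M))"
    by (rule Lext_pairing[OF horn finite_cyl scomplex_cyl sub scomplex_cyl0 cyl_pairing])
  show ?thesis
  proof (rule loc_mono[OF hom_Obj(1)[OF g] LextD[OF L g cyl_over[OF u f uf]]])
    fix e assume e: "e \<in> hom C (Src C e) V"
      and "\<exists>h. over (Src C e) (nrv (crk n M) (cyl n M)) (Cmp C g e) h \<and>
        (\<forall>m. \<forall>x\<in>Sx (nrv (crk n M) (cyl0 n M)) m. h m x = Rst H e m (?f m x))"
    then obtain h where h: "over (Src C e) (nrv (crk n M) (cyl n M)) (Cmp C g e) h"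
      "\<And>m x. x \<in> Sx (nrv (crk n M) (cyl0 n M)) m \<Longrightarrow> h m x = Rst H e m (?f m x)" by (elim exE conjE) simp
    have lr: "lq (set (map Inl xs)) = set xs" "rc (set (map Inl xs)) = {}" for xs
      unfolding lq_def rc_def by auto
    have mem: "map Inl xs \<in> Sx (nrv (crk n M) (cyl n M)) k" if xs: "xs \<in> Sx (sd n M) k" for xs k
    proof -
      have x: "length xs = Suc k" "sorted (map rank xs)" "set xs \<noteq> {}" "set xs \<subseteq> sd_vert n M" "chain (set xs)"
        using xs by (auto simp: sd_nrv Sx_nrv sdc_def)
      have "set (map Inl xs) \<in> cyl n M"
        by (rule cylI) (use x lr[of xs] in \<open>simp_all add: chain_def\<close>)
      moreover have "map (crk n M) (map Inl xs) = map rank xs" by (simp add: crk_simps)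
      then have "sorted (map (crk n M) (map Inl xs))" using x(2) by (simp only:)
      ultimately show ?thesis using x(1) unfolding Sx_nrv by (simp only: length_map)
    qed
    have "over (Src C e) (sd n M) (Cmp C g e) (\<lambda>k xs. h k (map Inl xs))"
    proof (rule over_pull[OF h(1) mem])
      fix k l \<alpha> xs assume "xs \<in> Sx (sd n M) k" "\<alpha> \<in> \<Delta> l k"
      then show "map Inl (Act (sd n M) k \<alpha> xs) = Act (nrv (crk n M) (cyl n M)) k \<alpha> (map Inl xs)"
        by (auto simp: Act_sd Act_nrv Sx_sd \<Delta>_def)
    qed
    moreover have "bdry_lv n M (\<lambda>m x. Rst H e m (u m x)) (\<lambda>k xs. h k (map Inl xs))"
      unfolding bdry_lv_def
    proof (intro allI ballI impI)
      fix k xs assume xs: "xs \<in> Sx (sd n M) k" and s: "ssupp (set xs) \<noteq> {..n}"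
      have "csupp (set (map Inl xs)) = ssupp (set xs)" unfolding csupp_def lr by (simp add: ssupp_def)
      then have "map Inl xs \<in> Sx (nrv (crk n M) (cyl0 n M)) k"
        using mem[OF xs] s unfolding Sx_nrv cyl0_def by simp
      then have "h k (map Inl xs) = Rst H e k (?f k (map Inl xs))" by (rule h(2))
      moreover have "lq (set (map Inl xs)) \<noteq> {}" unfolding lr using xs by (auto simp: Sx_sd)
      moreover have "map clv (map Inl xs) = map lvx xs" by (simp add: clv_simps)
      ultimately show "h k (map Inl xs) = Rst H e k (u k (map lvx xs))" by (simp only: if_False)
    qed
    ultimately show "\<exists>h. over (Src C e) (sd n M) (Cmp C g e) h \<and> bdry_lv n M (\<lambda>m x. Rst H e m (u m x)) h"
      by (intro exI conjI)
  qed
qed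

lemma map_Vtx_sd: "x \<in> \<Delta> k n \<Longrightarrow> map Vtx x \<in> Sx (sd n 0) k"
  by (auto simp: Sx_sd \<Delta>_def sorted_wrt_map)

lemma descend:
  assumes horn: "\<And>n k. n \<ge> 1 \<Longrightarrow> k \<le> n \<Longrightarrow> Lext (horn n k) (simplex n)"
  shows "g \<in> hom C V U \<Longrightarrow> over V (bdry n) g u \<Longrightarrow> over V (sd n M) g f \<Longrightarrow> bdry_lv n M u f \<Longrightarrow>
    loc V (\<lambda>e. \<exists>h. over (Src C e) (simplex n) (Cmp C g e) h \<and> (\<forall>m. \<forall>x\<in>Sx (bdry n) m. h m x = Rst H e m (u m x)))"
proof (induction M arbitrary: V g u f)
  case 0
  note g = 0(1) and u = 0(2) and f = 0(3) and uf = 0(4)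
  note V = hom_Obj(1)[OF g]
  have S: "Src C (Idt C V) = V" using id_hom[OF V] by (rule hom_Src)
  \<comment> \<open>At stage 0 the subdivision is the simplex itself, up to the constructor
    \<open>Vtx\<close>.\<close>
  have "over V (simplex n) g (\<lambda>k x. f k (map Vtx x))"
  proof (rule over_pull[OF f])
    show "x \<in> Sx (simplex n) k \<Longrightarrow> map Vtx x \<in> Sx (sd n 0) k" for k x
      unfolding Sx_simplex by (rule map_Vtx_sd)
    show "map Vtx (Act (simplex n) k \<alpha> x) = Act (sd n 0) k \<alpha> (map Vtx x)" if "x \<in> Sx (simplex n) k" "\<alpha> \<in> \<Delta> l k" for k l \<alpha> x
      using that unfolding Act_simplex Act_sd ocomp_def Sx_simplex by (auto simp: \<Delta>_def)
  qed
  moreover have "f m (map Vtx x) = Rst H (Idt C V) m (u m x)" if x: "x \<in> Sx (bdry n) m" for m x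
  proof -
    have "ssupp (set (map Vtx x)) = set x" unfolding ssupp_def by simp
    then have "f m (map Vtx x) = u m (map lvx (map Vtx x))"
      using bdry_lvD[OF uf map_Vtx_sd[of x m n]] x unfolding Sx_bdry by simp
    also have "map lvx (map Vtx x) = x" by (simp add: lvx_def comp_def)
    also have "u m x = Rst H (Idt C V) m (u m x)" using Rst_id[OF V over_mem[OF u x]] by (rule sym)
    finally show ?thesis .
  qed
  ultimately show ?case unfolding S id_right[OF g]
    by (intro loc_id[OF V]) (unfold S id_right[OF g], intro exI[of _ "\<lambda>k x. f k (map Vtx x)"] conjI allI ballI)
next
  case (Suc M)
  note g = Suc.prems(1) and u = Suc.prems(2) and f = Suc.prems(3) and uf = Suc.prems(4)
  show ?case
  proof (rule loc_over_trans[OF g descend_step[OF horn g u f uf]])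
    show "x \<in> Sx (bdry n) m \<Longrightarrow> u m x \<in> Sx (Val H V) m" for m x by (rule over_mem[OF u])
    show "Sx (bdry n) m \<subseteq> Sx (simplex n) m" for m by (auto simp: Sx_simplex Sx_bdry)
    fix e h assume e: "e \<in> hom C (Src C e) V"
      and h: "over (Src C e) (sd n M) (Cmp C g e) h \<and> bdry_lv n M (\<lambda>m x. Rst H e m (u m x)) h"
    show "loc (Src C e) (\<lambda>k. \<exists>h. over (Src C k) (simplex n) (Cmp C (Cmp C g e) k) h \<and>
        (\<forall>m. \<forall>x\<in>Sx (bdry n) m. h m x = Rst H k m (Rst H e m (u m x))))"
      by (rule Suc.IH[OF comp_hom[OF e g] over_Rst[OF u e] conjunct1[OF h] conjunct2[OF h]])
  qed
qed

end

section \<open>Faces in iterated subdivisions, and common stages\<close>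

lemma sl_retract:
  assumes F: "F \<noteq> {}" "finite F"
  shows "\<exists>\<rho>. mono \<rho> \<and> (\<forall>i. \<rho> i \<le> card F - 1) \<and> (\<forall>k\<le>card F - 1. \<rho> (sl F ! k) = k) \<and> (\<forall>i\<in>F. sl F ! \<rho> i = i)"
proof -
  let ?l = "card F - 1" let ?\<alpha> = "sl F"
  \<comment> \<open>Each i goes to the position of the least element of F not below i; the
    alternative \<open>k = ?l\<close> sends everything above F to the last position.\<close>
  define \<rho> where "\<rho> i = (LEAST k. k = ?l \<or> i \<le> ?\<alpha> ! k)" for i
  have len: "length ?\<alpha> = Suc ?l" using sl_Suc[OF F] .
  have P: "\<rho> i = ?l \<or> i \<le> ?\<alpha> ! \<rho> i" for i
    unfolding \<rho>_def by (rule LeastI[of _ ?l]) simp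
  have le: "\<rho> i \<le> k" if "k = ?l \<or> i \<le> ?\<alpha> ! k" for i k
    unfolding \<rho>_def using that by (rule Least_le)
  have "mono \<rho>"
  proof (rule monoI)
    fix i i' :: nat assume "i \<le> i'"
    then show "\<rho> i \<le> \<rho> i'" using P[of i'] by (intro le) auto
  qed
  moreover have "\<forall>i. \<rho> i \<le> ?l" using le by simp
  moreover have r: "\<rho> (?\<alpha> ! k) = k" if k: "k \<le> ?l" for k
  proof (rule antisym)
    show "\<rho> (?\<alpha> ! k) \<le> k" by (rule le) simp
    show "k \<le> \<rho> (?\<alpha> ! k)"
    proof (rule ccontr)
      assume "\<not> k \<le> \<rho> (?\<alpha> ! k)"
      then have lt: "\<rho> (?\<alpha> ! k) < k" by simp
      then have "?\<alpha> ! k \<le> ?\<alpha> ! \<rho> (?\<alpha> ! k)" using P[of "?\<alpha> ! k"] k by auto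
      moreover have "?\<alpha> ! \<rho> (?\<alpha> ! k) < ?\<alpha> ! k"
        using sorted_wrt_nth_less[OF strict_sorted_list_of_set lt, of F] len k by simp
      ultimately show False by simp
    qed
  qed
  moreover have "?\<alpha> ! \<rho> i = i" if "i \<in> F" for i
  proof -
    have "i \<in> set ?\<alpha>" using that F by simp
    then obtain k where k: "k < length ?\<alpha>" "?\<alpha> ! k = i" unfolding in_set_conv_nth by blast
    then show ?thesis using r[of k] len by simp
  qed
  ultimately show ?thesis by (intro exI[of _ \<rho>]) simp
qed

text \<open>The monotone retraction of the face inclusion acts on subdivisions, and on vertices
  supported in F it is inverse to the inclusion. The factorization is unique by
  \<open>sd_factor_unique\<close>, for the same reason.\<close>

lemma sd_factor:
  assumes ys: "ys \<in> Sx (sd n M) k" and F: "ssupp (set ys) \<subseteq> F" "finite F" "F \<noteq> {}"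
  shows "\<exists>xs\<in>Sx (sd (card F - 1) M) k. map (sd_map ((!) (sl F))) xs = ys"
proof -
  obtain \<rho> where \<rho>: "mono \<rho>" "\<And>i. \<rho> i \<le> card F - 1" "\<And>i. i \<in> F \<Longrightarrow> sl F ! \<rho> i = i"
    using sl_retract[OF F(3,2)] by auto
  have m: "mono_on {..n} \<rho>" "\<rho> ` {..n} \<subseteq> {..card F - 1}" using \<rho>(1,2) by (auto simp: mono_def mono_on_def)
  have "map (sd_map \<rho>) ys \<in> Sx (sd (card F - 1) M) k"
    by (rule sd_map_Sx[OF ys sd_map_in[OF m] sd_map_mono[OF m(1)]])
  moreover have "map (sd_map ((!) (sl F))) (map (sd_map \<rho>) ys) = ys"
    unfolding map_map
  proof (rule map_idI)
    fix y assume y: "y \<in> set ys"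
    have "sd_map (\<lambda>i. sl F ! \<rho> i) y = sd_map (\<lambda>i. i) y"
    proof (rule sd_map_cong)
      fix i assume "i \<in> supp y"
      then have "i \<in> F" using y F(1) unfolding ssupp_def by blast
      then show "sl F ! \<rho> i = i" by (rule \<rho>(3))
    qed
    then show "(sd_map ((!) (sl F)) \<circ> sd_map \<rho>) y = y" by (simp add: sd_map_comp sd_map_id)
  qed
  ultimately show ?thesis by (rule bexI[rotated])
qed

text \<open>Equalities in the sequential colimit hold from some stage on, so finitely many of them
  hold at one stage, which can be chosen beyond \<open>M0\<close>.\<close>

lemma common_stage:
  fixes Q :: "nat \<Rightarrow> 'b \<Rightarrow> bool"
  assumes "finite I" "\<And>i. i \<in> I \<Longrightarrow> \<exists>M. Q M i" "\<And>i M M'. i \<in> I \<Longrightarrow> Q M i \<Longrightarrow> M \<le> M' \<Longrightarrow> Q M' i"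
  shows "\<exists>M\<ge>M0. \<forall>i\<in>I. Q M i"
proof -
  obtain m where m: "\<And>i. i \<in> I \<Longrightarrow> Q (m i) i" using assms(2) by metis
  define M where "M = Max (insert M0 (m ` I))"
  have "M0 \<le> M" "\<And>i. i \<in> I \<Longrightarrow> m i \<le> M" unfolding M_def using assms(1) by auto
  have "Q M i" if "i \<in> I" for i by (rule assms(3)[OF that m[OF that] \<open>\<And>i. i \<in> I \<Longrightarrow> m i \<le> M\<close>[OF that]])
  then show ?thesis using \<open>M0 \<le> M\<close> by (intro exI[of _ M] conjI ballI)
qed

text \<open>The simplex of the zeroth stage that is adjoint to a simplex of \<open>X\<close>.\<close>

definition adj :: "'x sset \<Rightarrow> nat \<Rightarrow> 'x \<Rightarrow> nat \<Rightarrow> vertex list \<Rightarrow> 'x" where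
  "adj X m y = srestrict UNIV (sd m 0) (\<lambda>k xs. Act X m (map lvx xs) y)"

lemma lvx_list: assumes "xs \<in> Sx (sd n M) k" shows "map lvx xs \<in> \<Delta> k n"
proof -
  have x: "length xs = Suc k" "set xs \<subseteq> sd_vert n M" "sorted_wrt sd_le xs" using assms unfolding Sx_sd by auto
  have "sorted_wrt (\<lambda>x y. lvx x \<le> lvx y) xs"
    by (rule sorted_wrt_mono_rel[OF _ x(3)]) (use lvx_mono x(2) in blast)
  moreover have "lvx v \<le> n" if "v \<in> set xs" for v
    using lvx_mem[of v n M] supp_bounds[of v n M] x(2) that by auto
  ultimately show ?thesis using x(1) by (auto simp: \<Delta>_def sorted_wrt_map)
qed

context aug
begin

text \<open>As y(U) is discrete, a map over \<open>g\<close> on the horn is the same as a square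
  with constant bottom map.\<close>

lemma Lext_horn:
  assumes lf: "local_fibration C j H (yo C U) p" and nk: "n \<ge> 1" "k \<le> n"
  shows "Lext (horn n k) (simplex n)"
  unfolding Lext_def
proof (intro ballI allI impI)
  fix V g f assume V: "V \<in> Obj C" and g: "g \<in> hom C V U" and f: "over V (horn n k) g f"
  have v: "smap UNIV (simplex n) (Val (yo C U) V) (\<lambda>m x. g)" using g unfolding smap_def yo_def by simp
  have f': "smap UNIV (horn n k) (Val H V) f" "\<forall>m. \<forall>x\<in>Sx (horn n k) m. p V m (f m x) = g"
    using f unfolding over_def by simp_all
  have "\<exists>r\<in>j V. \<forall>e\<in>r. \<exists>h. smap UNIV (simplex n) (Val H (Src C e)) h \<and>
           (\<forall>m. \<forall>x\<in>Sx (horn n k) m. h m x = Rst H e m (f m x)) \<and>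
           (\<forall>m. \<forall>x\<in>Sx (simplex n) m. p (Src C e) m (h m x) = Rst (yo C U) e m g)"
    using lf[unfolded local_fibration_def, rule_format, OF V nk, of f "\<lambda>m x. g"] f' v by simp
  then have "loc V (\<lambda>e. \<exists>h. smap UNIV (simplex n) (Val H (Src C e)) h \<and>
           (\<forall>m. \<forall>x\<in>Sx (horn n k) m. h m x = Rst H e m (f m x)) \<and>
           (\<forall>m. \<forall>x\<in>Sx (simplex n) m. p (Src C e) m (h m x) = Rst (yo C U) e m g))"
    unfolding loc_def .
  then show "loc V (\<lambda>e. \<exists>h. over (Src C e) (simplex n) (Cmp C g e) h \<and>
      (\<forall>m. \<forall>x\<in>Sx (horn n k) m. h m x = Rst H e m (f m x)))"
  proof (rule loc_mono[OF V])
    fix e assume "\<exists>h. smap UNIV (simplex n) (Val H (Src C e)) h \<and>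
           (\<forall>m. \<forall>x\<in>Sx (horn n k) m. h m x = Rst H e m (f m x)) \<and>
           (\<forall>m. \<forall>x\<in>Sx (simplex n) m. p (Src C e) m (h m x) = Rst (yo C U) e m g)"
    then obtain h where h: "smap UNIV (simplex n) (Val H (Src C e)) h \<and>
           (\<forall>m. \<forall>x\<in>Sx (horn n k) m. h m x = Rst H e m (f m x)) \<and>
           (\<forall>m. \<forall>x\<in>Sx (simplex n) m. p (Src C e) m (h m x) = Rst (yo C U) e m g)" ..
    then show "\<exists>h. over (Src C e) (simplex n) (Cmp C g e) h \<and> (\<forall>m. \<forall>x\<in>Sx (horn n k) m. h m x = Rst H e m (f m x))"
      unfolding over_def by (intro exI[of _ h]) (simp add: yo_def)
  qed
qed

lemma adj_in:
  assumes V: "V \<in> Obj C" and y: "y \<in> Sx (Val H V) m"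
  shows "adj (Val H V) m y \<in> smaps UNIV (sd m 0) (Val H V)"
  unfolding adj_def
proof (rule smaps_srestrict)
  fix k xs assume xs: "xs \<in> Sx (sd m 0) k"
  show "Act (Val H V) m (map lvx xs) y \<in> Sx (Val H V) k" by (rule Act_mem[OF V lvx_list[OF xs] y])
  fix l \<alpha> assume \<alpha>: "\<alpha> \<in> \<Delta> l k"
  show "Act (sd m 0) k \<alpha> xs \<in> Sx (sd m 0) l" by (rule sd_Act_Sx[OF \<alpha> xs])
  have "map lvx (Act (sd m 0) k \<alpha> xs) = ocomp (map lvx xs) \<alpha>"
    using xs \<alpha> by (auto simp: Act_sd ocomp_def Sx_sd \<Delta>_def)
  then show "Act (Val H V) m (map lvx (Act (sd m 0) k \<alpha> xs)) y = Act (Val H V) k \<alpha> (Act (Val H V) m (map lvx xs) y)"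
    by (simp only: Act_comp[OF V lvx_list[OF xs] \<alpha> y])
qed

lemma adj_app: "xs \<in> Sx (sd m 0) k \<Longrightarrow> adj (Val H V) m y k xs = Act (Val H V) m (map lvx xs) y"
  unfolding adj_def by (rule srestrict_in[OF UNIV_I])

lemma epull_adj:
  assumes V: "V \<in> Obj C" and y: "y \<in> Sx (Val H V) n" and \<alpha>: "\<alpha> \<in> \<Delta> l n"
  shows "epull l 0 \<alpha> (adj (Val H V) n y) = adj (Val H V) l (Act (Val H V) n \<alpha> y)"
proof (rule smaps_ext[OF epull_in[OF \<alpha> adj_in[OF V y]] adj_in[OF V Act_mem[OF V \<alpha> y]]])
  fix k xs assume xs: "xs \<in> Sx (sd l 0) k"
  have "map lvx (map (sd_map ((!) \<alpha>)) xs) = ocomp \<alpha> (map lvx xs)"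
    using xs lvx_sd_map[OF Delta_mono_on[OF \<alpha>]] by (auto simp: ocomp_def Sx_sd subset_iff simp del: sd_vert.simps(1))
  then show "epull l 0 \<alpha> (adj (Val H V) n y) k xs = adj (Val H V) l (Act (Val H V) n \<alpha> y) k xs"
    by (simp only: epull_app[OF xs] adj_app[OF sd_Delta_Sx[OF \<alpha> xs]] adj_app[OF xs] Act_comp[OF V \<alpha> lvx_list[OF xs] y])
qed

text \<open>At every stage, the image of the simplex y in Ex-infinity evaluates y along last
  vertices, since all transition maps preserve them.\<close>

lemma ex_iter_adj:
  assumes V: "V \<in> Obj C" and y: "y \<in> Sx (Val H V) n" and xs: "xs \<in> Sx (sd n D) k"
  shows "ex_iter n 0 D (adj (Val H V) n y) k xs = Act (Val H V) n (map lvx xs) y"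
proof -
  have xs': "xs \<in> Sx (sd n (0 + D)) k" using xs by simp
  have "map lvx (map (lvi 0 D) xs) = map lvx xs"
    using xs lvi_0[of _ n D] by (auto simp: Sx_sd lvx_def)
  then show ?thesis by (simp only: ex_iter_app[OF adj_in[OF V y] xs'] adj_app[OF lvi_Sx[OF xs']])
qed

lemma yo_discrete:
  shows "Act (Val (yo C U) V) k \<alpha> x = x" "Sx (Val (yo C U) V) k = Sx (Val (yo C U) V) l"
    "g \<in> hom C V U \<Longrightarrow> g \<in> Sx (Val (yo C U) V) k"
  by (simp_all add: yo_def)

lemma p_smap: "V \<in> Obj C \<Longrightarrow> smap UNIV (Val H V) (Val (yo C U) V) (p V)"
  using aug unfolding spsh_map_def by simp

lemma yo_Rst_smap: "e \<in> hom C W V \<Longrightarrow> smap UNIV (Val (yo C U) V) (Val (yo C U) W) (Rst (yo C U) e)"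
  unfolding smap_def yo_def using comp_hom by simp

abbreviation kc :: "'o \<Rightarrow> nat \<Rightarrow> 'm \<Rightarrow> (nat \<times> (nat \<Rightarrow> vertex list \<Rightarrow> 'm)) set" where
  "kc V n g \<equiv> kcls (Val (yo C U) V) n g"

lemma kc_eq: "g \<in> hom C V U \<Longrightarrow> f \<in> smaps UNIV (sd n m) (Val (yo C U) V) \<Longrightarrow>
  ecls (Val (yo C U) V) n m f = kc V n g \<longleftrightarrow> (\<forall>k. \<forall>xs\<in>Sx (sd n m) k. f k xs = g)"
  by (rule kcls_eq[OF yo_discrete(1) yo_discrete(3)])

lemma kc_Act: "g \<in> hom C V U \<Longrightarrow> \<alpha> \<in> \<Delta> l n \<Longrightarrow> Act (ex_inf (Val (yo C U) V)) n \<alpha> (kc V n g) = kc V l g"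
  by (rule kcls_Act[OF yo_discrete(1) yo_discrete(3)])

lemma kc_in: "g \<in> hom C V U \<Longrightarrow> kc V n g \<in> Sx (ex_inf (Val (yo C U) V)) n"
  unfolding kcls_def by (rule ecls_in[OF kmap_in[OF yo_discrete(1) yo_discrete(3)]])

lemma kc_Rst:
  assumes e: "e \<in> hom C W V" and g: "g \<in> hom C V U"
  shows "ex_inf_map (Val (yo C U) W) (Rst (yo C U) e) n (kc V n g) = kc W n (Cmp C g e)"
proof -
  note kin = kmap_in[OF yo_discrete(1) yo_discrete(3)[OF g], of n 0]
  have "ex_inf_map (Val (yo C U) W) (Rst (yo C U) e) n (kc V n g) =
    ecls (Val (yo C U) W) n 0 (epush n 0 (Rst (yo C U) e) (srestrict UNIV (sd n 0) (\<lambda>k xs. g)))"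
    unfolding kcls_def by (rule ex_inf_map_ecls[OF yo_Rst_smap[OF e] kin])
  also have "\<dots> = kc W n (Cmp C g e)"
    unfolding kc_eq[OF comp_hom[OF e g] epush_in[OF yo_Rst_smap[OF e] kin]]
  proof (intro allI ballI)
    fix k xs assume xs: "xs \<in> Sx (sd n 0) k"
    show "epush n 0 (Rst (yo C U) e) (srestrict UNIV (sd n 0) (\<lambda>k xs. g)) k xs = Cmp C g e"
      unfolding epush_app[OF xs] srestrict_in[OF UNIV_I xs] by (simp add: yo_def)
  qed
  finally show ?thesis .
qed

lemma kc_p:
  assumes V: "V \<in> Obj C" and g: "g \<in> hom C V U" and f: "f \<in> smaps UNIV (sd n m) (Val H V)"
  shows "ex_inf_map (Val (yo C U) V) (p V) n (ecls (Val H V) n m f) = kc V n g \<longleftrightarrow>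
    (\<forall>k. \<forall>xs\<in>Sx (sd n m) k. p V k (f k xs) = g)"
  unfolding ex_inf_map_ecls[OF p_smap[OF V] f] kc_eq[OF g epush_in[OF p_smap[OF V] f]]
  by (simp add: epush_app cong: ball_cong)

lemma kc_p_adj:
  assumes V: "V \<in> Obj C" and g: "g \<in> hom C V U" and y: "y \<in> Sx (Val H V) n" "p V n y = g"
  shows "ex_inf_map (Val (yo C U) V) (p V) n (ecls (Val H V) n 0 (adj (Val H V) n y)) = kc V n g"
  unfolding kc_p[OF V g adj_in[OF V y(1)]]
proof (intro allI ballI)
  fix k xs assume xs: "xs \<in> Sx (sd n 0) k"
  show "p V k (adj (Val H V) n y k xs) = g"
    unfolding adj_app[OF xs] p_Act[OF V lvx_list[OF xs] y(1)] by (rule y(2))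
qed

lemma bdry_sl: "F \<noteq> {} \<Longrightarrow> F \<subset> {..n} \<Longrightarrow> sl F \<in> Sx (bdry n) (card F - 1)"
  unfolding Sx_bdry using sl_Delta[of F n] finite_subset[of F "{..n}"] by auto

text \<open>The top simplex of \<open>h\<close> has a representative at some stage. Each proper face
  of it becomes equal to the restriction of \<open>u\<close> at a later stage, and there are
  finitely many faces, so a single stage suffices for the whole boundary.\<close>

lemma weq_filler:
  assumes e: "e \<in> hom C W V" and g: "g \<in> hom C V U" and u: "over V (bdry n) g u"
    and h: "smap UNIV (simplex n) (ex_inf (Val H W)) h"
    and hu: "\<And>m x. x \<in> Sx (bdry n) m \<Longrightarrow>
      h m x = ex_inf_map (Val H W) (Rst H e) m (ecls (Val H V) m 0 (adj (Val H V) m (u m x)))"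
    and htp: "homotopic_rel_bdry n (ex_inf (Val (yo C U) W)) (\<lambda>m x. ex_inf_map (Val (yo C U) W) (p W) m (h m x))
      (\<lambda>m x. ex_inf_map (Val (yo C U) W) (Rst (yo C U) e) m (kc V m g))"
  shows "\<exists>M f. over W (sd n M) (Cmp C g e) f \<and> bdry_lv n M (\<lambda>m x. Rst H e m (u m x)) f"
proof -
  note V = hom_Obj(1)[OF g] and W = hom_Obj(1)[OF e] and ge = comp_hom[OF e g]
  have "h n [0..<Suc n] \<in> Sx (ex_inf (Val H W)) n"
    using h id_Delta[of n] unfolding smap_def Sx_simplex by blast
  then obtain M0 f0 where f0: "f0 \<in> smaps UNIV (sd n M0) (Val H W)" "h n [0..<Suc n] = ecls (Val H W) n M0 f0"
    unfolding Sx_ex_inf by blast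
  \<comment> \<open>The filler lies over \<open>v\<close> only up to homotopy a priori; in the
    discrete target this is equality.\<close>
  have "ex_inf_map (Val (yo C U) W) (p W) n (h n [0..<Suc n]) = kc W n (Cmp C g e)"
    by (rule homotopic_discrete[OF yo_discrete(1,2) htp yo_discrete(3)[OF ge]]) (rule kc_Rst[OF e g])
  then have pf0: "\<And>k xs. xs \<in> Sx (sd n M0) k \<Longrightarrow> p W k (f0 k xs) = Cmp C g e"
    unfolding f0(2) kc_p[OF W ge f0(1)] by simp
  let ?I = "{F. F \<noteq> {} \<and> F \<subset> {..n}}"
  \<comment> \<open>Two classes agree when representatives do at a common stage: \<open>f0\<close>
    comes from stage M0, the adjoint of a simplex of \<open>H\<close> from stage 0.\<close>
  let ?Q = "\<lambda>M F. M \<ge> M0 \<and> ex_iter (card F - 1) M0 (M - M0) (epull (card F - 1) M0 (sl F) f0) =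
      ex_iter (card F - 1) 0 (M - 0) (epush (card F - 1) 0 (Rst H e) (adj (Val H V) (card F - 1) (u (card F - 1) (sl F))))"
  have "\<exists>M\<ge>M0. \<forall>F\<in>?I. ?Q M F"
  proof (rule common_stage)
    have "?I \<subseteq> Pow {..n}" by blast
    then show "finite ?I" by (rule finite_subset) simp
    fix F assume F: "F \<in> ?I"
    let ?l = "card F - 1"
    have sl\<Delta>: "sl F \<in> \<Delta> ?l n" using sl_Delta[of F n] F by blast
    have bd: "sl F \<in> Sx (bdry n) ?l" using bdry_sl F by blast
    note uF = over_mem[OF u bd]
    have "h ?l (Act (simplex n) n (sl F) [0..<Suc n]) = Act (ex_inf (Val H W)) n (sl F) (h n [0..<Suc n])"
      using h id_Delta[of n] sl\<Delta> unfolding smap_def Sx_simplex by blast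
    then have "h ?l (sl F) = Act (ex_inf (Val H W)) n (sl F) (ecls (Val H W) n M0 f0)"
      unfolding Act_simplex ocomp_id(1)[OF sl\<Delta>] f0(2) .
    also have "\<dots> = ecls (Val H W) ?l M0 (epull ?l M0 (sl F) f0)" by (rule Act_ecls[OF sl\<Delta> f0(1)])
    finally have "ecls (Val H W) ?l M0 (epull ?l M0 (sl F) f0) =
      ecls (Val H W) ?l 0 (epush ?l 0 (Rst H e) (adj (Val H V) ?l (u ?l (sl F))))"
      unfolding hu[OF bd] ex_inf_map_ecls[OF Rst_smap[OF e] adj_in[OF V uF]] by (rule sym)
    then show "\<exists>M. ?Q M F"
      unfolding ecls_eq_iff[OF epull_in[OF sl\<Delta> f0(1)] epush_in[OF Rst_smap[OF e] adj_in[OF V uF]]] by auto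
    fix M M' assume Q: "?Q M F" and le: "M \<le> M'"
    show "?Q M' F" using ex_iter_raise[OF conjunct1[OF Q] _ conjunct2[OF Q] le] Q le by simp
  qed
  then obtain M where M: "M \<ge> M0" "\<And>F. F \<in> ?I \<Longrightarrow> ?Q M F" by (elim exE conjE) simp
  define f where "f = ex_iter n M0 (M - M0) f0"
  have M': "M0 + (M - M0) = M" using M(1) by simp
  have f: "f \<in> smaps UNIV (sd n M) (Val H W)" using ex_iter_in[OF f0(1), of "M - M0"] unfolding M' f_def .
  have "over W (sd n M) (Cmp C g e) f" unfolding over_def
  proof (intro conjI allI ballI)
    show "smap UNIV (sd n M) (Val H W) f" by (rule smaps_smap[OF f])
    fix k xs assume "xs \<in> Sx (sd n M) k"
    then have xs: "xs \<in> Sx (sd n (M0 + (M - M0))) k" unfolding M' .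
    show "p W k (f k xs) = Cmp C g e" unfolding f_def ex_iter_app[OF f0(1) xs] by (rule pf0[OF lvi_Sx[OF xs]])
  qed
  moreover have "bdry_lv n M (\<lambda>m x. Rst H e m (u m x)) f" unfolding bdry_lv_def
  proof (intro allI ballI impI)
    fix k ys assume ys: "ys \<in> Sx (sd n M) k" and s: "ssupp (set ys) \<noteq> {..n}"
    \<comment> \<open>The carrier \<open>F\<close> is a proper face, and \<open>ys\<close> comes
      from its subdivision. There the agreement reached at stage M applies.\<close>
    define F where "F = ssupp (set ys)"
    have ysn: "set ys \<subseteq> sd_vert n M" "set ys \<noteq> {}" using ys by (auto simp: Sx_sd)
    have F: "F \<noteq> {}" "F \<subset> {..n}" using ssupp_bounds[OF ysn(1)] ssupp_ne[OF ysn] s unfolding F_def by auto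
    then have FI: "F \<in> ?I" by simp
    have fin: "finite F" using F(2) finite_subset[of F "{..n}"] by auto
    let ?l = "card F - 1"
    have sl\<Delta>: "sl F \<in> \<Delta> ?l n" using sl_Delta[of F n] F by blast
    have bd: "sl F \<in> Sx (bdry n) ?l" using bdry_sl F by blast
    note uF = over_mem[OF u bd]
    obtain xs where xs: "xs \<in> Sx (sd ?l M) k" "map (sd_map ((!) (sl F))) xs = ys"
      using sd_factor[OF ys, of F] fin F(1) unfolding F_def by blast
    note Rin = epush_in[OF Rst_smap[OF e] adj_in[OF V uF]]
    have xs0: "xs \<in> Sx (sd ?l (0 + (M - 0))) k" using xs(1) by simp
    have lv: "map lvx xs \<in> \<Delta> k ?l" by (rule lvx_list[OF xs(1)])
    have "f k ys = epull ?l M (sl F) f k xs" unfolding epull_app[OF xs(1)] xs(2) ..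
    also have "epull ?l M (sl F) f = ex_iter ?l M0 (M - M0) (epull ?l M0 (sl F) f0)"
      using ex_iter_epull[OF sl\<Delta> f0(1), of "M - M0"] unfolding M' f_def by (rule sym)
    also have "\<dots> = ex_iter ?l 0 (M - 0) (epush ?l 0 (Rst H e) (adj (Val H V) ?l (u ?l (sl F))))"
      using M(2)[OF FI] by (rule conjunct2)
    also have "\<dots> = epush ?l (0 + (M - 0)) (Rst H e) (ex_iter ?l 0 (M - 0) (adj (Val H V) ?l (u ?l (sl F))))"
      by (rule ex_iter_epush[OF Rst_smap[OF e] adj_in[OF V uF]])
    also have "\<dots> k xs = Rst H e k (ex_iter ?l 0 (M - 0) (adj (Val H V) ?l (u ?l (sl F))) k xs)"
      by (rule epush_app[OF xs0])
    also have "ex_iter ?l 0 (M - 0) (adj (Val H V) ?l (u ?l (sl F))) k xs = Act (Val H V) ?l (map lvx xs) (u ?l (sl F))"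
      using ex_iter_adj[OF V uF xs(1)] by simp
    also have "\<dots> = u k (Act (bdry n) ?l (map lvx xs) (sl F))" by (rule over_Act[OF u bd lv, symmetric])
    also have "Act (bdry n) ?l (map lvx xs) (sl F) = map lvx ys"
      unfolding xs(2)[symmetric] Act_bdry ocomp_def
      using xs(1) lvx_sd_map[OF Delta_mono_on[OF sl\<Delta>]] by (auto simp: Sx_sd)
    finally show "f k ys = Rst H e k (u k (map lvx ys))" .
  qed
  ultimately show ?thesis by (intro exI conjI)
qed

text \<open>The criterion is applied to \<open>u\<close> followed by the map from \<open>H\<close>
  to its Ex-infinity. It gives local fillers on a subdivision, and \<open>descend\<close> moves them
  to the simplex itself, using that \<open>p\<close> is a local fibration.\<close>

theorem hypercover_fillers:
  assumes hc: "hypercover C j U H p"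
  shows "Lext (bdry n) (simplex n)"
  unfolding Lext_def
proof (intro ballI allI impI)
  have lf: "local_fibration C j H (yo C U) p" and lw: "local_weak_equivalence C j H (yo C U) p"
    using hc unfolding hypercover_def local_trivial_fibration_def by simp_all
  fix V g u assume V: "V \<in> Obj C" and g: "g \<in> hom C V U" and u: "over V (bdry n) g u"
  define u' where "u' m x = ecls (Val H V) m 0 (adj (Val H V) m (u m x))" for m x
  have u': "smap UNIV (bdry n) (ex_inf (Val H V)) u'" unfolding smap_def
  proof (intro conjI ballI)
    fix m x assume x: "x \<in> Sx (bdry n) m"
    note ux = over_mem[OF u x]
    show "u' m x \<in> Sx (ex_inf (Val H V)) m" unfolding u'_def by (rule ecls_in[OF adj_in[OF V ux]])
    fix l \<alpha> assume \<alpha>: "\<alpha> \<in> \<Delta> l m"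
    show "u' l (Act (bdry n) m \<alpha> x) = Act (ex_inf (Val H V)) m \<alpha> (u' m x)"
      unfolding u'_def Act_ecls[OF \<alpha> adj_in[OF V ux]] epull_adj[OF V ux \<alpha>] over_Act[OF u x \<alpha>] ..
  qed
  have v': "smap UNIV (simplex n) (ex_inf (Val (yo C U) V)) (\<lambda>m x. kc V m g)"
    unfolding smap_def using kc_in[OF g] kc_Act[OF g] by simp
  have comm: "ex_inf_map (Val (yo C U) V) (p V) m (u' m x) = kc V m g" if x: "x \<in> Sx (bdry n) m" for m x
    unfolding u'_def by (rule kc_p_adj[OF V g over_mem[OF u x] over_p[OF u x]])
  have "\<exists>r\<in>j V. \<forall>f\<in>r. \<exists>h. smap UNIV (simplex n) (Val (ex_inf_psh C H) (Src C f)) h \<and>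
           (\<forall>m. \<forall>x\<in>Sx (bdry n) m. h m x = Rst (ex_inf_psh C H) f m (u' m x)) \<and>
           homotopic_rel_bdry n (Val (ex_inf_psh C (yo C U)) (Src C f))
             (\<lambda>m x. ex_inf_map (Val (yo C U) (Src C f)) (p (Src C f)) m (h m x))
             (\<lambda>m x. Rst (ex_inf_psh C (yo C U)) f m (kc V m g))"
    using lw[unfolded local_weak_equivalence_def local_weq_fibrant_def, rule_format, OF V, of n u' "\<lambda>m x. kc V m g"]
      u' v' comm by (simp add: ex_inf_psh_def)
  then have L: "loc V (\<lambda>f. \<exists>h. smap UNIV (simplex n) (ex_inf (Val H (Src C f))) h \<and>
           (\<forall>m. \<forall>x\<in>Sx (bdry n) m. h m x = ex_inf_map (Val H (Src C f)) (Rst H f) m (u' m x)) \<and>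
           homotopic_rel_bdry n (ex_inf (Val (yo C U) (Src C f)))
             (\<lambda>m x. ex_inf_map (Val (yo C U) (Src C f)) (p (Src C f)) m (h m x))
             (\<lambda>m x. ex_inf_map (Val (yo C U) (Src C f)) (Rst (yo C U) f) m (kc V m g)))"
    unfolding loc_def by (simp add: ex_inf_psh_def)
  show "loc V (\<lambda>e. \<exists>h. over (Src C e) (simplex n) (Cmp C g e) h \<and>
      (\<forall>m. \<forall>x\<in>Sx (bdry n) m. h m x = Rst H e m (u m x)))"
  proof (rule loc_over_trans[OF g])
    \<comment> \<open>Stage and filler are packed into a pair, since the stage may vary with the
      member of the cover.\<close>
    show "loc V (\<lambda>e. \<exists>Mf. over (Src C e) (sd n (fst Mf)) (Cmp C g e) (snd Mf) \<and>
      bdry_lv n (fst Mf) (\<lambda>m x. Rst H e m (u m x)) (snd Mf))"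
    proof (rule loc_mono[OF V L])
      fix e assume e: "e \<in> hom C (Src C e) V" and
        "\<exists>h. smap UNIV (simplex n) (ex_inf (Val H (Src C e))) h \<and>
           (\<forall>m. \<forall>x\<in>Sx (bdry n) m. h m x = ex_inf_map (Val H (Src C e)) (Rst H e) m (u' m x)) \<and>
           homotopic_rel_bdry n (ex_inf (Val (yo C U) (Src C e)))
             (\<lambda>m x. ex_inf_map (Val (yo C U) (Src C e)) (p (Src C e)) m (h m x))
             (\<lambda>m x. ex_inf_map (Val (yo C U) (Src C e)) (Rst (yo C U) e) m (kc V m g))"
      then obtain h where h: "smap UNIV (simplex n) (ex_inf (Val H (Src C e))) h \<and>
           (\<forall>m. \<forall>x\<in>Sx (bdry n) m. h m x = ex_inf_map (Val H (Src C e)) (Rst H e) m (u' m x)) \<and>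
           homotopic_rel_bdry n (ex_inf (Val (yo C U) (Src C e)))
             (\<lambda>m x. ex_inf_map (Val (yo C U) (Src C e)) (p (Src C e)) m (h m x))
             (\<lambda>m x. ex_inf_map (Val (yo C U) (Src C e)) (Rst (yo C U) e) m (kc V m g))" by (elim exE)
      note h1 = conjunct1[OF h] and h2 = conjunct1[OF conjunct2[OF h]] and h3 = conjunct2[OF conjunct2[OF h]]
      have "\<exists>M f. over (Src C e) (sd n M) (Cmp C g e) f \<and> bdry_lv n M (\<lambda>m x. Rst H e m (u m x)) f"
        by (rule weq_filler[OF e g u h1 _ h3]) (rule h2[unfolded u'_def, rule_format])
      then show "\<exists>Mf. over (Src C e) (sd n (fst Mf)) (Cmp C g e) (snd Mf) \<and>
        bdry_lv n (fst Mf) (\<lambda>m x. Rst H e m (u m x)) (snd Mf)" by simp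
    qed
    fix e and Mf :: "nat \<times> (nat \<Rightarrow> vertex list \<Rightarrow> 'x)"
    assume e: "e \<in> hom C (Src C e) V" and Mf: "over (Src C e) (sd n (fst Mf)) (Cmp C g e) (snd Mf) \<and>
      bdry_lv n (fst Mf) (\<lambda>m x. Rst H e m (u m x)) (snd Mf)"
    show "loc (Src C e) (\<lambda>k. \<exists>h. over (Src C k) (simplex n) (Cmp C (Cmp C g e) k) h \<and>
        (\<forall>m. \<forall>x\<in>Sx (bdry n) m. h m x = Rst H k m (Rst H e m (u m x))))"
      by (rule descend[OF Lext_horn[OF lf] comp_hom[OF e g] over_Rst[OF u e] conjunct1[OF Mf] conjunct2[OF Mf]])
  next
    show "x \<in> Sx (bdry n) m \<Longrightarrow> u m x \<in> Sx (Val H V) m" for m x by (rule over_mem[OF u])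
    show "Sx (bdry n) m \<subseteq> Sx (simplex n) m" for m by (auto simp: Sx_simplex Sx_bdry)
  qed
qed

end

section \<open>Maps with local fillers are hypercovers\<close>

lemma epull_epull:
  assumes x: "x \<in> \<Delta> m n" and \<alpha>: "\<alpha> \<in> \<Delta> l m" and f: "f \<in> smaps UNIV (sd n M) X"
  shows "epull l M \<alpha> (epull m M x f) = epull l M (ocomp x \<alpha>) f"
proof (rule smaps_ext[OF epull_in[OF \<alpha> epull_in[OF x f]] epull_in[OF ocomp_Delta[OF x \<alpha>] f]])
  fix k xs assume xs: "xs \<in> Sx (sd l M) k"
  have "sd_map ((!) x) (sd_map ((!) \<alpha>) v) = sd_map ((!) (ocomp x \<alpha>)) v" if "v \<in> set xs" for v
  proof -
    have "supp v \<subseteq> {..l}" using supp_bounds[of v l M] that xs by (auto simp: Sx_sd)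
    then show ?thesis unfolding sd_map_comp using nth_ocomp[OF \<alpha>] by (intro sd_map_cong) auto
  qed
  then have "map (sd_map ((!) x)) (map (sd_map ((!) \<alpha>)) xs) = map (sd_map ((!) (ocomp x \<alpha>))) xs" by simp
  then show "epull l M \<alpha> (epull m M x f) k xs = epull l M (ocomp x \<alpha>) f k xs"
    by (simp only: epull_app[OF xs] epull_app[OF sd_Delta_Sx[OF \<alpha> xs]])
qed

lemma sd_factor_unique:
  assumes F: "F \<noteq> {}" "finite F" and xs: "xs \<in> Sx (sd (card F - 1) M) k" "xs' \<in> Sx (sd (card F - 1) M) k"
    and eq: "map (sd_map ((!) (sl F))) xs = map (sd_map ((!) (sl F))) xs'"
  shows "xs = xs'"
proof -
  let ?l = "card F - 1"
  obtain \<rho> where \<rho>: "\<And>k. k \<le> ?l \<Longrightarrow> \<rho> (sl F ! k) = k" using sl_retract[OF F] by auto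
  have r: "sd_map \<rho> (sd_map ((!) (sl F)) x) = x" if x: "x \<in> sd_vert ?l M" for x
  proof -
    have "sd_map (\<lambda>i. \<rho> (sl F ! i)) x = sd_map (\<lambda>i. i) x"
      using supp_bounds[OF x] \<rho> by (intro sd_map_cong) auto
    then show ?thesis by (simp add: sd_map_comp sd_map_id)
  qed
  have inv: "map (sd_map \<rho>) (map (sd_map ((!) (sl F))) zs) = zs" if "zs \<in> Sx (sd ?l M) k" for zs
    unfolding map_map by (rule map_idI) (use r that in \<open>auto simp: Sx_sd\<close>)
  show ?thesis using inv[OF xs(1)] inv[OF xs(2)] unfolding eq by simp
qed

section \<open>Maps from a boundary to Ex-infinity, represented on a subdivided boundary\<close>

definition dl :: "nat set \<Rightarrow> nat set \<Rightarrow> nat list" where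
  "dl F G = map (pos (sl F)) (sl G)"

lemma dl:
  assumes "G \<noteq> {}" "G \<subseteq> F" "finite F"
  shows "dl F G \<in> \<Delta> (card G - 1) (card F - 1)" "sl G = ocomp (sl F) (dl F G)"
proof -
  have G: "finite G" using assms finite_subset by blast
  have len: "length (sl F) = Suc (card F - 1)" using sl_Suc[of F] assms by blast
  have lenG: "length (sl G) = Suc (card G - 1)" using sl_Suc[of G] G assms by blast
  note pl = pos_list[OF sl_strict len _ lenG]
  show "dl F G \<in> \<Delta> (card G - 1) (card F - 1)" "sl G = ocomp (sl F) (dl F G)"
    unfolding dl_def ocomp_def using pl assms G by simp_all
qed

text \<open>These index the nondegenerate simplices of the boundary, and are finite in
  number.\<close>

definition pfaces :: "nat \<Rightarrow> nat set set" where
  "pfaces n = {F. F \<noteq> {} \<and> F \<subset> {..n}}"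

lemma pfacesD: "F \<in> pfaces n \<Longrightarrow> F \<noteq> {}" "F \<in> pfaces n \<Longrightarrow> F \<subset> {..n}" "F \<in> pfaces n \<Longrightarrow> finite F"
  unfolding pfaces_def by (auto intro: finite_subset)

lemma finite_pfaces: "finite (pfaces n)"
proof (rule finite_subset)
  show "pfaces n \<subseteq> Pow {..n}" unfolding pfaces_def by blast
qed simp

lemma pfaces_sub: "F \<in> pfaces n \<Longrightarrow> G \<noteq> {} \<Longrightarrow> G \<subseteq> F \<Longrightarrow> G \<in> pfaces n"
  unfolding pfaces_def by blast

lemma pfaces_sl: "F \<in> pfaces n \<Longrightarrow> sl F \<in> \<Delta> (card F - 1) n"
  using sl_Delta[of F n] unfolding pfaces_def by blast

lemma pfaces_bdry: "F \<in> pfaces n \<Longrightarrow> sl F \<in> Sx (bdry n) (card F - 1)"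
  unfolding Sx_bdry using pfaces_sl pfacesD[of F n] by auto

text \<open>A boundary has finitely many nondegenerate simplices, so a map from it to the colimit
  comes from a finite stage.\<close>

lemma bdry_stage:
  assumes u: "smap UNIV (bdry n) (ex_inf X) u"
  shows "\<exists>M \<phi>. (\<forall>F\<in>pfaces n. \<phi> F \<in> smaps UNIV (sd (card F - 1) M) X \<and>
      u (card F - 1) (sl F) = ecls X (card F - 1) M (\<phi> F)) \<and>
    (\<forall>F\<in>pfaces n. \<forall>G\<in>pfaces n. G \<subseteq> F \<longrightarrow> \<phi> G = epull (card G - 1) M (dl F G) (\<phi> F))"
proof -
  have "\<exists>z. snd z \<in> smaps UNIV (sd (card F - 1) (fst z)) X \<and>
     u (card F - 1) (sl F) = ecls X (card F - 1) (fst z) (snd z)" if F: "F \<in> pfaces n" for F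
  proof -
    have "u (card F - 1) (sl F) \<in> Sx (ex_inf X) (card F - 1)"
      using u pfaces_bdry[OF F] unfolding smap_def by simp
    then show ?thesis unfolding Sx_ex_inf by auto
  qed
  then have "\<forall>F\<in>pfaces n. \<exists>z. snd z \<in> smaps UNIV (sd (card F - 1) (fst z)) X \<and>
     u (card F - 1) (sl F) = ecls X (card F - 1) (fst z) (snd z)" by (intro ballI)
  from bchoice[OF this] obtain z where zz: "\<forall>F\<in>pfaces n. snd (z F) \<in> smaps UNIV (sd (card F - 1) (fst (z F))) X \<and>
     u (card F - 1) (sl F) = ecls X (card F - 1) (fst (z F)) (snd (z F))" ..
  note z = conjunct1[OF bspec[OF zz]] conjunct2[OF bspec[OF zz]]
  \<comment> \<open>Two increases of the stage: the first gives all faces representatives at the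
    same stage, the second makes these compatible with inclusions of faces.\<close>
  have "\<exists>M\<ge>0. \<forall>F\<in>pfaces n. fst (z F) \<le> M"
    by (rule common_stage[OF finite_pfaces]) auto
  then obtain M1 where M1: "\<And>F. F \<in> pfaces n \<Longrightarrow> fst (z F) \<le> M1" by auto
  define f1 where "f1 F = ex_iter (card F - 1) (fst (z F)) (M1 - fst (z F)) (snd (z F))" for F
  have f1: "f1 F \<in> smaps UNIV (sd (card F - 1) M1) X" if "F \<in> pfaces n" for F
    using ex_iter_in[OF z(1)[OF that], of "M1 - fst (z F)"] M1[OF that] unfolding f1_def by simp
  have uf1: "u (card F - 1) (sl F) = ecls X (card F - 1) M1 (f1 F)" if "F \<in> pfaces n" for F
    using ecls_up[OF z(1)[OF that], of "M1 - fst (z F)"] M1[OF that] z(2)[OF that] unfolding f1_def by simp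
  let ?Q = "\<lambda>M P. M \<ge> M1 \<and> ex_iter (card (snd P) - 1) M1 (M - M1) (f1 (snd P)) =
     ex_iter (card (snd P) - 1) M1 (M - M1) (epull (card (snd P) - 1) M1 (dl (fst P) (snd P)) (f1 (fst P)))"
  let ?I = "{P \<in> pfaces n \<times> pfaces n. snd P \<subseteq> fst P}"
  have "\<exists>M\<ge>M1. \<forall>P\<in>?I. ?Q M P"
  proof (rule common_stage)
    show "finite ?I" by (rule finite_subset[of _ "pfaces n \<times> pfaces n"]) (use finite_pfaces in auto)
    fix P assume "P \<in> ?I"
    then have F: "fst P \<in> pfaces n" and G: "snd P \<in> pfaces n" and GF: "snd P \<subseteq> fst P" by auto
    let ?F = "fst P" and ?G = "snd P"
    note d = dl[OF pfacesD(1)[OF G] GF pfacesD(3)[OF F]]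
    have "u (card ?G - 1) (Act (bdry n) (card ?F - 1) (dl ?F ?G) (sl ?F)) =
        Act (ex_inf X) (card ?F - 1) (dl ?F ?G) (u (card ?F - 1) (sl ?F))"
      using u pfaces_bdry[OF F] d(1) unfolding smap_def by blast
    then have "ecls X (card ?G - 1) M1 (f1 ?G) = ecls X (card ?G - 1) M1 (epull (card ?G - 1) M1 (dl ?F ?G) (f1 ?F))"
      unfolding Act_bdry d(2)[symmetric] uf1[OF F] uf1[OF G] Act_ecls[OF d(1) f1[OF F]] .
    then show "\<exists>M. ?Q M P" unfolding ecls_eq_iff[OF f1[OF G] epull_in[OF d(1) f1[OF F]]] by auto
    fix M M' assume Q: "?Q M P" and le: "M \<le> M'"
    show "?Q M' P" using ex_iter_raise[OF conjunct1[OF Q] conjunct1[OF Q] conjunct2[OF Q] le] Q le by simp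
  qed
  then obtain M where M: "M \<ge> M1" "\<forall>P\<in>?I. ?Q M P" by (elim exE conjE)
  define \<phi> where "\<phi> F = ex_iter (card F - 1) M1 (M - M1) (f1 F)" for F
  have MM: "M1 + (M - M1) = M" using M(1) by simp
  show ?thesis
  proof (intro exI[of _ M] exI[of _ \<phi>] conjI ballI impI)
    fix F assume F: "F \<in> pfaces n"
    show "\<phi> F \<in> smaps UNIV (sd (card F - 1) M) X"
      using ex_iter_in[OF f1[OF F], of "M - M1"] unfolding \<phi>_def MM .
    show "u (card F - 1) (sl F) = ecls X (card F - 1) M (\<phi> F)"
      using ecls_up[OF f1[OF F], of "M - M1"] uf1[OF F] unfolding \<phi>_def MM by simp
    fix G assume G: "G \<in> pfaces n" and GF: "G \<subseteq> F"
    note d = dl[OF pfacesD(1)[OF G] GF pfacesD(3)[OF F]]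
    have "(F, G) \<in> ?I" using F G GF by simp
    then have "?Q M (F, G)" using M(2) by blast
    then show "\<phi> G = epull (card G - 1) M (dl F G) (\<phi> F)"
      unfolding \<phi>_def using ex_iter_epull[OF d(1) f1[OF F], of "M - M1"] unfolding MM by simp
  qed
qed

text \<open>The map on the subdivided boundary assembled from its faces: each simplex is evaluated
  on its carrier. The choice is harmless, as the factorization through a face is unique.\<close>

definition glue :: "nat \<Rightarrow> (nat set \<Rightarrow> nat \<Rightarrow> vertex list \<Rightarrow> 'x) \<Rightarrow> nat \<Rightarrow> vertex list \<Rightarrow> 'x" where
  "glue M \<phi> k ys = (let F = ssupp (set ys) in
     \<phi> F k (SOME xs. xs \<in> Sx (sd (card F - 1) M) k \<and> map (sd_map ((!) (sl F))) xs = ys))"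

text \<open>The simplex may have a carrier \<open>G\<close> smaller than \<open>F\<close>;
  compatibility reduces the value on \<open>F\<close> to that on \<open>G\<close>.\<close>

lemma glue_face:
  assumes compat: "\<And>F G. F \<in> pfaces n \<Longrightarrow> G \<in> pfaces n \<Longrightarrow> G \<subseteq> F \<Longrightarrow> \<phi> G = epull (card G - 1) M (dl F G) (\<phi> F)"
    and F: "F \<in> pfaces n" and xs: "xs \<in> Sx (sd (card F - 1) M) k"
  shows "glue M \<phi> k (map (sd_map ((!) (sl F))) xs) = \<phi> F k xs"
proof -
  define ys where "ys = map (sd_map ((!) (sl F))) xs"
  define G where "G = ssupp (set ys)"
  have ys: "ys \<in> Sx (sd n M) k" unfolding ys_def by (rule sd_Delta_Sx[OF pfaces_sl[OF F] xs])
  have xv: "set xs \<subseteq> sd_vert (card F - 1) M" "set xs \<noteq> {}" using xs by (auto simp: Sx_sd)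
  have "G = (!) (sl F) ` ssupp (set xs)" unfolding G_def ys_def by (simp add: ssupp_sd_map)
  moreover have "(!) (sl F) ` {..card F - 1} \<subseteq> F"
  proof -
    have "sl F ! i \<in> set (sl F)" if "i \<le> card F - 1" for i
      using that sl_Suc[OF pfacesD(1,3)[OF F]] by (intro nth_mem) simp
    then show ?thesis using pfacesD(3)[OF F] by auto
  qed
  ultimately have GF: "G \<subseteq> F" and Gne: "G \<noteq> {}" using ssupp_bounds[OF xv(1)] ssupp_ne[OF xv] by auto
  have G: "G \<in> pfaces n" by (rule pfaces_sub[OF F Gne GF])
  let ?P = "\<lambda>xs. xs \<in> Sx (sd (card G - 1) M) k \<and> map (sd_map ((!) (sl G))) xs = ys"
  define zs where "zs = (SOME xs. ?P xs)"
  have "\<exists>xs. ?P xs" using sd_factor[OF ys, of G] pfacesD(1,3)[OF G] G_def by auto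
  then have "?P zs" unfolding zs_def by (rule someI_ex)
  then have zs: "zs \<in> Sx (sd (card G - 1) M) k" "map (sd_map ((!) (sl G))) zs = ys" by auto
  note d = dl[OF Gne GF pfacesD(3)[OF F]]
  have "map (sd_map ((!) (sl F))) (map (sd_map ((!) (dl F G))) zs) = map (sd_map ((!) (sl G))) zs"
    unfolding map_map
  proof (rule map_cong[OF refl])
    fix v assume "v \<in> set zs"
    then have v: "supp v \<subseteq> {..card G - 1}" using supp_bounds[of v "card G - 1" M] zs(1) by (auto simp: Sx_sd)
    have "sd_map (\<lambda>i. sl F ! (dl F G ! i)) v = sd_map ((!) (sl G)) v"
      by (subst d(2)) (use v nth_ocomp[OF d(1)] in \<open>intro sd_map_cong, auto\<close>)
    then show "(sd_map ((!) (sl F)) \<circ> sd_map ((!) (dl F G))) v = sd_map ((!) (sl G)) v"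
      by (simp add: sd_map_comp)
  qed
  then have "map (sd_map ((!) (dl F G))) zs = xs"
    using sd_factor_unique[OF pfacesD(1,3)[OF F] sd_Delta_Sx[OF d(1) zs(1)] xs] zs(2) unfolding ys_def by simp
  then have "\<phi> G k zs = \<phi> F k xs"
    unfolding compat[OF F G GF] epull_app[OF zs(1)] by (rule arg_cong)
  then show ?thesis unfolding glue_def Let_def ys_def[symmetric] G_def[symmetric] zs_def .
qed

context aug
begin

text \<open>A horn is a subcomplex of a finite complex: the missing facet is attached first and then
  the interior, each along its whole boundary.\<close>

lemma fillers_complex:
  assumes rlp: "\<And>n. Lext (bdry n) (simplex n)" and nk: "n \<ge> 1" "k \<le> n"
  shows "Lext (horn n k) (simplex n)"
  unfolding horn_nrv simplex_nrv
proof (rule Lext_complex[OF rlp])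
  show "finite {F. F \<noteq> {} \<and> F \<subseteq> {..n}}" by (rule finite_subset[of _ "Pow {..n}"]) auto
  show "scomplex id {F. F \<noteq> {} \<and> F \<subseteq> {..n}}"
    unfolding scomplex_def by (auto intro: finite_subset[of _ "{..n}"])
  show "scomplex id {F. F \<noteq> {} \<and> F \<subseteq> {..n} \<and> \<not> {..n} - {k} \<subseteq> F}"
    unfolding scomplex_def by (auto intro: finite_subset[of _ "{..n}"])
qed auto

lemma fillers_local_fibration:
  assumes rlp: "\<And>n. Lext (bdry n) (simplex n)"
  shows "local_fibration C j H (yo C U) p"
  unfolding local_fibration_def
proof (intro ballI allI impI)
  fix V n k u v assume V: "V \<in> Obj C" and nk: "1 \<le> n" "k \<le> n" and
    a: "smap UNIV (horn n k) (Val H V) u \<and> smap UNIV (simplex n) (Val (yo C U) V) v \<and>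
       (\<forall>m. \<forall>x\<in>Sx (horn n k) m. p V m (u m x) = v m x)"
  define g where "g = v n [0..<Suc n]"
  have v: "v m x = g" if "x \<in> \<Delta> m n" for m x
  proof -
    have "v m (Act (simplex n) n x [0..<Suc n]) = Act (Val (yo C U) V) n x (v n [0..<Suc n])"
      using a id_Delta[of n] that unfolding smap_def Sx_simplex by blast
    then show ?thesis unfolding Act_simplex ocomp_id(1)[OF that] yo_discrete(1) g_def .
  qed
  have g: "g \<in> hom C V U"
  proof -
    have "v n [0..<Suc n] \<in> Sx (Val (yo C U) V) n" using a id_Delta[of n] unfolding smap_def Sx_simplex by blast
    then show ?thesis unfolding g_def by (simp add: yo_def)
  qed
  have hs: "x \<in> \<Delta> m n" if "x \<in> Sx (horn n k) m" for m x using that by (simp add: horn_def)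
  have "over V (horn n k) g u" unfolding over_def using a v hs by simp
  from LextD[OF fillers_complex[OF rlp nk] g this]
  have "loc V (\<lambda>e. \<exists>h. smap UNIV (simplex n) (Val H (Src C e)) h \<and>
         (\<forall>m. \<forall>x\<in>Sx (horn n k) m. h m x = Rst H e m (u m x)) \<and>
         (\<forall>m. \<forall>x\<in>Sx (simplex n) m. p (Src C e) m (h m x) = Rst (yo C U) e m (v m x)))"
  proof (rule loc_mono[OF V])
    fix e assume "\<exists>h. over (Src C e) (simplex n) (Cmp C g e) h \<and> (\<forall>m. \<forall>x\<in>Sx (horn n k) m. h m x = Rst H e m (u m x))"
    then obtain h where h: "over (Src C e) (simplex n) (Cmp C g e) h \<and> (\<forall>m. \<forall>x\<in>Sx (horn n k) m. h m x = Rst H e m (u m x))" ..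
    have "p (Src C e) m (h m x) = Rst (yo C U) e m (v m x)" if "x \<in> Sx (simplex n) m" for m x
    proof -
      have "v m x = g" using v that unfolding Sx_simplex .
      then show ?thesis using over_p[OF conjunct1[OF h] that] by (simp add: yo_def)
    qed
    then show "\<exists>h. smap UNIV (simplex n) (Val H (Src C e)) h \<and>
         (\<forall>m. \<forall>x\<in>Sx (horn n k) m. h m x = Rst H e m (u m x)) \<and>
         (\<forall>m. \<forall>x\<in>Sx (simplex n) m. p (Src C e) m (h m x) = Rst (yo C U) e m (v m x))"
      using h unfolding over_def by (intro exI[of _ h]) simp
  qed
  then show "\<exists>r\<in>j V. \<forall>f\<in>r. \<exists>h. smap UNIV (simplex n) (Val H (Src C f)) h \<and>
           (\<forall>m. \<forall>x\<in>Sx (horn n k) m. h m x = Rst H f m (u m x)) \<and>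
           (\<forall>m. \<forall>x\<in>Sx (simplex n) m. p (Src C f) m (h m x) = Rst (yo C U) f m (v m x))"
    unfolding loc_def .
qed

lemma glue_over:
  assumes g: "g \<in> hom C V U"
    and \<phi>: "\<And>F. F \<in> pfaces n \<Longrightarrow> \<phi> F \<in> smaps UNIV (sd (card F - 1) M) (Val H V)"
    and compat: "\<And>F G. F \<in> pfaces n \<Longrightarrow> G \<in> pfaces n \<Longrightarrow> G \<subseteq> F \<Longrightarrow> \<phi> G = epull (card G - 1) M (dl F G) (\<phi> F)"
    and p\<phi>: "\<And>F k xs. F \<in> pfaces n \<Longrightarrow> xs \<in> Sx (sd (card F - 1) M) k \<Longrightarrow> p V k (\<phi> F k xs) = g"
  shows "over V (nrv rank {F \<in> sdc n M. ssupp F \<noteq> {..n}}) g (glue M \<phi>)"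
proof (rule overI)
  let ?B = "nrv rank {F \<in> sdc n M. ssupp F \<noteq> {..n}}"
  fix k ys assume ys0: "ys \<in> Sx ?B k"
  then have ys: "ys \<in> Sx (sd n M) k" and s: "ssupp (set ys) \<noteq> {..n}" unfolding sd_nrv by (auto simp: Sx_nrv)
  define F where "F = ssupp (set ys)"
  have yv: "set ys \<subseteq> sd_vert n M" "set ys \<noteq> {}" using ys by (auto simp: Sx_sd)
  have F: "F \<in> pfaces n" unfolding pfaces_def F_def using ssupp_bounds[OF yv(1)] ssupp_ne[OF yv] s by auto
  obtain xs where xs: "xs \<in> Sx (sd (card F - 1) M) k" "map (sd_map ((!) (sl F))) xs = ys"
    using sd_factor[OF ys, of F] pfacesD(1,3)[OF F] unfolding F_def by auto
  have gf: "glue M \<phi> k (map (sd_map ((!) (sl F))) xs) = \<phi> F k xs" if "xs \<in> Sx (sd (card F - 1) M) k" for k xs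
    by (rule glue_face[OF compat F that])
  have e: "glue M \<phi> k ys = \<phi> F k xs" using gf[OF xs(1)] unfolding xs(2) .
  show "glue M \<phi> k ys \<in> Sx (Val H V) k" unfolding e by (rule smapsD(1)[OF \<phi>[OF F] xs(1)])
  show "p V k (glue M \<phi> k ys) = g" unfolding e by (rule p\<phi>[OF F xs(1)])
  fix l \<alpha> assume \<alpha>: "\<alpha> \<in> \<Delta> l k"
  have "Act ?B k \<alpha> ys = map (sd_map ((!) (sl F))) (Act (sd (card F - 1) M) k \<alpha> xs)"
    unfolding map_Act_sd[OF \<alpha> xs(1), of _ n M] xs(2) by (simp add: Act_nrv Act_sd)
  then have "glue M \<phi> l (Act ?B k \<alpha> ys) = \<phi> F l (Act (sd (card F - 1) M) k \<alpha> xs)"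
    using gf[OF sd_Act_Sx[OF \<alpha> xs(1)]] by (simp only:)
  then show "glue M \<phi> l (Act ?B k \<alpha> ys) = Act (Val H V) k \<alpha> (glue M \<phi> k ys)"
    unfolding e smapsD(2)[OF \<phi>[OF F] \<alpha> xs(1)] .
qed

lemma ssupp_list_ocomp:
  assumes "x \<in> \<Delta> m n" "zs \<in> Sx (sd m M) k"
  shows "ssupp (set (map (sd_map ((!) x)) zs)) \<subseteq> set x"
proof -
  have z: "set zs \<subseteq> sd_vert m M" using assms(2) by (auto simp: Sx_sd)
  have "ssupp (set (map (sd_map ((!) x)) zs)) = (!) x ` ssupp (set zs)" by (simp add: ssupp_sd_map)
  also have "\<dots> \<subseteq> (!) x ` {..m}" using ssupp_bounds[OF z] by (rule image_mono)
  also have "\<dots> \<subseteq> set x"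
  proof
    fix i assume "i \<in> (!) x ` {..m}"
    then obtain a where "a \<le> m" "i = x ! a" by auto
    then show "i \<in> set x" using DeltaD(1)[OF assms(1)] by simp
  qed
  finally show ?thesis .
qed

text \<open>By adjunction, a map from the M-fold subdivided simplex is a simplex of Ex-infinity. Its
  face along x is the precomposition with the subdivision of x, and over the boundary it is compared
  with \<open>u\<close> through carriers.\<close>

lemma filler_class:
  assumes e: "e \<in> hom C W V" and g: "g \<in> hom C V U"
    and \<phi>: "\<And>F. F \<in> pfaces n \<Longrightarrow> \<phi> F \<in> smaps UNIV (sd (card F - 1) M) (Val H V)"
    and compat: "\<And>F G. F \<in> pfaces n \<Longrightarrow> G \<in> pfaces n \<Longrightarrow> G \<subseteq> F \<Longrightarrow> \<phi> G = epull (card G - 1) M (dl F G) (\<phi> F)"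
    and u: "smap UNIV (bdry n) (ex_inf (Val H V)) u"
    and u\<phi>: "\<And>F. F \<in> pfaces n \<Longrightarrow> u (card F - 1) (sl F) = ecls (Val H V) (card F - 1) M (\<phi> F)"
    and h: "over W (sd n M) (Cmp C g e) h"
    and hB: "\<And>m x. x \<in> Sx (nrv rank {F \<in> sdc n M. ssupp F \<noteq> {..n}}) m \<Longrightarrow> h m x = Rst H e m (glue M \<phi> m x)"
  shows "\<exists>h. smap UNIV (simplex n) (ex_inf (Val H W)) h \<and>
     (\<forall>m. \<forall>x\<in>Sx (bdry n) m. h m x = ex_inf_map (Val H W) (Rst H e) m (u m x)) \<and>
     (\<forall>m. \<forall>x\<in>Sx (simplex n) m. ex_inf_map (Val (yo C U) W) (p W) m (h m x) = kc W m (Cmp C g e))"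
proof -
  note W = hom_Obj(1)[OF e] and ge = comp_hom[OF e g]
  let ?h = "srestrict UNIV (sd n M) h"
  have hs: "?h \<in> smaps UNIV (sd n M) (Val H W)"
    by (rule smaps_srestrict) (use over_mem[OF h] over_Act[OF h] sd_Act_Sx in simp_all)
  let ?hh = "\<lambda>m x. ecls (Val H W) m M (epull m M x ?h)"
  have "smap UNIV (simplex n) (ex_inf (Val H W)) ?hh"
    unfolding smap_def Sx_simplex Act_simplex
  proof (intro conjI ballI)
    fix m x assume x: "x \<in> \<Delta> m n"
    show "?hh m x \<in> Sx (ex_inf (Val H W)) m" by (rule ecls_in[OF epull_in[OF x hs]])
    fix l \<alpha> assume \<alpha>: "\<alpha> \<in> \<Delta> l m"
    show "?hh l (ocomp x \<alpha>) = Act (ex_inf (Val H W)) m \<alpha> (?hh m x)"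
      unfolding Act_ecls[OF \<alpha> epull_in[OF x hs]] epull_epull[OF x \<alpha> hs] ..
  qed
  moreover have "?hh m x = ex_inf_map (Val H W) (Rst H e) m (u m x)" if x: "x \<in> Sx (bdry n) m" for m x
  proof -
    have x\<Delta>: "x \<in> \<Delta> m n" and sx: "set x \<noteq> {..n}" using x unfolding Sx_bdry by auto
    define F where "F = set x"
    have F: "F \<in> pfaces n" unfolding pfaces_def F_def using DeltaD(3,4)[OF x\<Delta>] sx by auto
    obtain \<epsilon> where \<epsilon>: "\<epsilon> \<in> \<Delta> m (card F - 1)" "x = ocomp (sl F) \<epsilon>"
      using epi_mono[OF x\<Delta>] unfolding F_def by blast
    have "u m (Act (bdry n) (card F - 1) \<epsilon> (sl F)) = Act (ex_inf (Val H V)) (card F - 1) \<epsilon> (u (card F - 1) (sl F))"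
      using u pfaces_bdry[OF F] \<epsilon>(1) unfolding smap_def by blast
    then have ux: "u m x = ecls (Val H V) m M (epull m M \<epsilon> (\<phi> F))"
      unfolding Act_bdry \<epsilon>(2)[symmetric] u\<phi>[OF F] Act_ecls[OF \<epsilon>(1) \<phi>[OF F]] .
    have "epull m M x ?h = epush m M (Rst H e) (epull m M \<epsilon> (\<phi> F))"
    proof (rule smaps_ext[OF epull_in[OF x\<Delta> hs] epush_in[OF Rst_smap[OF e] epull_in[OF \<epsilon>(1) \<phi>[OF F]]]])
      fix k zs assume zs: "zs \<in> Sx (sd m M) k"
      let ?ys = "map (sd_map ((!) x)) zs"
      have ys: "?ys \<in> Sx (sd n M) k" by (rule sd_Delta_Sx[OF x\<Delta> zs])
      have "ssupp (set ?ys) \<noteq> {..n}"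
        using ssupp_list_ocomp[OF x\<Delta> zs] DeltaD(3)[OF x\<Delta>] sx by auto
      then have "?ys \<in> Sx (nrv rank {F \<in> sdc n M. ssupp F \<noteq> {..n}}) k" using ys unfolding sd_nrv Sx_nrv by simp
      note hy = hB[OF this]
      have "map (sd_map ((!) (sl F))) (map (sd_map ((!) \<epsilon>)) zs) = ?ys"
        unfolding map_map
      proof (rule map_cong[OF refl])
        fix v assume "v \<in> set zs"
        then have v: "supp v \<subseteq> {..m}" using supp_bounds[of v m M] zs by (auto simp: Sx_sd)
        have "sd_map (\<lambda>i. sl F ! (\<epsilon> ! i)) v = sd_map ((!) x) v"
          by (subst \<epsilon>(2)) (use v nth_ocomp[OF \<epsilon>(1)] in \<open>intro sd_map_cong, auto\<close>)
        then show "(sd_map ((!) (sl F)) \<circ> sd_map ((!) \<epsilon>)) v = sd_map ((!) x) v"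
          by (simp add: sd_map_comp)
      qed
      moreover have g1: "glue M \<phi> k (map (sd_map ((!) (sl F))) (map (sd_map ((!) \<epsilon>)) zs)) = \<phi> F k (map (sd_map ((!) \<epsilon>)) zs)"
        by (rule glue_face[OF compat F sd_Delta_Sx[OF \<epsilon>(1) zs]])
      ultimately have gl: "glue M \<phi> k ?ys = \<phi> F k (map (sd_map ((!) \<epsilon>)) zs)"
        using g1 by (simp only:)
      show "epull m M x ?h k zs = epush m M (Rst H e) (epull m M \<epsilon> (\<phi> F)) k zs"
        unfolding epull_app[OF zs] epush_app[OF zs] srestrict_in[OF UNIV_I ys] hy gl ..
    qed
    then show ?thesis
      unfolding ux ex_inf_map_ecls[OF Rst_smap[OF e] epull_in[OF \<epsilon>(1) \<phi>[OF F]]] by (rule arg_cong)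
  qed
  moreover have "ex_inf_map (Val (yo C U) W) (p W) m (?hh m x) = kc W m (Cmp C g e)" if x: "x \<in> Sx (simplex n) m" for m x
  proof -
    have x\<Delta>: "x \<in> \<Delta> m n" using x unfolding Sx_simplex .
    show ?thesis unfolding kc_p[OF W ge epull_in[OF x\<Delta> hs]]
    proof (intro allI ballI)
      fix k zs assume zs: "zs \<in> Sx (sd m M) k"
      note ys = sd_Delta_Sx[OF x\<Delta> zs]
      show "p W k (epull m M x ?h k zs) = Cmp C g e"
        unfolding epull_app[OF zs] srestrict_in[OF UNIV_I ys] by (rule over_p[OF h ys])
    qed
  qed
  ultimately show ?thesis by (intro exI[of _ ?hh] conjI allI ballI)
qed

lemma kc_homotopy:
  assumes g: "g \<in> hom C V U" and a: "\<And>m x. x \<in> Sx (simplex n) m \<Longrightarrow> a m x = kc V m g"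
    and b: "\<And>m x. x \<in> Sx (simplex n) m \<Longrightarrow> b m x = kc V m g"
  shows "homotopic_rel_bdry n (ex_inf (Val (yo C U) V)) a b"
  unfolding homotopic_rel_bdry_def
proof (intro exI[of _ "\<lambda>m z. kc V m g"] conjI allI ballI)
  show "smap UNIV (sprod (simplex n) (simplex 1)) (ex_inf (Val (yo C U) V)) (\<lambda>m z. kc V m g)"
    unfolding smap_def using kc_in[OF g] kc_Act[OF g] by simp
  fix m x assume x: "x \<in> Sx (simplex n) m"
  show "kc V m g = a m x" "kc V m g = b m x" using a[OF x] b[OF x] by simp_all
next
  fix m x and t :: "nat list" assume "x \<in> Sx (bdry n) m"
  then have "x \<in> Sx (simplex n) m" by (simp add: Sx_bdry Sx_simplex)
  then show "kc V m g = a m x" using a by simp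
qed

text \<open>A boundary in Ex-infinity is given by a map on a subdivided boundary, which is a
  subcomplex of the finite complex \<open>sdc n M\<close>. It extends locally, and over y(U) the
  required homotopy can be taken constant.\<close>

lemma fillers_weq:
  assumes rlp: "\<And>n. Lext (bdry n) (simplex n)"
  shows "local_weak_equivalence C j H (yo C U) p"
  unfolding local_weak_equivalence_def local_weq_fibrant_def
proof (intro ballI allI impI)
  fix V n u v assume V: "V \<in> Obj C" and
    a: "smap UNIV (bdry n) (Val (ex_inf_psh C H) V) u \<and> smap UNIV (simplex n) (Val (ex_inf_psh C (yo C U)) V) v \<and>
        (\<forall>m. \<forall>x\<in>Sx (bdry n) m. ex_inf_map (Val (yo C U) V) (p V) m (u m x) = v m x)"
  have u: "smap UNIV (bdry n) (ex_inf (Val H V)) u" and v: "smap UNIV (simplex n) (ex_inf (Val (yo C U) V)) v"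
    and puv: "\<And>m x. x \<in> Sx (bdry n) m \<Longrightarrow> ex_inf_map (Val (yo C U) V) (p V) m (u m x) = v m x"
    using a unfolding ex_inf_psh_def by simp_all
  have "v n [0..<Suc n] \<in> Sx (ex_inf (Val (yo C U) V)) n"
    using v id_Delta[of n] unfolding smap_def Sx_simplex by blast
  then have "\<exists>g. (\<forall>k. g \<in> Sx (Val (yo C U) V) k) \<and> v n [0..<Suc n] = kc V n g"
    by (rule ex_inf_discrete[OF yo_discrete(1,2)])
  then obtain g where gg: "(\<forall>k. g \<in> Sx (Val (yo C U) V) k) \<and> v n [0..<Suc n] = kc V n g" ..
  then have g: "g \<in> hom C V U" by (simp add: yo_def)
  have vx: "v m x = kc V m g" if x: "x \<in> Sx (simplex n) m" for m x
  proof -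
    have x\<Delta>: "x \<in> \<Delta> m n" using x unfolding Sx_simplex .
    have "v m (Act (simplex n) n x [0..<Suc n]) = Act (ex_inf (Val (yo C U) V)) n x (v n [0..<Suc n])"
      using v id_Delta[of n] x\<Delta> unfolding smap_def Sx_simplex by blast
    then show ?thesis unfolding Act_simplex ocomp_id(1)[OF x\<Delta>] conjunct2[OF gg] kc_Act[OF g x\<Delta>] .
  qed
  obtain M \<phi> where \<phi>': "(\<forall>F\<in>pfaces n. \<phi> F \<in> smaps UNIV (sd (card F - 1) M) (Val H V) \<and>
      u (card F - 1) (sl F) = ecls (Val H V) (card F - 1) M (\<phi> F)) \<and>
    (\<forall>F\<in>pfaces n. \<forall>G\<in>pfaces n. G \<subseteq> F \<longrightarrow> \<phi> G = epull (card G - 1) M (dl F G) (\<phi> F))"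
    using bdry_stage[OF u] by (elim exE)
  have \<phi>: "\<phi> F \<in> smaps UNIV (sd (card F - 1) M) (Val H V)"
    and u\<phi>: "u (card F - 1) (sl F) = ecls (Val H V) (card F - 1) M (\<phi> F)" if "F \<in> pfaces n" for F
    using conjunct1[OF \<phi>', THEN bspec, OF that] by simp_all
  have compat: "\<phi> G = epull (card G - 1) M (dl F G) (\<phi> F)" if "F \<in> pfaces n" "G \<in> pfaces n" "G \<subseteq> F" for F G
    using conjunct2[OF \<phi>', rule_format, OF that] .
  have p\<phi>: "p V k (\<phi> F k xs) = g" if F: "F \<in> pfaces n" and xs: "xs \<in> Sx (sd (card F - 1) M) k" for F k xs
  proof -
    have "sl F \<in> Sx (simplex n) (card F - 1)" using pfaces_sl[OF F] unfolding Sx_simplex .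
    then have "ex_inf_map (Val (yo C U) V) (p V) (card F - 1) (ecls (Val H V) (card F - 1) M (\<phi> F)) = kc V (card F - 1) g"
      using puv[OF pfaces_bdry[OF F]] vx unfolding u\<phi>[OF F] by simp
    then show ?thesis unfolding kc_p[OF V g \<phi>[OF F]] using xs by blast
  qed
  have gl: "over V (nrv rank {F \<in> sdc n M. ssupp F \<noteq> {..n}}) g (glue M \<phi>)"
    by (rule glue_over[OF g \<phi> compat p\<phi>])
  have sc: "scomplex rank {F \<in> sdc n M. ssupp F \<noteq> {..n}}"
    unfolding scomplex_def
  proof (intro ballI conjI allI impI)
    fix F assume F': "F \<in> {F \<in> sdc n M. ssupp F \<noteq> {..n}}"
    then have F: "F \<in> sdc n M" by simp
    show "finite F" "F \<noteq> {}" "inj_on rank F" using scomplexD[OF scomplex_sdc F] by simp_all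
    fix G assume G: "G \<subseteq> F" "G \<noteq> {}"
    have "F \<subseteq> sd_vert n M" using F unfolding sdc_def by simp
    then have "ssupp G \<noteq> {..n}" using ssupp_mono[OF G(1)] ssupp_bounds[of F n M] F' by auto
    then show "G \<in> {F \<in> sdc n M. ssupp F \<noteq> {..n}}" using scomplex_face[OF scomplex_sdc F G] by simp
  qed
  have "Lext (nrv rank {F \<in> sdc n M. ssupp F \<noteq> {..n}}) (nrv rank (sdc n M))"
    by (rule Lext_complex[OF rlp finite_sdc scomplex_sdc _ sc]) auto
  from LextD[OF this g gl]
  have "loc V (\<lambda>f. \<exists>h. smap UNIV (simplex n) (Val (ex_inf_psh C H) (Src C f)) h \<and>
           (\<forall>m. \<forall>x\<in>Sx (bdry n) m. h m x = Rst (ex_inf_psh C H) f m (u m x)) \<and>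
           homotopic_rel_bdry n (Val (ex_inf_psh C (yo C U)) (Src C f))
             (\<lambda>m x. ex_inf_map (Val (yo C U) (Src C f)) (p (Src C f)) m (h m x))
             (\<lambda>m x. Rst (ex_inf_psh C (yo C U)) f m (v m x)))"
  proof (rule loc_mono[OF V])
    fix e assume e: "e \<in> hom C (Src C e) V" and "\<exists>h. over (Src C e) (nrv rank (sdc n M)) (Cmp C g e) h \<and>
      (\<forall>m. \<forall>x\<in>Sx (nrv rank {F \<in> sdc n M. ssupp F \<noteq> {..n}}) m. h m x = Rst H e m (glue M \<phi> m x))"
    then obtain h where h: "over (Src C e) (nrv rank (sdc n M)) (Cmp C g e) h \<and>
      (\<forall>m. \<forall>x\<in>Sx (nrv rank {F \<in> sdc n M. ssupp F \<noteq> {..n}}) m. h m x = Rst H e m (glue M \<phi> m x))" by (elim exE)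
    note h1 = conjunct1[OF h, folded sd_nrv] and h2 = conjunct2[OF h, rule_format]
    have "\<exists>hh. smap UNIV (simplex n) (ex_inf (Val H (Src C e))) hh \<and>
     (\<forall>m. \<forall>x\<in>Sx (bdry n) m. hh m x = ex_inf_map (Val H (Src C e)) (Rst H e) m (u m x)) \<and>
     (\<forall>m. \<forall>x\<in>Sx (simplex n) m. ex_inf_map (Val (yo C U) (Src C e)) (p (Src C e)) m (hh m x) = kc (Src C e) m (Cmp C g e))"
      by (rule filler_class[OF e g \<phi> compat u u\<phi> h1 h2])
    then obtain hh where hh: "smap UNIV (simplex n) (ex_inf (Val H (Src C e))) hh \<and>
     (\<forall>m. \<forall>x\<in>Sx (bdry n) m. hh m x = ex_inf_map (Val H (Src C e)) (Rst H e) m (u m x)) \<and>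
     (\<forall>m. \<forall>x\<in>Sx (simplex n) m. ex_inf_map (Val (yo C U) (Src C e)) (p (Src C e)) m (hh m x) = kc (Src C e) m (Cmp C g e))"
      by (elim exE)
    note hh1 = conjunct1[OF hh] and hh2 = conjunct1[OF conjunct2[OF hh]] and hh3 = conjunct2[OF conjunct2[OF hh], rule_format]
    have "homotopic_rel_bdry n (ex_inf (Val (yo C U) (Src C e)))
             (\<lambda>m x. ex_inf_map (Val (yo C U) (Src C e)) (p (Src C e)) m (hh m x))
             (\<lambda>m x. ex_inf_map (Val (yo C U) (Src C e)) (Rst (yo C U) e) m (v m x))"
      by (rule kc_homotopy[OF comp_hom[OF e g] hh3]) (simp_all only: vx kc_Rst[OF e g])
    then show "\<exists>h. smap UNIV (simplex n) (Val (ex_inf_psh C H) (Src C e)) h \<and>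
           (\<forall>m. \<forall>x\<in>Sx (bdry n) m. h m x = Rst (ex_inf_psh C H) e m (u m x)) \<and>
           homotopic_rel_bdry n (Val (ex_inf_psh C (yo C U)) (Src C e))
             (\<lambda>m x. ex_inf_map (Val (yo C U) (Src C e)) (p (Src C e)) m (h m x))
             (\<lambda>m x. Rst (ex_inf_psh C (yo C U)) e m (v m x))"
      using hh1 hh2 unfolding ex_inf_psh_def by (intro exI[of _ hh] conjI) simp_all
  qed
  then show "\<exists>r\<in>j V. \<forall>f\<in>r. \<exists>h. smap UNIV (simplex n) (Val (ex_inf_psh C H) (Src C f)) h \<and>
           (\<forall>m. \<forall>x\<in>Sx (bdry n) m. h m x = Rst (ex_inf_psh C H) f m (u m x)) \<and>
           homotopic_rel_bdry n (Val (ex_inf_psh C (yo C U)) (Src C f))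
             (\<lambda>m x. ex_inf_map (Val (yo C U) (Src C f)) (p (Src C f)) m (h m x))
             (\<lambda>m x. Rst (ex_inf_psh C (yo C U)) f m (v m x))"
    unfolding loc_def .
qed

theorem fillers_hypercover:
  assumes "\<And>n. Lext (bdry n) (simplex n)"
  shows "hypercover C j U H p"
  unfolding hypercover_def local_trivial_fibration_def
  using spsh aug fillers_local_fibration[OF assms] fillers_weq[OF assms] by (intro conjI)

end

section \<open>Labelings of simplices\<close>

text \<open>A simplex of the index simplicial set is encoded by the labels of its faces: the label of a
  degenerate face is \<open>None\<close>, that of a nondegenerate face is the morphism to \<open>U\<close> of the
  corresponding summand.  Hence \<open>\<alpha>\<close> acts by restriction along images, where it is injective.\<close>

type_synonym 'm lab = "nat set \<Rightarrow> 'm option"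

definition lact :: "nat list \<Rightarrow> 'm lab \<Rightarrow> 'm lab" where
  "lact \<alpha> s = (\<lambda>F. if F \<noteq> {} \<and> F \<subseteq> {..<length \<alpha>} \<and> inj_on ((!) \<alpha>) F then s ((!) \<alpha> ` F) else None)"

definition labs :: "nat \<Rightarrow> 'm lab set" where
  "labs k = {s. \<forall>F. s F \<noteq> None \<longrightarrow> F \<noteq> {} \<and> F \<subseteq> {..k}}"

text \<open>The boundary of a simplex: only the label of the top face is forgotten. A degenerate
  simplex has no such label and so equals its own boundary.\<close>

abbreviation ltop :: "nat \<Rightarrow> 'm lab \<Rightarrow> 'm lab" where
  "ltop k s \<equiv> s({..k} := None)"

lemma labsD: "s \<in> labs k \<Longrightarrow> s F = Some c \<Longrightarrow> F \<noteq> {} \<and> F \<subseteq> {..k}"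
  unfolding labs_def by auto

lemma lact_eq: "\<alpha> \<in> \<Delta> m k \<Longrightarrow> lact \<alpha> s F = (if F \<noteq> {} \<and> F \<subseteq> {..m} \<and> inj_on ((!) \<alpha>) F then s ((!) \<alpha> ` F) else None)"
  unfolding lact_def by (simp add: \<Delta>_def lessThan_Suc_atMost)

lemma lact_labs: "\<alpha> \<in> \<Delta> m k \<Longrightarrow> lact \<alpha> s \<in> labs m"
  unfolding labs_def by (simp add: lact_eq)

lemma Delta_image_set: "\<alpha> \<in> \<Delta> m k \<Longrightarrow> (!) \<alpha> ` {..m} = set \<alpha>"
  using nth_image[of "Suc m" \<alpha>] by (simp add: \<Delta>_def atLeast0LessThan lessThan_Suc_atMost)

lemma lact_comp:
  assumes "\<alpha> \<in> \<Delta> m k" "\<beta> \<in> \<Delta> l m"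
  shows "lact \<beta> (lact \<alpha> s) = lact (ocomp \<alpha> \<beta>) s"
proof
  fix F
  have nth: "ocomp \<alpha> \<beta> ! i = \<alpha> ! (\<beta> ! i)" if "i \<in> F" "F \<subseteq> {..l}" for i
    using nth_ocomp[OF assms(2), of i \<alpha>] that by auto
  show "lact \<beta> (lact \<alpha> s) F = lact (ocomp \<alpha> \<beta>) s F"
  proof (cases "F \<noteq> {} \<and> F \<subseteq> {..l}")
    case True
    have im: "(!) \<beta> ` F \<subseteq> {..m}" "(!) \<beta> ` F \<noteq> {}" using Delta_nth[OF assms(2)] True by auto
    have e: "(!) (ocomp \<alpha> \<beta>) ` F = (!) \<alpha> ` (!) \<beta> ` F" unfolding image_image using nth True by (intro image_cong) auto
    have i: "inj_on ((!) (ocomp \<alpha> \<beta>)) F \<longleftrightarrow> inj_on ((!) \<beta>) F \<and> inj_on ((!) \<alpha>) ((!) \<beta> ` F)"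
      using nth True comp_inj_on_iff[of "(!) \<beta>" F "(!) \<alpha>"]
      by (auto simp: inj_on_def)
    show ?thesis unfolding lact_eq[OF assms(2)] lact_eq[OF assms(1)] lact_eq[OF ocomp_Delta[OF assms]] e i
      using True im by simp
  qed (auto simp: lact_eq[OF assms(2)] lact_eq[OF ocomp_Delta[OF assms]])
qed

lemma lact_id: assumes "s \<in> labs n" shows "lact [0..<Suc n] s = s"
proof
  fix F
  have "(!) [0..<Suc n] ` F = F" "inj_on ((!) [0..<Suc n]) F" if "F \<subseteq> {..n}"
  proof -
    have id: "[0..<Suc n] ! i = i" if "i \<in> F" for i using that \<open>F \<subseteq> {..n}\<close> nth_upt[of 0 i "Suc n"] by auto
    show "(!) [0..<Suc n] ` F = F" using id by force
    show "inj_on ((!) [0..<Suc n]) F" using id by (simp add: inj_on_def del: upt_Suc)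
  qed
  moreover have "s F = None" if "\<not> (F \<noteq> {} \<and> F \<subseteq> {..n})" using assms that unfolding labs_def by blast
  ultimately show "lact [0..<Suc n] s F = s F" unfolding lact_eq[OF id_Delta] by auto
qed

lemma lact_ltop:
  assumes "\<alpha> \<in> \<Delta> m k" "set \<alpha> \<noteq> {..k}"
  shows "lact \<alpha> (s({..k} := x)) = lact \<alpha> s"
proof
  fix F
  have "(!) \<alpha> ` F \<noteq> {..k}" if "F \<subseteq> {..m}"
    using that Delta_image_set[OF assms(1)] assms(2) DeltaD(3)[OF assms(1)] by blast
  then show "lact \<alpha> (s({..k} := x)) F = lact \<alpha> s F" unfolding lact_eq[OF assms(1)] by simp
qed

lemma lact_sl_top:
  assumes "F \<noteq> {}" "F \<subseteq> {..k}"
  shows "lact (sl F) s {..card F - 1} = s F"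
proof -
  have fin: "finite F" using assms finite_subset by blast
  have D: "sl F \<in> \<Delta> (card F - 1) k" using sl_Delta assms by blast
  have "inj_on ((!) (sl F)) {..card F - 1}"
    using sl_Suc[OF assms(1) fin] by (auto simp: inj_on_def nth_eq_iff_index_eq)
  then show ?thesis unfolding lact_eq[OF D] Delta_image_set[OF D] using fin by simp
qed

section \<open>Degeneracies, nondegenerate roots and fibers over boundaries\<close>

definition surjm :: "nat \<Rightarrow> nat \<Rightarrow> nat list set" where
  "surjm m k = {\<sigma> \<in> \<Delta> m k. set \<sigma> = {..k}}"

lemma surjmD: "\<sigma> \<in> surjm m k \<Longrightarrow> \<sigma> \<in> \<Delta> m k" "\<sigma> \<in> surjm m k \<Longrightarrow> set \<sigma> = {..k}"
  unfolding surjm_def by auto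

lemma surjm_le: "\<sigma> \<in> surjm m k \<Longrightarrow> k \<le> m"
  using card_length[of \<sigma>] surjmD[of \<sigma> m k] DeltaD(1)[of \<sigma> m k] by simp

lemma surjm_id: "[0..<Suc n] \<in> surjm n n"
  unfolding surjm_def using id_Delta by (auto simp del: upt_Suc)

lemma surjm_comp: assumes "\<sigma> \<in> surjm m k" "\<tau> \<in> surjm l m" shows "ocomp \<sigma> \<tau> \<in> surjm l k"
proof -
  have "set (ocomp \<sigma> \<tau>) = (!) \<sigma> ` {..m}" unfolding ocomp_def using surjmD(2)[OF assms(2)] by simp
  also have "\<dots> = {..k}" using Delta_image_set[OF surjmD(1)[OF assms(1)]] surjmD(2)[OF assms(1)] by simp
  finally show ?thesis unfolding surjm_def using ocomp_Delta surjmD(1) assms by blast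
qed

text \<open>The section can be chosen through any prescribed i. Existence alone recovers a simplex
  from its degeneracy; the freedom in i recovers the degeneracy operator.\<close>

lemma surjm_section:
  assumes \<sigma>: "\<sigma> \<in> surjm m k" and i: "i \<le> m"
  shows "\<exists>\<gamma>\<in>\<Delta> k m. ocomp \<sigma> \<gamma> = [0..<Suc k] \<and> \<gamma> ! (\<sigma> ! i) = i"
proof -
  note D = surjmD(1)[OF \<sigma>]
  have ex: "\<exists>a. a \<le> m \<and> \<sigma> ! a = l" if "l \<le> k" for l
    using that Delta_image_set[OF D] surjmD(2)[OF \<sigma>] by (metis atMost_iff imageE)
  \<comment> \<open>Any choice of preimages is monotone, because \<sigma> is.\<close>
  define c where "c l = (if l = \<sigma> ! i then i else (SOME a. a \<le> m \<and> \<sigma> ! a = l))" for l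
  have c: "c l \<le> m" "\<sigma> ! c l = l" if "l \<le> k" for l
    using someI_ex[OF ex[OF that]] i unfolding c_def by auto
  define \<gamma> where "\<gamma> = map c [0..<Suc k]"
  have len: "length \<gamma> = Suc k" unfolding \<gamma>_def by simp
  have nth: "\<gamma> ! l = c l" if "l \<le> k" for l
    unfolding \<gamma>_def using that nth_map[of l "[0..<Suc k]" c] nth_upt[of 0 l "Suc k"] by (simp del: upt_Suc)
  have "sorted \<gamma>" unfolding sorted_iff_nth_mono
  proof (intro allI impI)
    fix a b assume ab: "a \<le> b" "b < length \<gamma>"
    show "\<gamma> ! a \<le> \<gamma> ! b"
    proof (rule ccontr)
      assume n: "\<not> \<gamma> ! a \<le> \<gamma> ! b"
      have k: "a \<le> k" "b \<le> k" using ab len by auto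
      then have lt: "c b \<le> c a" using n nth by simp
      have "\<sigma> ! c b \<le> \<sigma> ! c a" by (rule Delta_mono[OF D lt c(1)[OF k(1)]])
      then have "b \<le> a" using c(2)[OF k(1)] c(2)[OF k(2)] by simp
      then show False using n ab(1) by simp
    qed
  qed
  moreover have "set \<gamma> \<subseteq> {..m}" unfolding \<gamma>_def using c(1) by (auto simp del: upt_Suc)
  ultimately have \<gamma>: "\<gamma> \<in> \<Delta> k m" unfolding \<Delta>_def using len by simp
  have "ocomp \<sigma> \<gamma> = [0..<Suc k]" unfolding ocomp_def \<gamma>_def map_map
    by (rule map_idI) (use c(2) in \<open>auto simp del: upt_Suc\<close>)
  moreover have "\<gamma> ! (\<sigma> ! i) = i" using nth[OF Delta_nth[OF D i]] unfolding c_def by simp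
  ultimately show ?thesis using \<gamma> by (intro bexI[of _ \<gamma>]) simp_all
qed

lemma Delta_inj_id:
  assumes "\<tau> \<in> \<Delta> d d" "inj_on ((!) \<tau>) {..d}"
  shows "\<tau> = [0..<Suc d]"
proof -
  have "distinct \<tau>" unfolding distinct_conv_nth
    using assms DeltaD(1)[OF assms(1)] by (auto simp: inj_on_def)
  then have s: "sorted_wrt (<) \<tau>" using DeltaD(2)[OF assms(1)] by (simp add: strict_sorted_iff)
  have "card (set \<tau>) = Suc d" using \<open>distinct \<tau>\<close> DeltaD(1)[OF assms(1)] by (simp add: distinct_card)
  then have "set \<tau> = {..d}" using DeltaD(3)[OF assms(1)] by (intro card_subset_eq) auto
  then show ?thesis using strict_eq_sl[OF s] sl_atMost by simp
qed

text \<open>\<open>N k\<close> is meant to be the set of nondegenerate \<open>k\<close>-simplices.\<close>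

definition Sm :: "(nat \<Rightarrow> 'm lab set) \<Rightarrow> nat \<Rightarrow> 'm lab set" where
  "Sm N m = {s. \<exists>k. \<exists>\<sigma>\<in>surjm m k. \<exists>t\<in>N k. s = lact \<sigma> t}"

text \<open>A map from the boundary to the labeled simplices is encoded as a labeling without top
  label, all of whose proper faces are simplices. Only \<open>N\<close> below degree k enters, so
  cells of degree k can be chosen from \<open>Bd N k\<close>.\<close>

definition Bd :: "(nat \<Rightarrow> 'm lab set) \<Rightarrow> nat \<Rightarrow> 'm lab set" where
  "Bd N k = {a \<in> labs k. a {..k} = None \<and> (\<forall>F\<in>pfaces k. lact (sl F) a \<in> Sm N (card F - 1))}"

text \<open>The last condition excludes a degenerate simplex with the same boundary as t: lacking a
  top label, such a simplex would be \<open>ltop k t\<close> itself.\<close>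

definition good_at :: "(nat \<Rightarrow> 'm lab set) \<Rightarrow> nat \<Rightarrow> bool" where
  "good_at N k \<longleftrightarrow> (\<forall>t\<in>N k. t \<in> labs k \<and> t {..k} \<noteq> None \<and> ltop k t \<in> Bd N k \<and> ltop k t \<notin> Sm N k)"

lemma Sm_cong: assumes "\<And>k. k \<le> m \<Longrightarrow> N k = N' k" shows "Sm N m = Sm N' m"
proof -
  have "(\<exists>\<sigma>\<in>surjm m k. \<exists>t\<in>N k. s = lact \<sigma> t) \<longleftrightarrow> (\<exists>\<sigma>\<in>surjm m k. \<exists>t\<in>N' k. s = lact \<sigma> t)" for s k
    using surjm_le[of _ m k] assms[of k] by (cases "k \<le> m") auto
  then show ?thesis unfolding Sm_def by simp
qed

lemma pfaces_card: assumes "F \<in> pfaces k" shows "card F - 1 < k"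
proof -
  have "card F < card {..k}" using pfacesD(2)[OF assms] by (intro psubset_card_mono) auto
  moreover have "card F > 0" using pfacesD(1,3)[OF assms] by (simp add: card_gt_0_iff)
  ultimately show ?thesis by simp
qed

lemma Bd_cong: assumes "\<And>i. i < k \<Longrightarrow> N i = N' i" shows "Bd N k = Bd N' k"
proof -
  have "Sm N (card F - 1) = Sm N' (card F - 1)" if "F \<in> pfaces k" for F
    using pfaces_card[OF that] assms by (intro Sm_cong) simp
  then show ?thesis unfolding Bd_def by (intro Collect_cong) (simp cong: ball_cong)
qed

lemma good_at_cong:
  assumes "\<And>i. i \<le> k \<Longrightarrow> N i = N' i"
  shows "good_at N k \<longleftrightarrow> good_at N' k"
  unfolding good_at_def using Sm_cong[of k N N'] Bd_cong[of k N N'] assms by simp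

lemma SmI: "t \<in> N k \<Longrightarrow> \<sigma> \<in> surjm m k \<Longrightarrow> lact \<sigma> t \<in> Sm N m"
  unfolding Sm_def by blast

lemma SmE:
  assumes "s \<in> Sm N m" 
  obtains k \<sigma> t where "\<sigma> \<in> surjm m k" "t \<in> N k" "s = lact \<sigma> t"
  using assms unfolding Sm_def by blast

lemma Sm_deg: assumes "s \<in> Sm N l" "\<epsilon> \<in> surjm m l" shows "lact \<epsilon> s \<in> Sm N m"
proof -
  obtain k \<sigma> t where s: "\<sigma> \<in> surjm l k" "t \<in> N k" "s = lact \<sigma> t" using assms(1) by (rule SmE)
  show ?thesis unfolding s(3) lact_comp[OF surjmD(1)[OF s(1)] surjmD(1)[OF assms(2)]]
    by (rule SmI[where N = N and k = k, OF s(2) surjm_comp[OF s(1) assms(2)]])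
qed

lemma Sm_labs: "s \<in> Sm N m \<Longrightarrow> s \<in> labs m"
  by (elim SmE) (simp add: lact_labs[OF surjmD(1)])

lemma Bd_act:
  assumes a: "a \<in> Bd N k" and \<alpha>: "\<alpha> \<in> Sx (bdry k) m"
  shows "lact \<alpha> a \<in> Sm N m"
proof -
  have D: "\<alpha> \<in> \<Delta> m k" "set \<alpha> \<noteq> {..k}" using \<alpha> unfolding Sx_bdry by auto
  obtain \<epsilon> where \<epsilon>: "\<epsilon> \<in> \<Delta> m (card (set \<alpha>) - 1)" "set \<epsilon> = {..card (set \<alpha>) - 1}" "\<alpha> = ocomp (sl (set \<alpha>)) \<epsilon>"
    "sl (set \<alpha>) \<in> \<Delta> (card (set \<alpha>) - 1) k" using epi_mono[OF D(1)] .
  have "set \<alpha> \<in> pfaces k" unfolding pfaces_def using D(2) DeltaD(3,4)[OF D(1)] by (simp add: psubset_eq)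
  then have "lact (sl (set \<alpha>)) a \<in> Sm N (card (set \<alpha>) - 1)" using a unfolding Bd_def by blast
  moreover have "\<epsilon> \<in> surjm m (card (set \<alpha>) - 1)" using \<epsilon>(1,2) unfolding surjm_def by simp
  ultimately have "lact \<epsilon> (lact (sl (set \<alpha>)) a) \<in> Sm N m" by (rule Sm_deg)
  then show ?thesis unfolding lact_comp[OF \<epsilon>(4,1)] \<epsilon>(3)[symmetric] .
qed

locale labeling =
  fixes N :: "nat \<Rightarrow> 'm lab set"
  assumes good: "good_at N k"
begin

lemma N_labs: "t \<in> N k \<Longrightarrow> t \<in> labs k"
  and N_top: "t \<in> N k \<Longrightarrow> t {..k} \<noteq> None"
  and N_Bd: "t \<in> N k \<Longrightarrow> ltop k t \<in> Bd N k"
  and N_new: "t \<in> N k \<Longrightarrow> ltop k t \<notin> Sm N k"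
  using good[of k] unfolding good_at_def by blast+

lemma N_Sm: "t \<in> N k \<Longrightarrow> t \<in> Sm N k"
  using SmI[of t N k, OF _ surjm_id] lact_id[OF N_labs] by metis

text \<open>A surjective operator gives a degeneracy; any other operator misses the top label and
  acts on the boundary.\<close>

lemma N_act: assumes t: "t \<in> N d" and \<tau>: "\<tau> \<in> \<Delta> m d" shows "lact \<tau> t \<in> Sm N m"
proof (cases "set \<tau> = {..d}")
  case True
  then show ?thesis using SmI[where N = N and k = d, OF t] \<tau> unfolding surjm_def by blast
next
  case False
  have "lact \<tau> t = lact \<tau> (ltop d t)" using lact_ltop[OF \<tau> False] by (rule sym)
  then show ?thesis using Bd_act[OF N_Bd[OF t], of \<tau> m] \<tau> False unfolding Sx_bdry by simp
qed

lemma Sm_act: assumes "s \<in> Sm N k" "\<alpha> \<in> \<Delta> m k" shows "lact \<alpha> s \<in> Sm N m"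
proof -
  obtain d \<sigma> t where s: "\<sigma> \<in> surjm k d" "t \<in> N d" "s = lact \<sigma> t" using assms(1) by (rule SmE)
  show ?thesis unfolding s(3) lact_comp[OF surjmD(1)[OF s(1)] assms(2)]
    by (rule N_act[OF s(2) ocomp_Delta[OF surjmD(1)[OF s(1)] assms(2)]])
qed

text \<open>A section of \<sigma> exhibits t as a face of the other root t'. As t has a top label,
  the operator \<sigma>'\<gamma> is injective.\<close>

lemma root_inj:
  assumes t: "t \<in> N d" "t' \<in> N d'" and \<sigma>: "\<sigma> \<in> surjm m d" "\<sigma>' \<in> surjm m d'" and eq: "lact \<sigma> t = lact \<sigma>' t'"
    and \<gamma>: "\<gamma> \<in> \<Delta> d m" "ocomp \<sigma> \<gamma> = [0..<Suc d]"
  shows "t = lact (ocomp \<sigma>' \<gamma>) t'" "inj_on ((!) (ocomp \<sigma>' \<gamma>)) {..d}" "d \<le> d'"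
proof -
  have D: "ocomp \<sigma>' \<gamma> \<in> \<Delta> d d'" by (rule ocomp_Delta[OF surjmD(1)[OF \<sigma>(2)] \<gamma>(1)])
  have "t = lact \<gamma> (lact \<sigma> t)" unfolding lact_comp[OF surjmD(1)[OF \<sigma>(1)] \<gamma>(1)] \<gamma>(2) lact_id[OF N_labs[OF t(1)]] ..
  also have "\<dots> = lact (ocomp \<sigma>' \<gamma>) t'" unfolding eq by (rule lact_comp[OF surjmD(1)[OF \<sigma>(2)] \<gamma>(1)])
  finally show e: "t = lact (ocomp \<sigma>' \<gamma>) t'" .
  have "lact (ocomp \<sigma>' \<gamma>) t' {..d} \<noteq> None" using N_top[OF t(1)] e by simp
  then show i: "inj_on ((!) (ocomp \<sigma>' \<gamma>)) {..d}" unfolding lact_eq[OF D] by (meson)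
  have "card ((!) (ocomp \<sigma>' \<gamma>) ` {..d}) \<le> card {..d'}" using Delta_image[OF D] by (intro card_mono) auto
  then show "d \<le> d'" using card_image[OF i] by simp
qed

text \<open>The Eilenberg-Zilber lemma for labelings. By \<open>root_inj\<close> in both directions
  the degrees agree, so \<sigma>'\<gamma> is the identity for every section \<gamma> of \<sigma>;
  sections through all i then give \<sigma> = \<sigma>'.\<close>

lemma root_unique:
  assumes t: "t \<in> N d" "t' \<in> N d'" and \<sigma>: "\<sigma> \<in> surjm m d" "\<sigma>' \<in> surjm m d'" and eq: "lact \<sigma> t = lact \<sigma>' t'"
  shows "d = d'" "\<sigma> = \<sigma>'" "t = t'"
proof -
  have sec: "\<exists>\<gamma>\<in>\<Delta> d m. ocomp \<sigma> \<gamma> = [0..<Suc d] \<and> \<gamma> ! (\<sigma> ! i) = i" if "i \<le> m" for i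
    by (rule surjm_section[OF \<sigma>(1) that])
  obtain \<gamma> where \<gamma>: "\<gamma> \<in> \<Delta> d m" "ocomp \<sigma> \<gamma> = [0..<Suc d]" using sec[of 0] by auto
  obtain \<gamma>' where \<gamma>': "\<gamma>' \<in> \<Delta> d' m" "ocomp \<sigma>' \<gamma>' = [0..<Suc d']" using surjm_section[OF \<sigma>(2), of 0] by auto
  show d: "d = d'" using root_inj(3)[OF t \<sigma> eq \<gamma>] root_inj(3)[OF t(2,1) \<sigma>(2,1) eq[symmetric] \<gamma>'] by simp
  have id: "ocomp \<sigma>' \<gamma> = [0..<Suc d]" if \<gamma>: "\<gamma> \<in> \<Delta> d m" "ocomp \<sigma> \<gamma> = [0..<Suc d]" for \<gamma>
    using Delta_inj_id[of "ocomp \<sigma>' \<gamma>" d] root_inj(2)[OF t \<sigma> eq \<gamma>] ocomp_Delta[OF surjmD(1)[OF \<sigma>(2)] \<gamma>(1)] d by simp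
  show "t = t'" using root_inj(1)[OF t \<sigma> eq \<gamma>] unfolding id[OF \<gamma>] using lact_id[OF N_labs[OF t(2)]] d by simp
  show "\<sigma> = \<sigma>'"
  proof (rule nth_equalityI)
    show "length \<sigma> = length \<sigma>'" using DeltaD(1)[OF surjmD(1)[OF \<sigma>(1)]] DeltaD(1)[OF surjmD(1)[OF \<sigma>(2)]] by simp
    fix i assume "i < length \<sigma>"
    then have i: "i \<le> m" using DeltaD(1)[OF surjmD(1)[OF \<sigma>(1)]] by simp
    obtain \<gamma> where \<gamma>: "\<gamma> \<in> \<Delta> d m" "ocomp \<sigma> \<gamma> = [0..<Suc d]" "\<gamma> ! (\<sigma> ! i) = i" using sec[OF i] by auto
    have l: "\<sigma> ! i \<le> d" by (rule Delta_nth[OF surjmD(1)[OF \<sigma>(1)] i])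
    have "\<sigma>' ! i = ocomp \<sigma>' \<gamma> ! (\<sigma> ! i)" using nth_ocomp[OF \<gamma>(1) l] \<gamma>(3) by simp
    also have "\<dots> = \<sigma> ! i" unfolding id[OF \<gamma>(1,2)] using l nth_upt[of 0 "\<sigma> ! i" "Suc d"] by simp
    finally show "\<sigma> ! i = \<sigma>' ! i" by simp
  qed
qed

text \<open>A degeneracy that is not injective erases the top label, so having one characterizes the
  nondegenerate simplices.\<close>

lemma Sm_top: assumes "s \<in> Sm N k" "s {..k} \<noteq> None" shows "s \<in> N k"
proof -
  obtain d \<sigma> t where s: "\<sigma> \<in> surjm k d" "t \<in> N d" "s = lact \<sigma> t" using assms(1) by (rule SmE)
  note D = surjmD(1)[OF s(1)]
  have i: "inj_on ((!) \<sigma>) {..k}" using assms(2) unfolding s(3) lact_eq[OF D] by meson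
  have "card ((!) \<sigma> ` {..k}) \<le> card {..d}" using Delta_image[OF D] by (intro card_mono) auto
  then have "k \<le> d" using card_image[OF i] by simp
  then have d: "d = k" using surjm_le[OF s(1)] by simp
  have "\<sigma> = [0..<Suc k]" using Delta_inj_id[of \<sigma> k] D i unfolding d by simp
  then show ?thesis using s(2,3) lact_id[OF N_labs[OF s(2)]] unfolding d by simp
qed

lemma Sm_Bd: assumes s: "s \<in> Sm N k" shows "ltop k s \<in> Bd N k"
  unfolding Bd_def
proof (intro CollectI conjI ballI)
  show "ltop k s \<in> labs k" using Sm_labs[OF s] unfolding labs_def by simp
  show "ltop k s {..k} = None" by simp
  fix F assume F: "F \<in> pfaces k"
  have "set (sl F) \<noteq> {..k}" using pfacesD[OF F] by auto
  then have "lact (sl F) (ltop k s) = lact (sl F) s" by (rule lact_ltop[OF pfaces_sl[OF F]])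
  then show "lact (sl F) (ltop k s) \<in> Sm N (card F - 1)" using Sm_act[OF s pfaces_sl[OF F]] by simp
qed

text \<open>A simplex over a without top label is a itself; one with a top label would be a cell
  whose boundary has a degenerate filler, which \<open>N_new\<close> excludes.\<close>

lemma fiber_degenerate:
  assumes "a \<in> Sm N k" "a {..k} = None"
  shows "{s \<in> Sm N k. ltop k s = a} = {a}"
proof -
  have "s = a" if "s \<in> Sm N k" "ltop k s = a" for s
  proof (cases "s {..k} = None")
    case True
    then show ?thesis using that(2) by (metis fun_upd_triv)
  next
    case False
    then show ?thesis using N_new[OF Sm_top[OF that(1) False]] that(2) assms(1) by simp
  qed
  moreover have "ltop k a = a" using assms(2) by (metis fun_upd_triv)
  ultimately show ?thesis using assms(1) by auto
qed

lemma fiber_new: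
  assumes "a \<notin> Sm N k"
  shows "{s \<in> Sm N k. ltop k s = a} = {t \<in> N k. ltop k t = a}"
proof -
  have "s \<in> N k" if "s \<in> Sm N k" "ltop k s = a" for s
  proof (rule Sm_top[OF that(1)])
    show "s {..k} \<noteq> None"
    proof
      assume "s {..k} = None"
      then have "ltop k s = s" by (metis fun_upd_triv)
      then show False using that assms by simp
    qed
  qed
  then show ?thesis using N_Sm by blast
qed

end

section \<open>Families of subobjects\<close>

context site_ctx
begin

lemma monoD:
  assumes "is_mono C c" "x \<in> hom C A (Src C c)" "y \<in> hom C A (Src C c)" "Cmp C c x = Cmp C c y"
  shows "x = y"
  using assms hom_Obj(1)[OF assms(2)] unfolding is_mono_def by blast

text \<open>The sieve generated by c. For a monomorphism c it is the presheaf represented by the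
  source of c, as a subpresheaf of the presheaf represented by the target; sections of a summand can
  so be named by morphisms to U.\<close>

definition fac :: "'m \<Rightarrow> 'm set" where
  "fac c = {g \<in> Arr C. \<exists>k\<in>hom C (Src C g) (Src C c). Cmp C c k = g}"

lemma facE:
  assumes "g \<in> fac c" "c \<in> hom C A B"
  obtains k where "k \<in> hom C (Src C g) A" "Cmp C c k = g" "g \<in> hom C (Src C g) B"
proof -
  obtain k where k: "g \<in> Arr C" "k \<in> hom C (Src C g) (Src C c)" "Cmp C c k = g" using assms(1) unfolding fac_def by blast
  have k': "k \<in> hom C (Src C g) A" using k(2) hom_Src[OF assms(2)] by simp
  show ?thesis using that[OF k' k(3)] comp_hom[OF k' assms(2)] k(3) by simp
qed

lemma facI: assumes "k \<in> hom C V A" "c \<in> hom C A B" shows "Cmp C c k \<in> fac c"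
proof -
  have h: "Cmp C c k \<in> hom C V B" by (rule comp_hom[OF assms])
  show ?thesis unfolding fac_def using hom_Arr[OF h] hom_Src[OF h] hom_Src[OF assms(2)] assms(1) by auto
qed

lemma fac_self: "c \<in> hom C A B \<Longrightarrow> c \<in> fac c"
  using facI[OF id_hom, of A c B] id_right[of c A B] hom_Obj(1)[of c A B] by simp

lemma fac_comp:
  assumes "g \<in> fac c" "c \<in> hom C A B" "e \<in> hom C W (Src C g)"
  shows "Cmp C g e \<in> fac c"
proof -
  obtain k where k: "k \<in> hom C (Src C g) A" "Cmp C c k = g" using facE[OF assms(1,2)] .
  show ?thesis using facI[OF comp_hom[OF assms(3) k(1)] assms(2)] comp_assoc[OF assms(3) k(1) assms(2)] k(2) by simp
qed

lemma fac_trans: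
  assumes "c \<in> fac l" "l \<in> hom C A B" "g \<in> fac c"
  shows "g \<in> fac l"
proof -
  have c: "c \<in> hom C (Src C c) B" using facE[OF assms(1,2)] by metis
  obtain k where k: "k \<in> hom C (Src C g) (Src C c)" "Cmp C c k = g" using facE[OF assms(3) c] .
  show ?thesis using fac_comp[OF assms(1,2) k(1)] k(2) by simp
qed

lemma comp_mono:
  assumes l: "l \<in> hom C A B" "is_mono C l" and f: "f \<in> hom C D A" "is_mono C f"
  shows "is_mono C (Cmp C l f)"
  unfolding is_mono_def
proof (intro conjI ballI impI)
  have lf: "Cmp C l f \<in> hom C D B" by (rule comp_hom[OF f(1) l(1)])
  then show "Cmp C l f \<in> Arr C" by (rule hom_Arr)
  fix W x y assume W: "W \<in> Obj C" and x: "x \<in> hom C W (Src C (Cmp C l f))" and y: "y \<in> hom C W (Src C (Cmp C l f))"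
    and eq: "Cmp C (Cmp C l f) x = Cmp C (Cmp C l f) y"
  have x': "x \<in> hom C W D" and y': "y \<in> hom C W D" using x y hom_Src[OF lf] by simp_all
  have "Cmp C l (Cmp C f x) = Cmp C l (Cmp C f y)"
    using eq comp_assoc[OF x' f(1) l(1)] comp_assoc[OF y' f(1) l(1)] by simp
  then have "Cmp C f x = Cmp C f y"
    using monoD[OF l(2)] comp_hom[OF x' f(1)] comp_hom[OF y' f(1)] hom_Src[OF l(1)] by simp
  then show "x = y" using monoD[OF f(2)] x' y' hom_Src[OF f(1)] by simp
qed

end

locale sub = site_ctx C j for C :: "('o, 'm) cat" and j +
  fixes U :: 'o
  assumes U: "U \<in> Obj C" and basal_mono: "basal C j f \<Longrightarrow> is_mono C f"
begin

definition subob :: "'m \<Rightarrow> bool" where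
  "subob c \<longleftrightarrow> c \<in> hom C (Src C c) U \<and> is_mono C c"

lemma subobD: "subob c \<Longrightarrow> c \<in> hom C (Src C c) U" "subob c \<Longrightarrow> is_mono C c"
  unfolding subob_def by auto

text \<open>The sources of x and y need not be known to agree: equality of the composites implies
  it.\<close>

lemma subob_inj:
  assumes "subob c" "x \<in> hom C A (Src C c)" "y \<in> hom C A' (Src C c)" "Cmp C c x = Cmp C c y"
  shows "x = y"
proof -
  have "A = A'" using hom_Src[OF comp_hom[OF assms(2) subobD(1)[OF assms(1)]]]
      hom_Src[OF comp_hom[OF assms(3) subobD(1)[OF assms(1)]]] assms(4) by simp
  then show ?thesis using monoD[OF subobD(2)[OF assms(1)] assms(2)] assms(3,4) by simp
qed

lemma id_subob: "subob (Idt C U)"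
proof -
  have i: "Idt C U \<in> hom C U U" by (rule id_hom[OF U])
  have "is_mono C (Idt C U)" unfolding is_mono_def
    using hom_Arr[OF i] hom_Src[OF i] id_left by simp
  then show ?thesis unfolding subob_def using i hom_Src[OF i] by simp
qed

lemma cov_mono: assumes "V \<in> Obj C" "r \<in> j V" "f \<in> r" shows "is_mono C f"
  using basal_mono[of f] assms unfolding basal_def by blast

lemma cov_basal: assumes "V \<in> Obj C" "r \<in> j V" "f \<in> r" shows "basal C j f"
  using assms unfolding basal_def by blast

lemma subob_comp:
  assumes "subob l" "r \<in> j (Src C l)" "f \<in> r"
  shows "subob (Cmp C l f)" "f \<in> hom C (Src C f) (Src C l)" "Src C (Cmp C l f) = Src C f"
proof -
  note l = subobD[OF assms(1)]
  show f: "f \<in> hom C (Src C f) (Src C l)" using cov_hom[OF hom_Obj(1)[OF l(1)] assms(2,3)] .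
  have m: "is_mono C f" using cov_mono[OF hom_Obj(1)[OF l(1)] assms(2,3)] .
  show s: "Src C (Cmp C l f) = Src C f" using hom_Src[OF comp_hom[OF f l(1)]] .
  show "subob (Cmp C l f)" unfolding subob_def s
    using comp_hom[OF f l(1)] comp_mono[OF l f m] by simp
qed

text \<open>The presheaf \<open>P\<close> is the coproduct of the subobjects \<open>d i\<close> of \<open>U\<close>, and \<open>e i g\<close> is the section
  in the summand \<open>i\<close> that lies over \<open>g\<close>.\<close>

definition subfam :: "('o, 'm, 'x) psh \<Rightarrow> 'k set \<Rightarrow> ('k \<Rightarrow> 'm) \<Rightarrow> ('k \<Rightarrow> 'm \<Rightarrow> 'x) \<Rightarrow> bool" where
  "subfam P K d e \<longleftrightarrow> (\<forall>i\<in>K. subob (d i)) \<and>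
     (\<forall>V. \<forall>x. x \<in> Sec P V \<longleftrightarrow> (\<exists>i\<in>K. \<exists>g\<in>fac (d i). Src C g = V \<and> x = e i g)) \<and>
     (\<forall>i\<in>K. \<forall>i'\<in>K. \<forall>g\<in>fac (d i). \<forall>g'\<in>fac (d i'). e i g = e i' g' \<longrightarrow> i = i' \<and> g = g') \<and>
     (\<forall>i\<in>K. \<forall>g\<in>fac (d i). \<forall>f. f \<in> hom C (Src C f) (Src C g) \<longrightarrow> Res P f (e i g) = e i (Cmp C g f))"

lemma subfamD:
  assumes "subfam P K d e"
  shows "i \<in> K \<Longrightarrow> subob (d i)" "x \<in> Sec P V \<longleftrightarrow> (\<exists>i\<in>K. \<exists>g\<in>fac (d i). Src C g = V \<and> x = e i g)"
    "i \<in> K \<Longrightarrow> i' \<in> K \<Longrightarrow> g \<in> fac (d i) \<Longrightarrow> g' \<in> fac (d i') \<Longrightarrow> e i g = e i' g' \<Longrightarrow> i = i' \<and> g = g'"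
    "i \<in> K \<Longrightarrow> g \<in> fac (d i) \<Longrightarrow> f \<in> hom C W (Src C g) \<Longrightarrow> Res P f (e i g) = e i (Cmp C g f)"
  using assms hom_Src[of f W "Src C g"] unfolding subfam_def by simp_all

text \<open>The index type of \<open>presentation\<close> is prescribed. The index i is replaced by
  the object of its summand paired with the universal section, which lies over \<open>d i\<close>
  itself.\<close>

definition pix :: "('k \<Rightarrow> 'm) \<Rightarrow> ('k \<Rightarrow> 'm \<Rightarrow> 'x) \<Rightarrow> 'k \<Rightarrow> 'o \<times> 'x" where
  "pix d e i = (Src C (d i), e i (d i))"

definition pphi :: "'k set \<Rightarrow> ('k \<Rightarrow> 'm) \<Rightarrow> ('k \<Rightarrow> 'm \<Rightarrow> 'x) \<Rightarrow> 'o \<Rightarrow> ('o \<times> 'x) \<times> 'm \<Rightarrow> 'x" where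
  "pphi K d e V z = (let i = inv_into K (pix d e) (fst z) in e i (Cmp C (d i) (snd z)))"

lemma pix_inj: assumes "subfam P K d e" shows "inj_on (pix d e) K"
proof (rule inj_onI)
  fix i i' assume i: "i \<in> K" "i' \<in> K" and eq: "pix d e i = pix d e i'"
  have "d i \<in> fac (d i)" "d i' \<in> fac (d i')" using fac_self subobD(1) subfamD(1)[OF assms] i by blast+
  then show "i = i'" using subfamD(3)[OF assms i] eq unfolding pix_def by simp
qed

lemma pphi_pix: "subfam P K d e \<Longrightarrow> i \<in> K \<Longrightarrow> pphi K d e V (pix d e i, f) = e i (Cmp C (d i) f)"
  unfolding pphi_def Let_def fst_conv snd_conv by (simp add: inv_into_f_f[OF pix_inj])

lemma presentation_subfam:
  assumes P: "subfam P K d e"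
  shows "presentation C P (pix d e ` K) fst (pphi K d e)"
  unfolding presentation_def psh_iso_def psh_map_def
proof (intro conjI ballI)
  show "fst ` pix d e ` K \<subseteq> Obj C"
  proof
    fix A assume "A \<in> fst ` pix d e ` K"
    then obtain i where i: "i \<in> K" "A = Src C (d i)" unfolding pix_def by auto
    show "A \<in> Obj C" unfolding i(2) by (rule hom_Obj(1)[OF subobD(1)[OF subfamD(1)[OF P i(1)]]])
  qed
  have mem: "z \<in> Sec (coprod_repr C (pix d e ` K) fst) V \<longleftrightarrow> (\<exists>i\<in>K. \<exists>f\<in>hom C V (Src C (d i)). z = (pix d e i, f))" for z V
    unfolding coprod_repr_def by (cases z) (auto simp: pix_def)
  have fi: "Cmp C (d i) f \<in> fac (d i) \<and> Src C (Cmp C (d i) f) = V" if "i \<in> K" "f \<in> hom C V (Src C (d i))" for i f V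
    using facI[OF that(2) subobD(1)[OF subfamD(1)[OF P that(1)]]] hom_Src[OF comp_hom[OF that(2) subobD(1)[OF subfamD(1)[OF P that(1)]]]] by simp
  have into: "pphi K d e V z \<in> Sec P V" if z: "z \<in> Sec (coprod_repr C (pix d e ` K) fst) V" for z V
  proof -
    obtain i f where i: "i \<in> K" "f \<in> hom C V (Src C (d i))" "z = (pix d e i, f)" using z mem by blast
    show ?thesis unfolding i(3) pphi_pix[OF P i(1)] subfamD(2)[OF P] using fi[OF i(1,2)] i(1) by blast
  qed
  then show "\<And>V z. V \<in> Obj C \<Longrightarrow> z \<in> Sec (coprod_repr C (pix d e ` K) fst) V \<Longrightarrow> pphi K d e V z \<in> Sec P V" .
  show "pphi K d e (Src C f) (Res (coprod_repr C (pix d e ` K) fst) f z) = Res P f (pphi K d e (Trg C f) z)"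
    if f: "f \<in> Arr C" and z: "z \<in> Sec (coprod_repr C (pix d e ` K) fst) (Trg C f)" for f z
  proof -
    obtain i k where i: "i \<in> K" "k \<in> hom C (Trg C f) (Src C (d i))" "z = (pix d e i, k)" using z mem by blast
    note di = subobD(1)[OF subfamD(1)[OF P i(1)]]
    have f': "f \<in> hom C (Src C f) (Trg C f)" using f by (rule Arr_hom)
    have "Res P f (e i (Cmp C (d i) k)) = e i (Cmp C (Cmp C (d i) k) f)"
      by (rule subfamD(4)[OF P i(1), where W = "Src C f"]) (use fi[OF i(1,2)] f' in simp_all)
    then show ?thesis
      unfolding i(3) coprod_repr_def using comp_assoc[OF f' i(2) di] by (simp add: pphi_pix[OF P i(1)])
  qed
  show "bij_betw (pphi K d e V) (Sec (coprod_repr C (pix d e ` K) fst) V) (Sec P V)" if "V \<in> Obj C" for V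
    unfolding bij_betw_def
  proof (intro conjI inj_onI subset_antisym subsetI)
    fix z z' assume z: "z \<in> Sec (coprod_repr C (pix d e ` K) fst) V" "z' \<in> Sec (coprod_repr C (pix d e ` K) fst) V"
      and eq: "pphi K d e V z = pphi K d e V z'"
    obtain i f where i: "i \<in> K" "f \<in> hom C V (Src C (d i))" "z = (pix d e i, f)" using z(1) mem by blast
    obtain i' f' where i': "i' \<in> K" "f' \<in> hom C V (Src C (d i'))" "z' = (pix d e i', f')" using z(2) mem by blast
    have "e i (Cmp C (d i) f) = e i' (Cmp C (d i') f')" using eq unfolding i(3) i'(3) pphi_pix[OF P i(1)] pphi_pix[OF P i'(1)] .
    then have ic: "i = i' \<and> Cmp C (d i) f = Cmp C (d i') f'"
      by (rule subfamD(3)[OF P i(1) i'(1) conjunct1[OF fi[OF i(1,2)]] conjunct1[OF fi[OF i'(1,2)]]])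
    note ii = conjunct1[OF ic] and cc = conjunct2[OF ic]
    have "f = f'"
      by (rule subob_inj[OF subfamD(1)[OF P i(1)] i(2), where A' = V]) (use i'(2) cc ii in simp_all)
    then show "z = z'" unfolding i(3) i'(3) ii by simp
  next
    fix x assume "x \<in> pphi K d e V ` Sec (coprod_repr C (pix d e ` K) fst) V"
    then show "x \<in> Sec P V" using into by blast
  next
    fix x assume "x \<in> Sec P V"
    then obtain i g where i: "i \<in> K" "g \<in> fac (d i)" "Src C g = V" "x = e i g" unfolding subfamD(2)[OF P] by blast
    obtain k where k: "k \<in> hom C V (Src C (d i))" "Cmp C (d i) k = g"
      using facE[OF i(2) subobD(1)[OF subfamD(1)[OF P i(1)]]] i(3) by metis
    show "x \<in> pphi K d e V ` Sec (coprod_repr C (pix d e ` K) fst) V"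
    proof (rule image_eqI)
      show "x = pphi K d e V (pix d e i, k)" unfolding pphi_pix[OF P i(1)] k(2) i(4) ..
      show "(pix d e i, k) \<in> Sec (coprod_repr C (pix d e ` K) fst) V" using mem i(1) k(1) by blast
    qed
  qed
qed

text \<open>For coproducts of subobjects of U, a map over U consists of a map \<alpha> of indices
  and inclusions \<open>F i\<close> of subobjects. The proof transports these along the change of
  index sets.\<close>

lemma covering_basal_subfam:
  assumes P: "subfam P K d e" and Q: "subfam Q K' d' e'"
    and \<alpha>: "\<And>i. i \<in> K \<Longrightarrow> \<alpha> i \<in> K'"
    and F: "\<And>i. i \<in> K \<Longrightarrow> F i \<in> hom C (Src C (d i)) (Src C (d' (\<alpha> i)))" "\<And>i. i \<in> K \<Longrightarrow> d i = Cmp C (d' (\<alpha> i)) (F i)"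
      "\<And>i. i \<in> K \<Longrightarrow> basal C j (F i)"
    and \<pi>: "\<And>i g. i \<in> K \<Longrightarrow> g \<in> fac (d i) \<Longrightarrow> \<pi> (Src C g) (e i g) = e' (\<alpha> i) g"
    and cov: "\<And>k. k \<in> K' \<Longrightarrow> {i \<in> K. \<alpha> i = k} \<noteq> {} \<Longrightarrow> F ` {i \<in> K. \<alpha> i = k} \<in> j (Src C (d' k))"
  shows "covering_basal C j P Q \<pi>"
proof -
  let ?I = "pix d e ` K" let ?J = "pix d' e' ` K'"
  define iv where "iv = inv_into K (pix d e)"
  have iv: "iv (pix d e i) = i" if "i \<in> K" for i unfolding iv_def by (rule inv_into_f_f[OF pix_inj[OF P] that])
  let ?\<alpha> = "\<lambda>x. pix d' e' (\<alpha> (iv x))" let ?F = "\<lambda>x. F (iv x)"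
  have 1: "?\<alpha> x \<in> ?J \<and> ?F x \<in> hom C (fst x) (fst (?\<alpha> x)) \<and> basal C j (?F x)" if x: "x \<in> ?I" for x
  proof -
    obtain i where i: "i \<in> K" "x = pix d e i" using x by blast
    show ?thesis unfolding i(2) iv[OF i(1)] using \<alpha>[OF i(1)] F[OF i(1)] by (simp add: pix_def)
  qed
  have 2: "\<pi> V (pphi K d e V (x, g)) = pphi K' d' e' V (?\<alpha> x, Cmp C (?F x) g)" if x: "x \<in> ?I" and g: "g \<in> hom C V (fst x)" for V x g
  proof -
    obtain i where i: "i \<in> K" "x = pix d e i" using x by blast
    have g': "g \<in> hom C V (Src C (d i))" using g unfolding i(2) pix_def by simp
    note di = subobD(1)[OF subfamD(1)[OF P i(1)]] and d'i = subobD(1)[OF subfamD(1)[OF Q \<alpha>[OF i(1)]]]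
    have "\<pi> (Src C (Cmp C (d i) g)) (e i (Cmp C (d i) g)) = e' (\<alpha> i) (Cmp C (d i) g)" by (rule \<pi>[OF i(1) facI[OF g' di]])
    then have "\<pi> V (e i (Cmp C (d i) g)) = e' (\<alpha> i) (Cmp C (d i) g)" using hom_Src[OF comp_hom[OF g' di]] by simp
    also have "Cmp C (d i) g = Cmp C (d' (\<alpha> i)) (Cmp C (F i) g)"
      using comp_assoc[OF g' F(1)[OF i(1)] d'i] F(2)[OF i(1)] by simp
    finally have "\<pi> V (e i (Cmp C (d i) g)) = e' (\<alpha> i) (Cmp C (d' (\<alpha> i)) (Cmp C (F i) g))"
      using F(2)[OF i(1)] \<open>Cmp C (d i) g = Cmp C (d' (\<alpha> i)) (Cmp C (F i) g)\<close> by simp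
    then show ?thesis unfolding i(2) iv[OF i(1)] pphi_pix[OF P i(1)] pphi_pix[OF Q \<alpha>[OF i(1)]] .
  qed
  have 3: "?F ` {x \<in> ?I. ?\<alpha> x = y} \<in> j (fst y)" if y: "y \<in> ?J" and ne: "{x \<in> ?I. ?\<alpha> x = y} \<noteq> {}" for y
  proof -
    obtain k where k: "k \<in> K'" "y = pix d' e' k" using y by blast
    have "{x \<in> ?I. ?\<alpha> x = y} = pix d e ` {i \<in> K. \<alpha> i = k}"
      unfolding k(2) using iv inj_on_eq_iff[OF pix_inj[OF Q] \<alpha> k(1)] by auto
    moreover have "?F ` pix d e ` {i \<in> K. \<alpha> i = k} = F ` {i \<in> K. \<alpha> i = k}"
      unfolding image_image using iv by (intro image_cong) auto
    ultimately show ?thesis using cov[OF k(1)] ne unfolding k(2) pix_def by auto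
  qed
  have "presentation C P ?I fst (pphi K d e)" "presentation C Q ?J fst (pphi K' d' e')"
    using presentation_subfam[OF P] presentation_subfam[OF Q] .
  then show ?thesis unfolding covering_basal_def using 1 2 3
    by (intro disjI2 exI[of _ ?I] exI[of _ fst] exI[of _ "pphi K d e"] exI[of _ ?J] exI[of _ "pphi K' d' e'"]
       exI[of _ ?\<alpha>] exI[of _ ?F] conjI ballI impI) simp_all
qed

text \<open>The intersection of the sieves of all labels. When a subobject represents it, that
  subobject is the summand of a simplex, or the limit of a boundary.\<close>

definition sv :: "'m lab \<Rightarrow> 'm set" where
  "sv s = {g \<in> Arr C. Trg C g = U \<and> (\<forall>F c. s F = Some c \<longrightarrow> g \<in> fac c)}"

lemma sv_hom: "g \<in> sv s \<Longrightarrow> g \<in> hom C (Src C g) U"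
  unfolding sv_def hom_def by simp

lemma sv_facD: "g \<in> sv s \<Longrightarrow> s F = Some c \<Longrightarrow> g \<in> fac c"
  unfolding sv_def by simp

lemma svI: "g \<in> hom C V U \<Longrightarrow> (\<And>F c. s F = Some c \<Longrightarrow> g \<in> fac c) \<Longrightarrow> g \<in> sv s"
  unfolding sv_def hom_def by simp

definition lab_sub :: "'m lab \<Rightarrow> bool" where
  "lab_sub s \<longleftrightarrow> (\<forall>F c. s F = Some c \<longrightarrow> subob c)"

lemma sv_comp:
  assumes "lab_sub s" "g \<in> sv s" "e \<in> hom C W (Src C g)"
  shows "Cmp C g e \<in> sv s"
proof (rule svI)
  show "Cmp C g e \<in> hom C W U" by (rule comp_hom[OF assms(3) sv_hom[OF assms(2)]])
  fix F c assume c: "s F = Some c"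
  then have "subob c" using assms(1) unfolding lab_sub_def by blast
  then show "Cmp C g e \<in> fac c" using fac_comp[OF sv_facD[OF assms(2) c] subobD(1) assms(3)] by blast
qed

lemma sv_lact: "sv s \<subseteq> sv (lact \<alpha> s)"
proof
  fix g assume g: "g \<in> sv s"
  show "g \<in> sv (lact \<alpha> s)"
    by (rule svI[OF sv_hom[OF g]]) (auto simp: lact_def split: if_splits intro: sv_facD[OF g])
qed

text \<open>A degeneracy has a section, so both labelings have the same labels up to
  repetition.\<close>

lemma sv_surjm:
  assumes "\<sigma> \<in> surjm m k" "s \<in> labs k"
  shows "sv (lact \<sigma> s) = sv s"
proof -
  obtain \<gamma> where \<gamma>: "\<gamma> \<in> \<Delta> k m" "ocomp \<sigma> \<gamma> = [0..<Suc k]" using surjm_section[OF assms(1), of 0] by auto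
  have "s = lact \<gamma> (lact \<sigma> s)" unfolding lact_comp[OF surjmD(1)[OF assms(1)] \<gamma>(1)] \<gamma>(2) lact_id[OF assms(2)] ..
  then have "sv (lact \<sigma> s) \<subseteq> sv s" using sv_lact[of "lact \<sigma> s" \<gamma>] by simp
  then show ?thesis using sv_lact[of s \<sigma>] by blast
qed

lemma sv_upd: "a F = None \<Longrightarrow> sv (a(F := Some c)) = sv a \<inter> fac c"
proof (intro set_eqI iffI)
  assume a: "a F = None"
  fix g assume g: "g \<in> sv (a(F := Some c))"
  have "g \<in> fac b" if "a G = Some b" for G b
    using sv_facD[OF g, of G b] that a by (cases "G = F") auto
  then have "g \<in> sv a" by (rule svI[OF sv_hom[OF g]])
  then show "g \<in> sv a \<inter> fac c" using sv_facD[OF g, of F c] by simp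
next
  fix g assume g: "g \<in> sv a \<inter> fac c"
  then have "g \<in> fac b" if "(a(F := Some c)) G = Some b" for G b
    using sv_facD[of g a G b] that by (cases "G = F") auto
  moreover have "g \<in> hom C (Src C g) U" using sv_hom[of g a] g by simp
  ultimately show "g \<in> sv (a(F := Some c))" by (intro svI)
qed

section \<open>The labeled presheaf, encoded in the type of trees\<close>

definition subs :: "nat \<Rightarrow> nat set list" where
  "subs n = (SOME l. set l = Pow {..n})"

lemma set_subs: "set (subs n) = Pow {..n}"
  unfolding subs_def by (rule someI_ex) (use finite_list[of "Pow {..n}"] in simp)

text \<open>The site condition speaks of sections in \<open>'m rtree\<close>, hence the encoding. An
  absent label becomes a leaf, decorated with the morphism at hand; a present one gets a child, so
  that the two cannot be confused.\<close>

definition enc :: "nat \<Rightarrow> 'm lab \<times> 'm \<Rightarrow> 'm rtree" where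
  "enc n z = Node (snd z) (map (\<lambda>F. case fst z F of None \<Rightarrow> Node (snd z) [] | Some c \<Rightarrow> Node c [Node c []]) (subs n))"

lemma enc_inj: "inj_on (enc n) (labs n \<times> UNIV)"
proof (rule inj_onI)
  fix z z' :: "'m lab \<times> 'm" assume z: "z \<in> labs n \<times> UNIV" "z' \<in> labs n \<times> UNIV" and eq: "enc n z = enc n z'"
  have s: "snd z = snd z'" using eq unfolding enc_def by simp
  have "fst z F = fst z' F" for F
  proof (cases "F \<in> Pow {..n}")
    case True
    then have "F \<in> set (subs n)" using set_subs by simp
    then have "(case fst z F of None \<Rightarrow> Node (snd z) [] | Some c \<Rightarrow> Node c [Node c []]) =
      (case fst z' F of None \<Rightarrow> Node (snd z') [] | Some c \<Rightarrow> Node c [Node c []])"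
      using eq unfolding enc_def by simp
    then show ?thesis by (auto split: option.splits)
  next
    case False
    then have n: "s F = None" if "s \<in> labs n" for s :: "'m lab" using labsD[OF that, of F] by (cases "s F") auto
    show ?thesis using n[of "fst z"] n[of "fst z'"] z by auto
  qed
  then show "z = z'" using s by (simp add: prod_eq_iff fun_eq_iff)
qed

text \<open>The degree n is needed because a tree only records labels on subsets of {..n}.\<close>

definition dec :: "nat \<Rightarrow> 'm rtree \<Rightarrow> 'm lab \<times> 'm" where
  "dec n = inv_into (labs n \<times> UNIV) (enc n)"

lemma dec_enc: "s \<in> labs n \<Longrightarrow> dec n (enc n (s, g)) = (s, g)"
  unfolding dec_def by (rule inv_into_f_f[OF enc_inj]) simp

text \<open>The coproduct, over the labeled simplices s, of the subpresheaves \<open>sv s\<close> of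
  y(U). Operators change the simplex and keep the morphism to U, restriction does the opposite, and
  \<open>HQ\<close> remembers the morphism only.\<close>

definition HP :: "(nat \<Rightarrow> 'm lab set) \<Rightarrow> ('o, 'm, 'm rtree) spsh" where
  "HP N = \<lparr>Val = (\<lambda>V. \<lparr>Sx = (\<lambda>n. {enc n (s, g) | s g. s \<in> Sm N n \<and> g \<in> sv s \<and> Src C g = V}),
       Act = (\<lambda>n \<alpha> z. enc (length \<alpha> - 1) (lact \<alpha> (fst (dec n z)), snd (dec n z)))\<rparr>),
     Rst = (\<lambda>f n z. enc n (fst (dec n z), Cmp C (snd (dec n z)) f))\<rparr>"

definition HQ :: "'o \<Rightarrow> nat \<Rightarrow> 'm rtree \<Rightarrow> 'm" where
  "HQ V n z = snd (dec n z)"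

lemma Sx_HP: "z \<in> Sx (Val (HP N) V) n \<longleftrightarrow> (\<exists>s\<in>Sm N n. \<exists>g\<in>sv s. Src C g = V \<and> z = enc n (s, g))"
  unfolding HP_def by auto

lemma Act_HP: "s \<in> labs n \<Longrightarrow> \<alpha> \<in> \<Delta> m n \<Longrightarrow> Act (Val (HP N) V) n \<alpha> (enc n (s, g)) = enc m (lact \<alpha> s, g)"
  unfolding HP_def by (simp add: dec_enc \<Delta>_def)

lemma Rst_HP: "s \<in> labs n \<Longrightarrow> Rst (HP N) f n (enc n (s, g)) = enc n (s, Cmp C g f)"
  unfolding HP_def by (simp add: dec_enc)

lemma HQ_enc: "s \<in> labs n \<Longrightarrow> HQ V n (enc n (s, g)) = g"
  unfolding HQ_def by (simp add: dec_enc)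

end

locale sublab = sub C j U + labeling N for C :: "('o, 'm) cat" and j U N +
  assumes N_sub: "t \<in> N k \<Longrightarrow> lab_sub t"
begin

lemma Sm_sub: "s \<in> Sm N m \<Longrightarrow> lab_sub s"
proof (elim SmE)
  fix k \<sigma> t assume t: "t \<in> N k" "s = lact \<sigma> t"
  show "lab_sub s" using N_sub[OF t(1)] unfolding t(2) lab_sub_def lact_def by (simp split: if_splits)
qed

lemma HP_spsh: "simplicial_presheaf C D (HP N)"
  unfolding simplicial_presheaf_def simplicial_set_def smap_def
proof (intro conjI ballI allI impI)
  fix V n z assume z: "z \<in> Sx (Val (HP N) V) n"
  obtain s g where s: "s \<in> Sm N n" "g \<in> sv s" "Src C g = V" "z = enc n (s, g)" using z unfolding Sx_HP by blast
  note sl = Sm_labs[OF s(1)]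
  show "Act (Val (HP N) V) n [0..<Suc n] z = z" unfolding s(4) Act_HP[OF sl id_Delta] lact_id[OF sl] ..
  show "Rst (HP N) (Idt C V) n z = z" unfolding s(4) Rst_HP[OF sl] using id_right[OF sv_hom[OF s(2)]] s(3) by simp
  fix m \<alpha> assume \<alpha>: "\<alpha> \<in> \<Delta> m n"
  show "Act (Val (HP N) V) n \<alpha> z \<in> Sx (Val (HP N) V) m" unfolding s(4) Act_HP[OF sl \<alpha>] Sx_HP
    using Sm_act[OF s(1) \<alpha>] sv_lact[of s \<alpha>] s(2,3) by blast
  fix k \<beta> assume \<beta>: "\<beta> \<in> \<Delta> k m"
  show "Act (Val (HP N) V) m \<beta> (Act (Val (HP N) V) n \<alpha> z) = Act (Val (HP N) V) n (ocomp \<alpha> \<beta>) z"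
    unfolding s(4) Act_HP[OF sl \<alpha>] Act_HP[OF lact_labs[OF \<alpha>] \<beta>] Act_HP[OF sl ocomp_Delta[OF \<alpha> \<beta>]] lact_comp[OF \<alpha> \<beta>] ..
next
  fix f n z assume f: "f \<in> Arr C" and z: "z \<in> Sx (Val (HP N) (Trg C f)) n"
  obtain s g where s: "s \<in> Sm N n" "g \<in> sv s" "Src C g = Trg C f" "z = enc n (s, g)" using z unfolding Sx_HP by blast
  note sl = Sm_labs[OF s(1)]
  have f': "f \<in> hom C (Src C f) (Src C g)" using f s(3) Arr_hom by simp
  have gf: "Cmp C g f \<in> sv s" "Src C (Cmp C g f) = Src C f"
    using sv_comp[OF Sm_sub[OF s(1)] s(2) f'] hom_Src[OF comp_hom[OF f' sv_hom[OF s(2)]]] .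
  show "Rst (HP N) f n z \<in> Sx (Val (HP N) (Src C f)) n" unfolding s(4) Rst_HP[OF sl] Sx_HP using s(1) gf by blast
  show "Rst (HP N) f m (Act (Val (HP N) (Trg C f)) n \<alpha> z) = Act (Val (HP N) (Src C f)) n \<alpha> (Rst (HP N) f n z)"
    if \<alpha>: "\<alpha> \<in> \<Delta> m n" for m \<alpha>
    unfolding s(4) Act_HP[OF sl \<alpha>] Rst_HP[OF sl] Rst_HP[OF lact_labs[OF \<alpha>]] Act_HP[OF sl \<alpha>] ..
next
  fix f g n z assume f: "f \<in> Arr C" "g \<in> Arr C" "Trg C f = Src C g" and z: "z \<in> Sx (Val (HP N) (Trg C g)) n"
  obtain s k where s: "s \<in> Sm N n" "k \<in> sv s" "Src C k = Trg C g" "z = enc n (s, k)" using z unfolding Sx_HP by blast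
  note sl = Sm_labs[OF s(1)]
  have "Cmp C k (Cmp C g f) = Cmp C (Cmp C k g) f"
    using comp_assoc[of f "Src C f" "Src C g" g "Trg C g" k U] f s(3) Arr_hom sv_hom[OF s(2)] by (simp add: hom_def)
  then show "Rst (HP N) f n (Rst (HP N) g n z) = Rst (HP N) (Cmp C g f) n z" unfolding s(4) Rst_HP[OF sl] by simp
qed

lemma HQ_map: "spsh_map C D (HP N) (yo C U) HQ"
  unfolding spsh_map_def smap_def
proof (intro conjI ballI allI impI)
  fix V n z assume z: "z \<in> Sx (Val (HP N) V) n"
  obtain s g where s: "s \<in> Sm N n" "g \<in> sv s" "Src C g = V" "z = enc n (s, g)" using z unfolding Sx_HP by blast
  note sl = Sm_labs[OF s(1)]
  show "HQ V n z \<in> Sx (Val (yo C U) V) n" unfolding s(4) HQ_enc[OF sl] using sv_hom[OF s(2)] s(3) by (simp add: yo_def)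
  fix m \<alpha> assume \<alpha>: "\<alpha> \<in> \<Delta> m n"
  show "HQ V m (Act (Val (HP N) V) n \<alpha> z) = Act (Val (yo C U) V) n \<alpha> (HQ V n z)"
    unfolding s(4) Act_HP[OF sl \<alpha>] HQ_enc[OF sl] HQ_enc[OF lact_labs[OF \<alpha>]] by (simp add: yo_def)
next
  fix f n z assume z: "z \<in> Sx (Val (HP N) (Trg C f)) n"
  obtain s g where s: "s \<in> Sm N n" "g \<in> sv s" "z = enc n (s, g)" using z unfolding Sx_HP by blast
  note sl = Sm_labs[OF s(1)]
  show "HQ (Src C f) n (Rst (HP N) f n z) = Rst (yo C U) f n (HQ (Trg C f) n z)"
    unfolding s(3) Rst_HP[OF sl] HQ_enc[OF sl] by (simp add: yo_def)
qed

text \<open>The subobjects consist of the sections over nondegenerate simplices. Bijectivity is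
  uniqueness of roots, together with the fact that degeneracies do not change
  \<open>sv\<close>.\<close>

lemma HP_split: "split_spsh C D (HP N)"
  unfolding split_spsh_def
proof (intro exI[of _ "\<lambda>k V. {enc k (t, g) | t g. t \<in> N k \<and> g \<in> sv t \<and> Src C g = V}"] conjI ballI)
  show "{enc k (t, g) | t g. t \<in> N k \<and> g \<in> sv t \<and> Src C g = V} \<subseteq> Sx (Val (HP N) V) k" for k V
    using N_Sm unfolding HP_def by auto
  show "Rst (HP N) f k x \<in> {enc k (t, g) | t g. t \<in> N k \<and> g \<in> sv t \<and> Src C g = Src C f}"
    if f: "f \<in> Arr C" and x: "x \<in> {enc k (t, g) | t g. t \<in> N k \<and> g \<in> sv t \<and> Src C g = Trg C f}" for k f x
  proof -
    obtain t g where t: "t \<in> N k" "g \<in> sv t" "Src C g = Trg C f" "x = enc k (t, g)" using x by blast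
    have f': "f \<in> hom C (Src C f) (Src C g)" using f t(3) Arr_hom by simp
    have "Cmp C g f \<in> sv t" "Src C (Cmp C g f) = Src C f"
      using sv_comp[OF N_sub[OF t(1)] t(2) f'] hom_Src[OF comp_hom[OF f' sv_hom[OF t(2)]]] .
    then show ?thesis unfolding t(4) Rst_HP[OF N_labs[OF t(1)]] using t(1) by blast
  qed
  fix m V
  let ?N = "\<lambda>k. {enc k (t, g) | t g. t \<in> N k \<and> g \<in> sv t \<and> Src C g = V}"
  let ?f = "\<lambda>(k, \<sigma>, x). Act (Val (HP N) V) k \<sigma> x"
  let ?A = "SIGMA k:{..m}. {\<sigma> \<in> \<Delta> m k. set \<sigma> = {..k}} \<times> ?N k"
  have A: "\<exists>k \<sigma> t g. z = (k, \<sigma>, enc k (t, g)) \<and> \<sigma> \<in> surjm m k \<and> t \<in> N k \<and> g \<in> sv t \<and> Src C g = V" if "z \<in> ?A" for z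
    using that unfolding surjm_def by auto
  have f: "?f (k, \<sigma>, enc k (t, g)) = enc m (lact \<sigma> t, g)" if "\<sigma> \<in> surjm m k" "t \<in> N k" for k \<sigma> t g
    using Act_HP[OF N_labs[OF that(2)] surjmD(1)[OF that(1)]] by simp
  show "bij_betw ?f ?A (Sx (Val (HP N) V) m)" unfolding bij_betw_def
  proof (intro conjI inj_onI subset_antisym subsetI)
    fix z z' assume "z \<in> ?A" "z' \<in> ?A" and eq: "?f z = ?f z'"
    obtain k \<sigma> t g where z1: "z = (k, \<sigma>, enc k (t, g))" "\<sigma> \<in> surjm m k" "t \<in> N k" using A[OF \<open>z \<in> ?A\<close>] by auto
    obtain k' \<sigma>' t' g' where z2: "z' = (k', \<sigma>', enc k' (t', g'))" "\<sigma>' \<in> surjm m k'" "t' \<in> N k'"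
      using A[OF \<open>z' \<in> ?A\<close>] by auto
    note z = z1 z2
    have "enc m (lact \<sigma> t, g) = enc m (lact \<sigma>' t', g')" using eq unfolding z(1,4) f[OF z(2,3)] f[OF z(5,6)] .
    then have "dec m (enc m (lact \<sigma> t, g)) = dec m (enc m (lact \<sigma>' t', g'))" by (rule arg_cong)
    then have "(lact \<sigma> t, g) = (lact \<sigma>' t', g')"
      unfolding dec_enc[OF lact_labs[OF surjmD(1)[OF z(2)]]] dec_enc[OF lact_labs[OF surjmD(1)[OF z(5)]]] .
    then have e: "lact \<sigma> t = lact \<sigma>' t'" "g = g'" by simp_all
    show "z = z'" unfolding z(1,4) using root_unique[OF z(3,6,2,5) e(1)] e(2) by (simp only:)
  next
    fix x assume "x \<in> ?f ` ?A"
    then obtain z where z: "z \<in> ?A" "x = ?f z" by blast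
    obtain k \<sigma> t g where k: "z = (k, \<sigma>, enc k (t, g))" "\<sigma> \<in> surjm m k" "t \<in> N k" "g \<in> sv t" "Src C g = V" using A[OF z(1)] by blast
    show "x \<in> Sx (Val (HP N) V) m" unfolding z(2) k(1) f[OF k(2,3)] Sx_HP
      using SmI[where N = N and k = k, OF k(3,2)] sv_lact[of t \<sigma>] k(4,5) by blast
  next
    fix x assume "x \<in> Sx (Val (HP N) V) m"
    then obtain s g where s: "s \<in> Sm N m" "g \<in> sv s" "Src C g = V" "x = enc m (s, g)" unfolding Sx_HP by blast
    obtain k \<sigma> t where k: "\<sigma> \<in> surjm m k" "t \<in> N k" "s = lact \<sigma> t" using s(1) by (rule SmE)
    have "g \<in> sv t" using s(2) sv_surjm[OF k(1) N_labs[OF k(2)]] unfolding k(3) by simp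
    then have "(k, \<sigma>, enc k (t, g)) \<in> ?A" using k(1,2) s(3) surjm_le[OF k(1)] unfolding surjm_def by auto
    moreover have "x = ?f (k, \<sigma>, enc k (t, g))" unfolding f[OF k(1,2)] s(4) k(3) ..
    ultimately show "x \<in> ?f ` ?A" by (rule rev_image_eqI)
  qed
qed

end

context sub
begin

text \<open>\<open>l\<close> is the limit of the boundary \<open>a\<close>.  A boundary that a degenerate simplex fills needs no
  further fillers: as all summands are subobjects of \<open>U\<close>, the degenerate simplex is isomorphic to
  the limit.\<close>

definition cov_at :: "(nat \<Rightarrow> 'm lab set) \<Rightarrow> nat \<Rightarrow> bool" where
  "cov_at N k \<longleftrightarrow> (\<forall>a\<in>Bd N k. a \<notin> Sm N k \<longrightarrow> (\<exists>l r. subob l \<and> sv a = fac l \<and> r \<in> j (Src C l) \<and>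
     {t \<in> N k. ltop k t = a} = (\<lambda>f. a({..k} := Some (Cmp C l f))) ` r))"

definition cov_upto :: "(nat \<Rightarrow> 'm lab set) \<Rightarrow> nat \<Rightarrow> bool" where
  "cov_upto N k \<longleftrightarrow> (\<forall>i\<le>k. cov_at N i)"

lemma cov_uptoD: "cov_upto N k \<Longrightarrow> i \<le> k \<Longrightarrow> cov_at N i"
  unfolding cov_upto_def by simp

lemma cov_upto_le: "cov_upto N k \<Longrightarrow> i \<le> k \<Longrightarrow> cov_upto N i"
  unfolding cov_upto_def by simp

end

context sublab
begin

text \<open>The top label of a cell is a composite l f through the limit l of its boundary. It is
  thus contained in all other labels, and the intersection of all labels is the top label.\<close>

lemma new_cell:
  assumes cov: "cov_at N k" and t: "t \<in> N k"
  shows "\<exists>c. t {..k} = Some c \<and> subob c \<and> sv t = fac c"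
proof -
  let ?a = "ltop k t"
  obtain l r where l: "subob l" "sv ?a = fac l" "r \<in> j (Src C l)"
    and eq: "{u \<in> N k. ltop k u = ?a} = (\<lambda>f. ?a({..k} := Some (Cmp C l f))) ` r"
    using cov N_Bd[OF t] N_new[OF t] unfolding cov_at_def by meson
  have "t \<in> {u \<in> N k. ltop k u = ?a}" using t by simp
  then obtain f where f: "f \<in> r" "t = ?a({..k} := Some (Cmp C l f))" unfolding eq by blast
  note lf = subob_comp[OF l(1,3) f(1)]
  have "Cmp C l f \<in> fac l" by (rule facI[OF lf(2) subobD(1)[OF l(1)]])
  then have "fac (Cmp C l f) \<subseteq> fac l" using fac_trans[OF _ subobD(1)[OF l(1)]] by blast
  moreover have "sv t = sv ?a \<inter> fac (Cmp C l f)" by (subst f(2)) (rule sv_upd, simp)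
  ultimately have "sv t = fac (Cmp C l f)" unfolding l(2) by blast
  moreover have "t {..k} = Some (Cmp C l f)" by (subst f(2)) simp
  ultimately show ?thesis using lf(1) by blast
qed

lemma Sm_rep:
  assumes cov: "cov_upto N m" and s: "s \<in> Sm N m"
  shows "\<exists>c. subob c \<and> sv s = fac c"
proof -
  obtain k \<sigma> t where k: "\<sigma> \<in> surjm m k" "t \<in> N k" "s = lact \<sigma> t" using s by (rule SmE)
  show ?thesis using new_cell[OF cov_uptoD[OF cov surjm_le[OF k(1)]] k(2)] sv_surjm[OF k(1) N_labs[OF k(2)]] unfolding k(3) by auto
qed

text \<open>Treats both kinds of boundaries alike: in either case the simplices over a correspond to
  a covering family of the limit of a.\<close>

lemma fiber_cover:
  assumes cov: "cov_upto N k" and a: "a \<in> Bd N k"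
  shows "\<exists>l r e. subob l \<and> sv a = fac l \<and> r \<in> j (Src C l) \<and> bij_betw e r {s \<in> Sm N k. ltop k s = a} \<and>
     (\<forall>f\<in>r. sv (e f) = fac (Cmp C l f))"
proof (cases "a \<in> Sm N k")
  case True
  obtain c where c: "subob c" "sv a = fac c" using Sm_rep[OF cov True] by blast
  have a0: "a {..k} = None" using a unfolding Bd_def by simp
  show ?thesis
  \<comment> \<open>The only simplex over a is a itself, and its summand is the whole limit: this is
    the covering family of the identity.\<close>
  proof (intro exI[of _ c] exI[of _ "{Idt C (Src C c)}"] exI[of _ "\<lambda>_. a"] conjI)
    show "{Idt C (Src C c)} \<in> j (Src C c)" by (rule id_cov[OF hom_Obj(1)[OF subobD(1)[OF c(1)]]])
    show "bij_betw (\<lambda>_. a) {Idt C (Src C c)} {s \<in> Sm N k. ltop k s = a}"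
      unfolding fiber_degenerate[OF True a0] bij_betw_def by simp
    show "\<forall>f\<in>{Idt C (Src C c)}. sv a = fac (Cmp C c f)" using c(2) id_right[OF subobD(1)[OF c(1)]] by simp
  qed (use c in simp_all)
next
  case False
  obtain l r where l: "subob l" "sv a = fac l" "r \<in> j (Src C l)"
    and eq: "{u \<in> N k. ltop k u = a} = (\<lambda>f. a({..k} := Some (Cmp C l f))) ` r"
    using cov_uptoD[OF cov order_refl, unfolded cov_at_def, rule_format, OF a False] by blast
  have a0: "a {..k} = None" using a unfolding Bd_def by simp
  let ?e = "\<lambda>f. a({..k} := Some (Cmp C l f))"
  show ?thesis
  proof (intro exI[of _ l] exI[of _ r] exI[of _ ?e] conjI ballI)
    have "inj_on ?e r"
    proof (rule inj_onI)
      fix f f' assume f: "f \<in> r" "f' \<in> r" and fe: "?e f = ?e f'"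
      have "?e f {..k} = ?e f' {..k}" using fe by (rule fun_cong)
      then have "Cmp C l f = Cmp C l f'" by simp
      then show "f = f'" by (rule subob_inj[OF l(1) subob_comp(2)[OF l(1,3) f(1)] subob_comp(2)[OF l(1,3) f(2)]])
    qed
    then show "bij_betw ?e r {s \<in> Sm N k. ltop k s = a}" unfolding fiber_new[OF False] eq bij_betw_def by simp
    fix f assume f: "f \<in> r"
    have "Cmp C l f \<in> fac l" by (rule facI[OF subob_comp(2)[OF l(1,3) f] subobD(1)[OF l(1)]])
    then have "fac (Cmp C l f) \<subseteq> fac l" using fac_trans[OF _ subobD(1)[OF l(1)]] by blast
    then show "sv (?e f) = fac (Cmp C l f)" unfolding sv_upd[of a "{..k}", OF a0] l(2) by blast
  qed (use l in simp_all)
qed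

text \<open>The limit \<open>ml k a\<close> of a boundary \<open>a\<close>, a covering family \<open>mr k a\<close> of it, and a bijection \<open>me k a\<close>
  from that family to the simplices with boundary \<open>a\<close>.\<close>

definition la :: "nat \<Rightarrow> 'm lab \<Rightarrow> 'm \<times> 'm set \<times> ('m \<Rightarrow> 'm lab)" where
  "la k a = (SOME z. subob (fst z) \<and> sv a = fac (fst z) \<and> fst (snd z) \<in> j (Src C (fst z)) \<and>
     bij_betw (snd (snd z)) (fst (snd z)) {s \<in> Sm N k. ltop k s = a} \<and>
     (\<forall>f\<in>fst (snd z). sv (snd (snd z) f) = fac (Cmp C (fst z) f)))"

abbreviation "ml k a \<equiv> fst (la k a)"
abbreviation "mr k a \<equiv> fst (snd (la k a))"
abbreviation "me k a \<equiv> snd (snd (la k a))"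

lemma la:
  assumes cov: "cov_upto N k" and a: "a \<in> Bd N k"
  shows "subob (ml k a)" "sv a = fac (ml k a)" "mr k a \<in> j (Src C (ml k a))"
     "bij_betw (me k a) (mr k a) {s \<in> Sm N k. ltop k s = a}"
     "f \<in> mr k a \<Longrightarrow> sv (me k a f) = fac (Cmp C (ml k a) f)"
proof -
  let ?P = "\<lambda>z. subob (fst z) \<and> sv a = fac (fst z) \<and> fst (snd z) \<in> j (Src C (fst z)) \<and>
     bij_betw (snd (snd z)) (fst (snd z)) {s \<in> Sm N k. ltop k s = a} \<and>
     (\<forall>f\<in>fst (snd z). sv (snd (snd z) f) = fac (Cmp C (fst z) f))"
  obtain l r e where "?P (l, r, e)" using fiber_cover[OF cov a] by auto
  then have "?P (la k a)" unfolding la_def by (rule someI[of ?P])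
  then show "subob (ml k a)" "sv a = fac (ml k a)" "mr k a \<in> j (Src C (ml k a))"
     "bij_betw (me k a) (mr k a) {s \<in> Sm N k. ltop k s = a}"
     "f \<in> mr k a \<Longrightarrow> sv (me k a f) = fac (Cmp C (ml k a) f)" by simp_all
qed

definition sF :: "nat \<Rightarrow> 'm lab \<Rightarrow> 'm" where
  "sF k s = inv_into (mr k (ltop k s)) (me k (ltop k s)) s"

text \<open>The inclusion of the summand of s into U. It is formed from the covering family instead
  of choosing a representative of \<open>sv s\<close>, so that the morphisms to the limit are
  literally members of this family; \<open>j\<close> need not contain isomorphic copies of
  it.\<close>

definition smo :: "nat \<Rightarrow> 'm lab \<Rightarrow> 'm" where
  "smo k s = Cmp C (ml k (ltop k s)) (sF k s)"

lemma smo: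
  assumes cov: "cov_upto N k" and s: "s \<in> Sm N k"
  shows "sF k s \<in> mr k (ltop k s)" "subob (smo k s)" "sv s = fac (smo k s)"
    "sF k s \<in> hom C (Src C (smo k s)) (Src C (ml k (ltop k s)))" "basal C j (sF k s)"
proof -
  note L = la[OF cov Sm_Bd[OF s]]
  have "s \<in> me k (ltop k s) ` mr k (ltop k s)" using L(4) s unfolding bij_betw_def by simp
  then have F': "inv_into (mr k (ltop k s)) (me k (ltop k s)) s \<in> mr k (ltop k s)"
    "me k (ltop k s) (inv_into (mr k (ltop k s)) (me k (ltop k s)) s) = s"
    by (rule inv_into_into, rule f_inv_into_f)
  then show F: "sF k s \<in> mr k (ltop k s)" unfolding sF_def by simp
  show "sv s = fac (smo k s)" using L(5)[OF F] F'(2) unfolding smo_def sF_def by simp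
  show "subob (smo k s)" "sF k s \<in> hom C (Src C (smo k s)) (Src C (ml k (ltop k s)))"
    using subob_comp[OF L(1,3) F] unfolding smo_def by simp_all
  show "basal C j (sF k s)" by (rule cov_basal[OF hom_Obj(1)[OF subobD(1)[OF L(1)]] L(3) F])
qed

section \<open>Levels and matching objects as coproducts of subobjects\<close>

lemma level_subfam:
  assumes cov: "cov_upto N k"
  shows "subfam (level (HP N) k) (Sm N k) (smo k) (\<lambda>s g. enc k (s, g))"
  unfolding subfam_def
proof (intro conjI ballI allI impI)
  note S = smo[OF cov]
  show "subob (smo k s)" if "s \<in> Sm N k" for s by (rule S(2)[OF that])
  show "x \<in> Sec (level (HP N) k) V \<longleftrightarrow> (\<exists>s\<in>Sm N k. \<exists>g\<in>fac (smo k s). Src C g = V \<and> x = enc k (s, g))" for V x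
    unfolding level_def using S(3) by (simp add: Sx_HP)
  fix s s' g g' assume "s \<in> Sm N k" "s' \<in> Sm N k" and eq: "enc k (s, g) = enc k (s', g')"
  then have "dec k (enc k (s, g)) = (s, g)" "dec k (enc k (s', g')) = (s', g')" using dec_enc Sm_labs by blast+
  then show "s = s'" "g = g'" unfolding eq by simp_all
next
  fix s g f assume "s \<in> Sm N k"
  then show "Res (level (HP N) k) f (enc k (s, g)) = enc k (s, Cmp C g f)"
    unfolding level_def using Rst_HP[OF Sm_labs] by simp
qed

text \<open>Covers the degree sets \<open>UNIV\<close> and \<open>{..n}\<close> at once, so that
  truncated and full hypercovers are handled by the same lemmas.\<close>

definition down :: "nat \<Rightarrow> nat set \<Rightarrow> bool" where
  "down k D \<longleftrightarrow> k \<in> D \<and> (\<forall>m\<in>D. \<forall>i\<le>m. i \<in> D)"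

definition mx :: "nat set \<Rightarrow> nat \<Rightarrow> 'm lab \<Rightarrow> 'm \<Rightarrow> 'm \<times> (nat \<Rightarrow> nat list \<Rightarrow> 'm rtree)" where
  "mx D k a g = (g, srestrict D (bdry k) (\<lambda>m \<sigma>. enc m (lact \<sigma> a, g)))"

lemma bdry_act:
  assumes "\<sigma> \<in> Sx (bdry k) m" "\<alpha> \<in> \<Delta> l m"
  shows "ocomp \<sigma> \<alpha> \<in> Sx (bdry k) l"
proof -
  have \<sigma>: "\<sigma> \<in> \<Delta> m k" "set \<sigma> \<noteq> {..k}" using assms(1) unfolding Sx_bdry by auto
  have "\<sigma> ! i \<in> set \<sigma>" if "i \<in> set \<alpha>" for i
    using that DeltaD(3)[OF assms(2)] DeltaD(1)[OF \<sigma>(1)] by (intro nth_mem) auto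
  then have "set (ocomp \<sigma> \<alpha>) \<subseteq> set \<sigma>" unfolding ocomp_def by auto
  then have "set (ocomp \<sigma> \<alpha>) \<noteq> {..k}" using \<sigma>(2) DeltaD(3)[OF \<sigma>(1)] by blast
  then show ?thesis unfolding Sx_bdry using ocomp_Delta[OF \<sigma>(1) assms(2)] by simp
qed

lemma mx_in:
  assumes a: "a \<in> Bd N k" and g: "g \<in> sv a"
  shows "mx D k a g \<in> Sec (matching C D U (HP N) HQ k) (Src C g)"
proof -
  let ?x = "\<lambda>m \<sigma>. enc m (lact \<sigma> a, g)"
  have D: "\<sigma> \<in> \<Delta> m k" if "\<sigma> \<in> Sx (bdry k) m" for \<sigma> m using that unfolding Sx_bdry by simp
  have r: "srestrict D (bdry k) ?x m \<sigma> = ?x m \<sigma>" if "m \<in> D" "\<sigma> \<in> Sx (bdry k) m" for m \<sigma>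
    by (rule srestrict_in[OF that])
  have "smap D (bdry k) (Val (HP N) (Src C g)) (srestrict D (bdry k) ?x)" unfolding smap_def
  proof (intro conjI ballI)
    fix m \<sigma> assume m: "m \<in> D" and \<sigma>: "\<sigma> \<in> Sx (bdry k) m"
    show "srestrict D (bdry k) ?x m \<sigma> \<in> Sx (Val (HP N) (Src C g)) m"
      unfolding r[OF m \<sigma>] Sx_HP using Bd_act[OF a \<sigma>] sv_lact[of a \<sigma>] g by blast
    fix l \<alpha> assume l: "l \<in> D" and \<alpha>: "\<alpha> \<in> \<Delta> l m"
    have b: "ocomp \<sigma> \<alpha> \<in> Sx (bdry k) l" by (rule bdry_act[OF \<sigma> \<alpha>])
    show "srestrict D (bdry k) ?x l (Act (bdry k) m \<alpha> \<sigma>) = Act (Val (HP N) (Src C g)) m \<alpha> (srestrict D (bdry k) ?x m \<sigma>)"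
      unfolding r[OF m \<sigma>] Act_bdry r[OF l b] Act_HP[OF lact_labs[OF D[OF \<sigma>]] \<alpha>] lact_comp[OF D[OF \<sigma>] \<alpha>] ..
  qed
  moreover have "srestrict D (bdry k) (srestrict D (bdry k) ?x) = srestrict D (bdry k) ?x"
    by (rule srestrict_ext) (rule r)
  ultimately have "srestrict D (bdry k) ?x \<in> smaps D (bdry k) (Val (HP N) (Src C g))" unfolding smaps_iff by (rule conjI)
  moreover have "HQ (Src C g) m (srestrict D (bdry k) ?x m \<sigma>) = g" if "m \<in> D" "\<sigma> \<in> Sx (bdry k) m" for m \<sigma>
    unfolding r[OF that] by (rule HQ_enc[OF lact_labs[OF D[OF that(2)]]])
  ultimately show ?thesis unfolding matching_def mx_def using sv_hom[OF g] by simp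
qed

text \<open>A section of the matching object is a compatible family of simplices over one morphism
  g. Its labeling a collects the top labels of all proper faces, and \<open>key\<close> shows that
  these determine the family.\<close>

lemma mx_sur:
  assumes D: "down k D" and z: "z \<in> Sec (matching C D U (HP N) HQ k) V"
  shows "\<exists>a\<in>Bd N k. \<exists>g\<in>sv a. Src C g = V \<and> z = mx D k a g"
proof -
  obtain g x where zx: "z = (g, x)" by (cases z)
  have g: "g \<in> hom C V U" and x: "x \<in> smaps D (bdry k) (Val (HP N) V)"
    and px: "\<And>m \<sigma>. m \<in> D \<Longrightarrow> \<sigma> \<in> Sx (bdry k) m \<Longrightarrow> HQ V m (x m \<sigma>) = g"
    using z unfolding zx matching_def by auto
  have down: "i \<in> D" if "m \<in> D" "i \<le> m" for m i using D that unfolding down_def by blast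
  have sm: "smap D (bdry k) (Val (HP N) V) x" by (rule smaps_smap[OF x])
  define L where "L m \<sigma> = fst (dec m (x m \<sigma>))" for m \<sigma>
  have xe: "L m \<sigma> \<in> Sm N m \<and> x m \<sigma> = enc m (L m \<sigma>, g) \<and> g \<in> sv (L m \<sigma>)" if m: "m \<in> D" and \<sigma>: "\<sigma> \<in> Sx (bdry k) m" for m \<sigma>
  proof -
    have "x m \<sigma> \<in> Sx (Val (HP N) V) m" using sm m \<sigma> unfolding smap_def by blast
    then obtain s g' where s: "s \<in> Sm N m" "g' \<in> sv s" "x m \<sigma> = enc m (s, g')" unfolding Sx_HP by blast
    have "g' = g" using px[OF m \<sigma>] unfolding s(3) HQ_enc[OF Sm_labs[OF s(1)]] .
    moreover have "L m \<sigma> = s" unfolding L_def s(3) dec_enc[OF Sm_labs[OF s(1)]] by simp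
    ultimately show ?thesis using s by simp
  qed
  have Lact: "L l (ocomp \<sigma> \<alpha>) = lact \<alpha> (L m \<sigma>)" if m: "m \<in> D" and \<sigma>: "\<sigma> \<in> Sx (bdry k) m" and l: "l \<in> D" and \<alpha>: "\<alpha> \<in> \<Delta> l m" for m \<sigma> l \<alpha>
  proof -
    have "x l (Act (bdry k) m \<alpha> \<sigma>) = Act (Val (HP N) V) m \<alpha> (x m \<sigma>)" using sm m \<sigma> l \<alpha> unfolding smap_def by blast
    also have "x m \<sigma> = enc m (L m \<sigma>, g)" using xe[OF m \<sigma>] by simp
    also have "Act (Val (HP N) V) m \<alpha> \<dots> = enc l (lact \<alpha> (L m \<sigma>), g)"
      using xe[OF m \<sigma>] by (intro Act_HP[OF Sm_labs[where N = N] \<alpha>]) simp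
    finally have "x l (ocomp \<sigma> \<alpha>) = enc l (lact \<alpha> (L m \<sigma>), g)" unfolding Act_bdry .
    then show ?thesis unfolding L_def[of l] by (simp add: dec_enc[OF lact_labs[OF \<alpha>]])
  qed
  \<comment> \<open>The label of a face is the top label of the simplex that the family assigns to
    it.\<close>
  define a where "a F = (if F \<in> pfaces k then L (card F - 1) (sl F) {..card F - 1} else None)" for F
  have cD: "card F - 1 \<in> D" if "F \<in> pfaces k" for F
    using D pfaces_card[OF that] unfolding down_def by (meson less_imp_le)
  have key: "L m \<sigma> = lact \<sigma> a" if m: "m \<in> D" and \<sigma>: "\<sigma> \<in> Sx (bdry k) m" for m \<sigma>
  proof
    fix G
    have \<sigma>D: "\<sigma> \<in> \<Delta> m k" "set \<sigma> \<noteq> {..k}" using \<sigma> unfolding Sx_bdry by auto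
    have Ls: "L m \<sigma> \<in> labs m" using xe[OF m \<sigma>] Sm_labs by blast
    show "L m \<sigma> G = lact \<sigma> a G"
    proof (cases "G \<noteq> {} \<and> G \<subseteq> {..m}")
      case False
      then have "L m \<sigma> G = None" using labsD[OF Ls, of G] by (cases "L m \<sigma> G") auto
      then show ?thesis unfolding lact_eq[OF \<sigma>D(1)] using False by auto
    next
      case True
      then have G: "G \<noteq> {}" "G \<subseteq> {..m}" "finite G" using finite_subset[of G "{..m}"] by auto
      let ?c = "card G - 1"
      have slG: "sl G \<in> \<Delta> ?c m" using sl_Delta G by blast
      have "card G \<le> card {..m}" using G(2) by (intro card_mono) auto
      then have c: "?c \<in> D" using down[OF m] by simp
      let ?\<tau> = "ocomp \<sigma> (sl G)"
      have \<tau>: "?\<tau> \<in> Sx (bdry k) ?c" by (rule bdry_act[OF \<sigma> slG])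
      have \<tau>D: "?\<tau> \<in> \<Delta> ?c k" using \<tau> unfolding Sx_bdry by simp
      have \<tau>set: "set ?\<tau> = (!) \<sigma> ` G" unfolding ocomp_def using G(3) by simp
      have LG: "L m \<sigma> G = L ?c ?\<tau> {..?c}" unfolding Lact[OF m \<sigma> c slG] lact_sl_top[OF G(1,2)] ..
      show ?thesis
      proof (cases "inj_on ((!) \<sigma>) G")
        case inj: True
        have "distinct ?\<tau>" unfolding ocomp_def using inj G(3) by (simp add: distinct_map)
        then have "sorted_wrt (<) ?\<tau>" using DeltaD(2)[OF \<tau>D] by (simp add: strict_sorted_iff)
        then have \<tau>e: "?\<tau> = sl ((!) \<sigma> ` G)" using strict_eq_sl \<tau>set by metis
        have F: "(!) \<sigma> ` G \<in> pfaces k"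
          using \<tau> DeltaD(3)[OF \<tau>D] G(1) unfolding pfaces_def Sx_bdry \<tau>set[symmetric] by (auto simp: \<tau>set)
        have "card ((!) \<sigma> ` G) = card G" by (rule card_image[OF inj])
        then have "a ((!) \<sigma> ` G) = L ?c ?\<tau> {..?c}" unfolding a_def \<tau>e using F by simp
        then show ?thesis unfolding LG lact_eq[OF \<sigma>D(1)] using True inj by simp
      next
        \<comment> \<open>Here the operator factors through a proper degeneracy, so the simplex
          assigned to it is degenerate and has no top label, in accordance with
          \<open>lact\<close>.\<close>
        case ninj: False
        obtain \<epsilon> where \<epsilon>: "\<epsilon> \<in> \<Delta> ?c (card (set ?\<tau>) - 1)" "?\<tau> = ocomp (sl (set ?\<tau>)) \<epsilon>"
          using epi_mono[OF \<tau>D] by metis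
        have F: "set ?\<tau> \<in> pfaces k" using \<tau> DeltaD(3,4)[OF \<tau>D] unfolding pfaces_def Sx_bdry by (simp add: psubset_eq)
        have "L ?c ?\<tau> = lact \<epsilon> (L (card (set ?\<tau>) - 1) (sl (set ?\<tau>)))"
          by (subst \<epsilon>(2)) (rule Lact[OF cD[OF F] pfaces_bdry[OF F] c \<epsilon>(1)])
        moreover have "\<not> inj_on ((!) \<epsilon>) {..?c}"
        proof
          assume "inj_on ((!) \<epsilon>) {..?c}"
          then have "card {..?c} \<le> card {..card (set ?\<tau>) - 1}"
            using card_image Delta_image[OF \<epsilon>(1)] by (metis card_mono finite_atMost)
          then have "card G \<le> card (set ?\<tau>)" using G(1,3) pfacesD(1,3)[OF F] by (simp add: card_gt_0_iff Suc_le_eq)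
          then have "card ((!) \<sigma> ` G) = card G" unfolding \<tau>set using card_image_le[OF G(3), of "(!) \<sigma>"] by simp
          then show False using ninj eq_card_imp_inj_on[OF G(3)] by blast
        qed
        ultimately have "L ?c ?\<tau> {..?c} = None" by (simp add: lact_eq[OF \<epsilon>(1)])
        then show ?thesis unfolding LG lact_eq[OF \<sigma>D(1)] using ninj by simp
      qed
    qed
  qed
  have a: "a \<in> Bd N k" unfolding Bd_def
  proof (intro CollectI conjI ballI)
    show "a \<in> labs k" unfolding labs_def
    proof (intro CollectI allI impI)
      fix F assume "a F \<noteq> None"
      then have "F \<in> pfaces k" unfolding a_def by (simp split: if_splits)
      then show "F \<noteq> {} \<and> F \<subseteq> {..k}" using pfacesD(1,2)[of F k] by blast
    qed
    show "a {..k} = None" unfolding a_def pfaces_def by simp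
    show "lact (sl F) a \<in> Sm N (card F - 1)" if "F \<in> pfaces k" for F
      using key[OF cD[OF that] pfaces_bdry[OF that]] xe[OF cD[OF that] pfaces_bdry[OF that]] by simp
  qed
  have ga: "g \<in> sv a"
  proof (rule svI[OF g])
    fix F c assume c: "a F = Some c"
    then have F: "F \<in> pfaces k" unfolding a_def by (simp split: if_splits)
    then have "L (card F - 1) (sl F) {..card F - 1} = Some c" using c unfolding a_def by simp
    then show "g \<in> fac c" using sv_facD xe[OF cD[OF F] pfaces_bdry[OF F]] by blast
  qed
  have "x = srestrict D (bdry k) x" using smaps_srestrict_eq[OF x] by (rule sym)
  also have "\<dots> = srestrict D (bdry k) (\<lambda>m \<sigma>. enc m (lact \<sigma> a, g))"
    by (rule srestrict_ext) (use key xe in simp)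
  finally show ?thesis using a ga hom_Src[OF g] unfolding zx mx_def by blast
qed

lemma mx_inj:
  assumes D: "down k D" and a: "a \<in> Bd N k" "a' \<in> Bd N k" and eq: "mx D k a g = mx D k a' g'"
  shows "a = a' \<and> g = g'"
proof -
  have g: "g = g'" and x: "srestrict D (bdry k) (\<lambda>m \<sigma>. enc m (lact \<sigma> a, g)) = srestrict D (bdry k) (\<lambda>m \<sigma>. enc m (lact \<sigma> a', g'))"
    using eq[unfolded mx_def prod.inject] by (rule conjunct1, rule conjunct2)
  have "a F = a' F" for F
  proof (cases "F \<in> pfaces k")
    case True
    let ?c = "card F - 1"
    have c: "?c \<in> D" using D pfaces_card[OF True] unfolding down_def by (meson less_imp_le)
    note b = pfaces_bdry[OF True] and sl = pfaces_sl[OF True]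
    have "srestrict D (bdry k) (\<lambda>m \<sigma>. enc m (lact \<sigma> a, g)) ?c (sl F) = srestrict D (bdry k) (\<lambda>m \<sigma>. enc m (lact \<sigma> a', g')) ?c (sl F)"
      unfolding x ..
    then have "enc ?c (lact (sl F) a, g) = enc ?c (lact (sl F) a', g')" unfolding srestrict_in[OF c b] .
    then have "dec ?c (enc ?c (lact (sl F) a, g)) = dec ?c (enc ?c (lact (sl F) a', g'))" by (rule arg_cong)
    then have "lact (sl F) a = lact (sl F) a'" unfolding dec_enc[OF lact_labs[OF sl]] by simp
    then show ?thesis using lact_sl_top[of F k a] lact_sl_top[of F k a'] pfacesD[OF True] by auto
  next
    case False
    have bn: "b F = None" if b: "b \<in> Bd N k" for b
    proof (rule ccontr)
      assume n: "b F \<noteq> None"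
      then have "F \<noteq> {} \<and> F \<subseteq> {..k}" using b unfolding Bd_def labs_def by blast
      moreover have "F \<noteq> {..k}" using n b unfolding Bd_def by auto
      ultimately show False using False unfolding pfaces_def by blast
    qed
    show ?thesis using bn[OF a(1)] bn[OF a(2)] by simp
  qed
  then show ?thesis using g by blast
qed

lemma matching_subfam:
  assumes cov: "cov_upto N k" and D: "down k D"
  shows "subfam (matching C D U (HP N) HQ k) (Bd N k) (ml k) (mx D k)"
  unfolding subfam_def
proof (intro conjI ballI allI impI)
  note L = la[OF cov]
  show "subob (ml k a)" if "a \<in> Bd N k" for a by (rule L(1)[OF that])
  show "z \<in> Sec (matching C D U (HP N) HQ k) V \<longleftrightarrow> (\<exists>a\<in>Bd N k. \<exists>g\<in>fac (ml k a). Src C g = V \<and> z = mx D k a g)" for V z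
  proof
    assume "z \<in> Sec (matching C D U (HP N) HQ k) V"
    then show "\<exists>a\<in>Bd N k. \<exists>g\<in>fac (ml k a). Src C g = V \<and> z = mx D k a g" using mx_sur[OF D] L(2) by metis
  next
    assume "\<exists>a\<in>Bd N k. \<exists>g\<in>fac (ml k a). Src C g = V \<and> z = mx D k a g"
    then show "z \<in> Sec (matching C D U (HP N) HQ k) V" using mx_in L(2) by metis
  qed
  show "a = a'" "g = g'" if "a \<in> Bd N k" "a' \<in> Bd N k" "mx D k a g = mx D k a' g'" for a a' g g'
    using mx_inj[OF D that] by simp_all
  fix a g f assume a: "a \<in> Bd N k" and g: "g \<in> fac (ml k a)" and f: "f \<in> hom C (Src C f) (Src C g)"
  have "srestrict D (bdry k) (\<lambda>m \<sigma>. Rst (HP N) f m (srestrict D (bdry k) (\<lambda>m \<sigma>. enc m (lact \<sigma> a, g)) m \<sigma>)) =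
     srestrict D (bdry k) (\<lambda>m \<sigma>. enc m (lact \<sigma> a, Cmp C g f))"
  proof (rule srestrict_ext)
    fix m \<sigma> assume m: "m \<in> D" and \<sigma>: "\<sigma> \<in> Sx (bdry k) m"
    have "\<sigma> \<in> \<Delta> m k" using \<sigma> unfolding Sx_bdry by simp
    then show "Rst (HP N) f m (srestrict D (bdry k) (\<lambda>m \<sigma>. enc m (lact \<sigma> a, g)) m \<sigma>) = enc m (lact \<sigma> a, Cmp C g f)"
      unfolding srestrict_in[OF m \<sigma>] by (rule Rst_HP[OF lact_labs])
  qed
  then show "Res (matching C D U (HP N) HQ k) f (mx D k a g) = mx D k a (Cmp C g f)"
    unfolding matching_def mx_def by simp
qed

text \<open>On indices, the matching map is passage to the boundary; the morphism to U is
  kept.\<close>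

lemma matching_map_enc:
  assumes s: "s \<in> Sm N k"
  shows "matching_map D (HP N) HQ k V (enc k (s, g)) = mx D k (ltop k s) g"
proof -
  note sl = Sm_labs[OF s]
  have "srestrict D (bdry k) (\<lambda>m \<sigma>. Act (Val (HP N) V) k \<sigma> (enc k (s, g))) = srestrict D (bdry k) (\<lambda>m \<sigma>. enc m (lact \<sigma> (ltop k s), g))"
  proof (rule srestrict_ext)
    fix m \<sigma> assume \<sigma>: "\<sigma> \<in> Sx (bdry k) m"
    then have "\<sigma> \<in> \<Delta> m k" "set \<sigma> \<noteq> {..k}" unfolding Sx_bdry by auto
    then show "Act (Val (HP N) V) k \<sigma> (enc k (s, g)) = enc m (lact \<sigma> (ltop k s), g)"
      using Act_HP[OF sl] lact_ltop by metis
  qed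
  then show ?thesis unfolding matching_map_def mx_def HQ_enc[OF sl] by simp
qed

text \<open>The fibers of the matching map on indices correspond to covering families of the limits,
  which gives the covering basal condition. For local surjectivity, a section over g factors through
  a limit, and the covering family of the limit is pulled back along this factorization.\<close>

lemma verdier_level:
  assumes cov: "cov_upto N k" and D: "down k D"
  shows "semi_representable C (level (HP N) k)"
    "covering_basal C j (level (HP N) k) (matching C D U (HP N) HQ k) (matching_map D (HP N) HQ k)"
    "local_epi C j (level (HP N) k) (matching C D U (HP N) HQ k) (matching_map D (HP N) HQ k)"
proof -
  note P = level_subfam[OF cov] and Q = matching_subfam[OF cov D] and S = smo[OF cov] and L = la[OF cov]
  show "semi_representable C (level (HP N) k)"
    unfolding semi_representable_def using presentation_subfam[OF P] by blast
  show "covering_basal C j (level (HP N) k) (matching C D U (HP N) HQ k) (matching_map D (HP N) HQ k)"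
  proof (rule covering_basal_subfam[OF P Q, where \<alpha> = "ltop k" and F = "sF k"])
    fix s assume s: "s \<in> Sm N k"
    show "ltop k s \<in> Bd N k" by (rule Sm_Bd[OF s])
    show "sF k s \<in> hom C (Src C (smo k s)) (Src C (ml k (ltop k s)))" "basal C j (sF k s)" using S(4,5)[OF s] .
    show "smo k s = Cmp C (ml k (ltop k s)) (sF k s)" unfolding smo_def ..
    show "matching_map D (HP N) HQ k (Src C g) (enc k (s, g)) = mx D k (ltop k s) g" for g by (rule matching_map_enc[OF s])
  next
    fix a assume a: "a \<in> Bd N k"
    have "sF k ` {s \<in> Sm N k. ltop k s = a} = mr k a"
    proof -
      \<comment> \<open>On the fiber over a, \<open>sF k\<close> is inverse to the bijection
        \<open>me k a\<close>, so its image is the whole covering family.\<close>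
      have "sF k ` {s \<in> Sm N k. ltop k s = a} = inv_into (mr k a) (me k a) ` {s \<in> Sm N k. ltop k s = a}"
        by (rule image_cong) (auto simp: sF_def)
      also have "\<dots> = inv_into (mr k a) (me k a) ` (me k a ` mr k a)" using L(4)[OF a] unfolding bij_betw_def by simp
      also have "\<dots> = mr k a" using inv_into_image_cancel[of "me k a" "mr k a" "mr k a"] L(4)[OF a] unfolding bij_betw_def by simp
      finally show ?thesis .
    qed
    then show "sF k ` {s \<in> Sm N k. ltop k s = a} \<in> j (Src C (ml k a))" using L(3)[OF a] by simp
  qed
  show "local_epi C j (level (HP N) k) (matching C D U (HP N) HQ k) (matching_map D (HP N) HQ k)"
    unfolding local_epi_def
  proof (intro ballI)
    fix V z assume z: "z \<in> Sec (matching C D U (HP N) HQ k) V"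
    obtain a g where a: "a \<in> Bd N k" "g \<in> fac (ml k a)" "Src C g = V" "z = mx D k a g" using z unfolding subfamD(2)[OF Q] by blast
    note l = L(1)[OF a(1)] and r = L(3)[OF a(1)]
    obtain x where x: "x \<in> hom C V (Src C (ml k a))" "Cmp C (ml k a) x = g" "g \<in> hom C V U"
      using facE[OF a(2) subobD(1)[OF l]] unfolding a(3) .
    obtain t where t: "t \<in> j V" "\<forall>e\<in>t. \<exists>f\<in>mr k a. \<exists>y\<in>hom C (Src C e) (Src C f). Cmp C f y = Cmp C x e"
      using cov_pullback[OF r x(1)] by blast
    show "\<exists>r\<in>j V. \<forall>e\<in>r. \<exists>y\<in>Sec (level (HP N) k) (Src C e).
        matching_map D (HP N) HQ k (Src C e) y = Res (matching C D U (HP N) HQ k) e z"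
    proof (intro bexI[OF _ t(1)] ballI)
      fix e assume "e \<in> t"
      then obtain f y where f: "f \<in> mr k a" "y \<in> hom C (Src C e) (Src C f)" "Cmp C f y = Cmp C x e" using t(2) by blast
      have e: "e \<in> hom C (Src C e) V" by (rule cov_hom[OF hom_Obj(1)[OF x(1)] t(1) \<open>e \<in> t\<close>])
      note lf = subob_comp[OF l r f(1)]
      have "me k a f \<in> {s \<in> Sm N k. ltop k s = a}" using L(4)[OF a(1)] f(1) unfolding bij_betw_def by blast
      then have m: "me k a f \<in> Sm N k" "ltop k (me k a f) = a" by auto
      have "Cmp C g e = Cmp C (Cmp C (ml k a) f) y"
        using comp_assoc[OF e x(1) subobD(1)[OF l]] comp_assoc[OF f(2) lf(2) subobD(1)[OF l]] x(2) f(3) by simp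
      moreover have "Cmp C (Cmp C (ml k a) f) y \<in> fac (Cmp C (ml k a) f)"
        using facI[of y "Src C e" "Src C f" "Cmp C (ml k a) f" U] f(2) subobD(1)[OF lf(1)] lf(3) by simp
      ultimately have ge: "Cmp C g e \<in> sv (me k a f)" unfolding L(5)[OF a(1) f(1)] by simp
      have src: "Src C (Cmp C g e) = Src C e" by (rule hom_Src[OF comp_hom[OF e x(3)]])
      show "\<exists>y\<in>Sec (level (HP N) k) (Src C e).
        matching_map D (HP N) HQ k (Src C e) y = Res (matching C D U (HP N) HQ k) e z"
      proof (rule bexI[of _ "enc k (me k a f, Cmp C g e)"])
        show "enc k (me k a f, Cmp C g e) \<in> Sec (level (HP N) k) (Src C e)"
          unfolding level_def using m(1) ge src by (auto simp: Sx_HP)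
        have "Res (matching C D U (HP N) HQ k) e z = mx D k a (Cmp C g e)"
          unfolding a(4)
          by (rule subfamD(4)[OF Q, where W = "Src C e"]) (use e a in simp_all)
        then show "matching_map D (HP N) HQ k (Src C e) (enc k (me k a f, Cmp C g e)) = Res (matching C D U (HP N) HQ k) e z"
          unfolding matching_map_enc[OF m(1)] m(2) by simp
      qed
    qed
  qed
qed

lemma HP_truncated:
  assumes cov: "cov_upto N n"
  shows "truncated_verdier_hypercover C j n U (HP N) HQ"
  unfolding truncated_verdier_hypercover_def
proof (intro conjI allI impI)
  fix k assume k: "k \<le> n"
  have "down k {..n}" unfolding down_def using k by auto
  then show "semi_representable C (level (HP N) k)"
    "covering_basal C j (level (HP N) k) (matching C {..n} U (HP N) HQ k) (matching_map {..n} (HP N) HQ k)"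
    "local_epi C j (level (HP N) k) (matching C {..n} U (HP N) HQ k) (matching_map {..n} (HP N) HQ k)"
    using verdier_level[OF cov_upto_le[OF cov k]] by simp_all
qed (rule HP_spsh, rule HQ_map)

end

sublocale sublab \<subseteq> HP: aug C j U "HP N" HQ
  by unfold_locales (rule U, rule HP_spsh, rule HQ_map)

context sublab
begin

text \<open>A boundary over g is a section of a matching object, and a local preimage under the
  matching map is a local filler. So the matching maps being local epimorphisms is the hypothesis of
  \<open>fillers_hypercover\<close>.\<close>

lemma HP_verdier:
  assumes cov: "\<And>i. cov_upto N i"
  shows "verdier_hypercover C j U (HP N) HQ"
  unfolding verdier_hypercover_def
proof (intro conjI allI)
  have D: "down k UNIV" for k unfolding down_def by simp
  show "semi_representable C (level (HP N) k)"
    "covering_basal C j (level (HP N) k) (matching C UNIV U (HP N) HQ k) (matching_map UNIV (HP N) HQ k)" for k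
    using verdier_level[OF cov D] by simp_all
  show "hypercover C j U (HP N) HQ"
  proof (rule HP.fillers_hypercover)
    fix n
    show "HP.Lext (bdry n) (simplex n)" unfolding HP.Lext_def
    proof (intro ballI allI impI)
      fix V g u assume V: "V \<in> Obj C" and g: "g \<in> hom C V U" and u: "HP.over V (bdry n) g u"
      let ?u = "srestrict UNIV (bdry n) u"
      have r: "?u m \<sigma> = u m \<sigma>" if "\<sigma> \<in> Sx (bdry n) m" for m \<sigma> by (rule srestrict_in[OF UNIV_I that])
      have "?u \<in> smaps UNIV (bdry n) (Val (HP N) V)"
        by (rule smaps_srestrict) (use HP.over_mem[OF u] HP.over_Act[OF u] bdry_act Act_bdry in simp_all)
      then have z: "(g, ?u) \<in> Sec (matching C UNIV U (HP N) HQ n) V"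
        unfolding matching_def using g HP.over_p[OF u] r by simp
      have "loc V (\<lambda>e. \<exists>t\<in>Sec (level (HP N) n) (Src C e).
         matching_map UNIV (HP N) HQ n (Src C e) t = Res (matching C UNIV U (HP N) HQ n) e (g, ?u))"
        using verdier_level(3)[OF cov D, of n] V z unfolding local_epi_def loc_def by blast
      then show "loc V (\<lambda>e. \<exists>h. HP.over (Src C e) (simplex n) (Cmp C g e) h \<and>
          (\<forall>m. \<forall>x\<in>Sx (bdry n) m. h m x = Rst (HP N) e m (u m x)))"
      proof (rule loc_mono[OF V])
        fix e assume e: "e \<in> hom C (Src C e) V" and "\<exists>t\<in>Sec (level (HP N) n) (Src C e).
         matching_map UNIV (HP N) HQ n (Src C e) t = Res (matching C UNIV U (HP N) HQ n) e (g, ?u)"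
        then obtain t where t: "t \<in> Sec (level (HP N) n) (Src C e)"
          "matching_map UNIV (HP N) HQ n (Src C e) t = Res (matching C UNIV U (HP N) HQ n) e (g, ?u)" by blast
        have t1: "t \<in> Sx (Val (HP N) (Src C e)) n" using t(1) unfolding level_def by simp
        have pt: "HQ (Src C e) n t = Cmp C g e"
          and bt: "srestrict UNIV (bdry n) (\<lambda>m \<sigma>. Act (Val (HP N) (Src C e)) n \<sigma> t) =
             srestrict UNIV (bdry n) (\<lambda>m \<sigma>. Rst (HP N) e m (?u m \<sigma>))"
          using t(2) unfolding matching_map_def matching_def by simp_all
        note W = hom_Obj(1)[OF e]
        show "\<exists>h. HP.over (Src C e) (simplex n) (Cmp C g e) h \<and> (\<forall>m. \<forall>x\<in>Sx (bdry n) m. h m x = Rst (HP N) e m (u m x))"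
        \<comment> \<open>By the Yoneda lemma, the n-simplex t is a map out of the standard
          simplex.\<close>
        proof (intro exI[of _ "\<lambda>m x. Act (Val (HP N) (Src C e)) n x t"] conjI allI ballI)
          show "HP.over (Src C e) (simplex n) (Cmp C g e) (\<lambda>m x. Act (Val (HP N) (Src C e)) n x t)"
          proof (rule HP.overI)
            fix m x assume "x \<in> Sx (simplex n) m"
            then have x: "x \<in> \<Delta> m n" unfolding Sx_simplex .
            show "Act (Val (HP N) (Src C e)) n x t \<in> Sx (Val (HP N) (Src C e)) m" by (rule HP.Act_mem[OF W x t1])
            show "HQ (Src C e) m (Act (Val (HP N) (Src C e)) n x t) = Cmp C g e" unfolding HP.p_Act[OF W x t1] by (rule pt)
            fix l \<alpha> assume \<alpha>: "\<alpha> \<in> \<Delta> l m"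
            show "Act (Val (HP N) (Src C e)) n (Act (simplex n) m \<alpha> x) t =
              Act (Val (HP N) (Src C e)) m \<alpha> (Act (Val (HP N) (Src C e)) n x t)"
              unfolding Act_simplex HP.Act_comp[OF W x \<alpha> t1] ..
          qed
          fix m x assume x: "x \<in> Sx (bdry n) m"
          have "srestrict UNIV (bdry n) (\<lambda>m \<sigma>. Act (Val (HP N) (Src C e)) n \<sigma> t) m x =
             srestrict UNIV (bdry n) (\<lambda>m \<sigma>. Rst (HP N) e m (?u m \<sigma>)) m x" unfolding bt ..
          then show "Act (Val (HP N) (Src C e)) n x t = Rst (HP N) e m (u m x)"
            unfolding srestrict_in[OF UNIV_I x] .
        qed
      qed
    qed
  qed
qed

end

section \<open>Limits of boundaries\<close>

context sublab
begin

abbreviation se :: "nat \<Rightarrow> 'm lab \<Rightarrow> 'm \<Rightarrow> 'm rtree" where "se k s g \<equiv> enc k (s, g)"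
abbreviation Ix :: "nat \<Rightarrow> ('o \<times> 'm rtree) set" where "Ix k \<equiv> pix (smo k) (se k) ` Sm N k"
abbreviation Ax :: "nat \<Rightarrow> 'o \<times> 'm rtree \<Rightarrow> 'o" where "Ax \<equiv> (\<lambda>k. fst)"
abbreviation Px :: "nat \<Rightarrow> 'o \<Rightarrow> ('o \<times> 'm rtree) \<times> 'm \<Rightarrow> 'm rtree" where "Px k \<equiv> pphi (Sm N k) (smo k) (se k)"

lemma Bd_sub: assumes a: "a \<in> Bd N n" shows "lab_sub a"
  unfolding lab_sub_def
proof (intro allI impI)
  fix F c assume c: "a F = Some c"
  have "F \<noteq> {} \<and> F \<subseteq> {..n}" using a labsD[of a n F c] c unfolding Bd_def by simp
  moreover have "F \<noteq> {..n}" using a c unfolding Bd_def by auto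
  ultimately have F: "F \<in> pfaces n" unfolding pfaces_def by blast
  have "lact (sl F) a {..card F - 1} = Some c" using lact_sl_top[of F n a] pfacesD[OF F] c by auto
  then show "subob c" using Sm_sub[OF Bd_act[OF a pfaces_bdry[OF F]]] unfolding lab_sub_def by blast
qed

lemma universal_section_HP:
  assumes cov: "cov_upto N k" and s: "s \<in> Sm N k"
  shows "universal_section C Ax Px k (pix (smo k) (se k) s) = se k s (smo k s)"
  unfolding universal_section_def pphi_pix[OF level_subfam[OF cov] s]
  using id_right[OF subobD(1)[OF smo(2)[OF cov s]]] by (simp add: pix_def)

text \<open>An operator keeps the morphism to U, so on summands it is the inclusion x of one
  subobject of U into another.\<close>

lemma operator_HP:
  assumes cov: "cov_upto N k" and covl: "cov_upto N l" and s: "s \<in> Sm N k" and \<theta>: "\<theta> \<in> \<Delta> l k"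
  shows "\<exists>x\<in>hom C (Src C (smo k s)) (Src C (smo l (lact \<theta> s))). Cmp C (smo l (lact \<theta> s)) x = smo k s \<and>
    operator_on_summand C (HP N) Ix Ax Px k \<theta> (pix (smo k) (se k) s) = (pix (smo l) (se l) (lact \<theta> s), x)"
proof -
  let ?s' = "lact \<theta> s"
  have s': "?s' \<in> Sm N l" by (rule Sm_act[OF s \<theta>])
  note S = smo(2,3)[OF cov s] and S' = smo(2,3)[OF covl s']
  have "smo k s \<in> sv s" unfolding S(2) by (rule fac_self[OF subobD(1)[OF S(1)]])
  then have "smo k s \<in> sv ?s'" using sv_lact[of s \<theta>] by blast
  then have "smo k s \<in> fac (smo l ?s')" unfolding S'(2) .
  then obtain x where x: "x \<in> hom C (Src C (smo k s)) (Src C (smo l ?s'))" "Cmp C (smo l ?s') x = smo k s"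
    using facE[OF _ subobD(1)[OF S'(1)]] by metis
  have len: "length \<theta> - 1 = l" using DeltaD(1)[OF \<theta>] by simp
  let ?V = "Src C (smo k s)"
  have V: "?V \<in> Obj C" by (rule hom_Obj(1)[OF x(1)])
  have bij: "bij_betw (Px l ?V) (Sec (coprod_repr C (Ix l) (Ax l)) ?V) (Sec (level (HP N) l) ?V)"
    using presentation_subfam[OF level_subfam[OF covl]] V unfolding presentation_def psh_iso_def by simp
  have mem: "(pix (smo l) (se l) ?s', x) \<in> Sec (coprod_repr C (Ix l) (Ax l)) ?V"
    unfolding coprod_repr_def using s' x(1) by (simp add: pix_def)
  have e: "Px l ?V (pix (smo l) (se l) ?s', x) = se l ?s' (smo k s)"
    unfolding pphi_pix[OF level_subfam[OF covl] s'] x(2) ..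
  have "inv_into (Sec (coprod_repr C (Ix l) (Ax l)) ?V) (Px l ?V) (se l ?s' (smo k s)) = (pix (smo l) (se l) ?s', x)"
    unfolding e[symmetric] by (rule inv_into_f_f[OF bij_betw_imp_inj_on[OF bij] mem])
  moreover have "Act (Val (HP N) ?V) k \<theta> (se k s (smo k s)) = se l ?s' (smo k s)"
    by (rule Act_HP[OF Sm_labs[OF s] \<theta>])
  moreover have "Ax k (pix (smo k) (se k) s) = ?V" by (simp add: pix_def)
  ultimately have "operator_on_summand C (HP N) Ix Ax Px k \<theta> (pix (smo k) (se k) s) = (pix (smo l) (se l) ?s', x)"
    unfolding operator_on_summand_def Let_def len universal_section_HP[OF cov s] by simp
  then show ?thesis using x by blast
qed

text \<open>Since every summand is a subobject of U, a cone with apex g exists precisely when g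
  factors through all labels, and its legs are then determined. So the limit represents
  \<open>sv a\<close>, and uniqueness of induced maps makes it a monomorphism.\<close>

lemma bdry_limit:
  assumes mv: "matching_verdier C j" and cov: "cov_upto N m" and a: "a \<in> Bd N (Suc m)"
  shows "\<exists>l. subob l \<and> sv a = fac l"
proof -
  define ix where "ix k s = pix (smo k) (se k) s" for k s
  define b where "b k \<sigma> = ix k (lact \<sigma> a)" for k \<sigma>
  have covk: "cov_upto N k" if "k \<le> m" for k by (rule cov_upto_le[OF cov that])
  have fst_ix: "fst (ix k s) = Src C (smo k s)" for k s unfolding ix_def pix_def by simp
  have opr: "\<exists>x\<in>hom C (Src C (smo k s)) (Src C (smo l (lact \<theta> s))). Cmp C (smo l (lact \<theta> s)) x = smo k s \<and>
    operator_on_summand C (HP N) Ix Ax Px k \<theta> (ix k s) = (ix l (lact \<theta> s), x)"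
    if "k \<le> m" "l \<le> m" "s \<in> Sm N k" "\<theta> \<in> \<Delta> l k" for k l s \<theta>
    unfolding ix_def by (rule operator_HP[OF covk[OF that(1)] covk[OF that(2)] that(3,4)])
  have us: "universal_section C Ax Px k (ix k s) = se k s (smo k s)" if "k \<le> m" "s \<in> Sm N k" for k s
    unfolding ix_def by (rule universal_section_HP[OF covk[OF that(1)] that(2)])
  have \<sigma>D: "\<sigma> \<in> \<Delta> k (Suc m)" if "\<sigma> \<in> Sx (bdry (Suc m)) k" for k \<sigma> using that unfolding Sx_bdry by simp
  have ind_act: "fst (operator_on_summand C (HP N) Ix Ax Px k \<theta> (ix k s)) = ix l (lact \<theta> s)"
    if "k \<le> m" "l \<le> m" "s \<in> Sm N k" "\<theta> \<in> \<Delta> l k" for k l s \<theta>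
    using opr[OF that] by (elim bexE conjE) simp
  have smap: "smap {..m} (bdry (Suc m)) (ind C (HP N) Ix Ax Px) b" unfolding smap_def
  proof (intro conjI ballI)
    fix k \<sigma> assume k: "k \<in> {..m}" and \<sigma>: "\<sigma> \<in> Sx (bdry (Suc m)) k"
    have s: "lact \<sigma> a \<in> Sm N k" by (rule Bd_act[OF a \<sigma>])
    show "b k \<sigma> \<in> Sx (ind C (HP N) Ix Ax Px) k" unfolding ind_def b_def ix_def using s by simp
    fix l \<theta> assume l: "l \<in> {..m}" and \<theta>: "\<theta> \<in> \<Delta> l k"
    show "b l (Act (bdry (Suc m)) k \<theta> \<sigma>) = Act (ind C (HP N) Ix Ax Px) k \<theta> (b k \<sigma>)"
      unfolding ind_def b_def Act_bdry lact_comp[OF \<sigma>D[OF \<sigma>] \<theta>, symmetric] using ind_act[OF _ _ s \<theta>] k l by simp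
  qed
  have pres: "\<forall>k\<le>m. presentation C (level (HP N) k) (Ix k) (Ax k) (Px k)"
    using presentation_subfam[OF level_subfam[OF covk]] by simp
  have "matching_limit_exists C U (HP N) HQ Ix Ax Px m b"
    using conjunct1[OF mv[unfolded matching_verdier_def], rule_format, OF U, of m "HP N" HQ Ix Ax Px b]
      HP_truncated[OF cov] HP_split pres smap by blast
  then obtain L l \<pi> where cone: "matching_cone C U (HP N) HQ Ix Ax Px m b L l \<pi>"
    and univ: "\<And>L' l' \<pi>'. matching_cone C U (HP N) HQ Ix Ax Px m b L' l' \<pi>' \<Longrightarrow>
           \<exists>!h. h \<in> hom C L' L \<and> Cmp C l h = l' \<and>
              (\<forall>k\<le>m. \<forall>\<sigma>\<in>bdry_faces (Suc m) k. Cmp C (\<pi> \<sigma>) h = \<pi>' \<sigma>)"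
    unfolding matching_limit_exists_def by (elim exE conjE) simp
  have bf: "\<sigma> \<in> Sx (bdry (Suc m)) k" if "\<sigma> \<in> bdry_faces (Suc m) k" for \<sigma> k
    using that unfolding bdry_faces_def by simp
  have HQu: "HQ V k (universal_section C Ax Px k (b k \<sigma>)) = smo k (lact \<sigma> a)"
    if "k \<le> m" "\<sigma> \<in> Sx (bdry (Suc m)) k" for V k \<sigma>
    unfolding b_def us[OF that(1) Bd_act[OF a that(2)]] by (rule HQ_enc[OF Sm_labs[OF Bd_act[OF a that(2)]]])
  have lU: "l \<in> hom C L U" using cone unfolding matching_cone_def by simp
  have leg: "\<pi> \<sigma> \<in> hom C L (Src C (smo k (lact \<sigma> a)))" "Cmp C (smo k (lact \<sigma> a)) (\<pi> \<sigma>) = l"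
    if k: "k \<le> m" and \<sigma>: "\<sigma> \<in> bdry_faces (Suc m) k" for k \<sigma>
  proof -
    have "\<pi> \<sigma> \<in> hom C L (fst (b k \<sigma>)) \<and> Cmp C (HQ (fst (b k \<sigma>)) k (universal_section C Ax Px k (b k \<sigma>))) (\<pi> \<sigma>) = l"
      using cone k \<sigma> unfolding matching_cone_def Let_def by blast
    then show "\<pi> \<sigma> \<in> hom C L (Src C (smo k (lact \<sigma> a)))" "Cmp C (smo k (lact \<sigma> a)) (\<pi> \<sigma>) = l"
      unfolding HQu[OF k bf[OF \<sigma>]] unfolding b_def fst_ix by simp_all
  qed
  \<comment> \<open>Each label of a is the top label of a face, and the leg at this face factors l
    through it.\<close>
  have la: "l \<in> sv a"
  proof (rule svI[OF lU])
    fix F c assume c: "a F = Some c"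
    have "F \<noteq> {} \<and> F \<subseteq> {..Suc m}" using a labsD[of a "Suc m" F c] c unfolding Bd_def by simp
    moreover have "F \<noteq> {..Suc m}" using a c unfolding Bd_def by auto
    ultimately have F: "F \<in> pfaces (Suc m)" unfolding pfaces_def by blast
    let ?k = "card F - 1"
    have k: "?k \<le> m" using pfaces_card[OF F] by simp
    have \<sigma>: "sl F \<in> bdry_faces (Suc m) ?k" unfolding bdry_faces_def using pfaces_bdry[OF F] by simp
    have s: "lact (sl F) a \<in> Sm N ?k" by (rule Bd_act[OF a pfaces_bdry[OF F]])
    note S = smo(2,3)[OF covk[OF k] s]
    have "l \<in> fac (smo ?k (lact (sl F) a))" using facI[OF leg(1)[OF k \<sigma>] subobD(1)[OF S(1)]] leg(2)[OF k \<sigma>] by simp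
    then have "l \<in> sv (lact (sl F) a)" unfolding S(2) .
    moreover have "lact (sl F) a {..?k} = Some c" using lact_sl_top[of F "Suc m" a] pfacesD[OF F] c by auto
    ultimately show "l \<in> fac c" by (rule sv_facD)
  qed
  \<comment> \<open>The factorization of g through the summand of the face; it is unique, as the
    summand is a subobject. The degree is read off from the length of \<sigma>.\<close>
  define pr where "pr g \<sigma> = (SOME x. x \<in> hom C (Src C g) (Src C (smo (length \<sigma> - 1) (lact \<sigma> a))) \<and>
     Cmp C (smo (length \<sigma> - 1) (lact \<sigma> a)) x = g)" for g \<sigma>
  have pr: "pr g \<sigma> \<in> hom C (Src C g) (Src C (smo k (lact \<sigma> a)))" "Cmp C (smo k (lact \<sigma> a)) (pr g \<sigma>) = g"
    if g: "g \<in> sv a" and k: "k \<le> m" and \<sigma>: "\<sigma> \<in> bdry_faces (Suc m) k" for g k \<sigma>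
  proof -
    have len: "length \<sigma> - 1 = k" using DeltaD(1)[OF \<sigma>D[OF bf[OF \<sigma>]]] by simp
    have s: "lact \<sigma> a \<in> Sm N k" by (rule Bd_act[OF a bf[OF \<sigma>]])
    note S = smo(2,3)[OF covk[OF k] s]
    have "g \<in> fac (smo k (lact \<sigma> a))" unfolding S(2)[symmetric] using sv_lact[of a \<sigma>] g by blast
    then have "\<exists>x. x \<in> hom C (Src C g) (Src C (smo k (lact \<sigma> a))) \<and> Cmp C (smo k (lact \<sigma> a)) x = g"
      using facE[OF _ subobD(1)[OF S(1)]] by metis
    from someI_ex[OF this] show "pr g \<sigma> \<in> hom C (Src C g) (Src C (smo k (lact \<sigma> a)))" "Cmp C (smo k (lact \<sigma> a)) (pr g \<sigma>) = g"
      unfolding pr_def len by simp_all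
  qed
  have cone': "matching_cone C U (HP N) HQ Ix Ax Px m b (Src C g) g (pr g)" if g: "g \<in> sv a" for g
    unfolding matching_cone_def Let_def
  proof (intro conjI allI impI ballI)
    show "g \<in> hom C (Src C g) U" by (rule sv_hom[OF g])
    then show "Src C g \<in> Obj C" by (rule hom_Obj(1))
    fix k \<sigma> assume k: "k \<le> m" and \<sigma>: "\<sigma> \<in> bdry_faces (Suc m) k"
    note p1 = pr[OF g k \<sigma>]
    show "pr g \<sigma> \<in> hom C (Src C g) (fst (b k \<sigma>))" using p1(1) unfolding b_def fst_ix .
    show "Cmp C (HQ (fst (b k \<sigma>)) k (universal_section C Ax Px k (b k \<sigma>))) (pr g \<sigma>) = g"
      unfolding HQu[OF k bf[OF \<sigma>]] by (rule p1(2))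
    fix i \<delta> assume i: "i \<le> k" and \<delta>: "\<delta> \<in> \<Delta> i k" "sorted_wrt (<) \<delta>"
    have s: "lact \<sigma> a \<in> Sm N k" by (rule Bd_act[OF a bf[OF \<sigma>]])
    have s': "lact \<delta> (lact \<sigma> a) \<in> Sm N i" by (rule Sm_act[OF s \<delta>(1)])
    have im: "i \<le> m" using i k by simp
    have lc: "lact (ocomp \<sigma> \<delta>) a = lact \<delta> (lact \<sigma> a)" by (rule lact_comp[OF \<sigma>D[OF bf[OF \<sigma>]] \<delta>(1), symmetric])
    obtain x where x: "x \<in> hom C (Src C (smo k (lact \<sigma> a))) (Src C (smo i (lact \<delta> (lact \<sigma> a))))"
      "Cmp C (smo i (lact \<delta> (lact \<sigma> a))) x = smo k (lact \<sigma> a)"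
      "operator_on_summand C (HP N) Ix Ax Px k \<delta> (ix k (lact \<sigma> a)) = (ix i (lact \<delta> (lact \<sigma> a)), x)"
      using opr[OF k im s \<delta>(1)] by blast
    have \<sigma>\<delta>: "ocomp \<sigma> \<delta> \<in> bdry_faces (Suc m) i"
    proof -
      have "sorted_wrt (<) (ocomp \<sigma> \<delta>)"
      proof -
        have d: "distinct \<sigma>" "distinct \<delta>" using \<sigma> \<delta>(2) unfolding bdry_faces_def by (auto simp: strict_sorted_iff)
        have "inj_on ((!) \<sigma>) (set \<delta>)"
          using DeltaD(3)[OF \<delta>(1)] DeltaD(1)[OF \<sigma>D[OF bf[OF \<sigma>]]] d(1) by (auto simp: inj_on_def nth_eq_iff_index_eq subset_iff less_Suc_eq_le)
        then have "distinct (ocomp \<sigma> \<delta>)" unfolding ocomp_def using d(2) by (simp add: distinct_map)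
        moreover have "sorted (ocomp \<sigma> \<delta>)" using ocomp_Delta[OF \<sigma>D[OF bf[OF \<sigma>]] \<delta>(1)] DeltaD(2) by blast
        ultimately show ?thesis by (simp add: strict_sorted_iff)
      qed
      then show ?thesis using bdry_act[OF bf[OF \<sigma>] \<delta>(1)] unfolding bdry_faces_def by simp
    qed
    note p2 = pr[OF g im \<sigma>\<delta>, unfolded lc]
    note S' = smo(2)[OF covk[OF im] s']
    have "Cmp C (smo i (lact \<delta> (lact \<sigma> a))) (Cmp C x (pr g \<sigma>)) = g"
      using comp_assoc[OF p1(1) x(1) subobD(1)[OF S']] x(2) p1(2) by simp
    then have "Cmp C x (pr g \<sigma>) = pr g (ocomp \<sigma> \<delta>)"
      using subob_inj[OF S' comp_hom[OF p1(1) x(1)] p2(1)] p2(2) by simp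
    then show "Cmp C (snd (operator_on_summand C (HP N) Ix Ax Px k \<delta> (b k \<sigma>))) (pr g \<sigma>) = pr g (ocomp \<sigma> \<delta>)"
      unfolding b_def x(3) by simp
  qed
  have srcl: "Src C l = L" by (rule hom_Src[OF lU])
  have lift: "g \<in> fac l" if g: "g \<in> sv a" for g
  proof -
    obtain h where "h \<in> hom C (Src C g) L" "Cmp C l h = g" using univ[OF cone'[OF g]] by blast
    then show ?thesis using facI[OF _ lU] by metis
  qed
  note la_comp = sv_comp[OF Bd_sub[OF a] la]
  have "is_mono C l" unfolding is_mono_def
  proof (intro conjI ballI impI)
    show "l \<in> Arr C" by (rule hom_Arr[OF lU])
    fix W x y assume x: "x \<in> hom C W (Src C l)" and y: "y \<in> hom C W (Src C l)" and eq: "Cmp C l x = Cmp C l y"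
    have g: "Cmp C l x \<in> sv a" by (rule la_comp[OF x])
    have x': "x \<in> hom C W L" and y': "y \<in> hom C W L" using x y unfolding srcl .
    have sg: "Src C (Cmp C l x) = W" by (rule hom_Src[OF comp_hom[OF x' lU]])
    \<comment> \<open>A map z to the limit over a given morphism induces the cone \<open>pr\<close>
      whatever z is, because legs into subobjects are determined. Two such maps therefore
      coincide.\<close>
    have ok: "z \<in> hom C (Src C (Cmp C l x)) L \<and> Cmp C l z = Cmp C l x \<and>
              (\<forall>k\<le>m. \<forall>\<sigma>\<in>bdry_faces (Suc m) k. Cmp C (\<pi> \<sigma>) z = pr (Cmp C l x) \<sigma>)"
      if z: "z \<in> hom C W L" and lz: "Cmp C l z = Cmp C l x" for z
    proof (intro conjI allI impI ballI)
      show "z \<in> hom C (Src C (Cmp C l x)) L" unfolding sg by (rule z)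
      show "Cmp C l z = Cmp C l x" by (rule lz)
      fix k \<sigma> assume k: "k \<le> m" and \<sigma>: "\<sigma> \<in> bdry_faces (Suc m) k"
      note S = smo(2)[OF covk[OF k] Bd_act[OF a bf[OF \<sigma>]]]
      have "Cmp C (smo k (lact \<sigma> a)) (Cmp C (\<pi> \<sigma>) z) = Cmp C l x"
        using comp_assoc[OF z leg(1)[OF k \<sigma>] subobD(1)[OF S]] leg(2)[OF k \<sigma>] lz by simp
      then show "Cmp C (\<pi> \<sigma>) z = pr (Cmp C l x) \<sigma>"
        using subob_inj[OF S comp_hom[OF z leg(1)[OF k \<sigma>]] pr(1)[OF g k \<sigma>]] pr(2)[OF g k \<sigma>] by simp
    qed
    note u = univ[OF cone'[OF g]]
    show "x = y" using the1_equality[OF u ok[OF x' refl]] the1_equality[OF u ok[OF y' eq[symmetric]]] by simp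
  qed
  then have "subob l" unfolding subob_def srcl using lU by simp
  moreover have "fac l \<subseteq> sv a"
  proof
    fix g assume "g \<in> fac l"
    then obtain k where "k \<in> hom C (Src C g) L" "Cmp C l k = g" using facE[OF _ lU] by metis
    then show "g \<in> sv a" using la_comp[of k "Src C g"] unfolding srcl by simp
  qed
  ultimately show ?thesis using lift by blast
qed

text \<open>The site condition starts with the boundary of the 1-simplex. In degree 0 the boundary
  is empty, and its limit over U is U itself.\<close>

lemma Bd_zero: assumes "a \<in> Bd N 0" shows "sv a = fac (Idt C U)"
proof -
  have n: "a F = None" for F
  proof (rule ccontr)
    assume "a F \<noteq> None"
    then have "F \<noteq> {} \<and> F \<subseteq> {..0}" using assms unfolding Bd_def labs_def by blast
    then have "F = {..0}" by auto
    then show False using \<open>a F \<noteq> None\<close> assms unfolding Bd_def by simp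
  qed
  have i: "Idt C U \<in> hom C U U" by (rule id_hom[OF U])
  show ?thesis
  proof (intro set_eqI iffI)
    fix g assume "g \<in> sv a"
    then have "g \<in> hom C (Src C g) U" by (rule sv_hom)
    then show "g \<in> fac (Idt C U)" using facI[OF _ i] id_left by metis
  next
    fix g assume "g \<in> fac (Idt C U)"
    then have "g \<in> hom C (Src C g) U" using facE[OF _ i] by metis
    then show "g \<in> sv a" by (rule svI) (simp add: n)
  qed
qed

lemma bdry_meet:
  assumes mv: "matching_verdier C j" and cov: "\<And>k. k < n \<Longrightarrow> cov_at N k" and a: "a \<in> Bd N n"
  shows "\<exists>l. subob l \<and> sv a = fac l"
proof (cases n)
  case 0
  then show ?thesis using Bd_zero[of a] id_subob a by blast
next
  case (Suc m)
  have "cov_upto N m" unfolding cov_upto_def using cov Suc by simp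
  then show ?thesis using bdry_limit[OF mv] a unfolding Suc by blast
qed

end

section \<open>The construction by skeleta\<close>

lemma surjm_refl: assumes "\<sigma> \<in> surjm n n" shows "\<sigma> = [0..<Suc n]"
proof -
  note D = surjmD(1)[OF assms]
  have "card (set \<sigma>) = length \<sigma>" using surjmD(2)[OF assms] DeltaD(1)[OF D] by simp
  then have "distinct \<sigma>" by (rule card_distinct)
  then have "sorted_wrt (<) \<sigma>" using DeltaD(2)[OF D] by (simp add: strict_sorted_iff)
  then show ?thesis using strict_eq_sl surjmD(2)[OF assms] sl_atMost by metis
qed

text \<open>New cells of degree n have no proper degeneracies in degree n, so they only add
  themselves there.\<close>

lemma Sm_extend:
  assumes "\<And>k. k < n \<Longrightarrow> N k = N' k" and "s \<in> Sm N' n" and "N' n \<subseteq> labs n"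
  shows "s \<in> Sm N n \<or> s \<in> N' n"
proof -
  obtain k \<sigma> t where k: "\<sigma> \<in> surjm n k" "t \<in> N' k" "s = lact \<sigma> t" using assms(2) by (rule SmE)
  show ?thesis
  proof (cases "k = n")
    case True
    then have "s = t" using k surjm_refl[of \<sigma> n] lact_id[of t n] assms(3) by auto
    then show ?thesis using k(2) True by simp
  next
    case False
    then have "t \<in> N k" using surjm_le[OF k(1)] assms(1)[of k] k(2) by simp
    then show ?thesis using SmI[where N = N and k = k, OF _ k(1)] k(3) by simp
  qed
qed

context sub
begin

lemma cov_at_cong:
  assumes "\<And>i. i \<le> k \<Longrightarrow> N i = N' i"
  shows "cov_at N k \<longleftrightarrow> cov_at N' k"
  unfolding cov_at_def using Sm_cong[of k N N'] Bd_cong[of k N N'] assms by simp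

end

section \<open>Skeleta with a map to the given hypercover\<close>

locale filled = aug C j U H p + sub C j U for C :: "('o, 'm) cat" and j U and H :: "('o, 'm, 'x) spsh" and p
begin

text \<open>The function \<open>h\<close> gives the maps from the summands of nondegenerate simplices to \<open>H\<close>; it is
  extended to all simplices through their unique nondegenerate roots.\<close>

definition Gf :: "(nat \<Rightarrow> 'm lab set) \<Rightarrow> (nat \<Rightarrow> 'm lab \<Rightarrow> 'm \<Rightarrow> 'x) \<Rightarrow> nat \<Rightarrow> 'm lab \<Rightarrow> 'm \<Rightarrow> 'x" where
  "Gf N h m s g = (let z = (SOME z. fst (snd z) \<in> surjm m (fst z) \<and> snd (snd z) \<in> N (fst z) \<and> s = lact (fst (snd z)) (snd (snd z)))
     in Act (Val H (Src C g)) (fst z) (fst (snd z)) (h (fst z) (snd (snd z)) g))"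

lemma Gf_eq:
  assumes lab: "labeling N" and \<sigma>: "\<sigma> \<in> surjm m k" and t: "t \<in> N k"
  shows "Gf N h m (lact \<sigma> t) g = Act (Val H (Src C g)) k \<sigma> (h k t g)"
proof -
  let ?P = "\<lambda>z. fst (snd z) \<in> surjm m (fst z) \<and> snd (snd z) \<in> N (fst z) \<and> lact \<sigma> t = lact (fst (snd z)) (snd (snd z))"
  define z where "z = (SOME z. ?P z)"
  have "?P (k, \<sigma>, t)" using \<sigma> t by simp
  then have z: "?P z" unfolding z_def by (rule someI[of ?P])
  have "fst z = k" "fst (snd z) = \<sigma>" "snd (snd z) = t"
    using labeling.root_unique[OF lab t _ \<sigma>, of "snd (snd z)" "fst z" "fst (snd z)"] z by simp_all
  then show ?thesis unfolding Gf_def z_def[symmetric] Let_def by simp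
qed

lemma Gf_cong:
  assumes "labeling N" "labeling N'" "s \<in> Sm N m"
    and "\<And>k t. t \<in> N k \<Longrightarrow> t \<in> N' k \<and> h k t = h' k t"
  shows "Gf N h m s g = Gf N' h' m s g"
proof -
  obtain k \<sigma> t where k: "\<sigma> \<in> surjm m k" "t \<in> N k" "s = lact \<sigma> t" using assms(3) by (rule SmE)
  have t: "t \<in> N' k" "h k t = h' k t" using assms(4)[OF k(2)] by auto
  show ?thesis unfolding k(3) Gf_eq[OF assms(1) k(1,2)] Gf_eq[OF assms(2) k(1) t(1)] t(2) ..
qed

text \<open>Compatibility with operators is demanded only for those that miss a vertex; for
  degeneracies it holds by the construction of \<open>Gf\<close>.\<close>

definition h_at :: "(nat \<Rightarrow> 'm lab set) \<Rightarrow> (nat \<Rightarrow> 'm lab \<Rightarrow> 'm \<Rightarrow> 'x) \<Rightarrow> nat \<Rightarrow> bool" where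
  "h_at N h k \<longleftrightarrow> (\<forall>t\<in>N k. \<forall>g\<in>sv t. h k t g \<in> Sx (Val H (Src C g)) k \<and> p (Src C g) k (h k t g) = g \<and>
     (\<forall>e. e \<in> hom C (Src C e) (Src C g) \<longrightarrow> h k t (Cmp C g e) = Rst H e k (h k t g)) \<and>
     (\<forall>m. \<forall>\<alpha>\<in>Sx (bdry k) m. Act (Val H (Src C g)) k \<alpha> (h k t g) = Gf N h m (lact \<alpha> t) g))"

text \<open>The skeleton of dimension n - 1 with its map to \<open>H\<close>. It is a simplicial
  presheaf in all degrees, having only degenerate simplices from degree n on; the covering condition
  is imposed in degrees below n.\<close>

definition stage :: "nat \<Rightarrow> (nat \<Rightarrow> 'm lab set) \<Rightarrow> (nat \<Rightarrow> 'm lab \<Rightarrow> 'm \<Rightarrow> 'x) \<Rightarrow> bool" where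
  "stage n N h \<longleftrightarrow> (\<forall>k. good_at N k) \<and> (\<forall>k. \<forall>t\<in>N k. lab_sub t) \<and> (\<forall>k<n. cov_at N k) \<and>
     (\<forall>k. h_at N h k) \<and> (\<forall>k\<ge>n. N k = {})"

end

locale filled_lab = filled C j U H p + sublab C j U N for C :: "('o, 'm) cat" and j U and H :: "('o, 'm, 'x) spsh" and p N +
  fixes h :: "nat \<Rightarrow> 'm lab \<Rightarrow> 'm \<Rightarrow> 'x"
  assumes h_at: "h_at N h k"
begin

lemma lab: "labeling N"
  by unfold_locales (rule good)

lemma h_props:
  assumes "t \<in> N k" "g \<in> sv t"
  shows "h k t g \<in> Sx (Val H (Src C g)) k" "p (Src C g) k (h k t g) = g"
    "e \<in> hom C W (Src C g) \<Longrightarrow> h k t (Cmp C g e) = Rst H e k (h k t g)"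
    "\<alpha> \<in> Sx (bdry k) m \<Longrightarrow> Act (Val H (Src C g)) k \<alpha> (h k t g) = Gf N h m (lact \<alpha> t) g"
proof -
  note a = h_at[of k, unfolded h_at_def, THEN bspec, OF assms(1), THEN bspec, OF assms(2)]
  show "h k t g \<in> Sx (Val H (Src C g)) k" "p (Src C g) k (h k t g) = g" using a by simp_all
  show "h k t (Cmp C g e) = Rst H e k (h k t g)" if "e \<in> hom C W (Src C g)"
    using a that hom_Src[OF that] by simp
  show "Act (Val H (Src C g)) k \<alpha> (h k t g) = Gf N h m (lact \<alpha> t) g" if "\<alpha> \<in> Sx (bdry k) m" using a that by simp
qed

lemma Gf_props:
  assumes s: "s \<in> Sm N m" and g: "g \<in> sv s"
  shows "Gf N h m s g \<in> Sx (Val H (Src C g)) m" "p (Src C g) m (Gf N h m s g) = g"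
    "e \<in> hom C W (Src C g) \<Longrightarrow> Gf N h m s (Cmp C g e) = Rst H e m (Gf N h m s g)"
    "\<alpha> \<in> \<Delta> l m \<Longrightarrow> Gf N h l (lact \<alpha> s) g = Act (Val H (Src C g)) m \<alpha> (Gf N h m s g)"
proof -
  obtain k \<sigma> t where k: "\<sigma> \<in> surjm m k" "t \<in> N k" "s = lact \<sigma> t" using s by (rule SmE)
  note \<sigma> = surjmD(1)[OF k(1)]
  have gt: "g \<in> sv t" using g sv_surjm[OF k(1) N_labs[OF k(2)]] unfolding k(3) by simp
  note e = Gf_eq[OF lab k(1,2), of h, folded k(3)]
  note hp = h_props[OF k(2) gt]
  have V: "Src C g \<in> Obj C" by (rule hom_Obj(1)[OF sv_hom[OF g]])
  show "Gf N h m s g \<in> Sx (Val H (Src C g)) m" unfolding e by (rule Act_mem[OF V \<sigma> hp(1)])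
  show "p (Src C g) m (Gf N h m s g) = g" unfolding e p_Act[OF V \<sigma> hp(1)] by (rule hp(2))
  show "Gf N h m s (Cmp C g e) = Rst H e m (Gf N h m s g)" if f: "e \<in> hom C W (Src C g)" for e W
  proof -
    have "Src C (Cmp C g e) = W" by (rule hom_Src[OF comp_hom[OF f sv_hom[OF g]]])
    then show ?thesis unfolding e Rst_Act[OF f \<sigma> hp(1)] hp(3)[OF f] by simp
  qed
  show "Gf N h l (lact \<alpha> s) g = Act (Val H (Src C g)) m \<alpha> (Gf N h m s g)" if \<alpha>: "\<alpha> \<in> \<Delta> l m" for \<alpha> l
  proof -
    let ?X = "Val H (Src C g)" let ?\<tau> = "ocomp \<sigma> \<alpha>"
    have \<tau>: "?\<tau> \<in> \<Delta> l k" by (rule ocomp_Delta[OF \<sigma> \<alpha>])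
    have rhs: "Act ?X m \<alpha> (Gf N h m s g) = Act ?X k ?\<tau> (h k t g)" unfolding e by (rule Act_comp[OF V \<sigma> \<alpha> hp(1)])
    have lhs: "lact \<alpha> s = lact ?\<tau> t" unfolding k(3) by (rule lact_comp[OF \<sigma> \<alpha>])
    show ?thesis
    proof (cases "set ?\<tau> = {..k}")
      case True
      then have "?\<tau> \<in> surjm l k" using \<tau> unfolding surjm_def by simp
      then show ?thesis unfolding rhs lhs by (rule Gf_eq[OF lab _ k(2)])
    next
      case False
      then have "?\<tau> \<in> Sx (bdry k) l" using \<tau> unfolding Sx_bdry by simp
      then show ?thesis unfolding rhs lhs by (rule hp(4)[symmetric])
    qed
  qed
qed

text \<open>Over the limit l of a, the map on the skeleton turns a into a boundary in
  \<open>H\<close>, to which the local filling property applies. The triple z consists of the limit,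
  a covering family and the fillers over its members.\<close>

lemma filler:
  assumes mv: "matching_verdier C j" and fill: "Lext (bdry n) (simplex n)"
    and cov: "\<And>k. k < n \<Longrightarrow> cov_at N k" and a: "a \<in> Bd N n"
  shows "\<exists>z. subob (fst z) \<and> sv a = fac (fst z) \<and> fst (snd z) \<in> j (Src C (fst z)) \<and>
    (\<forall>f\<in>fst (snd z). snd (snd z) f \<in> Sx (Val H (Src C f)) n \<and> p (Src C f) n (snd (snd z) f) = Cmp C (fst z) f \<and>
      (\<forall>m. \<forall>\<sigma>\<in>Sx (bdry n) m. Act (Val H (Src C f)) n \<sigma> (snd (snd z) f) = Gf N h m (lact \<sigma> a) (Cmp C (fst z) f)))"
proof -
  obtain l where l: "subob l" "sv a = fac l" using bdry_meet[OF mv cov a] by blast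
  note lU = subobD(1)[OF l(1)] and V = hom_Obj(1)[OF subobD(1)[OF l(1)]]
  have la: "l \<in> sv a" unfolding l(2) by (rule fac_self[OF lU])
  define u where "u m \<sigma> = Gf N h m (lact \<sigma> a) l" for m \<sigma>
  have Sm: "lact \<sigma> a \<in> Sm N m" "l \<in> sv (lact \<sigma> a)" if "\<sigma> \<in> Sx (bdry n) m" for \<sigma> m
    using Bd_act[OF a that] sv_lact[of a \<sigma>] la by blast+
  have u: "over (Src C l) (bdry n) l u"
  proof (rule overI)
    fix m \<sigma> assume \<sigma>: "\<sigma> \<in> Sx (bdry n) m"
    note G = Gf_props[OF Sm[OF \<sigma>]]
    show "u m \<sigma> \<in> Sx (Val H (Src C l)) m" "p (Src C l) m (u m \<sigma>) = l" unfolding u_def by (rule G(1), rule G(2))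
    fix i \<alpha> assume \<alpha>: "\<alpha> \<in> \<Delta> i m"
    have "\<sigma> \<in> \<Delta> m n" using \<sigma> unfolding Sx_bdry by simp
    then show "u i (Act (bdry n) m \<alpha> \<sigma>) = Act (Val H (Src C l)) m \<alpha> (u m \<sigma>)"
      unfolding u_def Act_bdry G(4)[OF \<alpha>, symmetric] using lact_comp[OF _ \<alpha>] by metis
  qed
  obtain r where r: "r \<in> j (Src C l)" and w: "\<forall>f\<in>r. \<exists>w. over (Src C f) (simplex n) (Cmp C l f) w \<and>
      (\<forall>m. \<forall>x\<in>Sx (bdry n) m. w m x = Rst H f m (u m x))"
    using LextD[OF fill lU u] unfolding loc_def by blast
  from bchoice[OF w] obtain w where w: "\<forall>f\<in>r. over (Src C f) (simplex n) (Cmp C l f) (w f) \<and>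
      (\<forall>m. \<forall>x\<in>Sx (bdry n) m. w f m x = Rst H f m (u m x))" ..
  let ?z = "\<lambda>f. w f n [0..<Suc n]"
  have "?z f \<in> Sx (Val H (Src C f)) n \<and> p (Src C f) n (?z f) = Cmp C l f \<and>
      (\<forall>m. \<forall>\<sigma>\<in>Sx (bdry n) m. Act (Val H (Src C f)) n \<sigma> (?z f) = Gf N h m (lact \<sigma> a) (Cmp C l f))" if f: "f \<in> r" for f
  proof (intro conjI allI ballI)
    have wf: "over (Src C f) (simplex n) (Cmp C l f) (w f)" "\<And>m x. x \<in> Sx (bdry n) m \<Longrightarrow> w f m x = Rst H f m (u m x)"
      using w f by auto
    have id: "[0..<Suc n] \<in> Sx (simplex n) n" unfolding Sx_simplex by (rule id_Delta)
    show "?z f \<in> Sx (Val H (Src C f)) n" "p (Src C f) n (?z f) = Cmp C l f" by (rule over_mem[OF wf(1) id], rule over_p[OF wf(1) id])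
    fix m \<sigma> assume \<sigma>: "\<sigma> \<in> Sx (bdry n) m"
    then have D: "\<sigma> \<in> \<Delta> m n" unfolding Sx_bdry by simp
    have fh: "f \<in> hom C (Src C f) (Src C l)" by (rule cov_hom[OF V r f])
    have "Act (Val H (Src C f)) n \<sigma> (?z f) = w f m (Act (simplex n) n \<sigma> [0..<Suc n])" by (rule over_Act[OF wf(1) id D, symmetric])
    also have "\<dots> = w f m \<sigma>" unfolding Act_simplex ocomp_id(1)[OF D] ..
    also have "\<dots> = Rst H f m (Gf N h m (lact \<sigma> a) l)" unfolding wf(2)[OF \<sigma>] u_def ..
    also have "\<dots> = Gf N h m (lact \<sigma> a) (Cmp C l f)" by (rule Gf_props(3)[OF Sm[OF \<sigma>] fh, symmetric])
    finally show "Act (Val H (Src C f)) n \<sigma> (?z f) = Gf N h m (lact \<sigma> a) (Cmp C l f)" .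
  qed
  then show ?thesis using l r by (intro exI[of _ "(l, r, ?z)"]) simp
qed

text \<open>Cells are added over the boundaries without a degenerate filler, one for each member of
  the covering family, and the fillers over the members define the map to \<open>H\<close> on
  them.\<close>

lemma stage_step:
  assumes mv: "matching_verdier C j" and fill: "Lext (bdry n) (simplex n)" and st: "stage n N h"
  shows "\<exists>N' h'. stage (Suc n) N' h' \<and> (\<forall>k<n. N k = N' k \<and> h k = h' k)"
proof -
  have cov: "cov_at N k" if "k < n" for k using st that unfolding stage_def by simp
  have N0: "N k = {}" if "k \<ge> n" for k using st that unfolding stage_def by simp
  let ?P = "\<lambda>a z. subob (fst z) \<and> sv a = fac (fst z) \<and> fst (snd z) \<in> j (Src C (fst z)) \<and>
    (\<forall>f\<in>fst (snd z). snd (snd z) f \<in> Sx (Val H (Src C f)) n \<and> p (Src C f) n (snd (snd z) f) = Cmp C (fst z) f \<and>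
      (\<forall>m. \<forall>\<sigma>\<in>Sx (bdry n) m. Act (Val H (Src C f)) n \<sigma> (snd (snd z) f) = Gf N h m (lact \<sigma> a) (Cmp C (fst z) f)))"
  have "\<forall>a\<in>Bd N n. \<exists>z. ?P a z" using filler[OF mv fill cov] by (intro ballI)
  from bchoice[OF this] obtain z where z: "\<forall>a\<in>Bd N n. ?P a (z a)" ..
  define l where "l a = fst (z a)" for a
  define r where "r a = fst (snd (z a))" for a
  define w where "w a = snd (snd (z a))" for a
  have la: "subob (l a)" "sv a = fac (l a)" "r a \<in> j (Src C (l a))"
    and wa: "\<And>f. f \<in> r a \<Longrightarrow> w a f \<in> Sx (Val H (Src C f)) n" "\<And>f. f \<in> r a \<Longrightarrow> p (Src C f) n (w a f) = Cmp C (l a) f"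
      "\<And>f m \<sigma>. f \<in> r a \<Longrightarrow> \<sigma> \<in> Sx (bdry n) m \<Longrightarrow> Act (Val H (Src C f)) n \<sigma> (w a f) = Gf N h m (lact \<sigma> a) (Cmp C (l a) f)"
    if "a \<in> Bd N n" for a
    using bspec[OF z that] unfolding l_def r_def w_def by simp_all
  define cell where "cell a f = a({..n} := Some (Cmp C (l a) f))" for a f
  define N' where "N' = N(n := {cell a f | a f. a \<in> Bd N n \<and> a \<notin> Sm N n \<and> f \<in> r a})"
  \<comment> \<open>The cell t determines f, and g determines its factorization x through the
    summand of t, since l and its composites with the covering morphisms are monomorphisms. The
    filler over f is then restricted along x.\<close>
  define h' where "h' = h(n := (\<lambda>t g. let a = ltop n t; f = (SOME f. f \<in> r a \<and> t = cell a f);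
     x = (SOME x. x \<in> hom C (Src C g) (Src C f) \<and> Cmp C (Cmp C (l a) f) x = g) in Rst H x n (w a f)))"
  have same: "N k = N' k" "h k = h' k" if "k \<noteq> n" for k using that unfolding N'_def h'_def by simp_all
  have N'n: "\<exists>a f. a \<in> Bd N n \<and> a \<notin> Sm N n \<and> f \<in> r a \<and> t = cell a f" if "t \<in> N' n" for t
    using that unfolding N'_def by auto
  have atop: "a {..n} = None" "a \<in> labs n" if "a \<in> Bd N n" for a using that unfolding Bd_def by auto
  have lt: "ltop n (cell a f) = a" if "a \<in> Bd N n" for a f
    unfolding cell_def using atop(1)[OF that] by (simp add: fun_eq_iff)
  have cell_labs: "cell a f \<in> labs n" if "a \<in> Bd N n" for a f
    using atop(2)[OF that] unfolding cell_def labs_def by simp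
  have cell_top: "cell a f {..n} = Some (Cmp C (l a) f)" for a f unfolding cell_def by simp
  have Bd': "Bd N n = Bd N' n" by (rule Bd_cong) (use same in simp)
  have N'labs: "N' n \<subseteq> labs n" using N'n cell_labs by blast
  \<comment> \<open>Cells carry a top label and boundaries do not, so the new cells do not change
    which boundaries have a degenerate filler.\<close>
  have SmN': "a \<in> Sm N' n \<longleftrightarrow> a \<in> Sm N n" if "a \<in> Bd N n" for a
  proof
    assume "a \<in> Sm N' n"
    then have "a \<in> Sm N n \<or> a \<in> N' n"
      by (rule Sm_extend[where N = N and N' = N' and n = n, rotated]) (use same N'labs in simp_all)
    moreover have "a \<notin> N' n"
    proof
      assume "a \<in> N' n"
      then obtain b f where "a = cell b f" using N'n by blast
      then show False using cell_top[of b f] atop(1)[OF that] by simp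
    qed
    ultimately show "a \<in> Sm N n" by simp
  next
    assume "a \<in> Sm N n"
    then obtain k \<sigma> t where k: "\<sigma> \<in> surjm n k" "t \<in> N k" "a = lact \<sigma> t" by (rule SmE)
    have "k \<noteq> n" using k(2) N0[of n] by auto
    then have "t \<in> N' k" using k(2) same by simp
    then show "a \<in> Sm N' n" unfolding k(3) by (rule SmI[where N = N', OF _ k(1)])
  qed
  have good': "good_at N' k" for k
  proof (cases "k = n")
    case True
    show ?thesis unfolding True good_at_def
    proof (intro ballI)
      fix t assume "t \<in> N' n"
      then obtain a f where t: "a \<in> Bd N n" "a \<notin> Sm N n" "t = cell a f" using N'n by blast
      show "t \<in> labs n \<and> t {..n} \<noteq> None \<and> ltop n t \<in> Bd N' n \<and> ltop n t \<notin> Sm N' n"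
        unfolding t(3) lt[OF t(1)] SmN'[OF t(1)] using cell_labs[OF t(1)] cell_top t(1,2) Bd' by simp
    qed
  next
    case False
    show ?thesis
    proof (cases "k < n")
      case True
      have "good_at N k \<longleftrightarrow> good_at N' k" by (rule good_at_cong) (use same True in simp)
      then show ?thesis using good by simp
    next
      case False': False
      then have "N' k = {}" using same(1)[OF False] N0[of k] by simp
      then show ?thesis unfolding good_at_def by simp
    qed
  qed
  have lab': "labeling N'" by unfold_locales (rule good')
  have sub': "lab_sub t" if t: "t \<in> N' k" for t k
  proof (cases "k = n")
    case True
    then obtain a f where t': "a \<in> Bd N n" "f \<in> r a" "t = cell a f" using N'n t by blast
    have "subob (Cmp C (l a) f)" by (rule subob_comp(1)[OF la(1,3)[OF t'(1)] t'(2)])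
    then show ?thesis using Bd_sub[OF t'(1)] unfolding t'(3) cell_def lab_sub_def by simp
  next
    case False
    then show ?thesis using N_sub[of t k] t same by simp
  qed
  have cov': "cov_at N' k" if "k < Suc n" for k
  proof (cases "k = n")
    case True
    show ?thesis unfolding True cov_at_def
    proof (intro ballI impI)
      fix a assume a: "a \<in> Bd N' n" "a \<notin> Sm N' n"
      then have a1: "a \<in> Bd N n" "a \<notin> Sm N n" using Bd' SmN' by simp_all
      have "{t \<in> N' n. ltop n t = a} = (\<lambda>f. a({..n} := Some (Cmp C (l a) f))) ` r a"
      proof (intro set_eqI iffI)
        fix t assume t: "t \<in> {t \<in> N' n. ltop n t = a}"
        then obtain b f where b: "b \<in> Bd N n" "f \<in> r b" "t = cell b f" using N'n by blast
        have "b = a" using t lt[OF b(1), of f] unfolding b(3) by simp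
        then show "t \<in> (\<lambda>f. a({..n} := Some (Cmp C (l a) f))) ` r a" using b(2,3) unfolding cell_def by simp
      next
        fix t assume "t \<in> (\<lambda>f. a({..n} := Some (Cmp C (l a) f))) ` r a"
        then obtain f where f: "f \<in> r a" "t = cell a f" unfolding cell_def by blast
        then have "t \<in> N' n" unfolding N'_def using a1 by auto
        then show "t \<in> {t \<in> N' n. ltop n t = a}" using lt[OF a1(1), of f] f(2) by simp
      qed
      then show "\<exists>l r. subob l \<and> sv a = fac l \<and> r \<in> j (Src C l) \<and>
        {t \<in> N' n. ltop n t = a} = (\<lambda>f. a({..n} := Some (Cmp C l f))) ` r"
        using la[OF a1(1)] by blast
    qed
  next
    case False
    then have k: "k < n" using that by simp
    have "cov_at N k \<longleftrightarrow> cov_at N' k" by (rule cov_at_cong) (use same k in simp)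
    then show ?thesis using cov[OF k] by simp
  qed
  \<comment> \<open>Old simplices keep their images, because their roots are old cells and roots are
    unique.\<close>
  have Gf': "Gf N h m s g = Gf N' h' m s g" if "s \<in> Sm N m" for m s g
  proof (rule Gf_cong[OF lab lab' that])
    fix k t assume t: "t \<in> N k"
    then have "k \<noteq> n" using N0[of n] by auto
    then show "t \<in> N' k \<and> h k t = h' k t" using same t by simp
  qed
  have hat': "h_at N' h' k" for k
  proof (cases "k = n")
    case False
    show ?thesis unfolding h_at_def
    proof (intro ballI conjI allI impI)
      fix t g assume "t \<in> N' k" and g: "g \<in> sv t"
      then have t: "t \<in> N k" using same(1)[OF False] by simp
      note hp = h_props[OF t g, unfolded same(2)[OF False]]
      show "h' k t g \<in> Sx (Val H (Src C g)) k" "p (Src C g) k (h' k t g) = g" using hp(1,2) .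
      show "h' k t (Cmp C g e) = Rst H e k (h' k t g)" if "e \<in> hom C (Src C e) (Src C g)" for e by (rule hp(3)[OF that])
      show "Act (Val H (Src C g)) k \<alpha> (h' k t g) = Gf N' h' m (lact \<alpha> t) g" if \<alpha>: "\<alpha> \<in> Sx (bdry k) m" for m \<alpha>
      proof -
        have "\<alpha> \<in> \<Delta> m k" using \<alpha> unfolding Sx_bdry by simp
        then show ?thesis unfolding hp(4)[OF \<alpha>] by (rule Gf'[OF N_act[OF t]])
      qed
    qed
  next
    case True
    show ?thesis unfolding True h_at_def
    proof (intro ballI)
      fix t g assume "t \<in> N' n" and g: "g \<in> sv t"
      then obtain a f where t: "a \<in> Bd N n" "a \<notin> Sm N n" "f \<in> r a" "t = cell a f" using N'n by blast
      note A = la[OF t(1)] and W = wa[OF t(1) t(3)]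
      note lf = subob_comp[OF A(1,3) t(3)]
      let ?c = "Cmp C (l a) f"
      have cU: "?c \<in> hom C (Src C f) U" using subobD(1)[OF lf(1)] lf(3) by simp
      have sf: "(SOME f. f \<in> r a \<and> t = cell a f) = f"
      proof (rule some_equality)
        show "f \<in> r a \<and> t = cell a f" using t by simp
        fix f' assume f': "f' \<in> r a \<and> t = cell a f'"
        then have "cell a f' {..n} = cell a f {..n}" using t(4) by simp
        then have "Cmp C (l a) f' = ?c" unfolding cell_top by simp
        then show "f' = f" by (rule subob_inj[OF A(1) subob_comp(2)[OF A(1,3) conjunct1[OF f']] lf(2)])
      qed
      have h'e: "h' n t (Cmp C ?c x) = Rst H x n (w a f)" if x: "x \<in> hom C V (Src C f)" for x V
      proof -
        have V: "Src C (Cmp C ?c x) = V" by (rule hom_Src[OF comp_hom[OF x cU]])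
        have "(SOME y. y \<in> hom C (Src C (Cmp C ?c x)) (Src C f) \<and> Cmp C ?c y = Cmp C ?c x) = x"
        proof (rule some_equality)
          show "x \<in> hom C (Src C (Cmp C ?c x)) (Src C f) \<and> Cmp C ?c x = Cmp C ?c x" using x V by simp
          fix y assume y: "y \<in> hom C (Src C (Cmp C ?c x)) (Src C f) \<and> Cmp C ?c y = Cmp C ?c x"
          show "y = x"
            by (rule subob_inj[OF lf(1), of y V x V]) (use y x V lf(3) in simp_all)
        qed
        moreover have "ltop n t = a" unfolding t(4) by (rule lt[OF t(1)])
        ultimately show ?thesis unfolding h'_def using sf by (simp add: Let_def)
      qed
      have "t {..n} = Some ?c" unfolding t(4) by (rule cell_top)
      then have "g \<in> fac ?c" by (rule sv_facD[OF g])
      then obtain x where x: "x \<in> hom C (Src C g) (Src C f)" "Cmp C ?c x = g" using facE[OF _ cU] by metis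
      have hg: "h' n t g = Rst H x n (w a f)" using h'e[OF x(1)] unfolding x(2) .
      have 1: "h' n t g \<in> Sx (Val H (Src C g)) n" unfolding hg by (rule Rst_mem[OF x(1) W(1)])
      have 2: "p (Src C g) n (h' n t g) = g" unfolding hg p_Rst[OF x(1) W(1)] W(2) by (rule x(2))
      have 3: "h' n t (Cmp C g e) = Rst H e n (h' n t g)" if e: "e \<in> hom C (Src C e) (Src C g)" for e
      proof -
        have "Cmp C g e = Cmp C ?c (Cmp C x e)" using comp_assoc[OF e x(1) cU] x(2) by simp
        then show ?thesis unfolding hg Rst_comp[OF x(1) e W(1)] using h'e[OF comp_hom[OF e x(1)]] by simp
      qed
      have 4: "Act (Val H (Src C g)) n \<alpha> (h' n t g) = Gf N' h' m (lact \<alpha> t) g" if \<alpha>: "\<alpha> \<in> Sx (bdry n) m" for m \<alpha>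
      proof -
        have D: "\<alpha> \<in> \<Delta> m n" "set \<alpha> \<noteq> {..n}" using \<alpha> unfolding Sx_bdry by auto
        have s: "lact \<alpha> a \<in> Sm N m" by (rule Bd_act[OF t(1) \<alpha>])
        have "?c \<in> sv a" unfolding A(2) by (rule facI[OF lf(2) subobD(1)[OF A(1)]])
        then have c: "?c \<in> sv (lact \<alpha> a)" using sv_lact[of a \<alpha>] by blast
        have lx: "x \<in> hom C (Src C g) (Src C ?c)" using x(1) lf(3) by simp
        have "Act (Val H (Src C g)) n \<alpha> (h' n t g) = Rst H x m (Act (Val H (Src C f)) n \<alpha> (w a f))"
          unfolding hg by (rule Rst_Act[OF x(1) D(1) W(1), symmetric])
        also have "\<dots> = Rst H x m (Gf N h m (lact \<alpha> a) ?c)" unfolding wa(3)[OF t(1) t(3) \<alpha>] ..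
        also have "\<dots> = Gf N h m (lact \<alpha> a) (Cmp C ?c x)" by (rule Gf_props(3)[OF s c lx, symmetric])
        also have "\<dots> = Gf N' h' m (lact \<alpha> a) g" unfolding x(2) by (rule Gf'[OF s])
        also have "lact \<alpha> a = lact \<alpha> t" unfolding t(4) cell_def by (rule lact_ltop[OF D, symmetric])
        finally show ?thesis .
      qed
      show "h' n t g \<in> Sx (Val H (Src C g)) n \<and> p (Src C g) n (h' n t g) = g \<and>
       (\<forall>e. e \<in> hom C (Src C e) (Src C g) \<longrightarrow> h' n t (Cmp C g e) = Rst H e n (h' n t g)) \<and>
       (\<forall>m. \<forall>\<alpha>\<in>Sx (bdry n) m. Act (Val H (Src C g)) n \<alpha> (h' n t g) = Gf N' h' m (lact \<alpha> t) g)"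
        using 1 2 3 4 by simp
    qed
  qed
  have "N' k = {}" if "k \<ge> Suc n" for k using same(1)[of k] N0[of k] that by simp
  then have "stage (Suc n) N' h'" unfolding stage_def using good' sub' cov' hat'
    by (intro conjI allI ballI impI) simp_all
  then show ?thesis using same by (intro exI[of _ N'] exI[of _ h']) simp
qed

end

context filled
begin

text \<open>Dependent choice gives a sequence of growing skeleta. The conditions in degree k involve
  \<open>N\<close> only up to degree k, so they pass to the union.\<close>

lemma skeleta:
  assumes mv: "matching_verdier C j" and fill: "\<And>n. Lext (bdry n) (simplex n)"
  shows "\<exists>N h. (\<forall>k. good_at N k \<and> (\<forall>t\<in>N k. lab_sub t) \<and> cov_at N k \<and> h_at N h k)"
proof -
  let ?Q = "\<lambda>n x y. \<forall>k<n. fst x k = fst y k \<and> snd x k = snd y k"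
  have "\<exists>s. \<forall>n. (stage n (fst (s n)) (snd (s n))) \<and> ?Q n (s n) (s (Suc n))"
  proof (rule dependent_nat_choice)
    \<comment> \<open>The empty skeleton has no cells, so the map on them may be arbitrary.\<close>
    have "stage 0 (\<lambda>_. {}) undefined" unfolding stage_def good_at_def h_at_def by simp
    then show "\<exists>x. stage 0 (fst x) (snd x)" by (intro exI[of _ "(\<lambda>_. {}, undefined)"]) simp
    fix x n assume x: "stage n (fst x) (snd x)"
    interpret S: filled_lab C j U H p "fst x" "snd x"
      by unfold_locales (use x in \<open>simp_all add: stage_def\<close>)
    obtain N' h' where "stage (Suc n) N' h' \<and> (\<forall>k<n. fst x k = N' k \<and> snd x k = h' k)"
      using S.stage_step[OF mv fill x] by blast
    then show "\<exists>y. stage (Suc n) (fst y) (snd y) \<and> ?Q n x y" by (intro exI[of _ "(N', h')"]) simp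
  qed
  then obtain s where s: "\<And>n. stage n (fst (s n)) (snd (s n))" "\<And>n. ?Q n (s n) (s (Suc n))" by auto
  \<comment> \<open>Degree k is settled by the step from stage k to stage k + 1, and later steps
    leave it alone.\<close>
  define N where "N k = fst (s (Suc k)) k" for k
  define h where "h k = snd (s (Suc k)) k" for k
  have agree: "fst (s n) k = N k \<and> snd (s n) k = h k" if "k < n" for n k
    using that
  proof (induction n)
    case (Suc n)
    then show ?case using s(2)[of n] by (cases "k = n") (auto simp: N_def h_def)
  qed simp
  have st: "good_at (fst (s n)) k" "\<And>t. t \<in> fst (s n) k \<Longrightarrow> lab_sub t" "k < n \<Longrightarrow> cov_at (fst (s n)) k"
    "h_at (fst (s n)) (snd (s n)) k" "n \<le> k \<Longrightarrow> fst (s n) k = {}" for n k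
    using s(1)[of n] unfolding stage_def by simp_all
  have goodN: "good_at N k" for k
  proof -
    have "good_at N k \<longleftrightarrow> good_at (fst (s (Suc k))) k" by (rule good_at_cong) (use agree[of _ "Suc k"] in simp)
    then show ?thesis using st(1) by simp
  qed
  have labN: "labeling N" by unfold_locales (rule goodN)
  have lab: "labeling (fst (s n))" for n by unfold_locales (rule st(1))
  have "cov_at N k" for k
  proof -
    have "cov_at N k \<longleftrightarrow> cov_at (fst (s (Suc k))) k" by (rule cov_at_cong) (use agree[of _ "Suc k"] in simp)
    then show ?thesis using st(3) by simp
  qed
  moreover have "lab_sub t" if "t \<in> N k" for t k using st(2)[of t "Suc k" k] that unfolding N_def by simp
  moreover have "h_at N h k" for k unfolding h_at_def
  proof (intro ballI)
    let ?M = "fst (s (Suc k))" and ?h = "snd (s (Suc k))"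
    fix t g assume t: "t \<in> N k" and g: "g \<in> sv t"
    have tM: "t \<in> ?M k" using t unfolding N_def .
    have hk: "?h k = h k" unfolding h_def ..
    have G: "Gf ?M ?h m (lact \<alpha> t) g = Gf N h m (lact \<alpha> t) g" if \<alpha>: "\<alpha> \<in> Sx (bdry k) m" for m \<alpha>
    proof (rule Gf_cong[OF lab labN])
      have "\<alpha> \<in> \<Delta> m k" using \<alpha> unfolding Sx_bdry by simp
      then show "lact \<alpha> t \<in> Sm ?M m" by (rule labeling.N_act[OF lab tM])
      fix i u assume u: "u \<in> ?M i"
      then have "i < Suc k" using st(5)[of "Suc k" i] by (cases "i < Suc k") auto
      then show "u \<in> N i \<and> ?h i u = h i u" using agree[of i "Suc k"] u by simp
    qed
    note a = st(4)[of "Suc k" k, unfolded h_at_def, THEN bspec, OF tM, THEN bspec, OF g]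
    show "h k t g \<in> Sx (Val H (Src C g)) k \<and> p (Src C g) k (h k t g) = g \<and>
     (\<forall>e. e \<in> hom C (Src C e) (Src C g) \<longrightarrow> h k t (Cmp C g e) = Rst H e k (h k t g)) \<and>
     (\<forall>m. \<forall>\<alpha>\<in>Sx (bdry k) m. Act (Val H (Src C g)) k \<alpha> (h k t g) = Gf N h m (lact \<alpha> t) g)"
      using a G unfolding hk by simp
  qed
  ultimately show ?thesis using goodN by blast
qed

end

section \<open>The refinement map and the final theorem\<close>

context filled_lab
begin

lemma HP_map:
  "spsh_map C UNIV (HP N) H (\<lambda>V n z. Gf N h n (fst (dec n z)) (snd (dec n z)))"
  unfolding spsh_map_def smap_def
proof (intro conjI ballI allI impI)
  fix V n z assume z: "z \<in> Sx (Val (HP N) V) n"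
  obtain s g where s: "s \<in> Sm N n" "g \<in> sv s" "Src C g = V" "z = enc n (s, g)" using z unfolding Sx_HP by blast
  note sl = Sm_labs[OF s(1)] and G = Gf_props[OF s(1,2), unfolded s(3)]
  show "Gf N h n (fst (dec n z)) (snd (dec n z)) \<in> Sx (Val H V) n" unfolding s(4) dec_enc[OF sl] using G(1) by simp
  fix m \<alpha> assume \<alpha>: "\<alpha> \<in> \<Delta> m n"
  show "Gf N h m (fst (dec m (Act (Val (HP N) V) n \<alpha> z))) (snd (dec m (Act (Val (HP N) V) n \<alpha> z))) =
    Act (Val H V) n \<alpha> (Gf N h n (fst (dec n z)) (snd (dec n z)))"
    unfolding s(4) Act_HP[OF sl \<alpha>] dec_enc[OF sl] dec_enc[OF lact_labs[OF \<alpha>]] using G(4)[OF \<alpha>] by simp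
next
  fix f n z assume f: "f \<in> Arr C" and z: "z \<in> Sx (Val (HP N) (Trg C f)) n"
  obtain s g where s: "s \<in> Sm N n" "g \<in> sv s" "Src C g = Trg C f" "z = enc n (s, g)" using z unfolding Sx_HP by blast
  note sl = Sm_labs[OF s(1)]
  have f': "f \<in> hom C (Src C f) (Src C g)" using f s(3) Arr_hom by simp
  show "Gf N h n (fst (dec n (Rst (HP N) f n z))) (snd (dec n (Rst (HP N) f n z))) =
    Rst H f n (Gf N h n (fst (dec n z)) (snd (dec n z)))"
    unfolding s(4) Rst_HP[OF sl] dec_enc[OF sl] using Gf_props(3)[OF s(1,2) f'] by simp
qed

lemma HP_over:
  assumes z: "z \<in> Sx (Val (HP N) V) n"
  shows "p V n (Gf N h n (fst (dec n z)) (snd (dec n z))) = HQ V n z"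
proof -
  obtain s g where s: "s \<in> Sm N n" "g \<in> sv s" "Src C g = V" "z = enc n (s, g)" using z unfolding Sx_HP by blast
  note sl = Sm_labs[OF s(1)]
  show ?thesis unfolding s(4) HQ_enc[OF sl] dec_enc[OF sl] using Gf_props(2)[OF s(1,2)] s(3) by simp
qed

end

theorem propositionC4:
  fixes C :: "('o, 'm) cat" and j :: "('o, 'm) cov" and U :: 'o
    and H :: "('o, 'm, 'x) spsh" and p :: "'o \<Rightarrow> nat \<Rightarrow> 'x \<Rightarrow> 'm"
  assumes "site C j"
    and "locally_transitive C j"
    and "matching_verdier C j"
    and "U \<in> Obj C"
    and "hypercover C j U H p"
  shows "\<exists>(H' :: ('o, 'm, 'm rtree) spsh) q g.
    verdier_hypercover C j U H' q \<and> split_spsh C UNIV H' \<and>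
    spsh_map C UNIV H' H g \<and>
    (\<forall>V\<in>Obj C. \<forall>n. \<forall>x\<in>Sx (Val H' V) n. p V n (g V n x) = q V n x)"
proof -
  interpret filled C j U H p
    using assms unfolding hypercover_def matching_verdier_def by unfold_locales auto
  obtain N h where Nh: "\<forall>k. good_at N k \<and> (\<forall>t\<in>N k. lab_sub t) \<and> cov_at N k \<and> h_at N h k"
    using skeleta[OF assms(3) hypercover_fillers[OF assms(5)]] by blast
  interpret filled_lab C j U H p N h
    by unfold_locales (use Nh in simp_all)
  have "verdier_hypercover C j U (HP N) HQ" by (rule HP_verdier) (use Nh in \<open>simp add: cov_upto_def\<close>)
  then show ?thesis using HP_split HP_map HP_over by blast
qed

end
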